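(* Let $\mathcal{P}=\mathcal{T}(V)/(R_{\mathcal P})$ be a binary quadratic operad (with finite-dimensional space of generators $V$). (a) There is a morphism of operads $$\mathit{PostLie}\bullet\mathcal{P}\;\cong\;\mathrm{TSu}(\mathcal{P})\longrightarrow\mathrm{RB}_1(\mathcal{P})$$ which extends the map $\eta$ defined on the generators of $\mathrm{TSu}(\mathcal P)$ by $$\omega_\prec\mapsto\omega\circ(\mathrm{id}\otimes P),\qquad \omega_\succ\mapsto\omega\circ(P\otimes\mathrm{id}),\qquad\omega_\cdot\mapsto\omega,\qquad \omega\in V.$$ (b) Let $A$ be a $\mathcal{P}$-algebra and let $P:A\to A$ be a Rota-Baxter operator of weight one on $A$. Then the following operations make $A$ into a $(\mathit{PostLie}\bullet\mathcal{P})$-algebra: $$x\prec_jy:=x\circ_jP(y),\quad x\succ_jy:=P(x)\circ_jy,\quad x\cdot_jy:=x\circ_jy,\qquad \forall\,\circ_j\in\mathcal{P}(2),\ x,y\in A,$$ where $\prec_j,\succ_j,\cdot_j$ are the actions of the generators $(\circ_j)_\prec,(\circ_j)_\succ,(\circ_j)_\cdot$ of $\mathrm{TSu}(\mathcal P)\cong\mathit{PostLie}\bullet\mathcal P$.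
   Context: Fix a field $\mathbf{k}$. Operads are symmetric operads in $\mathbf{k}$-vector spaces (right actions of $\mathbb{S}_n$). **Free operad.** For an $\mathbb{S}_2$-module $V$ (seen as an $\mathbb S$-module concentrated in arity 2), $\mathcal{T}(V)(n)$ is spanned by planar binary rooted trees with $n$ leaves labeled bijectively by $\{1,\dots,n\}$ and vertices labeled by elements of $V$; trees are multilinear in the vertex labels, and exchanging the left and right subtrees of a vertex labeled $\omega$ gives the same element after replacing $\omega$ by $\omega^{(12)}$. A binary quadratic operad is $\mathcal{P}=\mathcal{T}(V)/(R_{\mathcal P})$ with $R_{\mathcal P}\subseteq\mathcal{T}(V)(3)$ an $\mathbb S_3$-submodule. **Trisuccessor.** $\widehat V=V\otimes(\mathbf{k}\prec\oplus\,\mathbf{k}\succ\oplus\,\mathbf{k}\,\cdot\,)$, with $\omega_\prec=\omega\otimes\prec$, $\omega_\succ=\omega\otimes\succ$, $\omega_{\cdot}=\omega\otimes\cdot$, $\omega_\star=\omega_\prec+\omega_\succ+\omega_\cdot$, and $\mathbb{S}_2$-action $(\omega_\prec)^{(12)}=(\omega^{(12)})_\succ$, $(\omega_\succ)^{(12)}=(\omega^{(12)})_\prec$, $(\omega_\cdot)^{(12)}=(\omega^{(12)})_\cdot$. For a labeled tree $\tau$ and a nonempty set $J$ of leaves, $\mathrm{TSu}_J(\tau)$ is obtained by relabeling: a vertex labeled $\omega$ lying on at least one path from the root to a leaf in $J$ gets the label $\omega_\prec$ if all such paths through it turn left there, $\omega_\succ$ if all turn right, $\omega_\cdot$ if some turn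 left and some right; every other vertex labeled $\omega$ gets $\omega_\star$. Extend linearly to $\mathcal T(V)(n)\to\mathcal T(\widehat V)(n)$. Then $\mathrm{TSu}(\mathcal{P})=\mathcal{T}(\widehat V)/(\mathrm{TSu}_J(r): r\in R_{\mathcal P},\ \emptyset\ne J\subseteq\{1,2,3\})$. **Rota-Baxter operads.** Let $V_P$ be the $\mathbb S$-module with $V_P(1)=\mathbf k P$ ($P$ a symbol), $V_P(2)=V$, zero otherwise. $\mathrm{RB}_1(\mathcal P)=\mathcal T(V_P)/(R_{\mathcal P},RB_{\mathcal P})$, where $$RB_{\mathcal P}=\{\omega\circ(P\otimes P)-P\circ\omega\circ(P\otimes\mathrm{id})-P\circ\omega\circ(\mathrm{id}\otimes P)-P\circ\omega\mid\omega\in V\}.$$ A Rota-Baxter operator of weight one on a $\mathcal P$-algebra $A$ is a linear map $P:A\to A$ with $P(x)\circ_jP(y)=P(P(x)\circ_jy)+P(x\circ_jP(y))+P(x\circ_jy)$ for all $\circ_j\in\mathcal P(2)=V$, $x,y\in A$. **PostLie and black product.** $\mathit{PostLie}$ is the operad of algebras with a bilinear operation $\circ$ and a skew-symmetric bilinear operation $[\,,]$ such that $[[x,y],z]+[[z,x],y]+[[y,z],x]=0$; $(x\circ y)\circ z-x\circ(y\circ z)-(x\circ z)\circ y+x\circ(z\circ y)-x\circ[y,z]=0$; $[x,y]\circ z-[x\circ z,y]-[x,y\circ z]=0$. For $\omega,\nu\in V$ let $\omega\circ_{\rm I}\nu,\omega\circ_{\rm II}\nu,\omega\circ_{\rm III}\nu\in\mathcal{T}(V)(3)$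 be $\omega(\nu(x,y),z)$, $\omega(\nu(y,z),x)$, $\omega(\nu(z,x),y)$; then $\mathcal{T}(V)(3)=\bigoplus_{u}V\circ_uV$. For binary quadratic operads with finite-dimensional generators, $\mathcal{T}(V)/(R)\bullet\mathcal{T}(W)/(S)=\mathcal{T}(V\otimes W\otimes \mathrm{sgn}_{\mathbb{S}_2})/(\Psi(R\otimes S))$, where $\Psi((\omega\circ_u\nu)\otimes(\omega'\circ_v\nu'))=(\omega\otimes\omega'\otimes1)\circ_u(\nu\otimes\nu'\otimes1)$ if $u=v$ and $0$ otherwise. The isomorphism $\mathit{PostLie}\bullet\mathcal P\cong\mathrm{TSu}(\mathcal P)$ is the one given on generators by $[\,,]\otimes\omega\otimes1\mapsto\omega_\cdot$ and $\circ\otimes\omega\otimes1\mapsto\omega_\prec$. *)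

theory Defs
  imports "HOL-Algebra.Module" "HOL-Algebra.AbelCoset" "HOL-Library.Poly_Mapping"
    "HOL-Combinatorics.Permutations"
begin

section \<open>Vector spaces\<close>

definition kring :: "'k::field ring" where
  "kring = \<lparr>carrier = UNIV, monoid.mult = (*), one = 1, zero = 0, add = (+)\<rparr>"

abbreviation vspace :: "('k::field, 'a) module \<Rightarrow> bool" where
  "vspace M \<equiv> module kring M"

text \<open>The record of modules in HOL-Algebra extends the record of rings, but a module has no
  multiplication of its own: the two multiplicative fields are irrelevant and left unspecified.\<close>

definition mk_module :: "'a set \<Rightarrow> 'a \<Rightarrow> ('a \<Rightarrow> 'a \<Rightarrow> 'a) \<Rightarrow> ('k \<Rightarrow> 'a \<Rightarrow> 'a) \<Rightarrow> ('k, 'a) module" where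
  "mk_module C z p s =
     \<lparr>carrier = C, monoid.mult = undefined, one = undefined, zero = z, add = p, smult = s\<rparr>"

definition linear_map :: "('k::field, 'a) module \<Rightarrow> ('k, 'b) module \<Rightarrow> ('a \<Rightarrow> 'b) \<Rightarrow> bool" where
  "linear_map M N h \<longleftrightarrow>
     h \<in> carrier M \<rightarrow> carrier N \<and>
     (\<forall>x\<in>carrier M. \<forall>y\<in>carrier M. h (x \<oplus>\<^bsub>M\<^esub> y) = h x \<oplus>\<^bsub>N\<^esub> h y) \<and>
     (\<forall>c. \<forall>x\<in>carrier M. h (c \<odot>\<^bsub>M\<^esub> x) = c \<odot>\<^bsub>N\<^esub> h x)"

definition lin_span :: "('k::field, 'a) module \<Rightarrow> 'a set \<Rightarrow> 'a set" where
  "lin_span M S = \<Inter>{N. submodule N kring M \<and> S \<subseteq> N}"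

definition fin_dim :: "('k::field, 'a) module \<Rightarrow> bool" where
  "fin_dim M \<longleftrightarrow> (\<exists>B. finite B \<and> B \<subseteq> carrier M \<and> lin_span M B = carrier M)"

definition zero_module :: "('k, 'a) module \<Rightarrow> ('k, 'a) module" where
  "zero_module M = M\<lparr>carrier := {\<zero>\<^bsub>M\<^esub>}\<rparr>"

definition quot_module :: "('k, 'a) module \<Rightarrow> 'a set \<Rightarrow> ('k, 'a set) module" where
  "quot_module M N =
     mk_module (a_rcosets\<^bsub>M\<^esub> N) N (set_add M) (\<lambda>c X. \<Union>x\<in>X. N +>\<^bsub>M\<^esub> (c \<odot>\<^bsub>M\<^esub> x))"

definition free_module :: "'x set \<Rightarrow> ('k::field, 'x \<Rightarrow>\<^sub>0 'k) module" where
  "free_module X =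
     mk_module {f. Poly_Mapping.keys f \<subseteq> X} 0 (+) (\<lambda>c. Poly_Mapping.map ((*) c))"

definition bas :: "'x \<Rightarrow> ('x \<Rightarrow>\<^sub>0 'k::field)" where
  "bas x = Poly_Mapping.single x 1"

definition push :: "('x \<Rightarrow> 'y) \<Rightarrow> ('x \<Rightarrow>\<^sub>0 'k::field) \<Rightarrow> ('y \<Rightarrow>\<^sub>0 'k)" where
  "push h f = (\<Sum>s\<in>Poly_Mapping.keys f. Poly_Mapping.single (h s) (Poly_Mapping.lookup f s))"

definition push2 ::
  "('x \<Rightarrow> 'y \<Rightarrow> 'z) \<Rightarrow> ('x \<Rightarrow>\<^sub>0 'k::field) \<Rightarrow> ('y \<Rightarrow>\<^sub>0 'k) \<Rightarrow> ('z \<Rightarrow>\<^sub>0 'k)" where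
  "push2 h f g = (\<Sum>s\<in>Poly_Mapping.keys f. \<Sum>t\<in>Poly_Mapping.keys g.
     Poly_Mapping.single (h s t) (Poly_Mapping.lookup f s * Poly_Mapping.lookup g t))"

text \<open>\<open>induced M N h\<close> is the map into \<open>quot_module M N\<close> that \<open>h\<close> induces on cosets, on the
  understanding that all representatives of a coset have the same image.\<close>

definition induced :: "('k, 'b) module \<Rightarrow> 'b set \<Rightarrow> ('a \<Rightarrow> 'b) \<Rightarrow> 'a set \<Rightarrow> 'b set" where
  "induced M N h X = (\<Union>x\<in>X. N +>\<^bsub>M\<^esub> h x)"


section \<open>S-modules and symmetric operads\<close>

record ('k, 'a) smodule =
  sp :: "nat \<Rightarrow> ('k, 'a) module"
  act :: "nat \<Rightarrow> 'a \<Rightarrow> (nat \<Rightarrow> nat) \<Rightarrow> 'a"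

text \<open>\<open>pcomp Q m n i\<close> is the partial composition \<open>Q(m) \<times> Q(n) \<rightarrow> Q(m + n - 1)\<close> at the input \<open>i\<close>.\<close>

record ('k, 'a) operad = "('k, 'a) smodule" +
  opunit :: 'a
  pcomp :: "nat \<Rightarrow> nat \<Rightarrow> nat \<Rightarrow> 'a \<Rightarrow> 'a \<Rightarrow> 'a"

text \<open>\<open>Q(n)\<close> is a right representation of the symmetric group on \<open>{1..n}\<close>.\<close>

locale smodule =
  fixes Q :: "('k::field, 'a, 'm) smodule_scheme"
  assumes vspace_sp: "vspace (sp Q n)"
    and act_linear: "\<sigma> permutes {1..n} \<Longrightarrow> linear_map (sp Q n) (sp Q n) (\<lambda>x. act Q n x \<sigma>)"
    and act_id: "x \<in> carrier (sp Q n) \<Longrightarrow> act Q n x id = x"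
    and act_act: "\<sigma> permutes {1..n} \<Longrightarrow> \<tau> permutes {1..n} \<Longrightarrow> x \<in> carrier (sp Q n) \<Longrightarrow>
      act Q n (act Q n x \<sigma>) \<tau> = act Q n x (\<sigma> \<circ> \<tau>)"

text \<open>If an operation with \<open>n\<close> inputs is composed into input \<open>i\<close> of another one, the input \<open>j \<noteq> i\<close>
  of the latter becomes the input \<open>slot i n j\<close> of the composite.
  \<open>perm_comp m n i \<sigma> \<tau>\<close> is the resulting permutation \<open>\<sigma> \<circ>\<^sub>i \<tau>\<close> of \<open>{1..m + n - 1}\<close>.\<close>

definition slot :: "nat \<Rightarrow> nat \<Rightarrow> nat \<Rightarrow> nat" where
  "slot i n j = (if j < i then j else j + n - 1)"

definition perm_comp :: "nat \<Rightarrow> nat \<Rightarrow> nat \<Rightarrow> (nat \<Rightarrow> nat) \<Rightarrow> (nat \<Rightarrow> nat) \<Rightarrow> nat \<Rightarrow> nat" where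
  "perm_comp m n i \<sigma> \<tau> l =
     (if l < 1 \<or> m + n - 1 < l then l
      else if l < i then slot (\<sigma> i) n (\<sigma> l)
      else if l < i + n then \<sigma> i - 1 + \<tau> (l + 1 - i)
      else slot (\<sigma> i) n (\<sigma> (l + 1 - n)))"

locale operad = smodule Q for Q :: "('k::field, 'a, 'm) operad_scheme" +
  assumes unit_closed: "opunit Q \<in> carrier (sp Q 1)"
    and pcomp_linear_left: "i \<in> {1..m} \<Longrightarrow> y \<in> carrier (sp Q n) \<Longrightarrow>
      linear_map (sp Q m) (sp Q (m + n - 1)) (\<lambda>x. pcomp Q m n i x y)"
    and pcomp_linear_right: "i \<in> {1..m} \<Longrightarrow> x \<in> carrier (sp Q m) \<Longrightarrow>
      linear_map (sp Q n) (sp Q (m + n - 1)) (\<lambda>y. pcomp Q m n i x y)"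
    and unit_left: "y \<in> carrier (sp Q n) \<Longrightarrow> pcomp Q 1 n 1 (opunit Q) y = y"
    and unit_right: "i \<in> {1..m} \<Longrightarrow> x \<in> carrier (sp Q m) \<Longrightarrow> pcomp Q m 1 i x (opunit Q) = x"
    and sequential: "i \<in> {1..l} \<Longrightarrow> j \<in> {1..m} \<Longrightarrow>
      x \<in> carrier (sp Q l) \<Longrightarrow> y \<in> carrier (sp Q m) \<Longrightarrow> z \<in> carrier (sp Q n) \<Longrightarrow>
      pcomp Q (l + m - 1) n (i - 1 + j) (pcomp Q l m i x y) z
        = pcomp Q l (m + n - 1) i x (pcomp Q m n j y z)"
    and parallel: "i \<in> {1..l} \<Longrightarrow> k \<in> {1..l} \<Longrightarrow> i < k \<Longrightarrow>
      x \<in> carrier (sp Q l) \<Longrightarrow> y \<in> carrier (sp Q m) \<Longrightarrow> z \<in> carrier (sp Q n) \<Longrightarrow>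
      pcomp Q (l + m - 1) n (k - 1 + m) (pcomp Q l m i x y) z
        = pcomp Q (l + n - 1) m i (pcomp Q l n k x z) y"
    and equivariant: "i \<in> {1..m} \<Longrightarrow> \<sigma> permutes {1..m} \<Longrightarrow> \<tau> permutes {1..n} \<Longrightarrow>
      x \<in> carrier (sp Q m) \<Longrightarrow> y \<in> carrier (sp Q n) \<Longrightarrow>
      pcomp Q m n i (act Q m x \<sigma>) (act Q n y \<tau>)
        = act Q (m + n - 1) (pcomp Q m n (\<sigma> i) x y) (perm_comp m n i \<sigma> \<tau>)"

locale operad_hom = src: operad Q + tgt: operad Q'
  for Q :: "('k::field, 'a, 'm) operad_scheme" and Q' :: "('k, 'b, 'n) operad_scheme" +
  fixes f :: "nat \<Rightarrow> 'a \<Rightarrow> 'b"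
  assumes hom_linear: "linear_map (sp Q n) (sp Q' n) (f n)"
    and hom_act: "\<sigma> permutes {1..n} \<Longrightarrow> x \<in> carrier (sp Q n) \<Longrightarrow>
      f n (act Q n x \<sigma>) = act Q' n (f n x) \<sigma>"
    and hom_unit: "f 1 (opunit Q) = opunit Q'"
    and hom_pcomp: "i \<in> {1..m} \<Longrightarrow> x \<in> carrier (sp Q m) \<Longrightarrow> y \<in> carrier (sp Q n) \<Longrightarrow>
      f (m + n - 1) (pcomp Q m n i x y) = pcomp Q' m n i (f m x) (f n y)"

locale operad_iso = operad_hom +
  assumes iso_bij: "bij_betw (f n) (carrier (sp Q n)) (carrier (sp Q' n))"

definition operad_ideal :: "('k::field, 'a) operad \<Rightarrow> (nat \<Rightarrow> 'a set) \<Rightarrow> bool" where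
  "operad_ideal Q I \<longleftrightarrow>
     (\<forall>n. submodule (I n) kring (sp Q n)) \<and>
     (\<forall>n \<sigma>. \<sigma> permutes {1..n} \<longrightarrow> (\<forall>x\<in>I n. act Q n x \<sigma> \<in> I n)) \<and>
     (\<forall>m n. \<forall>i\<in>{1..m}. \<forall>x\<in>carrier (sp Q m). \<forall>y\<in>carrier (sp Q n).
        x \<in> I m \<or> y \<in> I n \<longrightarrow> pcomp Q m n i x y \<in> I (m + n - 1))"

definition gen_ideal :: "('k::field, 'a) operad \<Rightarrow> (nat \<Rightarrow> 'a set) \<Rightarrow> nat \<Rightarrow> 'a set" where
  "gen_ideal Q S n = \<Inter>{I n |I. operad_ideal Q I \<and> (\<forall>m. S m \<subseteq> I m)}"

definition quot_operad :: "('k::field, 'a) operad \<Rightarrow> (nat \<Rightarrow> 'a set) \<Rightarrow> ('k, 'a set) operad" where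
  "quot_operad Q I =
     \<lparr>sp = (\<lambda>n. quot_module (sp Q n) (I n)),
      act = (\<lambda>n X \<sigma>. \<Union>x\<in>X. I n +>\<^bsub>sp Q n\<^esub> act Q n x \<sigma>),
      opunit = I 1 +>\<^bsub>sp Q 1\<^esub> opunit Q,
      pcomp = (\<lambda>m n i X Y. \<Union>x\<in>X. \<Union>y\<in>Y. I (m + n - 1) +>\<^bsub>sp Q (m + n - 1)\<^esub> pcomp Q m n i x y)\<rparr>"


section \<open>The endomorphism operad and algebras over an operad\<close>

text \<open>An \<open>n\<close>-tuple of elements of \<open>A\<close> is an extensional function on \<open>{1..n}\<close>.\<close>

abbreviation tuples :: "('k, 'a) module \<Rightarrow> nat \<Rightarrow> (nat \<Rightarrow> 'a) set" where
  "tuples A n \<equiv> {1..n} \<rightarrow>\<^sub>E carrier A"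

definition multilinear_maps :: "('k::field, 'a) module \<Rightarrow> nat \<Rightarrow> ((nat \<Rightarrow> 'a) \<Rightarrow> 'a) set" where
  "multilinear_maps A n = {f \<in> tuples A n \<rightarrow>\<^sub>E carrier A.
     \<forall>e\<in>tuples A n. \<forall>i\<in>{1..n}. linear_map A A (\<lambda>x. f (e(i := x)))}"

definition End_operad :: "('k::field, 'a) module \<Rightarrow> ('k, (nat \<Rightarrow> 'a) \<Rightarrow> 'a) operad" where
  "End_operad A =
     \<lparr>sp = (\<lambda>n. mk_module (multilinear_maps A n)
        (\<lambda>e\<in>tuples A n. \<zero>\<^bsub>A\<^esub>)
        (\<lambda>f g. \<lambda>e\<in>tuples A n. f e \<oplus>\<^bsub>A\<^esub> g e)
        (\<lambda>c f. \<lambda>e\<in>tuples A n. c \<odot>\<^bsub>A\<^esub> f e)),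
      act = (\<lambda>n f \<sigma>. \<lambda>e\<in>tuples A n. f (\<lambda>j\<in>{1..n}. e (inv_into UNIV \<sigma> j))),
      opunit = (\<lambda>e\<in>tuples A 1. e 1),
      pcomp = (\<lambda>m n i f g. \<lambda>e\<in>tuples A (m + n - 1).
        f (\<lambda>j\<in>{1..m}. if j = i then g (\<lambda>l\<in>{1..n}. e (l + i - 1)) else e (slot i n j)))\<rparr>"

definition operad_algebra ::
  "('k::field, 'q) operad \<Rightarrow> ('k, 'a) module \<Rightarrow> (nat \<Rightarrow> 'q \<Rightarrow> (nat \<Rightarrow> 'a) \<Rightarrow> 'a) \<Rightarrow> bool" where
  "operad_algebra Q A \<rho> \<longleftrightarrow> vspace A \<and> operad_hom Q (End_operad A) \<rho>"

definition binop :: "(nat \<Rightarrow> 'q \<Rightarrow> (nat \<Rightarrow> 'a) \<Rightarrow> 'a) \<Rightarrow> 'q \<Rightarrow> 'a \<Rightarrow> 'a \<Rightarrow> 'a" where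
  "binop \<rho> \<mu> x y = \<rho> 2 \<mu> (\<lambda>j\<in>{1..2}. if j = 1 then x else y)"

definition rota_baxter_weight_one ::
  "('k::field, 'q) operad \<Rightarrow> ('k, 'a) module \<Rightarrow> (nat \<Rightarrow> 'q \<Rightarrow> (nat \<Rightarrow> 'a) \<Rightarrow> 'a) \<Rightarrow> ('a \<Rightarrow> 'a) \<Rightarrow> bool"
where
  "rota_baxter_weight_one Q A \<rho> T \<longleftrightarrow> linear_map A A T \<and>
     (\<forall>\<mu>\<in>carrier (sp Q 2). \<forall>x\<in>carrier A. \<forall>y\<in>carrier A.
        binop \<rho> \<mu> (T x) (T y)
          = T (binop \<rho> \<mu> (T x) y) \<oplus>\<^bsub>A\<^esub> T (binop \<rho> \<mu> x (T y)) \<oplus>\<^bsub>A\<^esub> T (binop \<rho> \<mu> x y))"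


section \<open>The free operad on an S-module\<close>

text \<open>\<open>T(E)(n)\<close> is spanned by the planar rooted trees whose vertices with \<open>k\<close> inputs are labelled by
  \<open>E(k)\<close> and whose leaves are labelled bijectively by \<open>{1..n}\<close>.  A leaf labelled \<open>i\<close> stands for the
  \<open>i\<close>-th input, so \<open>\<sigma>\<close> acts from the right by relabelling \<open>i\<close> to \<open>\<sigma>\<^sup>-\<^sup>1(i)\<close>.
  The trees themselves span the operad \<open>tree_operad E\<close>; dividing it by the ideal generated by linearity
  in each vertex label and by compatibility with the symmetric group actions on the labels gives the
  free operad.\<close>

datatype 'e ltree = Leaf nat | Node 'e "'e ltree list"

primrec leaves :: "'e ltree \<Rightarrow> nat list" where
  "leaves (Leaf i) = [i]"
| "leaves (Node e ts) = concat (map leaves ts)"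

primrec tsubst :: "(nat \<Rightarrow> 'e ltree) \<Rightarrow> 'e ltree \<Rightarrow> 'e ltree" where
  "tsubst g (Leaf i) = g i"
| "tsubst g (Node e ts) = Node e (map (tsubst g) ts)"

definition relabel :: "(nat \<Rightarrow> nat) \<Rightarrow> 'e ltree \<Rightarrow> 'e ltree" where
  "relabel h = tsubst (\<lambda>i. Leaf (h i))"

definition graft :: "nat \<Rightarrow> nat \<Rightarrow> 'e ltree \<Rightarrow> 'e ltree \<Rightarrow> 'e ltree" where
  "graft n i s t =
     tsubst (\<lambda>j. if j = i then relabel (\<lambda>l. l + i - 1) t else Leaf (slot i n j)) s"

primrec labelled_by :: "('k, 'e, 'm) smodule_scheme \<Rightarrow> 'e ltree \<Rightarrow> bool" where
  "labelled_by E (Leaf i) \<longleftrightarrow> True"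
| "labelled_by E (Node e ts) \<longleftrightarrow> e \<in> carrier (sp E (length ts)) \<and> list_all (labelled_by E) ts"

definition trees :: "('k, 'e, 'm) smodule_scheme \<Rightarrow> nat \<Rightarrow> 'e ltree set" where
  "trees E n = {t. labelled_by E t \<and> distinct (leaves t) \<and> set (leaves t) = {1..n}}"

definition tree_operad :: "('k::field, 'e) smodule \<Rightarrow> ('k, 'e ltree \<Rightarrow>\<^sub>0 'k) operad" where
  "tree_operad E =
     \<lparr>sp = (\<lambda>n. free_module (trees E n)),
      act = (\<lambda>n x \<sigma>. push (relabel (inv_into UNIV \<sigma>)) x),
      opunit = bas (Leaf 1),
      pcomp = (\<lambda>m n i. push2 (graft n i))\<rparr>"

definition permute_subtrees :: "(nat \<Rightarrow> nat) \<Rightarrow> 'e ltree list \<Rightarrow> 'e ltree list" where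
  "permute_subtrees \<sigma> ts = map (\<lambda>j. ts ! (inv_into UNIV \<sigma> (Suc j) - 1)) [0..<length ts]"

definition tree_relators :: "('k::field, 'e) smodule \<Rightarrow> nat \<Rightarrow> ('e ltree \<Rightarrow>\<^sub>0 'k) set" where
  "tree_relators E n =
     {bas (Node (a \<oplus>\<^bsub>sp E (length ts)\<^esub> b) ts) - bas (Node a ts) - bas (Node b ts) |a b ts.
        Node a ts \<in> trees E n \<and> Node b ts \<in> trees E n} \<union>
     {bas (Node (c \<odot>\<^bsub>sp E (length ts)\<^esub> a) ts) - Poly_Mapping.single (Node a ts) c |a c ts.
        Node a ts \<in> trees E n} \<union>
     {bas (Node (act E (length ts) a \<sigma>) ts) - bas (Node a (permute_subtrees \<sigma> ts)) |a \<sigma> ts.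
        \<sigma> permutes {1..length ts} \<and> Node a ts \<in> trees E n}"

definition tree_ideal :: "('k::field, 'e) smodule \<Rightarrow> nat \<Rightarrow> ('e ltree \<Rightarrow>\<^sub>0 'k) set" where
  "tree_ideal E = gen_ideal (tree_operad E) (tree_relators E)"

definition free_operad :: "('k::field, 'e) smodule \<Rightarrow> ('k, ('e ltree \<Rightarrow>\<^sub>0 'k) set) operad" where
  "free_operad E = quot_operad (tree_operad E) (tree_ideal E)"

definition tree_class ::
  "('k::field, 'e) smodule \<Rightarrow> nat \<Rightarrow> ('e ltree \<Rightarrow>\<^sub>0 'k) \<Rightarrow> ('e ltree \<Rightarrow>\<^sub>0 'k) set" where
  "tree_class E n x = tree_ideal E n +>\<^bsub>sp (tree_operad E) n\<^esub> x"

text \<open>The linear map from \<open>T(E)(n)\<close> to \<open>T(F)(n)\<close> induced by a map from trees to trees.\<close>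

definition tree_induced ::
  "('k::field, 'f) smodule \<Rightarrow> nat \<Rightarrow> ('e ltree \<Rightarrow> 'f ltree) \<Rightarrow>
   ('e ltree \<Rightarrow>\<^sub>0 'k) set \<Rightarrow> ('f ltree \<Rightarrow>\<^sub>0 'k) set" where
  "tree_induced F n h = induced (sp (tree_operad F) n) (tree_ideal F n) (push h)"


section \<open>Binary quadratic operads\<close>

text \<open>A representation of the symmetric group on two letters: \<open>swp\<close> is the action of \<open>(12)\<close>.\<close>

record ('k, 'v) s2mod =
  vsp :: "('k, 'v) module"
  swp :: "'v \<Rightarrow> 'v"

definition s2_module :: "('k::field, 'v) s2mod \<Rightarrow> bool" where
  "s2_module V \<longleftrightarrow> vspace (vsp V) \<and> linear_map (vsp V) (vsp V) (swp V) \<and>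
     (\<forall>v\<in>carrier (vsp V). swp V (swp V v) = v)"

definition arity2 :: "('k, 'v) s2mod \<Rightarrow> ('k, 'v) smodule" where
  "arity2 V =
     \<lparr>sp = (\<lambda>n. if n = 2 then vsp V else zero_module (vsp V)),
      act = (\<lambda>n v \<sigma>. if n = 2 \<and> \<sigma> 1 = 2 then swp V v else v)\<rparr>"

type_synonym ('k, 'v) free_elem = "('v ltree \<Rightarrow>\<^sub>0 'k) set"

definition gen2 :: "('k::field, 'v) s2mod \<Rightarrow> 'v \<Rightarrow> ('k, 'v) free_elem" where
  "gen2 V \<omega> = tree_class (arity2 V) 2 (bas (Node \<omega> [Leaf 1, Leaf 2]))"

definition s3_submodule :: "('k::field, 'v) s2mod \<Rightarrow> ('k, 'v) free_elem set \<Rightarrow> bool" where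
  "s3_submodule V R \<longleftrightarrow> submodule R kring (sp (free_operad (arity2 V)) 3) \<and>
     (\<forall>\<sigma> r. \<sigma> permutes {1..3} \<longrightarrow> r \<in> R \<longrightarrow> act (free_operad (arity2 V)) 3 r \<sigma> \<in> R)"

definition s3_span :: "('k::field, 'v) s2mod \<Rightarrow> ('k, 'v) free_elem set \<Rightarrow> ('k, 'v) free_elem set" where
  "s3_span V S = \<Inter>{R. s3_submodule V R \<and> S \<subseteq> R}"

definition quad_ideal ::
  "('k::field, 'v) s2mod \<Rightarrow> ('k, 'v) free_elem set \<Rightarrow> nat \<Rightarrow> ('k, 'v) free_elem set" where
  "quad_ideal V R = gen_ideal (free_operad (arity2 V)) (\<lambda>n. if n = 3 then R else {})"

definition quad_operad ::
  "('k::field, 'v) s2mod \<Rightarrow> ('k, 'v) free_elem set \<Rightarrow> ('k, ('k, 'v) free_elem set) operad" where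
  "quad_operad V R = quot_operad (free_operad (arity2 V)) (quad_ideal V R)"

definition quad_gen ::
  "('k::field, 'v) s2mod \<Rightarrow> ('k, 'v) free_elem set \<Rightarrow> 'v \<Rightarrow> ('k, 'v) free_elem set" where
  "quad_gen V R \<omega> = quad_ideal V R 2 +>\<^bsub>sp (free_operad (arity2 V)) 2\<^esub> gen2 V \<omega>"


section \<open>The trisuccessor\<close>

datatype tri = Prec | Succ | Dot

text \<open>\<open>V \<otimes> (k\<prec> \<oplus> k\<succ> \<oplus> k\<cdot>)\<close> is the sum of three copies of \<open>V\<close> indexed by \<open>tri\<close>.\<close>

definition hat :: "('k, 'v) s2mod \<Rightarrow> ('k, tri \<Rightarrow> 'v) s2mod" where
  "hat V =
     \<lparr>vsp = mk_module {f. \<forall>d. f d \<in> carrier (vsp V)} (\<lambda>d. \<zero>\<^bsub>vsp V\<^esub>)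
        (\<lambda>f g d. f d \<oplus>\<^bsub>vsp V\<^esub> g d) (\<lambda>c f d. c \<odot>\<^bsub>vsp V\<^esub> f d),
      swp = (\<lambda>f d. case d of Prec \<Rightarrow> swp V (f Succ) | Succ \<Rightarrow> swp V (f Prec) | Dot \<Rightarrow> swp V (f Dot))\<rparr>"

definition dec :: "('k, 'v) s2mod \<Rightarrow> 'v \<Rightarrow> tri \<Rightarrow> (tri \<Rightarrow> 'v)" where
  "dec V \<omega> d = (\<lambda>d'. if d' = d then \<omega> else \<zero>\<^bsub>vsp V\<^esub>)"

definition dec_star :: "('k, 'v) s2mod \<Rightarrow> 'v \<Rightarrow> (tri \<Rightarrow> 'v)" where
  "dec_star V \<omega> = dec V \<omega> Prec \<oplus>\<^bsub>vsp (hat V)\<^esub> dec V \<omega> Succ \<oplus>\<^bsub>vsp (hat V)\<^esub> dec V \<omega> Dot"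

text \<open>The list of booleans tells which subtrees of the vertex contain a leaf in \<open>J\<close>.  In \<open>T(V)\<close> a
  vertex with a number of inputs other than two is necessarily labelled by zero.\<close>

fun tsu_label :: "('k, 'v) s2mod \<Rightarrow> bool list \<Rightarrow> 'v \<Rightarrow> (tri \<Rightarrow> 'v)" where
  "tsu_label V [True, False] \<omega> = dec V \<omega> Prec"
| "tsu_label V [False, True] \<omega> = dec V \<omega> Succ"
| "tsu_label V [True, True] \<omega> = dec V \<omega> Dot"
| "tsu_label V [False, False] \<omega> = dec_star V \<omega>"
| "tsu_label V _ \<omega> = \<zero>\<^bsub>vsp (hat V)\<^esub>"

primrec tsu_tree :: "('k, 'v) s2mod \<Rightarrow> nat set \<Rightarrow> 'v ltree \<Rightarrow> (tri \<Rightarrow> 'v) ltree" where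
  "tsu_tree V J (Leaf i) = Leaf i"
| "tsu_tree V J (Node \<omega> ts) =
     Node (tsu_label V (map (\<lambda>t. J \<inter> set (leaves t) \<noteq> {}) ts) \<omega>) (map (tsu_tree V J) ts)"

definition TSu_map ::
  "('k::field, 'v) s2mod \<Rightarrow> nat \<Rightarrow> nat set \<Rightarrow> ('k, 'v) free_elem \<Rightarrow> ('k, tri \<Rightarrow> 'v) free_elem" where
  "TSu_map V n J = tree_induced (arity2 (hat V)) n (tsu_tree V J)"

definition TSu_rel ::
  "('k::field, 'v) s2mod \<Rightarrow> ('k, 'v) free_elem set \<Rightarrow> ('k, tri \<Rightarrow> 'v) free_elem set" where
  "TSu_rel V R = {TSu_map V 3 J r |J r. r \<in> R \<and> J \<noteq> {} \<and> J \<subseteq> {1,2,3}}"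

definition TSu ::
  "('k::field, 'v) s2mod \<Rightarrow> ('k, 'v) free_elem set \<Rightarrow> ('k, ('k, tri \<Rightarrow> 'v) free_elem set) operad" where
  "TSu V R = quad_operad (hat V) (TSu_rel V R)"

definition TSu_gen ::
  "('k::field, 'v) s2mod \<Rightarrow> ('k, 'v) free_elem set \<Rightarrow> 'v \<Rightarrow> tri \<Rightarrow> ('k, tri \<Rightarrow> 'v) free_elem set" where
  "TSu_gen V R \<omega> d = quad_gen (hat V) (TSu_rel V R) (dec V \<omega> d)"


section \<open>The Rota-Baxter operad\<close>

text \<open>The S-module \<open>V\<^sub>P\<close> sits inside \<open>k \<times> V\<close>: arity 1 is \<open>k \<times> 0\<close>, spanned by \<open>P = (1, 0)\<close>, and arity 2
  is \<open>0 \<times> V\<close>.\<close>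

definition VP :: "('k::field, 'v) s2mod \<Rightarrow> ('k, 'k \<times> 'v) smodule" where
  "VP V =
     \<lparr>sp = (\<lambda>n. mk_module
        ((if n = 1 then UNIV else {0}) \<times> (if n = 2 then carrier (vsp V) else {\<zero>\<^bsub>vsp V\<^esub>}))
        (0, \<zero>\<^bsub>vsp V\<^esub>)
        (\<lambda>x y. (fst x + fst y, snd x \<oplus>\<^bsub>vsp V\<^esub> snd y))
        (\<lambda>c x. (c * fst x, c \<odot>\<^bsub>vsp V\<^esub> snd x))),
      act = (\<lambda>n x \<sigma>. if n = 2 \<and> \<sigma> 1 = 2 then (fst x, swp V (snd x)) else x)\<rparr>"

primrec map_labels :: "('e \<Rightarrow> 'f) \<Rightarrow> 'e ltree \<Rightarrow> 'f ltree" where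
  "map_labels h (Leaf i) = Leaf i"
| "map_labels h (Node e ts) = Node (h e) (map (map_labels h) ts)"

definition VP_op :: "('k::field, 'v) s2mod \<Rightarrow> 'v \<Rightarrow> ('k, 'k \<times> 'v) free_elem" where
  "VP_op V \<omega> = tree_class (VP V) 2 (bas (Node (0, \<omega>) [Leaf 1, Leaf 2]))"

definition VP_P :: "('k::field, 'v) s2mod \<Rightarrow> ('k, 'k \<times> 'v) free_elem" where
  "VP_P V = tree_class (VP V) 1 (bas (Node (1, \<zero>\<^bsub>vsp V\<^esub>) [Leaf 1]))"

text \<open>\<open>\<omega> \<circ> (P \<otimes> id)\<close>, \<open>\<omega> \<circ> (id \<otimes> P)\<close>, \<open>\<omega> \<circ> (P \<otimes> P)\<close> and \<open>P \<circ> \<mu>\<close> in an operad, for \<open>\<omega>\<close> and \<open>\<mu>\<close> of arity 2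
  and \<open>P\<close> of arity 1.\<close>

definition comp_P_id :: "('k::field, 'a) operad \<Rightarrow> 'a \<Rightarrow> 'a \<Rightarrow> 'a" where
  "comp_P_id Q \<omega> P = pcomp Q 2 1 1 \<omega> P"

definition comp_id_P :: "('k::field, 'a) operad \<Rightarrow> 'a \<Rightarrow> 'a \<Rightarrow> 'a" where
  "comp_id_P Q \<omega> P = pcomp Q 2 1 2 \<omega> P"

definition comp_P_P :: "('k::field, 'a) operad \<Rightarrow> 'a \<Rightarrow> 'a \<Rightarrow> 'a" where
  "comp_P_P Q \<omega> P = pcomp Q 2 1 2 (pcomp Q 2 1 1 \<omega> P) P"

definition P_comp :: "('k::field, 'a) operad \<Rightarrow> 'a \<Rightarrow> 'a \<Rightarrow> 'a" where
  "P_comp Q P \<mu> = pcomp Q 1 2 1 P \<mu>"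

definition RB_relator :: "('k::field, 'v) s2mod \<Rightarrow> 'v \<Rightarrow> ('k, 'k \<times> 'v) free_elem" where
  "RB_relator V \<omega> =
    (let Q = free_operad (VP V); w = VP_op V \<omega>; P = VP_P V in
       comp_P_P Q w P
         \<ominus>\<^bsub>sp Q 2\<^esub> P_comp Q P (comp_P_id Q w P)
         \<ominus>\<^bsub>sp Q 2\<^esub> P_comp Q P (comp_id_P Q w P)
         \<ominus>\<^bsub>sp Q 2\<^esub> P_comp Q P w)"

text \<open>The relations of the operad with generators \<open>V\<close> are transported along the inclusion
  \<open>T(V) \<rightarrow> T(V\<^sub>P)\<close>.\<close>

definition RB_ideal ::
  "('k::field, 'v) s2mod \<Rightarrow> ('k, 'v) free_elem set \<Rightarrow> nat \<Rightarrow> ('k, 'k \<times> 'v) free_elem set" where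
  "RB_ideal V R = gen_ideal (free_operad (VP V)) (\<lambda>n.
     if n = 3 then tree_induced (VP V) 3 (map_labels (Pair 0)) ` R
     else if n = 2 then RB_relator V ` carrier (vsp V)
     else {})"

definition RB1 ::
  "('k::field, 'v) s2mod \<Rightarrow> ('k, 'v) free_elem set \<Rightarrow> ('k, ('k, 'k \<times> 'v) free_elem set) operad" where
  "RB1 V R = quot_operad (free_operad (VP V)) (RB_ideal V R)"

definition RB1_op ::
  "('k::field, 'v) s2mod \<Rightarrow> ('k, 'v) free_elem set \<Rightarrow> 'v \<Rightarrow> ('k, 'k \<times> 'v) free_elem set" where
  "RB1_op V R \<omega> = RB_ideal V R 2 +>\<^bsub>sp (free_operad (VP V)) 2\<^esub> VP_op V \<omega>"

definition RB1_P ::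
  "('k::field, 'v) s2mod \<Rightarrow> ('k, 'v) free_elem set \<Rightarrow> ('k, 'k \<times> 'v) free_elem set" where
  "RB1_P V R = RB_ideal V R 1 +>\<^bsub>sp (free_operad (VP V)) 1\<^esub> VP_P V"


section \<open>The operad PostLie\<close>

text \<open>The generating space has the basis \<open>[x,y]\<close>, \<open>x \<circ> y\<close>, \<open>y \<circ> x\<close>.\<close>

datatype plgen = Bracket | Circ | CircOp

definition PL :: "('k::field, plgen \<Rightarrow>\<^sub>0 'k) s2mod" where
  "PL =
     \<lparr>vsp = free_module UNIV,
      swp = (\<lambda>f. Poly_Mapping.single Bracket (- Poly_Mapping.lookup f Bracket)
               + Poly_Mapping.single Circ (Poly_Mapping.lookup f CircOp)
               + Poly_Mapping.single CircOp (Poly_Mapping.lookup f Circ))\<rparr>"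

definition pl_br :: "(plgen \<Rightarrow>\<^sub>0 'k::field) ltree \<Rightarrow> (plgen \<Rightarrow>\<^sub>0 'k) ltree \<Rightarrow> (plgen \<Rightarrow>\<^sub>0 'k) ltree" where
  "pl_br s t = Node (bas Bracket) [s, t]"

definition pl_circ :: "(plgen \<Rightarrow>\<^sub>0 'k::field) ltree \<Rightarrow> (plgen \<Rightarrow>\<^sub>0 'k) ltree \<Rightarrow> (plgen \<Rightarrow>\<^sub>0 'k) ltree" where
  "pl_circ s t = Node (bas Circ) [s, t]"

definition PL_rel :: "('k::field, plgen \<Rightarrow>\<^sub>0 'k) free_elem set" where
  "PL_rel =
    (let x = Leaf 1; y = Leaf 2; z = Leaf 3 in
     s3_span PL (tree_class (arity2 PL) 3 `
      {bas (pl_br (pl_br x y) z) + bas (pl_br (pl_br z x) y) + bas (pl_br (pl_br y z) x),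
       bas (pl_circ (pl_circ x y) z) - bas (pl_circ x (pl_circ y z))
         - bas (pl_circ (pl_circ x z) y) + bas (pl_circ x (pl_circ z y))
         - bas (pl_circ x (pl_br y z)),
       bas (pl_circ (pl_br x y) z) - bas (pl_br (pl_circ x z) y) - bas (pl_br x (pl_circ y z))}))"


section \<open>The black product\<close>

definition tensor_relators ::
  "('k::field, 'v) module \<Rightarrow> ('k, 'w) module \<Rightarrow> ('v \<times> 'w \<Rightarrow>\<^sub>0 'k) set" where
  "tensor_relators V W =
     {bas (a \<oplus>\<^bsub>V\<^esub> b, w) - bas (a, w) - bas (b, w) |a b w.
        a \<in> carrier V \<and> b \<in> carrier V \<and> w \<in> carrier W} \<union>
     {bas (v, a \<oplus>\<^bsub>W\<^esub> b) - bas (v, a) - bas (v, b) |v a b.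
        v \<in> carrier V \<and> a \<in> carrier W \<and> b \<in> carrier W} \<union>
     {bas (c \<odot>\<^bsub>V\<^esub> v, w) - Poly_Mapping.single (v, w) c |c v w. v \<in> carrier V \<and> w \<in> carrier W} \<union>
     {bas (v, c \<odot>\<^bsub>W\<^esub> w) - Poly_Mapping.single (v, w) c |c v w. v \<in> carrier V \<and> w \<in> carrier W}"

definition tensor_null ::
  "('k::field, 'v) module \<Rightarrow> ('k, 'w) module \<Rightarrow> ('v \<times> 'w \<Rightarrow>\<^sub>0 'k) set" where
  "tensor_null V W = lin_span (free_module (carrier V \<times> carrier W)) (tensor_relators V W)"

definition tensor ::
  "('k::field, 'v) module \<Rightarrow> ('k, 'w) module \<Rightarrow> ('k, ('v \<times> 'w \<Rightarrow>\<^sub>0 'k) set) module" where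
  "tensor V W = quot_module (free_module (carrier V \<times> carrier W)) (tensor_null V W)"

text \<open>\<open>V \<otimes> W \<otimes> sgn\<close>: since \<open>sgn\<close> is the ground field with \<open>(12)\<close> acting by \<open>-1\<close>, this is \<open>V \<otimes> W\<close> with
  the diagonal action of \<open>(12)\<close> negated.\<close>

definition tensor_sgn ::
  "('k::field, 'v) s2mod \<Rightarrow> ('k, 'w) s2mod \<Rightarrow> ('k, ('v \<times> 'w \<Rightarrow>\<^sub>0 'k) set) s2mod" where
  "tensor_sgn V W =
     \<lparr>vsp = tensor (vsp V) (vsp W),
      swp = (\<lambda>X. \<ominus>\<^bsub>tensor (vsp V) (vsp W)\<^esub>
        induced (free_module (carrier (vsp V) \<times> carrier (vsp W))) (tensor_null (vsp V) (vsp W))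
          (push (map_prod (swp V) (swp W))) X)\<rparr>"

text \<open>\<open>ten V W v w\<close> is \<open>v \<otimes> w \<otimes> 1\<close>.\<close>

definition ten ::
  "('k::field, 'v) s2mod \<Rightarrow> ('k, 'w) s2mod \<Rightarrow> 'v \<Rightarrow> 'w \<Rightarrow> ('v \<times> 'w \<Rightarrow>\<^sub>0 'k) set" where
  "ten V W v w =
     tensor_null (vsp V) (vsp W) +>\<^bsub>free_module (carrier (vsp V) \<times> carrier (vsp W))\<^esub> bas (v, w)"

datatype shape = ShI | ShII | ShIII

primrec shape_tree :: "shape \<Rightarrow> 'v \<Rightarrow> 'v \<Rightarrow> 'v ltree" where
  "shape_tree ShI \<omega> \<nu> = Node \<omega> [Node \<nu> [Leaf 1, Leaf 2], Leaf 3]"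
| "shape_tree ShII \<omega> \<nu> = Node \<omega> [Node \<nu> [Leaf 2, Leaf 3], Leaf 1]"
| "shape_tree ShIII \<omega> \<nu> = Node \<omega> [Node \<nu> [Leaf 3, Leaf 1], Leaf 2]"

definition circ_u :: "('k::field, 'v) s2mod \<Rightarrow> shape \<Rightarrow> 'v \<Rightarrow> 'v \<Rightarrow> ('k, 'v) free_elem" where
  "circ_u V u \<omega> \<nu> = tree_class (arity2 V) 3 (bas (shape_tree u \<omega> \<nu>))"

text \<open>The defining property of \<open>\<Psi>\<close>, regarded as a bilinear map on \<open>T(V)(3) \<times> T(W)(3)\<close>.  Since
  \<open>T(V)(3)\<close> is the direct sum over \<open>u\<close> of the spaces \<open>V \<circ>\<^sub>u V\<close>, it determines \<open>\<Psi>\<close> uniquely on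
  the carriers.\<close>

definition is_Psi ::
  "('k::field, 'v) s2mod \<Rightarrow> ('k, 'w) s2mod \<Rightarrow>
   (('k, 'v) free_elem \<Rightarrow> ('k, 'w) free_elem \<Rightarrow> ('k, ('v \<times> 'w \<Rightarrow>\<^sub>0 'k) set) free_elem) \<Rightarrow> bool" where
  "is_Psi V W \<beta> \<longleftrightarrow>
    (let TV = sp (free_operad (arity2 V)) 3; TW = sp (free_operad (arity2 W)) 3;
         TVW = sp (free_operad (arity2 (tensor_sgn V W))) 3 in
     (\<forall>y\<in>carrier TW. linear_map TV TVW (\<lambda>x. \<beta> x y)) \<and>
     (\<forall>x\<in>carrier TV. linear_map TW TVW (\<lambda>y. \<beta> x y)) \<and>
     (\<forall>u v. \<forall>\<omega>\<in>carrier (vsp V). \<forall>\<nu>\<in>carrier (vsp V). \<forall>\<omega>'\<in>carrier (vsp W). \<forall>\<nu>'\<in>carrier (vsp W).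
        \<beta> (circ_u V u \<omega> \<nu>) (circ_u W v \<omega>' \<nu>') =
          (if u = v then circ_u (tensor_sgn V W) u (ten V W \<omega> \<omega>') (ten V W \<nu> \<nu>') else \<zero>\<^bsub>TVW\<^esub>)))"

definition Psi ::
  "('k::field, 'v) s2mod \<Rightarrow> ('k, 'w) s2mod \<Rightarrow>
   ('k, 'v) free_elem \<Rightarrow> ('k, 'w) free_elem \<Rightarrow> ('k, ('v \<times> 'w \<Rightarrow>\<^sub>0 'k) set) free_elem" where
  "Psi V W = (SOME \<beta>. is_Psi V W \<beta>)"

definition black_rel ::
  "('k::field, 'v) s2mod \<Rightarrow> ('k, 'v) free_elem set \<Rightarrow> ('k, 'w) s2mod \<Rightarrow> ('k, 'w) free_elem set \<Rightarrow>
   ('k, ('v \<times> 'w \<Rightarrow>\<^sub>0 'k) set) free_elem set" where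
  "black_rel V R W S =
     lin_span (sp (free_operad (arity2 (tensor_sgn V W))) 3) {Psi V W r s |r s. r \<in> R \<and> s \<in> S}"

definition black_product ::
  "('k::field, 'v) s2mod \<Rightarrow> ('k, 'v) free_elem set \<Rightarrow> ('k, 'w) s2mod \<Rightarrow> ('k, 'w) free_elem set \<Rightarrow>
   ('k, ('k, ('v \<times> 'w \<Rightarrow>\<^sub>0 'k) set) free_elem set) operad" where
  "black_product V R W S = quad_operad (tensor_sgn V W) (black_rel V R W S)"

definition black_gen ::
  "('k::field, 'v) s2mod \<Rightarrow> ('k, 'v) free_elem set \<Rightarrow> ('k, 'w) s2mod \<Rightarrow> ('k, 'w) free_elem set \<Rightarrow>
   'v \<Rightarrow> 'w \<Rightarrow> ('k, ('v \<times> 'w \<Rightarrow>\<^sub>0 'k) set) free_elem set" where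
  "black_gen V R W S v w = quad_gen (tensor_sgn V W) (black_rel V R W S) (ten V W v w)"

end

theory Submission
  imports Defs
begin

text \<open>
  On generators the isomorphism of \<open>PostLie \<bullet> P\<close> with \<open>TSu(P)\<close> identifies \<open>PostLie(2) \<otimes> V \<otimes> sgn\<close> with
  three copies of \<open>V\<close>.  The space of relators of PostLie is spanned by seven elements, one for each nonempty
  subset \<open>J\<close> of \<open>{1,2,3}\<close>, chosen such that \<open>\<Psi>\<close> pairs the relator of \<open>J\<close> with \<open>r\<close> to \<open>TSu\<^sub>J(r)\<close>.

  By freeness \<open>\<eta>\<close> extends to a morphism from the free operad on the decorated generators to the free operad
  on \<open>V\<^sub>P\<close>.  Let \<open>\<tau>\<^sub>J\<close> be the tree \<open>\<tau>\<close> with \<open>P\<close> inserted at every leaf outside \<open>J\<close>.  Modulo the relations of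
  \<open>RB\<^sub>1(P)\<close>, the image of \<open>TSu\<^sub>J(\<tau>)\<close> is \<open>\<tau>\<^sub>J\<close> if \<open>J\<close> contains a leaf of \<open>\<tau>\<close>, and otherwise the image composed
  with \<open>P\<close> at the root is \<open>\<tau>\<^sub>J\<close>.  This is an induction on \<open>\<tau>\<close> in which the Rota-Baxter relation is used only at
  vertices without a leaf of \<open>J\<close> above them.  Hence \<open>TSu\<^sub>J(r)\<close> is mapped to a relation \<open>r\<close> composed with copies
  of \<open>P\<close>, which is zero.

  For (b), evaluating trees in \<open>A\<close> gives a morphism from \<open>RB\<^sub>1(P)\<close> to the endomorphism operad of \<open>A\<close>, which is
  composed with the two morphisms above.
\<close>

text \<open>The free operad is a quotient of the operad of trees by an ideal that is given only as
  an intersection. Its universal property handles morphisms, but three ingredients are not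
  morphisms: \<open>TSu_map\<close> for a fixed J, since the label of a vertex depends on all leaves
  above it; the coordinates on T(V)(3), on which \<Psi> rests; and the comparison of
  \<open>rbt\<close> with the insertion of P, which is made subtree by subtree. The first two
  descend to the quotient because they respect \<open>crel\<close>, an explicit spanning set of the
  ideal. For the third, subtrees have arbitrary leaf sets while ideals live over
  \<open>{1..n}\<close>; \<open>gid\<close> transports membership between them.

  Signs shape the isomorphism: (12) acts on PostLie(2) \<otimes> V with an extra sign, so once x
  \<circ> y goes to \<prec>, y \<circ> x has to go to minus \<succ>. The same sign makes \<Psi>
  equivariant only up to the sign of the permutation, which subspaces do not notice. Hence it is
  enough to compute with the three defining relations of PostLie: Jacobi matches J = {1,2,3}, the
  second relation J = {1}, the third J = {1,2}, and permutations produce the remaining J.\<close>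

abbreviation keys :: "('x \<Rightarrow>\<^sub>0 'k::zero) \<Rightarrow> 'x set" where
  "keys \<equiv> Poly_Mapping.keys"

abbreviation lookup :: "('x \<Rightarrow>\<^sub>0 'k::zero) \<Rightarrow> 'x \<Rightarrow> 'k" where
  "lookup \<equiv> Poly_Mapping.lookup"

abbreviation single :: "'x \<Rightarrow> 'k::zero \<Rightarrow> ('x \<Rightarrow>\<^sub>0 'k)" where
  "single \<equiv> Poly_Mapping.single"

abbreviation TV :: "('k::field, 'v) s2mod \<Rightarrow> ('k, ('v ltree \<Rightarrow>\<^sub>0 'k) set) operad" where
  "TV V \<equiv> free_operad (arity2 V)"

abbreviation TP :: "('k::field, 'v) s2mod \<Rightarrow> ('k, (('k \<times> 'v) ltree \<Rightarrow>\<^sub>0 'k) set) operad" where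
  "TP V \<equiv> free_operad (VP V)"

abbreviation elts :: "('k, 'v) s2mod \<Rightarrow> 'v set" where
  "elts V \<equiv> carrier (vsp V)"

abbreviation clV :: "('k::field, 'v) s2mod \<Rightarrow> nat \<Rightarrow> ('v ltree \<Rightarrow>\<^sub>0 'k) \<Rightarrow> ('v ltree \<Rightarrow>\<^sub>0 'k) set" where
  "clV V \<equiv> tree_class (arity2 V)"

abbreviation clP :: "('k::field, 'v) s2mod \<Rightarrow> nat \<Rightarrow> (('k \<times> 'v) ltree \<Rightarrow>\<^sub>0 'k) \<Rightarrow> (('k \<times> 'v) ltree \<Rightarrow>\<^sub>0 'k) set" where
  "clP V \<equiv> tree_class (VP V)"

section \<open>Linear algebra over the ground field: subspaces, spans and linear maps\<close>

lemma kring_simps [simp]: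
  "carrier kring = UNIV" "x \<otimes>\<^bsub>kring\<^esub> y = x * y" "\<one>\<^bsub>kring\<^esub> = 1" "\<zero>\<^bsub>kring\<^esub> = 0" "x \<oplus>\<^bsub>kring\<^esub> y = x + y"
  by (simp_all add: kring_def)

lemma cring_kring: "cring (kring :: 'k::field ring)"
proof (intro cringI abelian_groupI comm_monoidI)
  show "\<exists>y\<in>carrier kring. y \<oplus>\<^bsub>kring\<^esub> x = \<zero>\<^bsub>kring\<^esub>" for x :: 'k
    by (rule bexI[of _ "- x"]) auto
qed (auto simp: algebra_simps)

text \<open>Negatives are absent from the premises because they come for free: (-1) x is an additive
  inverse of x, since (-1) + 1 = 0 and the scalar 0 sends x to the zero vector.\<close>

lemma vspaceI:
  fixes M :: "('k::field, 'a) module"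
  assumes "\<zero>\<^bsub>M\<^esub> \<in> carrier M"
    and "\<And>x y. x \<in> carrier M \<Longrightarrow> y \<in> carrier M \<Longrightarrow> x \<oplus>\<^bsub>M\<^esub> y \<in> carrier M"
    and "\<And>x y z. x \<in> carrier M \<Longrightarrow> y \<in> carrier M \<Longrightarrow> z \<in> carrier M \<Longrightarrow>
           (x \<oplus>\<^bsub>M\<^esub> y) \<oplus>\<^bsub>M\<^esub> z = x \<oplus>\<^bsub>M\<^esub> (y \<oplus>\<^bsub>M\<^esub> z)"
    and "\<And>x y. x \<in> carrier M \<Longrightarrow> y \<in> carrier M \<Longrightarrow> x \<oplus>\<^bsub>M\<^esub> y = y \<oplus>\<^bsub>M\<^esub> x"
    and "\<And>x. x \<in> carrier M \<Longrightarrow> \<zero>\<^bsub>M\<^esub> \<oplus>\<^bsub>M\<^esub> x = x"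
    and "\<And>c x. x \<in> carrier M \<Longrightarrow> c \<odot>\<^bsub>M\<^esub> x \<in> carrier M"
    and "\<And>x. x \<in> carrier M \<Longrightarrow> 0 \<odot>\<^bsub>M\<^esub> x = \<zero>\<^bsub>M\<^esub>"
    and "\<And>x. x \<in> carrier M \<Longrightarrow> 1 \<odot>\<^bsub>M\<^esub> x = x"
    and "\<And>c d x. x \<in> carrier M \<Longrightarrow> (c + d) \<odot>\<^bsub>M\<^esub> x = c \<odot>\<^bsub>M\<^esub> x \<oplus>\<^bsub>M\<^esub> d \<odot>\<^bsub>M\<^esub> x"
    and "\<And>c x y. x \<in> carrier M \<Longrightarrow> y \<in> carrier M \<Longrightarrow> c \<odot>\<^bsub>M\<^esub> (x \<oplus>\<^bsub>M\<^esub> y) = c \<odot>\<^bsub>M\<^esub> x \<oplus>\<^bsub>M\<^esub> c \<odot>\<^bsub>M\<^esub> y"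
    and "\<And>c d x. x \<in> carrier M \<Longrightarrow> (c * d) \<odot>\<^bsub>M\<^esub> x = c \<odot>\<^bsub>M\<^esub> (d \<odot>\<^bsub>M\<^esub> x)"
  shows "vspace M"
proof (intro moduleI cring_kring abelian_groupI)
  show "\<exists>y\<in>carrier M. y \<oplus>\<^bsub>M\<^esub> x = \<zero>\<^bsub>M\<^esub>" if "x \<in> carrier M" for x
    using assms(6)[of x "-1"] assms(7,8)[of x] assms(9)[of x "-1" 1] that
    by (intro bexI[of _ "(-1) \<odot>\<^bsub>M\<^esub> x"]) auto
qed (use assms in auto)

lemma smult_minus_one: "vspace M \<Longrightarrow> x \<in> carrier M \<Longrightarrow> (-1) \<odot>\<^bsub>M\<^esub> x = \<ominus>\<^bsub>M\<^esub> x"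
proof -
  assume "vspace M" and x: "x \<in> carrier M"
  then interpret module kring M by simp
  show ?thesis
    using smult_l_distr[of "-1" 1 x] x smult_one[of x] smult_l_null[of x] smult_closed[of "-1" x]
    by (simp add: M.minus_equality)
qed

lemma vspace_submoduleI:
  assumes "vspace M" "H \<subseteq> carrier M" "\<zero>\<^bsub>M\<^esub> \<in> H"
    and "\<And>x y. x \<in> H \<Longrightarrow> y \<in> H \<Longrightarrow> x \<oplus>\<^bsub>M\<^esub> y \<in> H" and "\<And>c x. x \<in> H \<Longrightarrow> c \<odot>\<^bsub>M\<^esub> x \<in> H"
  shows "submodule H kring M"
proof -
  interpret module kring M by fact
  show ?thesis
  proof (rule submoduleI)
    show "\<ominus>\<^bsub>M\<^esub> x \<in> H" if "x \<in> H" for x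
      using smult_minus_one[OF assms(1), of x] assms(5)[of x "-1"] that assms(2) by auto
  qed (use assms in auto)
qed

lemma vspace_submoduleD:
  assumes "vspace M" "submodule H kring M"
  shows "H \<subseteq> carrier M" "\<zero>\<^bsub>M\<^esub> \<in> H"
    "\<And>x y. x \<in> H \<Longrightarrow> y \<in> H \<Longrightarrow> x \<oplus>\<^bsub>M\<^esub> y \<in> H" "\<And>c x. x \<in> H \<Longrightarrow> c \<odot>\<^bsub>M\<^esub> x \<in> H"
    "\<And>x. x \<in> H \<Longrightarrow> \<ominus>\<^bsub>M\<^esub> x \<in> H" "\<And>x y. x \<in> H \<Longrightarrow> y \<in> H \<Longrightarrow> x \<ominus>\<^bsub>M\<^esub> y \<in> H"
proof -
  interpret module kring M by fact
  note E = submoduleE[OF assms(2)]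
  show 1: "H \<subseteq> carrier M" by (rule E)
  show 3: "\<And>x y. x \<in> H \<Longrightarrow> y \<in> H \<Longrightarrow> x \<oplus>\<^bsub>M\<^esub> y \<in> H" by (rule E)
  show "\<And>c x. x \<in> H \<Longrightarrow> c \<odot>\<^bsub>M\<^esub> x \<in> H" by (rule E) auto
  show 4: "\<And>x. x \<in> H \<Longrightarrow> \<ominus>\<^bsub>M\<^esub> x \<in> H" by (rule E)
  show "\<And>x y. x \<in> H \<Longrightarrow> y \<in> H \<Longrightarrow> x \<ominus>\<^bsub>M\<^esub> y \<in> H"
    using 3 4 by (simp add: a_minus_def)
  obtain x where "x \<in> H" using E(2) by auto
  then show "\<zero>\<^bsub>M\<^esub> \<in> H"
    using 3[of x "\<ominus>\<^bsub>M\<^esub> x"] 4[of x] 1 M.r_neg[of x] by auto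
qed

lemma submodule_Inter:
  assumes "vspace M" "S \<noteq> {}" "\<And>H. H \<in> S \<Longrightarrow> submodule H kring M"
  shows "submodule (\<Inter>S) kring M"
proof (rule vspace_submoduleI[OF assms(1)])
  note D = vspace_submoduleD[OF assms(1) assms(3)]
  show "\<Inter>S \<subseteq> carrier M" using assms(2) D(1) by blast
  show "\<zero>\<^bsub>M\<^esub> \<in> \<Inter>S" using D(2) by simp
  show "x \<oplus>\<^bsub>M\<^esub> y \<in> \<Inter>S" if "x \<in> \<Inter>S" "y \<in> \<Inter>S" for x y
    using that D(3) by simp
  show "c \<odot>\<^bsub>M\<^esub> x \<in> \<Inter>S" if "x \<in> \<Inter>S" for c x
    using that D(4) by simp
qed

lemma submodule_carrier: "vspace M \<Longrightarrow> submodule (carrier M) kring M"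
  by (rule module.carrier_is_submodule)

lemma lin_span_submodule:
  assumes "vspace M" "S \<subseteq> carrier M"
  shows "submodule (lin_span M S) kring M"
  unfolding lin_span_def using assms submodule_carrier
  by (intro submodule_Inter) auto

lemma lin_span_least: "submodule N kring M \<Longrightarrow> S \<subseteq> N \<Longrightarrow> lin_span M S \<subseteq> N"
  by (auto simp: lin_span_def)

lemma lin_span_superset: "S \<subseteq> lin_span M S"
  by (auto simp: lin_span_def)

lemma linear_mapI:
  assumes "\<And>x. x \<in> carrier M \<Longrightarrow> h x \<in> carrier N"
    and "\<And>x y. x \<in> carrier M \<Longrightarrow> y \<in> carrier M \<Longrightarrow> h (x \<oplus>\<^bsub>M\<^esub> y) = h x \<oplus>\<^bsub>N\<^esub> h y"
    and "\<And>c x. x \<in> carrier M \<Longrightarrow> h (c \<odot>\<^bsub>M\<^esub> x) = c \<odot>\<^bsub>N\<^esub> h x"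
  shows "linear_map M N h"
  using assms by (auto simp: linear_map_def)

lemma linear_mapD:
  assumes "linear_map M N h"
  shows "x \<in> carrier M \<Longrightarrow> h x \<in> carrier N"
    "x \<in> carrier M \<Longrightarrow> y \<in> carrier M \<Longrightarrow> h (x \<oplus>\<^bsub>M\<^esub> y) = h x \<oplus>\<^bsub>N\<^esub> h y"
    "x \<in> carrier M \<Longrightarrow> h (c \<odot>\<^bsub>M\<^esub> x) = c \<odot>\<^bsub>N\<^esub> h x"
  using assms by (auto simp: linear_map_def)

lemma linear_map_zero:
  assumes "vspace M" "vspace N" "linear_map M N h"
  shows "h \<zero>\<^bsub>M\<^esub> = \<zero>\<^bsub>N\<^esub>"
proof -
  interpret M: module kring M by fact
  interpret N: module kring N by fact
  show ?thesis
    using linear_mapD(3)[OF assms(3), of "\<zero>\<^bsub>M\<^esub>" 0] linear_mapD(1)[OF assms(3), of "\<zero>\<^bsub>M\<^esub>"]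
      M.smult_l_null[of "\<zero>\<^bsub>M\<^esub>"] N.smult_l_null by simp
qed

lemma linear_map_minus:
  assumes "vspace M" "vspace N" "linear_map M N h"
  shows "x \<in> carrier M \<Longrightarrow> h (\<ominus>\<^bsub>M\<^esub> x) = \<ominus>\<^bsub>N\<^esub> h x"
    "x \<in> carrier M \<Longrightarrow> y \<in> carrier M \<Longrightarrow> h (x \<ominus>\<^bsub>M\<^esub> y) = h x \<ominus>\<^bsub>N\<^esub> h y"
proof -
  interpret M: module kring M by fact
  interpret N: module kring N by fact
  show 1: "h (\<ominus>\<^bsub>M\<^esub> x) = \<ominus>\<^bsub>N\<^esub> h x" if "x \<in> carrier M" for x
    using linear_mapD(1,3)[OF assms(3) that] smult_minus_one[OF assms(1) that]
      smult_minus_one[OF assms(2), of "h x"] by metis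
  show "h (x \<ominus>\<^bsub>M\<^esub> y) = h x \<ominus>\<^bsub>N\<^esub> h y" if "x \<in> carrier M" "y \<in> carrier M"
    using that 1[of y] linear_mapD(2)[OF assms(3), of x "\<ominus>\<^bsub>M\<^esub> y"] by (simp add: a_minus_def)
qed

lemma linear_map_compose:
  "linear_map M N h \<Longrightarrow> linear_map N L g \<Longrightarrow> linear_map M L (\<lambda>x. g (h x))"
  by (auto simp: linear_map_def Pi_def)

lemma linear_map_cong:
  assumes "vspace M" "linear_map M N h" "\<And>x. x \<in> carrier M \<Longrightarrow> h x = g x"
  shows "linear_map M N g"
proof -
  interpret M: module kring M by fact
  show ?thesis
    using assms(2,3) by (auto simp: linear_map_def Pi_def)
qed

lemma linear_map_id: "linear_map M M (\<lambda>x. x)"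
  by (auto simp: linear_map_def)

lemma submodule_kernel:
  assumes "vspace M" "vspace N" "linear_map M N h" "submodule K kring N"
  shows "submodule {x \<in> carrier M. h x \<in> K} kring M"
proof -
  interpret M: module kring M by fact
  show ?thesis
    using vspace_submoduleD[OF assms(2,4)] linear_mapD[OF assms(3)]
      linear_map_zero[OF assms(1,2,3)]
    by (intro vspace_submoduleI[OF assms(1)]) auto
qed

lemma submodule_zero: "vspace M \<Longrightarrow> submodule {\<zero>\<^bsub>M\<^esub>} kring M"
proof -
  assume *: "vspace M"
  then interpret M: module kring M .
  show ?thesis by (rule vspace_submoduleI[OF *]) auto
qed

text \<open>The preimage of \<open>K\<close> is a subspace, so it contains the span once it contains
  \<open>S\<close>. This replaces expansions into linear combinations whenever a space of relations
  is given as a span.\<close>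

lemma linear_map_lin_span:
  assumes "vspace M" "vspace N" "linear_map M N h" "S \<subseteq> carrier M" "submodule K kring N"
    and "\<And>s. s \<in> S \<Longrightarrow> h s \<in> K" and "x \<in> lin_span M S"
  shows "h x \<in> K"
  using lin_span_least[OF submodule_kernel[OF assms(1,2,3,5)], of S] assms(4,6,7) by auto

subsection \<open>Quotients\<close>

lemma coset_eq_iff:
  assumes "vspace M" "submodule N kring M" "x \<in> carrier M" "y \<in> carrier M"
  shows "N +>\<^bsub>M\<^esub> x = N +>\<^bsub>M\<^esub> y \<longleftrightarrow> x \<ominus>\<^bsub>M\<^esub> y \<in> N"
proof -
  interpret M: module kring M by fact
  interpret S: submodule N kring M by fact
  interpret A: abelian_subgroup N M
    using S.subgroup_axioms M.abelian_group_axioms by (intro abelian_subgroupI3 additive_subgroupI)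
  have "N +>\<^bsub>M\<^esub> x = N +>\<^bsub>M\<^esub> y \<longleftrightarrow> x \<in> N +>\<^bsub>M\<^esub> y"
    using A.a_repr_independence'[of x y] A.a_repr_independenceD[of x y] assms(3,4) by metis
  then show ?thesis
    using A.a_rcos_module[OF assms(4,3)] by (simp add: a_minus_def)
qed

lemma coset_eq_self_iff:
  assumes "vspace M" "submodule N kring M" "x \<in> carrier M"
  shows "N +>\<^bsub>M\<^esub> x = N \<longleftrightarrow> x \<in> N"
proof -
  interpret M: module kring M by fact
  have *: "N +>\<^bsub>M\<^esub> \<zero>\<^bsub>M\<^esub> = N"
    using M.a_coset_add_zero vspace_submoduleD(1)[OF assms(1,2)] by simp
  show ?thesis
    using coset_eq_iff[OF assms(1,2,3), of "\<zero>\<^bsub>M\<^esub>"] * assms(3)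
    by (metis M.zero_closed M.r_zero M.add.inv_one a_inv_def a_minus_def)
qed

lemma coset_iff:
  assumes "vspace M" "submodule N kring M" "x \<in> carrier M"
  shows "y \<in> N +>\<^bsub>M\<^esub> x \<longleftrightarrow> (y \<in> carrier M \<and> N +>\<^bsub>M\<^esub> y = N +>\<^bsub>M\<^esub> x)"
proof -
  interpret M: module kring M by fact
  interpret S: submodule N kring M by fact
  interpret A: abelian_subgroup N M
    using S.subgroup_axioms M.abelian_group_axioms by (intro abelian_subgroupI3 additive_subgroupI)
  show ?thesis
    using A.a_repr_independence'[of y x] A.a_repr_independenceD[of y x] A.a_rcos_self[of y] assms(3)
      A.a_elemrcos_carrier[of x y] by metis
qed

text \<open>Operations on quotients are defined as unions over all representatives. Such a union
  collapses to a single value as soon as the value is independent of the representative, because x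
  represents its own coset.\<close>

lemma UN_coset:
  assumes "vspace M" "submodule N kring M" "x \<in> carrier M"
    and "\<And>y. y \<in> carrier M \<Longrightarrow> N +>\<^bsub>M\<^esub> y = N +>\<^bsub>M\<^esub> x \<Longrightarrow> h y = h x"
  shows "(\<Union>y\<in>N +>\<^bsub>M\<^esub> x. h y) = h x"
proof -
  have "x \<in> N +>\<^bsub>M\<^esub> x" using coset_iff[OF assms(1,2,3), of x] assms(3) by blast
  moreover have "h y = h x" if "y \<in> N +>\<^bsub>M\<^esub> x" for y
    using that coset_iff[OF assms(1,2,3), of y] assms(4) by blast
  ultimately show ?thesis by blast
qed

lemma linear_coset_cong:
  assumes "vspace M" "submodule N kring M" "vspace L" "submodule K kring L"
    and "linear_map M L h" "\<And>z. z \<in> N \<Longrightarrow> h z \<in> K"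
    and "x \<in> carrier M" "y \<in> carrier M" "N +>\<^bsub>M\<^esub> y = N +>\<^bsub>M\<^esub> x"
  shows "K +>\<^bsub>L\<^esub> h y = K +>\<^bsub>L\<^esub> h x"
proof -
  have "y \<ominus>\<^bsub>M\<^esub> x \<in> N" using coset_eq_iff[OF assms(1,2,8,7)] assms(9) by blast
  then have "h y \<ominus>\<^bsub>L\<^esub> h x \<in> K"
    using assms(6)[of "y \<ominus>\<^bsub>M\<^esub> x"] linear_map_minus(2)[OF assms(1,3,5,8,7)] by simp
  then show ?thesis
    using coset_eq_iff[OF assms(3,4) linear_mapD(1)[OF assms(5,8)] linear_mapD(1)[OF assms(5,7)]] by blast
qed

lemma induced_coset:
  assumes "vspace M" "submodule N kring M" "vspace L" "submodule K kring L"
    and "linear_map M L h" "\<And>z. z \<in> N \<Longrightarrow> h z \<in> K" "x \<in> carrier M"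
  shows "induced L K h (N +>\<^bsub>M\<^esub> x) = K +>\<^bsub>L\<^esub> h x"
  unfolding induced_def
  by (intro UN_coset[OF assms(1,2,7)] linear_coset_cong[OF assms(1-6)] assms(7))

lemma carrier_quot_module: "carrier (quot_module M N) = (\<lambda>x. N +>\<^bsub>M\<^esub> x) ` carrier M"
  by (auto simp: quot_module_def mk_module_def A_RCOSETS_def' image_def)

lemma add_quot_module:
  assumes "vspace M" "submodule N kring M" "x \<in> carrier M" "y \<in> carrier M"
  shows "(N +>\<^bsub>M\<^esub> x) \<oplus>\<^bsub>quot_module M N\<^esub> (N +>\<^bsub>M\<^esub> y) = N +>\<^bsub>M\<^esub> (x \<oplus>\<^bsub>M\<^esub> y)"
proof -
  interpret M: module kring M by fact
  interpret S: submodule N kring M by fact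
  interpret A: abelian_subgroup N M
    using S.subgroup_axioms M.abelian_group_axioms by (intro abelian_subgroupI3 additive_subgroupI)
  show ?thesis
    using A.a_rcos_sum assms by (simp add: quot_module_def mk_module_def)
qed

lemma smult_quot_module:
  assumes "vspace M" "submodule N kring M" "x \<in> carrier M"
  shows "c \<odot>\<^bsub>quot_module M N\<^esub> (N +>\<^bsub>M\<^esub> x) = N +>\<^bsub>M\<^esub> (c \<odot>\<^bsub>M\<^esub> x)"
proof -
  interpret M: module kring M by fact
  have "linear_map M M (\<lambda>x. c \<odot>\<^bsub>M\<^esub> x)"
    by (rule linear_mapI) (simp_all add: M.smult_r_distr flip: M.smult_assoc1, simp add: mult.commute)
  from induced_coset[OF assms(1,2,1,2) this] show ?thesis
    using vspace_submoduleD(4)[OF assms(1,2)] assms(3)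
    by (simp add: quot_module_def mk_module_def induced_def)
qed

lemma zero_quot_module [simp]: "\<zero>\<^bsub>quot_module M N\<^esub> = N"
  by (simp add: quot_module_def mk_module_def)

lemma quot_zero_coset:
  assumes "vspace M" "submodule N kring M"
  shows "N = N +>\<^bsub>M\<^esub> \<zero>\<^bsub>M\<^esub>"
  using coset_eq_self_iff[OF assms, of "\<zero>\<^bsub>M\<^esub>"] vspace_submoduleD[OF assms] by auto

lemma vspace_quot_module:
  assumes "vspace M" "submodule N kring M"
  shows "vspace (quot_module M N)"
proof -
  interpret M: module kring M by fact
  let ?Q = "quot_module M N"
  note q = add_quot_module[OF assms] smult_quot_module[OF assms]
  have Q: "\<exists>x\<in>carrier M. X = N +>\<^bsub>M\<^esub> x" if "X \<in> carrier ?Q" for X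
    using that by (auto simp: carrier_quot_module)
  have C: "N +>\<^bsub>M\<^esub> x \<in> carrier ?Q" if "x \<in> carrier M" for x
    using that by (auto simp: carrier_quot_module)
  have z: "\<zero>\<^bsub>?Q\<^esub> = N +>\<^bsub>M\<^esub> \<zero>\<^bsub>M\<^esub>"
    using quot_zero_coset[OF assms] by simp
  show ?thesis
  proof (rule vspaceI)
    show "\<zero>\<^bsub>?Q\<^esub> \<in> carrier ?Q"
      unfolding z by (rule C) simp
    fix X assume "X \<in> carrier ?Q"
    with Q obtain x where x: "x \<in> carrier M" "X = N +>\<^bsub>M\<^esub> x" by blast
    show "\<zero>\<^bsub>?Q\<^esub> \<oplus>\<^bsub>?Q\<^esub> X = X"
      unfolding z x(2) using x(1) q(1)[of "\<zero>\<^bsub>M\<^esub>" x] by simp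
    show "0 \<odot>\<^bsub>?Q\<^esub> X = \<zero>\<^bsub>?Q\<^esub>"
      unfolding z x(2) using x(1) q(2)[of x 0] M.smult_l_null[of x] by simp
    show "1 \<odot>\<^bsub>?Q\<^esub> X = X"
      unfolding x(2) using x(1) q(2)[of x 1] M.smult_one[of x] by simp
    show cs: "c \<odot>\<^bsub>?Q\<^esub> X \<in> carrier ?Q" for c
      unfolding x(2) using x(1) q(2)[of x c] C[of "c \<odot>\<^bsub>M\<^esub> x"] by simp
    show "(c + d) \<odot>\<^bsub>?Q\<^esub> X = c \<odot>\<^bsub>?Q\<^esub> X \<oplus>\<^bsub>?Q\<^esub> d \<odot>\<^bsub>?Q\<^esub> X" for c d
      unfolding x(2) using x(1) q(2)[of x] q(1)[of "c \<odot>\<^bsub>M\<^esub> x" "d \<odot>\<^bsub>M\<^esub> x"] M.smult_l_distr[of c d x]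
      by simp
    show "(c * d) \<odot>\<^bsub>?Q\<^esub> X = c \<odot>\<^bsub>?Q\<^esub> (d \<odot>\<^bsub>?Q\<^esub> X)" for c d
      unfolding x(2) using x(1) q(2)[of x] q(2)[of "d \<odot>\<^bsub>M\<^esub> x"] M.smult_assoc1[of c d x] by simp
    fix Y assume "Y \<in> carrier ?Q"
    with Q obtain y where y: "y \<in> carrier M" "Y = N +>\<^bsub>M\<^esub> y" by blast
    show "X \<oplus>\<^bsub>?Q\<^esub> Y \<in> carrier ?Q"
      unfolding x(2) y(2) using x(1) y(1) q(1)[of x y] C[of "x \<oplus>\<^bsub>M\<^esub> y"] by simp
    show "X \<oplus>\<^bsub>?Q\<^esub> Y = Y \<oplus>\<^bsub>?Q\<^esub> X"
      unfolding x(2) y(2) using x(1) y(1) q(1)[of x y] q(1)[of y x] M.a_comm[of x y] by simp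
    show "c \<odot>\<^bsub>?Q\<^esub> (X \<oplus>\<^bsub>?Q\<^esub> Y) = c \<odot>\<^bsub>?Q\<^esub> X \<oplus>\<^bsub>?Q\<^esub> c \<odot>\<^bsub>?Q\<^esub> Y" for c
      unfolding x(2) y(2) using x(1) y(1) q M.smult_r_distr[of c x y] by simp
    fix Z assume "Z \<in> carrier ?Q"
    with Q obtain w where w: "w \<in> carrier M" "Z = N +>\<^bsub>M\<^esub> w" by blast
    show "X \<oplus>\<^bsub>?Q\<^esub> Y \<oplus>\<^bsub>?Q\<^esub> Z = X \<oplus>\<^bsub>?Q\<^esub> (Y \<oplus>\<^bsub>?Q\<^esub> Z)"
      unfolding x(2) y(2) w(2) using x(1) y(1) w(1) q(1) M.a_assoc[of x y w] by simp
  qed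
qed

lemma linear_map_coset:
  assumes "vspace M" "submodule N kring M"
  shows "linear_map M (quot_module M N) (\<lambda>x. N +>\<^bsub>M\<^esub> x)"
  by (rule linear_mapI) (simp_all add: carrier_quot_module add_quot_module[OF assms] smult_quot_module[OF assms])

lemma linear_map_quotI:
  assumes "vspace M" "submodule N kring M" "linear_map M L (\<lambda>x. f (N +>\<^bsub>M\<^esub> x))"
  shows "linear_map (quot_module M N) L f"
proof -
  interpret M: module kring M by fact
  show ?thesis
    using linear_mapD[OF assms(3)]
    by (intro linear_mapI)
      (auto simp: carrier_quot_module add_quot_module[OF assms(1,2)] smult_quot_module[OF assms(1,2)])
qed

lemma linear_map_induced:
  assumes "vspace M" "submodule N kring M" "vspace L" "submodule K kring L"
    and "linear_map M L h" "\<And>z. z \<in> N \<Longrightarrow> h z \<in> K"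
  shows "linear_map (quot_module M N) (quot_module L K) (induced L K h)"
proof (rule linear_map_quotI[OF assms(1,2)])
  show "linear_map M (quot_module L K) (\<lambda>x. induced L K h (N +>\<^bsub>M\<^esub> x))"
    using linear_map_cong[OF assms(1) linear_map_compose[OF assms(5) linear_map_coset[OF assms(3,4)]]]
      induced_coset[OF assms] by metis
qed

text \<open>The factor map evaluates \<open>h\<close> at a chosen representative; two
  representatives differ by an element of \<open>N\<close>, which \<open>h\<close> kills. In
  contrast to \<open>induced\<close>, the target can be any vector space, so this is the form needed
  for maps into endomorphism operads.\<close>

lemma linear_map_factor:
  assumes "vspace M" "submodule N kring M" "vspace L"
    and "linear_map M L h" "\<And>z. z \<in> N \<Longrightarrow> h z = \<zero>\<^bsub>L\<^esub>"
  shows "\<exists>g. linear_map (quot_module M N) L g \<and> (\<forall>x\<in>carrier M. g (N +>\<^bsub>M\<^esub> x) = h x)"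
proof -
  interpret M: module kring M by fact
  interpret L: module kring L by fact
  let ?g = "\<lambda>X. h (SOME x. x \<in> X)"
  have g: "?g (N +>\<^bsub>M\<^esub> x) = h x" if x: "x \<in> carrier M" for x
  proof -
    let ?y = "SOME y. y \<in> N +>\<^bsub>M\<^esub> x"
    have "x \<in> N +>\<^bsub>M\<^esub> x" using coset_iff[OF assms(1,2) x] x by simp
    then have "?y \<in> N +>\<^bsub>M\<^esub> x" by (rule someI)
    then have "?y \<in> carrier M" "N +>\<^bsub>M\<^esub> ?y = N +>\<^bsub>M\<^esub> x" using coset_iff[OF assms(1,2) x] by auto
    then have "h (?y \<ominus>\<^bsub>M\<^esub> x) = \<zero>\<^bsub>L\<^esub>" "?y \<in> carrier M"
      using coset_eq_iff[OF assms(1,2) _ x] assms(5) by auto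
    then have "h ?y \<ominus>\<^bsub>L\<^esub> h x = \<zero>\<^bsub>L\<^esub>"
      using linear_map_minus(2)[OF assms(1,3,4) _ x] by simp
    then show ?thesis
      using linear_mapD(1)[OF assms(4)] x \<open>?y \<in> carrier M\<close>
      by (simp add: a_minus_def L.minus_equality[symmetric] L.add.inv_solve_right')
  qed
  show ?thesis
    by (intro exI[of _ ?g] conjI ballI g linear_map_quotI[OF assms(1,2)])
      (rule linear_map_cong[OF assms(1,4)], simp add: g)
qed

subsection \<open>Free modules\<close>

lemma free_module_simps [simp]:
  "carrier (free_module X) = {f. keys f \<subseteq> X}" "\<zero>\<^bsub>free_module X\<^esub> = 0"
  "f \<oplus>\<^bsub>free_module X\<^esub> g = f + g" "c \<odot>\<^bsub>free_module X\<^esub> f = Poly_Mapping.map ((*) c) f"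
  by (simp_all add: free_module_def mk_module_def)

lemma lookup_map_mult [simp]:
  "lookup (Poly_Mapping.map ((*) (c::'k::field)) f) x = c * lookup f x"
  by (simp add: Poly_Mapping.map.rep_eq when_def)

lemma keys_map_mult: "keys (Poly_Mapping.map ((*) (c::'k::field)) f) \<subseteq> keys f"
  by (auto simp: in_keys_iff)

lemma map_mult_simps [simp]:
  fixes c :: "'k::field"
  shows "Poly_Mapping.map ((*) c) (single x d) = single x (c * d)"
    "Poly_Mapping.map ((*) c) 0 = 0"
  by (rule poly_mapping_eqI; simp add: lookup_single when_def)+

lemma vspace_free_module: "vspace (free_module X :: ('k::field, 'x \<Rightarrow>\<^sub>0 'k) module)"
proof (rule vspaceI)
  show "f \<oplus>\<^bsub>free_module X\<^esub> g \<in> carrier (free_module X)"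
    if "f \<in> carrier (free_module X)" "g \<in> carrier (free_module X)" for f g :: "'x \<Rightarrow>\<^sub>0 'k"
    using that keys_add[of f g] by auto
  show "c \<odot>\<^bsub>free_module X\<^esub> f \<in> carrier (free_module X)"
    if "f \<in> carrier (free_module X)" for f :: "'x \<Rightarrow>\<^sub>0 'k" and c
    using that keys_map_mult[of c f] by auto
qed (auto simp: algebra_simps lookup_add intro!: poly_mapping_eqI)

lemma keys_bas [simp]: "keys (bas x :: _ \<Rightarrow>\<^sub>0 'k::field) = {x}"
  by (simp add: bas_def)

lemma free_module_minus [simp]:
  assumes "keys f \<subseteq> X" "keys g \<subseteq> X"
  shows "\<ominus>\<^bsub>free_module X\<^esub> f = - (f :: _ \<Rightarrow>\<^sub>0 'k::field)" "f \<ominus>\<^bsub>free_module X\<^esub> g = (f :: _ \<Rightarrow>\<^sub>0 'k::field) - g"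
proof -
  have *: "\<ominus>\<^bsub>free_module X\<^esub> f = - f" if "keys f \<subseteq> X" for f :: "_ \<Rightarrow>\<^sub>0 'k"
  proof -
    have "\<ominus>\<^bsub>free_module X\<^esub> f = Poly_Mapping.map ((*) (- 1)) f"
      using smult_minus_one[OF vspace_free_module, of f X] that by simp
    then show ?thesis by (auto intro!: poly_mapping_eqI)
  qed
  show "\<ominus>\<^bsub>free_module X\<^esub> f = - f" "f \<ominus>\<^bsub>free_module X\<^esub> g = f - g"
    using * assms by (auto simp: a_minus_def)
qed

lemma free_module_induct [consumes 1, case_names zero add]:
  assumes "keys f \<subseteq> X"
    and "P 0"
    and "\<And>f x c. keys f \<subseteq> X \<Longrightarrow> x \<in> X \<Longrightarrow> P f \<Longrightarrow> P (single x c + f)"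
  shows "P (f :: 'x \<Rightarrow>\<^sub>0 'k::field)"
proof -
  have "finite (keys f)" by simp
  then show ?thesis using assms(1)
  proof (induction "keys f" arbitrary: f rule: finite_induct)
    case empty
    then have "f = 0" by (metis keys_eq_empty)
    then show ?case using assms(2) by simp
  next
    case (insert x F)
    let ?g = "f - single x (lookup f x)"
    have k: "keys ?g = F"
      using insert(2,4) by (auto simp: in_keys_iff lookup_minus lookup_single when_def set_eq_iff split: if_splits)
    have "P ?g" by (rule insert(3)) (use k insert in auto)
    then have "P (single x (lookup f x) + ?g)"
      by (intro assms(3)) (use k insert(4,5) in blast)+
    then show ?case by simp
  qed
qed

lemma free_linear_eqI:
  assumes "vspace N" "linear_map (free_module X) N f" "linear_map (free_module X) N g"
    and "\<And>x. x \<in> X \<Longrightarrow> f (bas x) = g (bas x)" and "keys z \<subseteq> X"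
  shows "f z = g z"
  using assms(5)
proof (induction rule: free_module_induct)
  case zero
  show ?case
    using linear_map_zero[OF vspace_free_module assms(1,2)] linear_map_zero[OF vspace_free_module assms(1,3)] by simp
next
  case (add z x c)
  have s: "single x c = c \<odot>\<^bsub>free_module X\<^esub> bas x" by (simp add: bas_def)
  have "f (single x c \<oplus>\<^bsub>free_module X\<^esub> z) = g (single x c \<oplus>\<^bsub>free_module X\<^esub> z)"
    using add linear_mapD(2,3)[OF assms(2)] linear_mapD(2,3)[OF assms(3)] assms(4)
    unfolding s by (simp add: order.trans[OF keys_map_mult] del: map_mult_simps)
  then show ?case by simp
qed

definition lext :: "('k::field, 'b) module \<Rightarrow> ('x \<Rightarrow> 'b) \<Rightarrow> ('x \<Rightarrow>\<^sub>0 'k) \<Rightarrow> 'b" where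
  "lext N F f = (\<Oplus>\<^bsub>N\<^esub> s\<in>keys f. lookup f s \<odot>\<^bsub>N\<^esub> F s)"

text \<open>Additivity of \<open>lext\<close> compares sums over three different supports. Enlarging
  the supports to a common finite set only adds terms with coefficient zero and allows a comparison
  term by term.\<close>

lemma lext_superset:
  assumes "vspace N" "finite S" "keys f \<subseteq> S" "F \<in> S \<rightarrow> carrier N"
  shows "lext N F f = (\<Oplus>\<^bsub>N\<^esub> s\<in>S. lookup f s \<odot>\<^bsub>N\<^esub> F s)"
proof -
  interpret N: module kring N by fact
  show ?thesis
    unfolding lext_def using assms N.smult_l_null
    by (intro N.add.finprod_mono_neutral_cong_left) (auto simp: in_keys_iff Pi_iff)
qed

lemma lext_linear:
  assumes "vspace N" "F \<in> X \<rightarrow> carrier N"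
  shows "linear_map (free_module X) N (lext N F)"
proof -
  interpret N: module kring N by fact
  have F: "c \<odot>\<^bsub>N\<^esub> F s \<in> carrier N" if "s \<in> X" for c s using assms(2) that by (auto simp: Pi_iff)
  show ?thesis
  proof (rule linear_mapI)
    show "lext N F f \<in> carrier N" if "f \<in> carrier (free_module X)" for f
      unfolding lext_def using F that by (intro N.finsum_closed) auto
    show "lext N F (f \<oplus>\<^bsub>free_module X\<^esub> g) = lext N F f \<oplus>\<^bsub>N\<^esub> lext N F g"
      if "f \<in> carrier (free_module X)" "g \<in> carrier (free_module X)" for f g
    proof -
      let ?S = "keys f \<union> keys g"
      have S: "?S \<subseteq> X" "F \<in> ?S \<rightarrow> carrier N" using that assms(2) by auto
      have "lext N F (f + g) = (\<Oplus>\<^bsub>N\<^esub> s\<in>?S. lookup (f + g) s \<odot>\<^bsub>N\<^esub> F s)"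
        by (rule lext_superset[OF assms(1) _ _ S(2)]) (auto dest: subsetD[OF keys_add])
      also have "\<dots> = (\<Oplus>\<^bsub>N\<^esub> s\<in>?S. lookup f s \<odot>\<^bsub>N\<^esub> F s \<oplus>\<^bsub>N\<^esub> lookup g s \<odot>\<^bsub>N\<^esub> F s)"
        using S N.smult_l_distr[simplified] F by (intro N.finsum_cong') (auto simp: lookup_add Pi_iff)
      also have "\<dots> = (\<Oplus>\<^bsub>N\<^esub> s\<in>?S. lookup f s \<odot>\<^bsub>N\<^esub> F s) \<oplus>\<^bsub>N\<^esub> (\<Oplus>\<^bsub>N\<^esub> s\<in>?S. lookup g s \<odot>\<^bsub>N\<^esub> F s)"
        using F S by (intro N.finsum_addf) auto
      also have "\<dots> = lext N F f \<oplus>\<^bsub>N\<^esub> lext N F g"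
        using lext_superset[OF assms(1) _ _ S(2), of f] lext_superset[OF assms(1) _ _ S(2), of g] by simp
      finally show ?thesis by simp
    qed
    show "lext N F (c \<odot>\<^bsub>free_module X\<^esub> f) = c \<odot>\<^bsub>N\<^esub> lext N F f" if "f \<in> carrier (free_module X)" for c f
    proof -
      let ?S = "keys f"
      have S: "?S \<subseteq> X" "F \<in> ?S \<rightarrow> carrier N" using that assms(2) by auto
      have "lext N F (Poly_Mapping.map ((*) c) f)
          = (\<Oplus>\<^bsub>N\<^esub> s\<in>?S. lookup (Poly_Mapping.map ((*) c) f) s \<odot>\<^bsub>N\<^esub> F s)"
        by (rule lext_superset[OF assms(1) _ keys_map_mult S(2)]) simp
      also have "\<dots> = (\<Oplus>\<^bsub>N\<^esub> s\<in>?S. c \<odot>\<^bsub>N\<^esub> (lookup f s \<odot>\<^bsub>N\<^esub> F s))"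
        using S N.smult_assoc1[simplified] F by (intro N.finsum_cong') (auto simp: Pi_iff)
      also have "\<dots> = c \<odot>\<^bsub>N\<^esub> lext N F f"
        unfolding lext_def using F S by (intro N.finsum_smult_ldistr[symmetric]) auto
      finally show ?thesis by simp
    qed
  qed
qed

lemma lext_bas [simp]:
  assumes "vspace N" "F x \<in> carrier N"
  shows "lext N F (bas x) = F x"
proof -
  interpret N: module kring N by fact
  show ?thesis using assms N.smult_one by (simp add: lext_def bas_def)
qed

lemma push_superset:
  assumes "finite S" "keys f \<subseteq> S"
  shows "push h f = (\<Sum>s\<in>S. single (h s) (lookup f s))"
  unfolding push_def using assms by (intro sum.mono_neutral_left) (auto simp: in_keys_iff)

lemma push_add: "push h (f + g) = push h f + push h g"
  using push_superset[of "keys f \<union> keys g" f h]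
    push_superset[of "keys f \<union> keys g" g h]
    push_superset[of "keys f \<union> keys g" "f + g" h]
  by (simp add: keys_add lookup_add single_add sum.distrib)

lemma push_single [simp]: "push h (single x c) = single (h x) c"
  by (cases "c = 0") (simp_all add: push_def)

lemma push_zero [simp]: "push h 0 = 0"
  by (simp add: push_def)

lemma push_uminus: "push h (- f) = - push h f"
  by (simp add: push_def single_uminus sum_negf)

lemma push_diff: "push h (f - g) = push h f - push h g"
  using push_add[of h f "- g"] by (simp add: push_uminus)

lemma push_bas [simp]: "push h (bas x) = bas (h x)"
  by (simp add: bas_def)

lemma push_cong: "(\<And>x. x \<in> keys f \<Longrightarrow> h x = g x) \<Longrightarrow> push h f = push g f"
  by (simp add: push_def)

lemma map_mult_add: "Poly_Mapping.map ((*) (c::'k::field)) (f + g) = Poly_Mapping.map ((*) c) f + Poly_Mapping.map ((*) c) g"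
  by (rule poly_mapping_eqI) (simp add: lookup_add algebra_simps)

lemma push_smult: "push h (Poly_Mapping.map ((*) c) f) = Poly_Mapping.map ((*) c) (push h f)"
proof -
  have "keys f \<subseteq> UNIV" by simp
  then show ?thesis
    by (induction rule: free_module_induct) (simp_all add: push_add map_mult_add)
qed

lemma push_push: "push g (push h f) = push (\<lambda>x. g (h x)) f"
proof -
  have "keys f \<subseteq> UNIV" by simp
  then show ?thesis
    by (induction rule: free_module_induct) (simp_all add: push_add)
qed

lemma keys_push: "keys (push h f) \<subseteq> h ` keys f"
proof -
  have "keys f \<subseteq> keys f" by simp
  then show ?thesis
    unfolding push_def
    by (intro order.trans[OF keys_sum]) (auto split: if_splits)
qed

lemma push_linear: "h \<in> X \<rightarrow> Y \<Longrightarrow> linear_map (free_module X) (free_module Y) (push h)"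
proof (rule linear_mapI)
  show "push h f \<in> carrier (free_module Y)" if "h \<in> X \<rightarrow> Y" "f \<in> carrier (free_module X)" for f :: "_ \<Rightarrow>\<^sub>0 'c"
    using that keys_push[of h f] by fastforce
qed (simp_all add: push_add push_smult)

lemma push_ident: "(\<And>x. x \<in> keys f \<Longrightarrow> h x = x) \<Longrightarrow> push h f = f"
proof -
  assume *: "\<And>x. x \<in> keys f \<Longrightarrow> h x = x"
  have "push (\<lambda>x. x) f = f"
  proof -
    have "keys f \<subseteq> UNIV" by simp
    then show ?thesis by (induction rule: free_module_induct) (simp_all add: push_add)
  qed
  then show ?thesis using push_cong[of f h "\<lambda>x. x"] * by simp
qed

lemma push2_superset:
  assumes "finite S" "keys f \<subseteq> S" "finite T" "keys g \<subseteq> T"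
  shows "push2 h f g = (\<Sum>s\<in>S. \<Sum>t\<in>T.
     single (h s t) (lookup f s * lookup g t))"
proof -
  have "push2 h f g = (\<Sum>s\<in>S. \<Sum>t\<in>keys g.
     single (h s t) (lookup f s * lookup g t))"
    unfolding push2_def using assms by (intro sum.mono_neutral_left) (auto simp: in_keys_iff)
  also have "\<dots> = (\<Sum>s\<in>S. \<Sum>t\<in>T.
     single (h s t) (lookup f s * lookup g t))"
    using assms by (intro sum.cong refl sum.mono_neutral_left) (auto simp: in_keys_iff)
  finally show ?thesis .
qed

lemma push2_add_left: "push2 h (f + f') g = push2 h f g + push2 h f' g"
proof -
  let ?S = "keys f \<union> keys f'"
  show ?thesis
    using push2_superset[of ?S f "keys g" g h] push2_superset[of ?S f' "keys g" g h]
      push2_superset[of ?S "f + f'" "keys g" g h]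
    by (simp add: keys_add lookup_add single_add sum.distrib distrib_right)
qed

text \<open>Multiplication of coefficients is commutative, so rules for the second argument of
  \<open>push2\<close> follow from those for the first.\<close>

lemma push2_flip: "push2 h f g = push2 (\<lambda>x y. h y x) g f"
  unfolding push2_def by (subst sum.swap) (simp add: mult.commute)

lemma push2_add_right: "push2 h f (g + g') = push2 h f g + push2 h f g'"
  by (simp add: push2_flip[of h f] push2_add_left)

lemma push2_single [simp]:
  "push2 h (single x c) (single y d) = single (h x y) (c * d)"
  by (cases "c = 0"; cases "d = 0") (simp_all add: push2_def)

lemma push2_zero [simp]: "push2 h 0 g = 0" "push2 h f 0 = 0"
  by (simp_all add: push2_def)

lemma push2_bas_left: "push2 h (bas x) g = push (h x) g"
proof -
  have "keys g \<subseteq> UNIV" by simp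
  then show ?thesis
    by (induction rule: free_module_induct) (simp_all add: push_add push2_add_right bas_def)
qed

lemma push2_bas_right: "push2 h f (bas y) = push (\<lambda>x. h x y) f"
  by (subst push2_flip) (rule push2_bas_left)

lemma push2_bas [simp]: "push2 h (bas x) (bas y) = bas (h x y)"
  by (simp add: bas_def)

lemma push2_smult_left: "push2 h (Poly_Mapping.map ((*) c) f) g = Poly_Mapping.map ((*) c) (push2 h f g)"
proof -
  have "keys f \<subseteq> UNIV" by simp
  then show ?thesis
  proof (induction rule: free_module_induct)
    case (add f x d)
    have "keys g \<subseteq> UNIV" by simp
    then have "push2 h (single x (c * d)) g = Poly_Mapping.map ((*) c) (push2 h (single x d) g)"
      by (induction rule: free_module_induct) (simp_all add: push2_add_right map_mult_add mult.assoc)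
    then show ?case using add by (simp add: push2_add_left map_mult_add)
  qed simp
qed

lemma push2_smult_right: "push2 h f (Poly_Mapping.map ((*) c) g) = Poly_Mapping.map ((*) c) (push2 h f g)"
  by (simp add: push2_flip[of h f] push2_smult_left)

lemma keys_push2:
  "keys (push2 h f g) \<subseteq> (\<lambda>(x, y). h x y) ` (keys f \<times> keys g)"
  unfolding push2_def
  by (intro order.trans[OF keys_sum] UN_least order.trans[OF keys_sum]) (auto split: if_splits)

lemma push2_linear:
  fixes f :: "'x \<Rightarrow>\<^sub>0 'k::field" and g :: "'y \<Rightarrow>\<^sub>0 'k"
  assumes "\<And>x y. x \<in> X \<Longrightarrow> y \<in> Y \<Longrightarrow> h x y \<in> Z"
  shows "keys g \<subseteq> Y \<Longrightarrow> linear_map (free_module X) (free_module Z) (\<lambda>f. push2 h f g)"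
    "keys f \<subseteq> X \<Longrightarrow> linear_map (free_module Y) (free_module Z) (\<lambda>g. push2 h f g)"
proof -
  have 1: "keys (push2 h f g) \<subseteq> Z" if "keys f \<subseteq> X" "keys g \<subseteq> Y"
    for f :: "'x \<Rightarrow>\<^sub>0 'k" and g :: "'y \<Rightarrow>\<^sub>0 'k"
    using keys_push2[of h f g] that assms by fastforce
  show "keys g \<subseteq> Y \<Longrightarrow> linear_map (free_module X) (free_module Z) (\<lambda>f. push2 h f g)"
    "keys f \<subseteq> X \<Longrightarrow> linear_map (free_module Y) (free_module Z) (\<lambda>g. push2 h f g)"
    by (rule linear_mapI; simp add: 1 push2_add_left push2_add_right push2_smult_left push2_smult_right)+
qed

section \<open>Operad ideals and closure properties of operads\<close>

lemma operad_idealD: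
  assumes "operad_ideal Q I"
  shows "submodule (I n) kring (sp Q n)"
    "\<sigma> permutes {1..n} \<Longrightarrow> x \<in> I n \<Longrightarrow> act Q n x \<sigma> \<in> I n"
    "i \<in> {1..m} \<Longrightarrow> x \<in> I m \<Longrightarrow> x \<in> carrier (sp Q m) \<Longrightarrow> y \<in> carrier (sp Q n) \<Longrightarrow> pcomp Q m n i x y \<in> I (m + n - 1)"
    "i \<in> {1..m} \<Longrightarrow> x \<in> carrier (sp Q m) \<Longrightarrow> y \<in> I n \<Longrightarrow> y \<in> carrier (sp Q n) \<Longrightarrow> pcomp Q m n i x y \<in> I (m + n - 1)"
  using assms by (auto simp: operad_ideal_def)

lemma operad_ideal_subset:
  assumes "operad Q" "operad_ideal Q I"
  shows "I n \<subseteq> carrier (sp Q n)"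
proof -
  interpret operad Q by fact
  show ?thesis using vspace_submoduleD(1)[OF vspace_sp operad_idealD(1)[OF assms(2)]] .
qed

lemma (in operad) pcomp_closed:
  "i \<in> {1..m} \<Longrightarrow> x \<in> carrier (sp Q m) \<Longrightarrow> y \<in> carrier (sp Q n) \<Longrightarrow> pcomp Q m n i x y \<in> carrier (sp Q (m + n - 1))"
  using linear_mapD(1)[OF pcomp_linear_left] .

lemma (in operad) act_closed:
  "\<sigma> permutes {1..n} \<Longrightarrow> x \<in> carrier (sp Q n) \<Longrightarrow> act Q n x \<sigma> \<in> carrier (sp Q n)"
  using linear_mapD(1)[OF act_linear] .

subsection \<open>Ideals\<close>

lemma operad_idealI:
  assumes "\<And>n. submodule (I n) kring (sp Q n)"
    "\<And>n x \<sigma>. \<sigma> permutes {1..n} \<Longrightarrow> x \<in> I n \<Longrightarrow> act Q n x \<sigma> \<in> I n"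
    "\<And>m n i x y. i \<in> {1..m} \<Longrightarrow> x \<in> I m \<Longrightarrow> x \<in> carrier (sp Q m) \<Longrightarrow> y \<in> carrier (sp Q n) \<Longrightarrow> pcomp Q m n i x y \<in> I (m + n - 1)"
    "\<And>m n i x y. i \<in> {1..m} \<Longrightarrow> x \<in> carrier (sp Q m) \<Longrightarrow> y \<in> I n \<Longrightarrow> y \<in> carrier (sp Q n) \<Longrightarrow> pcomp Q m n i x y \<in> I (m + n - 1)"
  shows "operad_ideal Q I"
  using assms unfolding operad_ideal_def by blast

lemma operad_ideal_carrier:
  assumes "operad Q"
  shows "operad_ideal Q (\<lambda>n. carrier (sp Q n))"
proof -
  interpret operad Q by fact
  show ?thesis
    by (intro operad_idealI submodule_carrier vspace_sp act_closed pcomp_closed)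
qed

lemma operad_ideal_zero:
  assumes "operad Q"
  shows "operad_ideal Q (\<lambda>n. {\<zero>\<^bsub>sp Q n\<^esub>})"
proof -
  interpret operad Q by fact
  show ?thesis
  proof (rule operad_idealI)
    show "act Q n x \<sigma> \<in> {\<zero>\<^bsub>sp Q n\<^esub>}" if "\<sigma> permutes {1..n}" "x \<in> {\<zero>\<^bsub>sp Q n\<^esub>}" for n x \<sigma>
      using linear_map_zero[OF vspace_sp vspace_sp act_linear[OF that(1)]] that(2) by simp
    show "pcomp Q m n i x y \<in> {\<zero>\<^bsub>sp Q (m + n - 1)\<^esub>}"
      if "i \<in> {1..m}" "x \<in> {\<zero>\<^bsub>sp Q m\<^esub>}" "x \<in> carrier (sp Q m)" "y \<in> carrier (sp Q n)" for m n i x y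
      using linear_map_zero[OF vspace_sp vspace_sp pcomp_linear_left[OF that(1,4)]] that(2) by simp
    show "pcomp Q m n i x y \<in> {\<zero>\<^bsub>sp Q (m + n - 1)\<^esub>}"
      if "i \<in> {1..m}" "x \<in> carrier (sp Q m)" "y \<in> {\<zero>\<^bsub>sp Q n\<^esub>}" "y \<in> carrier (sp Q n)" for m n i x y
      using linear_map_zero[OF vspace_sp vspace_sp pcomp_linear_right[OF that(1,2)]] that(3) by simp
  qed (rule submodule_zero[OF vspace_sp])
qed

lemma operad_ideal_preimage:
  assumes "operad_hom Q Q' f" "operad_ideal Q' J"
  shows "operad_ideal Q (\<lambda>n. {x \<in> carrier (sp Q n). f n x \<in> J n})"
proof -
  interpret operad_hom Q Q' f by fact
  note J = operad_idealD[OF assms(2)]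
  show ?thesis
  proof (rule operad_idealI)
    show "submodule {x \<in> carrier (sp Q n). f n x \<in> J n} kring (sp Q n)" for n
      by (rule submodule_kernel[OF src.vspace_sp tgt.vspace_sp hom_linear J(1)])
  qed (use J src.act_closed src.pcomp_closed linear_mapD(1)[OF hom_linear] in
        \<open>auto simp: hom_act hom_pcomp simp del: One_nat_def atLeastAtMost_iff\<close>)
qed

lemma gen_ideal_least:
  assumes "operad_ideal Q I" "\<And>m. S m \<subseteq> I m"
  shows "gen_ideal Q S n \<subseteq> I n"
  using assms unfolding gen_ideal_def by blast

lemma gen_ideal_superset: "S n \<subseteq> gen_ideal Q S n"
  unfolding gen_ideal_def by blast

text \<open>An intersection of ideals is an ideal provided that the family is not empty. The premise
  on \<open>S\<close> guarantees this: the whole operad is then an ideal that contains the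
  generators.\<close>

lemma operad_ideal_gen_ideal:
  assumes "operad Q" "\<And>m. S m \<subseteq> carrier (sp Q m)"
  shows "operad_ideal Q (gen_ideal Q S)"
proof -
  interpret operad Q by fact
  let ?P = "\<lambda>I. operad_ideal Q I \<and> (\<forall>m. S m \<subseteq> I m)"
  have P: "?P (\<lambda>n. carrier (sp Q n))" using operad_ideal_carrier[OF assms(1)] assms(2) by simp
  have mem: "x \<in> gen_ideal Q S n \<longleftrightarrow> (\<forall>I. ?P I \<longrightarrow> x \<in> I n)" for x n
    unfolding gen_ideal_def by blast
  show ?thesis
  proof (rule operad_idealI)
    show "submodule (gen_ideal Q S n) kring (sp Q n)" for n
      unfolding gen_ideal_def using P operad_idealD(1) by (intro submodule_Inter[OF vspace_sp]) auto
  next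
    show "act Q n x \<sigma> \<in> gen_ideal Q S n" if "\<sigma> permutes {1..n}" "x \<in> gen_ideal Q S n" for n x \<sigma>
      using that operad_idealD(2) unfolding mem by metis
  next
    show "pcomp Q m n i x y \<in> gen_ideal Q S (m + n - 1)"
      if "i \<in> {1..m}" "x \<in> gen_ideal Q S m" "x \<in> carrier (sp Q m)" "y \<in> carrier (sp Q n)" for m n i x y
      using that operad_idealD(3) unfolding mem by metis
  next
    show "pcomp Q m n i x y \<in> gen_ideal Q S (m + n - 1)"
      if "i \<in> {1..m}" "x \<in> carrier (sp Q m)" "y \<in> gen_ideal Q S n" "y \<in> carrier (sp Q n)" for m n i x y
      using that operad_idealD(4) unfolding mem by metis
  qed
qed

subsection \<open>Quotient operads\<close>

lemma perm_comp_slot: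
  assumes "i \<in> {1..m}" "\<sigma> permutes {1..m}" "k \<in> {1..m}" "k \<noteq> i"
  shows "perm_comp m n i \<sigma> \<tau> (slot i n k) = slot (\<sigma> i) n (\<sigma> k)"
  using assms by (auto simp: perm_comp_def slot_def)

lemma perm_comp_inner:
  assumes "i \<in> {1..m}" "\<sigma> permutes {1..m}" "l \<in> {1..n}"
  shows "perm_comp m n i \<sigma> \<tau> (l + i - 1) = \<tau> l + \<sigma> i - 1"
proof -
  have "\<sigma> i \<ge> 1" using permutes_in_image[OF assms(2), of i] assms(1) by simp
  moreover have "\<not> l + i - 1 < i" "l + i - 1 < i + n" "l + i - 1 \<le> m + n - 1" "l + i - 1 + 1 - i = l"
    using assms by auto
  ultimately show ?thesis using assms by (simp add: perm_comp_def)
qed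

lemma slot_range: "i \<in> {1..m} \<Longrightarrow> k \<in> {1..m} \<Longrightarrow> k \<noteq> i \<Longrightarrow> slot i n k \<in> {1..m + n - 1}"
  by (auto simp: slot_def)

text \<open>An input of a composite is either a remaining input of the outer operation or an input
  of the inner one. Identities between permutations of the composite are checked separately on these
  two kinds.\<close>

lemma slot_cases:
  assumes "i \<in> {1..m}" "l \<in> {1..m + n - 1}"
  obtains k where "k \<in> {1..m}" "k \<noteq> i" "l = slot i n k" | p where "p \<in> {1..n}" "l = p + i - 1"
proof -
  consider "l < i" | "i \<le> l" "l < i + n" | "i + n \<le> l" by linarith
  then show ?thesis
  proof cases
    case 1
    then have "l \<in> {1..m}" "l \<noteq> i" "l = slot i n l" using assms by (auto simp: slot_def)
    then show ?thesis by (rule that(1))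
  next
    case 2
    then have "l + 1 - i \<in> {1..n}" "l = l + 1 - i + i - 1" using assms by auto
    then show ?thesis by (rule that(2))
  next
    case 3
    then have "l + 1 - n \<in> {1..m}" "l + 1 - n \<noteq> i" using assms by auto
    moreover have "l = slot i n (l + 1 - n)" using 3 assms by (simp add: slot_def)
    ultimately show ?thesis by (rule that(1))
  qed
qed

text \<open>Only the image is computed, by the two kinds of inputs of \<open>slot_cases\<close>: a
  map of a finite set onto itself is automatically injective.\<close>

lemma perm_comp_permutes:
  assumes "i \<in> {1..m}" "\<sigma> permutes {1..m}" "\<tau> permutes {1..n}"
  shows "perm_comp m n i \<sigma> \<tau> permutes {1..m + n - 1}"
proof -
  let ?p = "perm_comp m n i \<sigma> \<tau>" and ?A = "{1..m + n - 1}"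
  have si: "\<sigma> i \<in> {1..m}" using permutes_in_image[OF assms(2), of i] assms(1) by simp
  have "?p ` ?A = ?A"
  proof (intro equalityI subsetI)
    fix l assume "l \<in> ?p ` ?A"
    then obtain l' where l': "l' \<in> ?A" "l = ?p l'" by blast
    from assms(1) l'(1) show "l \<in> ?A"
    proof (cases rule: slot_cases)
      case (1 k)
      have "\<sigma> k \<in> {1..m}" "\<sigma> k \<noteq> \<sigma> i"
        using permutes_in_image[OF assms(2), of k] permutes_inj[OF assms(2)] 1 by (auto simp: inj_eq)
      then show ?thesis using slot_range[OF si] perm_comp_slot[OF assms(1,2) 1(1,2)] 1 l' by simp
    next
      case (2 p)
      have "\<tau> p \<in> {1..n}" using permutes_in_image[OF assms(3), of p] 2 by simp
      then show ?thesis using perm_comp_inner[OF assms(1,2) 2(1), of \<tau>] 2 l' si by auto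
    qed
  next
    fix l assume "l \<in> ?A"
    with si show "l \<in> ?p ` ?A"
    proof (cases rule: slot_cases)
      case (1 k)
      obtain k' where k': "k' \<in> {1..m}" "\<sigma> k' = k"
        using permutes_image[OF assms(2)] 1(1) by (metis imageE)
      then have "k' \<noteq> i" using 1 by auto
      then show ?thesis
        using perm_comp_slot[OF assms(1,2) k'(1), of n \<tau>] slot_range[OF assms(1) k'(1), of n] k'(2) 1
        by (metis imageI)
    next
      case (2 p)
      obtain p' where p': "p' \<in> {1..n}" "\<tau> p' = p"
        using permutes_image[OF assms(3)] 2(1) by (metis imageE)
      have "p' + i - 1 \<in> ?A" using p' assms(1) by auto
      then show ?thesis
        using perm_comp_inner[OF assms(1,2) p'(1), of \<tau>] p'(2) 2 by (metis imageI)
    qed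
  qed
  then have "bij_betw ?p ?A ?A"
    by (simp add: bij_betw_def eq_card_imp_inj_on)
  then show ?thesis
    by (rule bij_imp_permutes) (auto simp: perm_comp_def)
qed

lemma operad_homI:
  assumes "operad Q" "operad Q'"
    and "\<And>n. linear_map (sp Q n) (sp Q' n) (f n)"
    and "\<And>n \<sigma> x. \<sigma> permutes {1..n} \<Longrightarrow> x \<in> carrier (sp Q n) \<Longrightarrow> f n (act Q n x \<sigma>) = act Q' n (f n x) \<sigma>"
    and "f 1 (opunit Q) = opunit Q'"
    and "\<And>m n i x y. i \<in> {1..m} \<Longrightarrow> x \<in> carrier (sp Q m) \<Longrightarrow> y \<in> carrier (sp Q n) \<Longrightarrow>
      f (m + n - 1) (pcomp Q m n i x y) = pcomp Q' m n i (f m x) (f n y)"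
  shows "operad_hom Q Q' f"
  using assms unfolding operad_hom_def operad_hom_axioms_def by blast

locale operad_quotient = operad Q for Q :: "('k::field, 'a) operad" +
  fixes I :: "nat \<Rightarrow> 'a set"
  assumes ideal: "operad_ideal Q I"
begin

abbreviation cl :: "nat \<Rightarrow> 'a \<Rightarrow> 'a set" where
  "cl n x \<equiv> I n +>\<^bsub>sp Q n\<^esub> x"

lemma submod: "submodule (I n) kring (sp Q n)"
  by (rule operad_idealD(1)[OF ideal])

lemma sp_quot [simp]: "sp (quot_operad Q I) n = quot_module (sp Q n) (I n)"
  and opunit_quot [simp]: "opunit (quot_operad Q I) = cl 1 (opunit Q)"
  by (simp_all add: quot_operad_def)

lemma carrier_quot: "carrier (quot_module (sp Q n) (I n)) = cl n ` carrier (sp Q n)"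
  by (simp add: carrier_quot_module)

lemma act_quot:
  assumes "\<sigma> permutes {1..n}" "x \<in> carrier (sp Q n)"
  shows "act (quot_operad Q I) n (cl n x) \<sigma> = cl n (act Q n x \<sigma>)"
  using induced_coset[OF vspace_sp submod vspace_sp submod act_linear[OF assms(1)] _ assms(2)]
    operad_idealD(2)[OF ideal assms(1)]
  by (simp add: quot_operad_def induced_def)

text \<open>Composition is linear only in each argument separately. Independence of the
  representatives is therefore shown in two steps: x' is replaced by x while y' is kept, then y' is
  replaced by y.\<close>

lemma pcomp_quot:
  assumes "i \<in> {1..m}" "x \<in> carrier (sp Q m)" "y \<in> carrier (sp Q n)"
  shows "pcomp (quot_operad Q I) m n i (cl m x) (cl n y) = cl (m + n - 1) (pcomp Q m n i x y)"
proof -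
  have 1: "cl (m + n - 1) (pcomp Q m n i x' y') = cl (m + n - 1) (pcomp Q m n i x y')"
    if "x' \<in> carrier (sp Q m)" "cl m x' = cl m x" "y' \<in> carrier (sp Q n)" for x' y'
    using linear_coset_cong[OF vspace_sp submod vspace_sp submod pcomp_linear_left[OF assms(1) that(3)] _ assms(2) that(1,2)]
      operad_idealD(3)[OF ideal assms(1) _ _ that(3)] operad_ideal_subset[OF operad_axioms ideal] by blast
  have 2: "cl (m + n - 1) (pcomp Q m n i x y') = cl (m + n - 1) (pcomp Q m n i x y)"
    if "y' \<in> carrier (sp Q n)" "cl n y' = cl n y" for y'
    using linear_coset_cong[OF vspace_sp submod vspace_sp submod pcomp_linear_right[OF assms(1,2)] _ assms(3) that]
      operad_idealD(4)[OF ideal assms(1,2)] operad_ideal_subset[OF operad_axioms ideal] by blast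
  have "pcomp (quot_operad Q I) m n i (cl m x) (cl n y)
      = (\<Union>x\<in>cl m x. \<Union>y\<in>cl n y. cl (m + n - 1) (pcomp Q m n i x y))"
    by (simp add: quot_operad_def)
  also have "\<dots> = (\<Union>y\<in>cl n y. cl (m + n - 1) (pcomp Q m n i x y))"
  proof (rule UN_coset[OF vspace_sp submod assms(2)])
    fix x' assume x': "x' \<in> carrier (sp Q m)" "cl m x' = cl m x"
    show "(\<Union>y\<in>cl n y. cl (m + n - 1) (pcomp Q m n i x' y)) = (\<Union>y\<in>cl n y. cl (m + n - 1) (pcomp Q m n i x y))"
      using coset_iff[OF vspace_sp submod assms(3)] 1[OF x'] by (intro SUP_cong refl) blast
  qed
  also have "\<dots> = cl (m + n - 1) (pcomp Q m n i x y)"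
    by (rule UN_coset[OF vspace_sp submod assms(3)]) (rule 2)
  finally show ?thesis .
qed

lemma linear_map_cl: "linear_map (sp Q n) (quot_module (sp Q n) (I n)) (cl n)"
  by (rule linear_map_coset[OF vspace_sp submod])

lemma linear_map_from_quot:
  "linear_map (sp Q n) L (\<lambda>x. f (cl n x)) \<Longrightarrow> linear_map (quot_module (sp Q n) (I n)) L f"
  by (rule linear_map_quotI[OF vspace_sp submod])

lemma operad_quot: "operad (quot_operad Q I)"
proof (intro operad.intro smodule.intro operad_axioms.intro)
  fix l m n i j k \<sigma> \<tau> X Y Z
  show "vspace (sp (quot_operad Q I) n)"
    using vspace_quot_module[OF vspace_sp submod] by simp
  show "linear_map (sp (quot_operad Q I) n) (sp (quot_operad Q I) n) (\<lambda>x. act (quot_operad Q I) n x \<sigma>)"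
    if "\<sigma> permutes {1..n}"
    using linear_map_cong[OF vspace_sp linear_map_compose[OF act_linear[OF that] linear_map_cl]]
    by (simp add: act_quot[OF that] linear_map_from_quot)
  show "opunit (quot_operad Q I) \<in> carrier (sp (quot_operad Q I) 1)"
    using carrier_quot[of 1] unit_closed by simp
  { assume "X \<in> carrier (sp (quot_operad Q I) n)"
    then obtain x where x: "x \<in> carrier (sp Q n)" "X = cl n x" by (auto simp: carrier_quot)
    show "act (quot_operad Q I) n X id = X" using x by (simp add: act_quot permutes_id act_id)
    show "act (quot_operad Q I) n (act (quot_operad Q I) n X \<sigma>) \<tau> = act (quot_operad Q I) n X (\<sigma> \<circ> \<tau>)"
      if "\<sigma> permutes {1..n}" "\<tau> permutes {1..n}"
      using x that by (simp add: act_quot permutes_compose act_closed act_act) }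
  show "linear_map (sp (quot_operad Q I) m) (sp (quot_operad Q I) (m + n - 1))
        (\<lambda>X. pcomp (quot_operad Q I) m n i X Y)" if XY: "i \<in> {1..m}" "Y \<in> carrier (sp (quot_operad Q I) n)"
  proof -
    obtain y where y: "y \<in> carrier (sp Q n)" "Y = cl n y" using XY(2) by (auto simp: carrier_quot)
    show ?thesis
      unfolding sp_quot
      by (rule linear_map_from_quot,
          rule linear_map_cong[OF vspace_sp linear_map_compose[OF pcomp_linear_left[OF XY(1) y(1)] linear_map_cl]])
        (simp only: y(2) pcomp_quot[OF XY(1) _ y(1)])
  qed
  show "linear_map (sp (quot_operad Q I) n) (sp (quot_operad Q I) (m + n - 1))
        (\<lambda>Y. pcomp (quot_operad Q I) m n i X Y)" if XY: "i \<in> {1..m}" "X \<in> carrier (sp (quot_operad Q I) m)"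
  proof -
    obtain x where x: "x \<in> carrier (sp Q m)" "X = cl m x" using XY(2) by (auto simp: carrier_quot)
    show ?thesis
      unfolding sp_quot
      by (rule linear_map_from_quot,
          rule linear_map_cong[OF vspace_sp linear_map_compose[OF pcomp_linear_right[OF XY(1) x(1)] linear_map_cl]])
        (simp only: x(2) pcomp_quot[OF XY(1) x(1)])
  qed
  show "pcomp (quot_operad Q I) 1 n 1 (opunit (quot_operad Q I)) Y = Y" if XY: "Y \<in> carrier (sp (quot_operad Q I) n)"
  proof -
    obtain y where y: "y \<in> carrier (sp Q n)" "Y = cl n y" using XY by (auto simp: carrier_quot)
    show ?thesis using pcomp_quot[of 1 1 "opunit Q" y n] y unit_closed unit_left by simp
  qed
  show "pcomp (quot_operad Q I) m 1 i X (opunit (quot_operad Q I)) = X"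
    if XY: "i \<in> {1..m}" "X \<in> carrier (sp (quot_operad Q I) m)"
  proof -
    obtain x where x: "x \<in> carrier (sp Q m)" "X = cl m x" using XY by (auto simp: carrier_quot)
    show ?thesis using pcomp_quot[of i m x "opunit Q" 1] x XY unit_closed unit_right by simp
  qed
  { assume "X \<in> carrier (sp (quot_operad Q I) l)" "Y \<in> carrier (sp (quot_operad Q I) m)"
      "Z \<in> carrier (sp (quot_operad Q I) n)"
    then obtain x y z where x: "x \<in> carrier (sp Q l)" "X = cl l x"
      and y: "y \<in> carrier (sp Q m)" "Y = cl m y" and z: "z \<in> carrier (sp Q n)" "Z = cl n z"
      by (auto simp: carrier_quot)
    show "pcomp (quot_operad Q I) (l + m - 1) n (i - 1 + j) (pcomp (quot_operad Q I) l m i X Y) Z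
        = pcomp (quot_operad Q I) l (m + n - 1) i X (pcomp (quot_operad Q I) m n j Y Z)"
      if ij: "i \<in> {1..l}" "j \<in> {1..m}"
    proof -
      have e: "l + m - 1 + n - 1 = l + (m + n - 1) - 1" "i - 1 + j \<in> {1..l + m - 1}" using ij by auto
      show ?thesis
        unfolding x(2) y(2) z(2) pcomp_quot[OF ij(1) x(1) y(1)] pcomp_quot[OF ij(2) y(1) z(1)]
          pcomp_quot[OF e(2) pcomp_closed[OF ij(1) x(1) y(1)] z(1)]
          pcomp_quot[OF ij(1) x(1) pcomp_closed[OF ij(2) y(1) z(1)]] sequential[OF ij x(1) y(1) z(1)] e(1) ..
    qed
    show "pcomp (quot_operad Q I) (l + m - 1) n (k - 1 + m) (pcomp (quot_operad Q I) l m i X Y) Z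
        = pcomp (quot_operad Q I) (l + n - 1) m i (pcomp (quot_operad Q I) l n k X Z) Y"
      if ik: "i \<in> {1..l}" "k \<in> {1..l}" "i < k"
    proof -
      have e: "l + m - 1 + n - 1 = l + n - 1 + m - 1" "k - 1 + m \<in> {1..l + m - 1}" "i \<in> {1..l + n - 1}"
        using ik by auto
      show ?thesis
        unfolding x(2) y(2) z(2) pcomp_quot[OF ik(1) x(1) y(1)] pcomp_quot[OF ik(2) x(1) z(1)]
          pcomp_quot[OF e(2) pcomp_closed[OF ik(1) x(1) y(1)] z(1)]
          pcomp_quot[OF e(3) pcomp_closed[OF ik(2) x(1) z(1)] y(1)] parallel[OF ik x(1) y(1) z(1)] e(1) ..
    qed }
  { assume p: "i \<in> {1..m}" "\<sigma> permutes {1..m}" "\<tau> permutes {1..n}"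
    and "X \<in> carrier (sp (quot_operad Q I) m)" "Y \<in> carrier (sp (quot_operad Q I) n)"
    then obtain x y where x: "x \<in> carrier (sp Q m)" "X = cl m x" and y: "y \<in> carrier (sp Q n)" "Y = cl n y"
      by (auto simp: carrier_quot)
    have s: "\<sigma> i \<in> {1..m}" using permutes_in_image[OF p(2), of i] p(1) by simp
    have pc: "perm_comp m n i \<sigma> \<tau> permutes {1..m + n - 1}"
      using perm_comp_permutes[OF p] .
    show "pcomp (quot_operad Q I) m n i (act (quot_operad Q I) m X \<sigma>) (act (quot_operad Q I) n Y \<tau>)
        = act (quot_operad Q I) (m + n - 1) (pcomp (quot_operad Q I) m n (\<sigma> i) X Y) (perm_comp m n i \<sigma> \<tau>)"
      unfolding x(2) y(2) act_quot[OF p(2) x(1)] act_quot[OF p(3) y(1)]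
        pcomp_quot[OF p(1) act_closed[OF p(2) x(1)] act_closed[OF p(3) y(1)]] pcomp_quot[OF s x(1) y(1)]
        act_quot[OF pc pcomp_closed[OF s x(1) y(1)]] equivariant[OF p x(1) y(1)] .. }
qed

lemma hom_cl: "operad_hom Q (quot_operad Q I) cl"
  by (rule operad_homI) (simp_all add: operad_axioms operad_quot linear_map_cl act_quot pcomp_quot del: One_nat_def)

text \<open>Linear algebra yields the factor map in each arity. It respects the operad structure
  because every element of the quotient is a class \<open>cl n x\<close> and the operations on
  classes are computed on representatives.\<close>

lemma hom_factor:
  assumes "operad_hom Q Q' f" "\<And>n x. x \<in> I n \<Longrightarrow> f n x = \<zero>\<^bsub>sp Q' n\<^esub>"
  shows "\<exists>g. operad_hom (quot_operad Q I) Q' g \<and> (\<forall>n. \<forall>x\<in>carrier (sp Q n). g n (cl n x) = f n x)"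
proof -
  interpret h: operad_hom Q Q' f by fact
  have "\<exists>g. linear_map (quot_module (sp Q n) (I n)) (sp Q' n) g \<and> (\<forall>x\<in>carrier (sp Q n). g (cl n x) = f n x)" for n
    by (rule linear_map_factor[OF vspace_sp submod h.tgt.vspace_sp h.hom_linear]) (rule assms(2))
  then obtain g where g: "\<And>n. linear_map (quot_module (sp Q n) (I n)) (sp Q' n) (g n)"
    "\<And>n x. x \<in> carrier (sp Q n) \<Longrightarrow> g n (cl n x) = f n x" by metis
  have "operad_hom (quot_operad Q I) Q' g"
  proof (rule operad_homI[OF operad_quot h.tgt.operad_axioms])
    show "linear_map (sp (quot_operad Q I) n) (sp Q' n) (g n)" for n using g(1) by simp
    show "g n (act (quot_operad Q I) n X \<sigma>) = act Q' n (g n X) \<sigma>"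
      if "\<sigma> permutes {1..n}" "X \<in> carrier (sp (quot_operad Q I) n)" for n \<sigma> X
      using that by (auto simp: carrier_quot act_quot g(2) act_closed h.hom_act)
    show "g 1 (opunit (quot_operad Q I)) = opunit Q'"
      using g(2)[OF unit_closed] h.hom_unit by simp
    show "g (m + n - 1) (pcomp (quot_operad Q I) m n i X Y) = pcomp Q' m n i (g m X) (g n Y)"
      if XY: "i \<in> {1..m}" "X \<in> carrier (sp (quot_operad Q I) m)" "Y \<in> carrier (sp (quot_operad Q I) n)" for m n i X Y
    proof -
      obtain x y where x: "x \<in> carrier (sp Q m)" "X = cl m x" and y: "y \<in> carrier (sp Q n)" "Y = cl n y"
        using XY(2,3) by (auto simp: carrier_quot)
      show ?thesis
        unfolding x(2) y(2) pcomp_quot[OF XY(1) x(1) y(1)] g(2)[OF x(1)] g(2)[OF y(1)]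
          g(2)[OF pcomp_closed[OF XY(1) x(1) y(1)]] h.hom_pcomp[OF XY(1) x(1) y(1)] ..
    qed
  qed
  then show ?thesis using g(2) by blast
qed

end

lemma operad_hom_compose:
  assumes "operad_hom Q Q' f" "operad_hom Q' Q'' g"
  shows "operad_hom Q Q'' (\<lambda>n x. g n (f n x))"
proof -
  interpret f: operad_hom Q Q' f by fact
  interpret g: operad_hom Q' Q'' g by fact
  note c = linear_mapD(1)[OF f.hom_linear]
  show ?thesis
    by (rule operad_homI[OF f.src.operad_axioms g.tgt.operad_axioms])
      (use linear_map_compose[OF f.hom_linear g.hom_linear] in
        \<open>simp_all add: f.hom_act g.hom_act f.hom_unit g.hom_unit f.hom_pcomp g.hom_pcomp c del: One_nat_def\<close>)
qed

text \<open>The preimage of \<open>J\<close> is an operad ideal, and a generated ideal lies in every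
  ideal that contains its generators. With \<open>J\<close> zero this yields vanishing on the ideal;
  with another \<open>J\<close> it yields maps between quotients.\<close>

lemma gen_ideal_hom_zero:
  assumes "operad_hom Q Q' f" "\<And>m x. x \<in> S m \<Longrightarrow> x \<in> carrier (sp Q m) \<and> f m x \<in> J m" "operad_ideal Q' J"
    and "x \<in> gen_ideal Q S n"
  shows "f n x \<in> J n"
  using gen_ideal_least[OF operad_ideal_preimage[OF assms(1,3)], of S n] assms(2,4) by blast

subsection \<open>Trees\<close>

lemma leaves_tsubst: "leaves (tsubst g t) = concat (map (\<lambda>i. leaves (g i)) (leaves t))"
proof (induction t)
  case (Node e ts)
  then show ?case by (induction ts) auto
qed simp

lemma tsubst_tsubst: "tsubst g (tsubst h t) = tsubst (\<lambda>i. tsubst g (h i)) t"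
  by (induction t) auto

lemma tsubst_cong: "(\<And>i. i \<in> set (leaves t) \<Longrightarrow> g i = h i) \<Longrightarrow> tsubst g t = tsubst h t"
  by (induction t) auto

lemma tsubst_Leaf [simp]: "tsubst Leaf t = t"
  by (induction t) (auto intro: map_idI)

lemma leaves_relabel [simp]: "leaves (relabel h t) = map h (leaves t)"
  by (simp add: relabel_def leaves_tsubst)

lemma relabel_simps [simp]:
  "relabel h (Leaf i) = Leaf (h i)" "relabel h (Node e ts) = Node e (map (relabel h) ts)"
  by (simp_all add: relabel_def)

lemma relabel_relabel: "relabel g (relabel h t) = relabel (\<lambda>i. g (h i)) t"
  by (simp add: relabel_def tsubst_tsubst)

lemma relabel_ident: "(\<And>i. i \<in> set (leaves t) \<Longrightarrow> h i = i) \<Longrightarrow> relabel h t = t"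
  using tsubst_cong[of t "\<lambda>i. Leaf (h i)" Leaf] by (simp add: relabel_def)

lemma relabel_cong: "(\<And>i. i \<in> set (leaves t) \<Longrightarrow> g i = h i) \<Longrightarrow> relabel g t = relabel h t"
  unfolding relabel_def by (rule tsubst_cong) simp

lemma tsubst_relabel: "tsubst g (relabel h t) = tsubst (\<lambda>i. g (h i)) t"
  by (simp add: relabel_def tsubst_tsubst)

lemma relabel_tsubst: "relabel h (tsubst g t) = tsubst (\<lambda>i. relabel h (g i)) t"
  by (simp add: relabel_def tsubst_tsubst)

lemma labelled_by_tsubst:
  "labelled_by E (tsubst g t) \<longleftrightarrow> labelled_by E t \<and> (\<forall>i\<in>set (leaves t). labelled_by E (g i))"
  by (induction t) (auto simp: list_all_iff)

lemma labelled_by_relabel [simp]: "labelled_by E (relabel h t) \<longleftrightarrow> labelled_by E t"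
  by (simp add: relabel_def labelled_by_tsubst)

lemma distinct_concat_map:
  "distinct xs \<Longrightarrow> (\<And>x. x \<in> set xs \<Longrightarrow> distinct (f x)) \<Longrightarrow>
   (\<And>x y. x \<in> set xs \<Longrightarrow> y \<in> set xs \<Longrightarrow> x \<noteq> y \<Longrightarrow> set (f x) \<inter> set (f y) = {}) \<Longrightarrow>
   distinct (concat (map f xs))"
proof (induction xs)
  case (Cons x xs)
  have "set (f x) \<inter> set (f y) = {}" if "y \<in> set xs" for y
    using Cons.prems(1) Cons.prems(3)[of x y] that by auto
  moreover have "distinct (concat (map f xs))"
    using Cons.prems by (intro Cons.IH) auto
  ultimately show ?case
    using Cons.prems(2)[of x] by fastforce
qed simp

lemma relabel_trees:
  assumes "\<sigma> permutes {1..n}" "t \<in> trees E n"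
  shows "relabel (inv_into UNIV \<sigma>) t \<in> trees E n"
  using assms permutes_inv[OF assms(1)]
  by (auto simp: trees_def distinct_map permutes_image simp del: One_nat_def intro: inj_on_subset[OF permutes_inj])

lemma graft_trees:
  assumes "i \<in> {1..m}" "s \<in> trees E m" "t \<in> trees E n"
  shows "graft n i s t \<in> trees E (m + n - 1)"
proof -
  let ?f = "\<lambda>j. if j = i then map (\<lambda>l. l + i - 1) (leaves t) else [slot i n j]"
  have s: "labelled_by E s" "distinct (leaves s)" "set (leaves s) = {1..m}"
    and t: "labelled_by E t" "distinct (leaves t)" "set (leaves t) = {1..n}"
    using assms by (auto simp: trees_def)
  have l: "leaves (graft n i s t) = concat (map ?f (leaves s))"
    unfolding graft_def leaves_tsubst by (intro arg_cong[where f = concat] map_cong) auto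
  have f: "set (?f j) = (if j = i then {i..<i + n} else {slot i n j})" for j
  proof -
    have "(\<lambda>l. l + i - 1) ` {1..n} = {i..<i + n}"
    proof -
      have "x \<in> (\<lambda>l. l + i - 1) ` {1..n}" if "x \<in> {i..<i + n}" for x
        using that assms(1) by (intro image_eqI[of _ _ "x + 1 - i"]) auto
      then show ?thesis using assms(1) by auto
    qed
    then show ?thesis using t(3) by simp
  qed
  have "distinct (concat (map ?f (leaves s)))"
  proof (rule distinct_concat_map[OF s(2)])
    show "distinct (?f j)" for j
      using t(2) assms(1) by (auto simp: distinct_map inj_on_def)
    show "set (?f j) \<inter> set (?f k) = {}" if "j \<in> set (leaves s)" "k \<in> set (leaves s)" "j \<noteq> k" for j k
      unfolding f using that assms(1) unfolding s(3) by (auto simp: slot_def split: if_splits)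
  qed
  moreover have "set (concat (map ?f (leaves s))) = {1..m + n - 1}"
  proof -
    have "set (concat (map ?f (leaves s))) = (\<Union>j\<in>{1..m}. if j = i then {i..<i + n} else {slot i n j})"
      unfolding set_concat set_map s(3) image_image f ..
    also have "\<dots> = {1..m + n - 1}"
    proof (intro equalityI subsetI)
      fix l assume "l \<in> (\<Union>j\<in>{1..m}. if j = i then {i..<i + n} else {slot i n j})"
      then show "l \<in> {1..m + n - 1}"
        using slot_range[OF assms(1), of _ n] assms(1) by (auto split: if_splits)
    next
      fix l assume "l \<in> {1..m + n - 1}"
      with assms(1) show "l \<in> (\<Union>j\<in>{1..m}. if j = i then {i..<i + n} else {slot i n j})"
      proof (cases rule: slot_cases)
        case (1 k)
        then show ?thesis by (intro UN_I[of k]) auto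
      next
        case (2 p)
        then show ?thesis using assms(1) by (intro UN_I[of i]) auto
      qed
    qed
    finally show ?thesis .
  qed
  moreover have "labelled_by E (graft n i s t)"
    using s t by (simp add: graft_def labelled_by_tsubst)
  ultimately show ?thesis
    by (simp add: trees_def l)
qed

text \<open>Both sides are one substitution into s, so they can be compared at each leaf of s.
  Labels are at least 1, which keeps the truncated subtractions in the shifts exact.\<close>

lemma graft_sequential:
  assumes "i \<in> {1..l}" "j \<in> {1..m}" "s \<in> trees E l" "t \<in> trees E m" "u \<in> trees E n"
  shows "graft n (i - 1 + j) (graft m i s t) u = graft (m + n - 1) i s (graft n j t u)"
proof -
  have L: "k \<ge> 1" if "k \<in> set (leaves s) \<union> set (leaves t)" for k
    using that assms(3,4) by (auto simp: trees_def)
  show ?thesis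
    unfolding graft_def tsubst_tsubst
  proof (rule tsubst_cong)
    fix k assume k: "k \<in> set (leaves s)"
    show "tsubst (\<lambda>ja. if ja = i - 1 + j then relabel (\<lambda>l. l + (i - 1 + j) - 1) u else Leaf (slot (i - 1 + j) n ja))
         (if k = i then relabel (\<lambda>l. l + i - 1) t else Leaf (slot i m k)) =
        (if k = i then relabel (\<lambda>l. l + i - 1) (tsubst (\<lambda>ja. if ja = j then relabel (\<lambda>l. l + j - 1) u else Leaf (slot j n ja)) t)
         else Leaf (slot i (m + n - 1) k))"
    proof (cases "k = i")
      case True
      have "tsubst (\<lambda>ja. if ja = i - 1 + j then relabel (\<lambda>l. l + (i - 1 + j) - 1) u else Leaf (slot (i - 1 + j) n ja)) (relabel (\<lambda>l. l + i - 1) t)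
        = relabel (\<lambda>l. l + i - 1) (tsubst (\<lambda>ja. if ja = j then relabel (\<lambda>l. l + j - 1) u else Leaf (slot j n ja)) t)"
        unfolding relabel_def tsubst_tsubst
        by (rule tsubst_cong) (use L assms(1,2) in \<open>auto simp: slot_def tsubst_tsubst intro!: tsubst_cong\<close>)
      then show ?thesis using True by simp
    next
      case False
      have "k \<ge> 1" using L k by simp
      then show ?thesis using False assms(1,2) by (auto simp: slot_def)
    qed
  qed
qed

lemma graft_parallel:
  assumes "i \<in> {1..l}" "k \<in> {1..l}" "i < k" "s \<in> trees E l" "t \<in> trees E m" "u \<in> trees E n"
  shows "graft n (k - 1 + m) (graft m i s t) u = graft m i (graft n k s u) t"
  unfolding graft_def tsubst_tsubst
proof (rule tsubst_cong)
  fix j assume "j \<in> set (leaves s)"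
  then have j: "j \<ge> 1" using assms(4) by (auto simp: trees_def)
  let ?f = "\<lambda>j. if j = k - 1 + m then relabel (\<lambda>l. l + (k - 1 + m) - 1) u else Leaf (slot (k - 1 + m) n j)"
  let ?g = "\<lambda>j. if j = i then relabel (\<lambda>l. l + i - 1) t else Leaf (slot i m j)"
  have fi: "tsubst ?f (relabel (\<lambda>l. l + i - 1) t) = relabel (\<lambda>l. l + i - 1) t"
    using assms(1-3,5) unfolding relabel_def tsubst_tsubst
    by (intro tsubst_cong) (auto simp: slot_def trees_def)
  have gk: "tsubst ?g (relabel (\<lambda>l. l + k - 1) u) = relabel (\<lambda>l. l + (k - 1 + m) - 1) u"
    using assms(1-3,6) unfolding relabel_def tsubst_tsubst
    by (intro tsubst_cong) (auto simp: slot_def trees_def)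
  consider "j = i" | "j = k" | "j \<noteq> i" "j \<noteq> k" by blast
  then show "tsubst ?f (?g j) = tsubst ?g (if j = k then relabel (\<lambda>l. l + k - 1) u else Leaf (slot k n j))"
  proof cases
    case 1 then show ?thesis using fi assms(1-3) by (simp add: slot_def)
  next
    case 2 then show ?thesis using gk assms(1-3) by (simp add: slot_def)
  next
    case 3 then show ?thesis using j assms(1-3) by (auto simp: slot_def)
  qed
qed

lemma inv_perm: "\<sigma> permutes S \<Longrightarrow> inv_into UNIV \<sigma> (\<sigma> x) = x" "\<sigma> permutes S \<Longrightarrow> \<sigma> (inv_into UNIV \<sigma> x) = x"
  by (simp_all add: permutes_inverses)

text \<open>The description of \<open>perm_comp\<close> on the two kinds of inputs is inverted,
  because the action relabels leaves by the inverse permutation. After that, both sides are compared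
  at each leaf of s.\<close>

lemma graft_equivariant:
  assumes "i \<in> {1..m}" "\<sigma> permutes {1..m}" "\<tau> permutes {1..n}" "s \<in> trees E m" "t \<in> trees E n"
  shows "graft n i (relabel (inv_into UNIV \<sigma>) s) (relabel (inv_into UNIV \<tau>) t)
    = relabel (inv_into UNIV (perm_comp m n i \<sigma> \<tau>)) (graft n (\<sigma> i) s t)"
proof -
  let ?p = "perm_comp m n i \<sigma> \<tau>" and ?inv = "inv_into UNIV"
  note p = inv_perm(1)[OF perm_comp_permutes[OF assms(1-3)]]
  have p1: "?inv ?p (slot (\<sigma> i) n k) = slot i n (?inv \<sigma> k)" if "k \<in> {1..m}" "k \<noteq> \<sigma> i" for k
  proof -
    have k: "?inv \<sigma> k \<in> {1..m}" "?inv \<sigma> k \<noteq> i"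
      using that permutes_in_image[OF permutes_inv[OF assms(2)], of k] inv_perm(2)[OF assms(2), of k] by auto
    show ?thesis
      using p[of "slot i n (?inv \<sigma> k)"] unfolding perm_comp_slot[OF assms(1,2) k] inv_perm(2)[OF assms(2)] .
  qed
  have p2: "?inv ?p (l + \<sigma> i - 1) = ?inv \<tau> l + i - 1" if "l \<in> {1..n}" for l
  proof -
    have l: "?inv \<tau> l \<in> {1..n}"
      using that permutes_in_image[OF permutes_inv[OF assms(3)], of l] by simp
    show ?thesis
      using p[of "?inv \<tau> l + i - 1"] unfolding perm_comp_inner[OF assms(1,2) l] inv_perm(2)[OF assms(3)] .
  qed
  show ?thesis
    unfolding graft_def tsubst_relabel relabel_tsubst
  proof (rule tsubst_cong)
    fix k assume "k \<in> set (leaves s)"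
    then have k: "k \<in> {1..m}" using assms(4) by (auto simp: trees_def)
    have e: "?inv \<sigma> k = i \<longleftrightarrow> k = \<sigma> i" using inv_perm[OF assms(2)] by metis
    have "relabel (\<lambda>l. l + i - 1) (relabel (?inv \<tau>) t) = relabel (?inv ?p) (relabel (\<lambda>l. l + \<sigma> i - 1) t)"
      unfolding relabel_relabel using p2 assms(5) by (intro relabel_cong) (auto simp: trees_def)
    then show "(if ?inv \<sigma> k = i then relabel (\<lambda>l. l + i - 1) (relabel (?inv \<tau>) t) else Leaf (slot i n (?inv \<sigma> k)))
      = relabel (?inv ?p) (if k = \<sigma> i then relabel (\<lambda>l. l + \<sigma> i - 1) t else Leaf (slot (\<sigma> i) n k))"
      using p1[OF k] e by simp
  qed
qed

subsection \<open>The operad of trees\<close>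

text \<open>Both sides are trilinear, so agreement on basis elements is enough. This turns the
  composition axioms of the operad of trees into the identities for \<open>graft\<close>.\<close>

lemma push2_assoc:
  assumes "\<And>a b c. a \<in> X \<Longrightarrow> b \<in> Y \<Longrightarrow> c \<in> Z \<Longrightarrow> h (g a b) c = h' a (g' b c)"
    and "keys x \<subseteq> X" "keys y \<subseteq> Y" "keys z \<subseteq> Z"
  shows "push2 h (push2 g x y) z = push2 h' x (push2 g' y z)"
  using assms(2)
proof (induction rule: free_module_induct)
  case (add x a c)
  have "push2 h (push2 g (single a c) y) z = push2 h' (single a c) (push2 g' y z)"
    using assms(3)
  proof (induction rule: free_module_induct)
    case (add y b d)
    have "push2 h (single (g a b) (c * d)) z
        = push2 h' (single a c) (push2 g' (single b d) z)"
      using assms(4)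
      by (induction rule: free_module_induct)
        (simp_all add: push2_add_right assms(1) \<open>a \<in> X\<close> \<open>b \<in> Y\<close> mult.assoc)
    then show ?case using add by (simp add: push2_add_left push2_add_right)
  qed simp
  then show ?case using add by (simp add: push2_add_left)
qed simp

lemma push2_parallel:
  assumes "\<And>a b c. a \<in> X \<Longrightarrow> b \<in> Y \<Longrightarrow> c \<in> Z \<Longrightarrow> h (g a b) c = h' (g' a c) b"
    and "keys x \<subseteq> X" "keys y \<subseteq> Y" "keys z \<subseteq> Z"
  shows "push2 h (push2 g x y) z = push2 h' (push2 g' x z) y"
proof -
  have "push2 h (push2 g x y) z = push2 (\<lambda>c p. h p c) z (push2 g x y)"
    by (rule push2_flip)
  also have "\<dots> = push2 h' (push2 (\<lambda>c a. g' a c) z x) y"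
    by (rule push2_assoc[symmetric, of Z X Y]) (use assms in auto)
  also have "\<dots> = push2 h' (push2 g' x z) y"
    by (simp add: push2_flip[of g'])
  finally show ?thesis .
qed

lemma push2_push:
  "push2 h (push f x) (push g y) = push2 (\<lambda>a b. h (f a) (g b)) x y"
proof -
  have "keys x \<subseteq> UNIV" by simp
  then show ?thesis
  proof (induction rule: free_module_induct)
    case (add x a c)
    have "keys y \<subseteq> UNIV" by simp
    then have "push2 h (single (f a) c) (push g y) = push2 (\<lambda>a b. h (f a) (g b)) (single a c) y"
      by (induction rule: free_module_induct) (simp_all add: push2_add_right push_add)
    then show ?case using add by (simp add: push2_add_left push_add)
  qed simp
qed

lemma push_push2: "push f (push2 h x y) = push2 (\<lambda>a b. f (h a b)) x y"
proof -
  have "keys x \<subseteq> UNIV" by simp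
  then show ?thesis
  proof (induction rule: free_module_induct)
    case (add x a c)
    have "keys y \<subseteq> UNIV" by simp
    then have "push f (push2 h (single a c) y) = push2 (\<lambda>a b. f (h a b)) (single a c) y"
      by (induction rule: free_module_induct) (simp_all add: push2_add_right push_add)
    then show ?case using add by (simp add: push2_add_left push_add)
  qed simp
qed

lemma push2_cong:
  assumes "\<And>a b. a \<in> keys x \<Longrightarrow> b \<in> keys y \<Longrightarrow> h a b = h' a b"
  shows "push2 h x y = push2 h' x y"
  using assms by (simp add: push2_def)

lemma sp_tree_operad [simp]: "sp (tree_operad E) n = free_module (trees E n)"
  and act_tree_operad [simp]: "act (tree_operad E) n x \<sigma> = push (relabel (inv_into UNIV \<sigma>)) x"
  and opunit_tree_operad [simp]: "opunit (tree_operad E) = bas (Leaf 1)"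
  and pcomp_tree_operad [simp]: "pcomp (tree_operad E) m n i = push2 (graft n i)"
  by (simp_all add: tree_operad_def)

lemma Leaf_trees [simp]: "Leaf i \<in> trees E n \<longleftrightarrow> {i} = {1..n}"
  by (auto simp: trees_def)

lemma operad_tree_operad: "operad (tree_operad E)"
proof (intro operad.intro smodule.intro operad_axioms.intro)
  fix l m n i j k \<sigma> \<tau> and x y z :: "'b ltree \<Rightarrow>\<^sub>0 'a"
  show "vspace (sp (tree_operad E) n)"
    using vspace_free_module by simp
  show "linear_map (sp (tree_operad E) n) (sp (tree_operad E) n) (\<lambda>x. act (tree_operad E) n x \<sigma>)"
    if "\<sigma> permutes {1..n}"
    using push_linear[of "relabel (inv_into UNIV \<sigma>)" "trees E n" "trees E n"] relabel_trees[OF that] by auto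
  show "opunit (tree_operad E) \<in> carrier (sp (tree_operad E) 1)" by simp
  { assume x: "x \<in> carrier (sp (tree_operad E) n)"
    show "act (tree_operad E) n x id = x"
      by (simp add: push_ident relabel_ident)
    show "act (tree_operad E) n (act (tree_operad E) n x \<sigma>) \<tau> = act (tree_operad E) n x (\<sigma> \<circ> \<tau>)"
      if "\<sigma> permutes {1..n}" "\<tau> permutes {1..n}"
      using o_inv_distrib[of \<sigma> \<tau>] that by (simp add: push_push relabel_relabel permutes_bij comp_def) }
  show "linear_map (sp (tree_operad E) m) (sp (tree_operad E) (m + n - 1)) (\<lambda>x. pcomp (tree_operad E) m n i x y)"
    if "i \<in> {1..m}" "y \<in> carrier (sp (tree_operad E) n)"
    using push2_linear(1)[of "trees E m" "trees E n" "graft n i" "trees E (m + n - 1)" y, OF graft_trees[OF that(1)]] that(2)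
    by simp
  show "linear_map (sp (tree_operad E) n) (sp (tree_operad E) (m + n - 1)) (\<lambda>y. pcomp (tree_operad E) m n i x y)"
    if "i \<in> {1..m}" "x \<in> carrier (sp (tree_operad E) m)"
    using push2_linear(2)[of "trees E m" "trees E n" "graft n i" "trees E (m + n - 1)" x, OF graft_trees[OF that(1)]] that(2)
    by simp
  show "pcomp (tree_operad E) 1 n 1 (opunit (tree_operad E)) y = y" if "y \<in> carrier (sp (tree_operad E) n)"
    by (simp add: push2_bas_left push_ident graft_def relabel_ident)
  show "pcomp (tree_operad E) m 1 i x (opunit (tree_operad E)) = x"
    if "i \<in> {1..m}" "x \<in> carrier (sp (tree_operad E) m)"
  proof -
    have "graft 1 i t (Leaf 1) = t" if "t \<in> keys x" for t
      using tsubst_cong[of t _ Leaf] by (simp add: graft_def slot_def)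
    then show ?thesis
      by (simp add: push2_bas_right push_ident)
  qed
  { assume x: "x \<in> carrier (sp (tree_operad E) l)" and y: "y \<in> carrier (sp (tree_operad E) m)"
      and z: "z \<in> carrier (sp (tree_operad E) n)"
    show "pcomp (tree_operad E) (l + m - 1) n (i - 1 + j) (pcomp (tree_operad E) l m i x y) z
        = pcomp (tree_operad E) l (m + n - 1) i x (pcomp (tree_operad E) m n j y z)"
      if "i \<in> {1..l}" "j \<in> {1..m}"
      unfolding pcomp_tree_operad
      by (rule push2_assoc[of "trees E l" "trees E m" "trees E n"], rule graft_sequential[OF that])
        (use x y z in simp_all)
    show "pcomp (tree_operad E) (l + m - 1) n (k - 1 + m) (pcomp (tree_operad E) l m i x y) z
        = pcomp (tree_operad E) (l + n - 1) m i (pcomp (tree_operad E) l n k x z) y"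
      if "i \<in> {1..l}" "k \<in> {1..l}" "i < k"
      unfolding pcomp_tree_operad
      by (rule push2_parallel[of "trees E l" "trees E m" "trees E n"], rule graft_parallel[OF that])
        (use x y z in simp_all) }
  show "pcomp (tree_operad E) m n i (act (tree_operad E) m x \<sigma>) (act (tree_operad E) n y \<tau>)
      = act (tree_operad E) (m + n - 1) (pcomp (tree_operad E) m n (\<sigma> i) x y) (perm_comp m n i \<sigma> \<tau>)"
    if "i \<in> {1..m}" "\<sigma> permutes {1..m}" "\<tau> permutes {1..n}"
      "x \<in> carrier (sp (tree_operad E) m)" "y \<in> carrier (sp (tree_operad E) n)"
    unfolding act_tree_operad pcomp_tree_operad push2_push push_push2
    by (rule push2_cong, rule graft_equivariant[OF that(1-3), where E = E]) (use that(4,5) in auto)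
qed

subsection \<open>The universal property of the free operad\<close>

lemma mset_permute_subtrees:
  assumes "\<sigma> permutes {1..length ts}"
  shows "mset (permute_subtrees \<sigma> ts) = mset ts"
proof -
  let ?n = "length ts"
  \<comment> \<open>List positions start at 0 while \<sigma> permutes \<open>{1..length ts}\<close>,
    hence the shift by one before and after applying the inverse.\<close>
  define p where "p = (\<lambda>j. if j < ?n then inv_into UNIV \<sigma> (Suc j) - 1 else j)"
  have r: "inv_into UNIV \<sigma> (Suc j) \<in> {1..?n}" if "j < ?n" for j
    using permutes_in_image[OF permutes_inv[OF assms], of "Suc j"] that by simp
  have "inj_on p {..<?n}"
  proof (rule inj_onI)
    fix i j assume "i \<in> {..<?n}" "j \<in> {..<?n}" "p i = p j"
    then have "inv_into UNIV \<sigma> (Suc i) = inv_into UNIV \<sigma> (Suc j)"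
      using r[of i] r[of j] by (simp add: p_def) arith
    then show "i = j" using permutes_inj[OF permutes_inv[OF assms]] by (simp add: inj_eq)
  qed
  moreover have "p ` {..<?n} \<subseteq> {..<?n}"
  proof (rule image_subsetI)
    show "p j \<in> {..<?n}" if "j \<in> {..<?n}" for j using r[of j] that by (simp add: p_def) arith
  qed
  ultimately have "bij_betw p {..<?n} {..<?n}"
    by (simp add: bij_betw_def endo_inj_surj)
  then have "p permutes {..<?n}"
    by (rule bij_imp_permutes) (simp add: p_def)
  then have "mset (permute_list p ts) = mset ts" by (rule mset_permute_list)
  moreover have "permute_list p ts = permute_subtrees \<sigma> ts"
    by (simp add: permute_list_def permute_subtrees_def p_def)
  ultimately show ?thesis by simp
qed

lemma leaves_permute_subtrees:
  fixes ts :: "'e ltree list"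
  assumes "\<sigma> permutes {1..length ts}"
  shows "mset (leaves (Node a (permute_subtrees \<sigma> ts))) = mset (leaves (Node b ts))"
proof -
  have "mset (concat (map leaves us)) = sum_mset (image_mset (\<lambda>t. mset (leaves t)) (mset us))" for us :: "'e ltree list"
    by (induction us) auto
  then show ?thesis using mset_permute_subtrees[OF assms] by (simp only: leaves.simps)
qed

lemma length_permute_subtrees [simp]: "length (permute_subtrees \<sigma> ts) = length ts"
  by (simp add: permute_subtrees_def)

lemma permute_subtrees_trees:
  assumes "\<sigma> permutes {1..length ts}" "Node a ts \<in> trees E n"
  shows "Node a (permute_subtrees \<sigma> ts) \<in> trees E n"
proof -
  have 1: "set (permute_subtrees \<sigma> ts) = set ts"
    using mset_permute_subtrees[OF assms(1)] by (metis set_mset_mset)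
  have 2: "distinct (leaves (Node a (permute_subtrees \<sigma> ts)))"
      "set (leaves (Node a (permute_subtrees \<sigma> ts))) = {1..n}"
    using mset_eq_imp_distinct_iff[OF leaves_permute_subtrees[OF assms(1), of a a]]
      mset_eq_setD[OF leaves_permute_subtrees[OF assms(1), of a a]] assms(2)
    by (simp_all only: trees_def mem_Collect_eq simp_thms)
  show ?thesis
    unfolding trees_def mem_Collect_eq using 2 assms(2) 1 by (auto simp: trees_def list_all_iff)
qed

lemma (in smodule) relabel_root_trees:
  assumes "Node a ts \<in> trees Q n" "b \<in> carrier (sp Q (length ts))"
  shows "Node b ts \<in> trees Q n"
  using assms by (simp add: trees_def)

lemma tree_relators_carrier:
  assumes "smodule E"
  shows "tree_relators E n \<subseteq> carrier (sp (tree_operad E) n)"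
proof -
  interpret smodule E by fact
  have 1: "Node (a \<oplus>\<^bsub>sp E (length ts)\<^esub> b) ts \<in> trees E n" if "Node a ts \<in> trees E n" "Node b ts \<in> trees E n" for a b ts
  proof -
    interpret module kring "sp E (length ts)" by (rule vspace_sp)
    show ?thesis using that by (intro relabel_root_trees[OF that(1)]) (simp add: trees_def)
  qed
  have 2: "Node (c \<odot>\<^bsub>sp E (length ts)\<^esub> a) ts \<in> trees E n" if "Node a ts \<in> trees E n" for a c ts
  proof -
    interpret module kring "sp E (length ts)" by (rule vspace_sp)
    show ?thesis using that by (intro relabel_root_trees[OF that(1)]) (simp add: trees_def)
  qed
  have 3: "Node (act E (length ts) a \<sigma>) ts \<in> trees E n" if "\<sigma> permutes {1..length ts}" "Node a ts \<in> trees E n" for a \<sigma> ts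
    using that linear_mapD(1)[OF act_linear[OF that(1)]]
    by (intro relabel_root_trees[OF that(2)]) (simp add: trees_def)
  have k: "keys (x - y) \<subseteq> T" if "keys x \<subseteq> T" "keys y \<subseteq> T"
    for x y :: "_ \<Rightarrow>\<^sub>0 'a" and T
    using that keys_diff[of x y] by blast
  have s: "keys (single t c) \<subseteq> T" if "t \<in> T" for t and c :: 'a and T
    using that by simp
  show ?thesis
    unfolding tree_relators_def using 1 2 3 permute_subtrees_trees[where E = E and n = n]
    by (auto simp del: One_nat_def dest!: subsetD[OF keys_diff] split: if_splits)
qed

locale free_operad_smodule = smodule E for E :: "('k::field, 'e) smodule"
begin

sublocale quot: operad_quotient "tree_operad E" "tree_ideal E"
  by (intro operad_quotient.intro operad_quotient_axioms.intro operad_tree_operad)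
    (simp only: tree_ideal_def operad_ideal_gen_ideal[OF operad_tree_operad tree_relators_carrier[OF smodule_axioms]])

sublocale free: operad "free_operad E"
  unfolding free_operad_def by (rule quot.operad_quot)

lemma sp_free: "sp (free_operad E) n = quot_module (free_module (trees E n)) (tree_ideal E n)"
  using quot.sp_quot[of n] by (simp add: free_operad_def)

lemma carrier_free: "carrier (sp (free_operad E) n) = tree_class E n ` {x. keys x \<subseteq> trees E n}"
  using quot.carrier_quot[of n] by (simp add: sp_free tree_class_def image_def)

lemma tree_class_linear: "linear_map (free_module (trees E n)) (sp (free_operad E) n) (tree_class E n)"
  using quot.linear_map_cl[of n] by (simp add: sp_free tree_class_def[abs_def])

lemma tree_class_closed [intro]: "keys x \<subseteq> trees E n \<Longrightarrow> tree_class E n x \<in> carrier (sp (free_operad E) n)"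
  by (auto simp: carrier_free)

lemma act_free:
  "\<sigma> permutes {1..n} \<Longrightarrow> keys x \<subseteq> trees E n \<Longrightarrow>
    act (free_operad E) n (tree_class E n x) \<sigma> = tree_class E n (push (relabel (inv_into UNIV \<sigma>)) x)"
  using quot.act_quot[of \<sigma> n x] by (simp add: free_operad_def tree_class_def)

lemma pcomp_free:
  "i \<in> {1..m} \<Longrightarrow> keys x \<subseteq> trees E m \<Longrightarrow> keys y \<subseteq> trees E n \<Longrightarrow>
    pcomp (free_operad E) m n i (tree_class E m x) (tree_class E n y) = tree_class E (m + n - 1) (push2 (graft n i) x y)"
  using quot.pcomp_quot[of i m x y n] by (simp add: free_operad_def tree_class_def)

lemma opunit_free: "opunit (free_operad E) = tree_class E 1 (bas (Leaf 1))"
  by (simp add: free_operad_def tree_class_def)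

lemma tree_class_eq_iff:
  assumes "keys x \<subseteq> trees E n" "keys y \<subseteq> trees E n"
  shows "tree_class E n x = tree_class E n y \<longleftrightarrow> x - y \<in> tree_ideal E n"
  using coset_eq_iff[OF quot.vspace_sp quot.submod, of x n y] assms
  by (simp add: tree_class_def)

lemma tree_class_ideal:
  "x \<in> tree_ideal E n \<Longrightarrow> tree_class E n x = \<zero>\<^bsub>sp (free_operad E) n\<^esub>"
  using coset_eq_self_iff[OF quot.vspace_sp quot.submod, of x n] operad_ideal_subset[OF operad_tree_operad quot.ideal, of n]
  by (auto simp: tree_class_def sp_free)

lemma zero_free: "\<zero>\<^bsub>sp (free_operad E) n\<^esub> = tree_class E n 0"
  using quot_zero_coset[OF quot.vspace_sp quot.submod, of n] by (simp add: tree_class_def sp_free)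

lemma tree_relators_ideal: "tree_relators E n \<subseteq> tree_ideal E n"
  unfolding tree_ideal_def by (rule gen_ideal_superset)

lemma linear_free_eqI:
  assumes "vspace N" "linear_map (sp (free_operad E) n) N f" "linear_map (sp (free_operad E) n) N g"
    and "\<And>t. t \<in> trees E n \<Longrightarrow> f (tree_class E n (bas t)) = g (tree_class E n (bas t))"
    and "x \<in> carrier (sp (free_operad E) n)"
  shows "f x = g x"
proof -
  obtain z where z: "keys z \<subseteq> trees E n" "x = tree_class E n z"
    using assms(5) by (auto simp: carrier_free)
  show ?thesis
    unfolding z(2)
    by (rule free_linear_eqI[OF assms(1) linear_map_compose[OF tree_class_linear assms(2)]
          linear_map_compose[OF tree_class_linear assms(3)] assms(4) z(1)])
qed

text \<open>Values are prescribed on all trees instead of on generators, which avoids a recursion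
  inside \<open>Q'\<close> over subtrees whose leaves are not numbered \<open>1..n\<close>.
  Compatibility with relabelling, unit and grafting makes the linear extension a morphism on the
  operad of trees. The last three premises concern labels at the root only; relators at other
  vertices lie in the generated ideal, which a morphism kills together with its generators.\<close>

lemma free_operad_hom:
  fixes Q' :: "('k, 'b) operad"
  assumes Q': "operad Q'"
    and F: "\<And>n t. t \<in> trees E n \<Longrightarrow> F n t \<in> carrier (sp Q' n)"
    and F_act: "\<And>n t \<sigma>. t \<in> trees E n \<Longrightarrow> \<sigma> permutes {1..n} \<Longrightarrow> F n (relabel (inv_into UNIV \<sigma>) t) = act Q' n (F n t) \<sigma>"
    and F_unit: "F 1 (Leaf 1) = opunit Q'"
    and F_graft: "\<And>m n i s t. i \<in> {1..m} \<Longrightarrow> s \<in> trees E m \<Longrightarrow> t \<in> trees E n \<Longrightarrow>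
        F (m + n - 1) (graft n i s t) = pcomp Q' m n i (F m s) (F n t)"
    and F_add: "\<And>n a b ts. Node a ts \<in> trees E n \<Longrightarrow> Node b ts \<in> trees E n \<Longrightarrow>
        F n (Node (a \<oplus>\<^bsub>sp E (length ts)\<^esub> b) ts) = F n (Node a ts) \<oplus>\<^bsub>sp Q' n\<^esub> F n (Node b ts)"
    and F_smult: "\<And>n a c ts. Node a ts \<in> trees E n \<Longrightarrow>
        F n (Node (c \<odot>\<^bsub>sp E (length ts)\<^esub> a) ts) = c \<odot>\<^bsub>sp Q' n\<^esub> F n (Node a ts)"
    and F_perm: "\<And>n a \<sigma> ts. Node a ts \<in> trees E n \<Longrightarrow> \<sigma> permutes {1..length ts} \<Longrightarrow>
        F n (Node (act E (length ts) a \<sigma>) ts) = F n (Node a (permute_subtrees \<sigma> ts))"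
  shows "\<exists>f. operad_hom (free_operad E) Q' f \<and> (\<forall>n. \<forall>t\<in>trees E n. f n (tree_class E n (bas t)) = F n t)"
proof -
  interpret Q': operad Q' by fact
  let ?f = "\<lambda>n. lext (sp Q' n) (F n)"
  have lin: "linear_map (free_module (trees E n)) (sp Q' n) (?f n)" for n
    by (rule lext_linear[OF Q'.vspace_sp]) (use F in auto)
  have bas: "?f n (bas t) = F n t" if "t \<in> trees E n" for n t
    by (rule lext_bas[OF Q'.vspace_sp]) (rule F[OF that])
  have hom: "operad_hom (tree_operad E) Q' ?f"
  proof (rule operad_homI[OF operad_tree_operad Q'])
    show "linear_map (sp (tree_operad E) n) (sp Q' n) (?f n)" for n using lin by simp
    show "?f n (act (tree_operad E) n x \<sigma>) = act Q' n (?f n x) \<sigma>"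
      if "\<sigma> permutes {1..n}" "x \<in> carrier (sp (tree_operad E) n)" for n \<sigma> x
    proof -
      have 1: "linear_map (free_module (trees E n)) (free_module (trees E n)) (push (relabel (inv_into UNIV \<sigma>)))"
        using relabel_trees[OF that(1)] by (intro push_linear) auto
      show ?thesis
        unfolding act_tree_operad
      proof (rule free_linear_eqI[OF Q'.vspace_sp linear_map_compose[OF 1 lin] linear_map_compose[OF lin Q'.act_linear[OF that(1)]]])
        show "?f n (push (relabel (inv_into UNIV \<sigma>)) (bas t)) = act Q' n (?f n (bas t)) \<sigma>" if "t \<in> trees E n" for t
          using bas[OF relabel_trees[OF \<open>\<sigma> permutes _\<close> that]] F_act[OF that \<open>\<sigma> permutes _\<close>] bas[OF that] by simp
      qed (use that in simp)
    qed
    show "?f 1 (opunit (tree_operad E)) = opunit Q'"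
      using bas[of "Leaf 1" 1] F_unit by simp
    show "?f (m + n - 1) (pcomp (tree_operad E) m n i x y) = pcomp Q' m n i (?f m x) (?f n y)"
      if i: "i \<in> {1..m}" and x: "x \<in> carrier (sp (tree_operad E) m)" and y: "y \<in> carrier (sp (tree_operad E) n)" for m n i x y
    proof -
      note T = operad_tree_operad[of E]
      \<comment> \<open>Bilinearity is used in two rounds: first y is arbitrary and x a single tree,
        then x is arbitrary as well.\<close>
      have "?f (m + n - 1) (push2 (graft n i) (bas s) y) = pcomp Q' m n i (F m s) (?f n y)" if s: "s \<in> trees E m" for s
      proof (rule free_linear_eqI[OF Q'.vspace_sp, where X = "trees E n" and z = y
            and f = "\<lambda>y. ?f (m + n - 1) (push2 (graft n i) (bas s) y)" and g = "\<lambda>y. pcomp Q' m n i (F m s) (?f n y)"])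
        have "bas s \<in> carrier (sp (tree_operad E) m)" using s by simp
        from operad.pcomp_linear_right[OF T i this, of n]
        show "linear_map (free_module (trees E n)) (sp Q' (m + n - 1)) (\<lambda>y. ?f (m + n - 1) (push2 (graft n i) (bas s) y))"
          using linear_map_compose[OF _ lin] by simp
        show "linear_map (free_module (trees E n)) (sp Q' (m + n - 1)) (\<lambda>y. pcomp Q' m n i (F m s) (?f n y))"
          by (rule linear_map_compose[OF lin Q'.pcomp_linear_right[OF i F[OF s]]])
        show "?f (m + n - 1) (push2 (graft n i) (bas s) (bas t)) = pcomp Q' m n i (F m s) (?f n (bas t))"
          if "t \<in> trees E n" for t
          using bas[OF graft_trees[OF i s that]] bas[OF that] F_graft[OF i s that] by simp
        show "keys y \<subseteq> trees E n" using y by simp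
      qed
      note 1 = this
      have yc: "?f n y \<in> carrier (sp Q' n)" using linear_mapD(1)[OF lin, of y n] y by simp
      show ?thesis
        unfolding pcomp_tree_operad
      proof (rule free_linear_eqI[OF Q'.vspace_sp, where X = "trees E m" and z = x
            and f = "\<lambda>x. ?f (m + n - 1) (push2 (graft n i) x y)" and g = "\<lambda>x. pcomp Q' m n i (?f m x) (?f n y)"])
        from operad.pcomp_linear_left[OF T i y]
        show "linear_map (free_module (trees E m)) (sp Q' (m + n - 1)) (\<lambda>x. ?f (m + n - 1) (push2 (graft n i) x y))"
          using linear_map_compose[OF _ lin] by simp
        show "linear_map (free_module (trees E m)) (sp Q' (m + n - 1)) (\<lambda>x. pcomp Q' m n i (?f m x) (?f n y))"
          by (rule linear_map_compose[OF lin Q'.pcomp_linear_left[OF i yc]])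
        show "?f (m + n - 1) (push2 (graft n i) (bas s) y) = pcomp Q' m n i (?f m (bas s)) (?f n y)"
          if "s \<in> trees E m" for s
          using 1[OF that] bas[OF that] by simp
        show "keys x \<subseteq> trees E m" using x by simp
      qed
    qed
  qed
  have rel: "?f m x = \<zero>\<^bsub>sp Q' m\<^esub>" if "x \<in> tree_relators E m" for m x
  proof -
    interpret M: module kring "sp Q' m" by (rule Q'.vspace_sp)
    note D = linear_mapD[OF lin[of m]] and minus = linear_map_minus(2)[OF vspace_free_module Q'.vspace_sp lin[of m]]
    have minus: "?f m (x - y) = ?f m x \<ominus>\<^bsub>sp Q' m\<^esub> ?f m y"
      if "keys x \<subseteq> trees E m" "keys y \<subseteq> trees E m" for x y
      using minus[of x y] that by simp
    have kd: "keys (x - y) \<subseteq> trees E m"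
      if "keys x \<subseteq> trees E m" "keys y \<subseteq> trees E m" for x y :: "_ \<Rightarrow>\<^sub>0 'k"
      using that keys_diff[of x y] by blast
    have sg: "?f m (single t c) = c \<odot>\<^bsub>sp Q' m\<^esub> F m t" if "t \<in> trees E m" for t c
      using D(3)[of "bas t" c] that bas[OF that] by (simp add: bas_def)
    from that consider
        a b ts where "x = bas (Node (a \<oplus>\<^bsub>sp E (length ts)\<^esub> b) ts) - bas (Node a ts) - bas (Node b ts)"
          "Node a ts \<in> trees E m" "Node b ts \<in> trees E m"
      | a c ts where "x = bas (Node (c \<odot>\<^bsub>sp E (length ts)\<^esub> a) ts) - single (Node a ts) c"
          "Node a ts \<in> trees E m"
      | a \<sigma> ts where "x = bas (Node (act E (length ts) a \<sigma>) ts) - bas (Node a (permute_subtrees \<sigma> ts))"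
          "\<sigma> permutes {1..length ts}" "Node a ts \<in> trees E m"
      unfolding tree_relators_def by blast
    then show ?thesis
    proof cases
      case 1
      interpret L: module kring "sp E (length ts)" by (rule vspace_sp)
      have t: "Node (a \<oplus>\<^bsub>sp E (length ts)\<^esub> b) ts \<in> trees E m"
        using 1(2,3) by (intro relabel_root_trees[OF 1(2)]) (simp add: trees_def)
      have "?f m x = (F m (Node a ts) \<oplus>\<^bsub>sp Q' m\<^esub> F m (Node b ts)) \<ominus>\<^bsub>sp Q' m\<^esub> F m (Node a ts) \<ominus>\<^bsub>sp Q' m\<^esub> F m (Node b ts)"
        unfolding 1(1) using t 1(2,3) by (simp add: minus kd bas F_add)
      then show ?thesis
        using F[OF 1(2)] F[OF 1(3)]
        by (simp add: a_minus_def M.a_assoc flip: M.minus_add) (simp add: M.r_neg flip: M.a_assoc)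
    next
      case 2
      interpret L: module kring "sp E (length ts)" by (rule vspace_sp)
      have t: "Node (c \<odot>\<^bsub>sp E (length ts)\<^esub> a) ts \<in> trees E m"
        using 2(2) by (intro relabel_root_trees[OF 2(2)]) (simp add: trees_def)
      have "?f m x = c \<odot>\<^bsub>sp Q' m\<^esub> F m (Node a ts) \<ominus>\<^bsub>sp Q' m\<^esub> c \<odot>\<^bsub>sp Q' m\<^esub> F m (Node a ts)"
        unfolding 2(1) using t 2(2) by (simp add: minus sg bas F_smult)
      then show ?thesis using F[OF 2(2)] by (simp add: a_minus_def M.r_neg)
    next
      case 3
      have t: "Node (act E (length ts) a \<sigma>) ts \<in> trees E m"
        using 3(2,3) linear_mapD(1)[OF act_linear[OF 3(2)]]
        by (intro relabel_root_trees[OF 3(3)]) (simp add: trees_def)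
      have "?f m x = F m (Node a (permute_subtrees \<sigma> ts)) \<ominus>\<^bsub>sp Q' m\<^esub> F m (Node a (permute_subtrees \<sigma> ts))"
        unfolding 3(1) using t permute_subtrees_trees[OF 3(2,3)] by (simp add: minus bas F_perm[OF 3(3,2)])
      then show ?thesis using F[OF permute_subtrees_trees[OF 3(2,3)]] by (simp add: a_minus_def M.r_neg)
    qed
  qed
  have "?f n x = \<zero>\<^bsub>sp Q' n\<^esub>" if "x \<in> tree_ideal E n" for n x
    using gen_ideal_hom_zero[OF hom _ operad_ideal_zero[OF Q'], of "tree_relators E" x n] rel
      tree_relators_carrier[OF smodule_axioms] that unfolding tree_ideal_def by blast
  from quot.hom_factor[OF hom this] obtain g where
    g: "operad_hom (quot_operad (tree_operad E) (tree_ideal E)) Q' g"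
    "\<And>n x. x \<in> carrier (sp (tree_operad E) n) \<Longrightarrow> g n (quot.cl n x) = ?f n x" by auto
  have "g n (tree_class E n (bas t)) = F n t" if "t \<in> trees E n" for n t
    using g(2)[of "bas t" n] that bas[OF that] by (simp add: tree_class_def)
  then show ?thesis using g(1) unfolding free_operad_def by blast
qed

end

subsection \<open>Relators in context\<close>

text \<open>Subtrees of a tree in \<open>trees E n\<close> carry only some of the labels
  \<open>1..n\<close>, so inductions over trees need arbitrary label sets.\<close>

definition ltrees :: "('k, 'e) smodule \<Rightarrow> nat set \<Rightarrow> 'e ltree set" where
  "ltrees E L = {t. labelled_by E t \<and> distinct (leaves t) \<and> set (leaves t) = L}"

lemma trees_ltrees: "trees E n = ltrees E {1..n}"
  by (simp add: trees_def ltrees_def)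

lemma Node_ltrees:
  "Node a ts \<in> ltrees E L \<longleftrightarrow> a \<in> carrier (sp E (length ts)) \<and> list_all (labelled_by E) ts \<and>
    distinct (concat (map leaves ts)) \<and> set (concat (map leaves ts)) = L"
  by (auto simp: ltrees_def)

lemma Leaf_ltrees [simp]: "Leaf i \<in> ltrees E L \<longleftrightarrow> L = {i}"
  by (auto simp: ltrees_def)

lemma finite_ltrees: "t \<in> ltrees E L \<Longrightarrow> finite L"
  by (auto simp: ltrees_def)

lemma tsubst_ltrees:
  assumes "t \<in> ltrees E L" "\<And>i. i \<in> L \<Longrightarrow> g i \<in> ltrees E (K i)"
    and "\<And>i j. i \<in> L \<Longrightarrow> j \<in> L \<Longrightarrow> i \<noteq> j \<Longrightarrow> K i \<inter> K j = {}"
  shows "tsubst g t \<in> ltrees E (\<Union>i\<in>L. K i)"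
proof -
  have g: "labelled_by E (g i)" "distinct (leaves (g i))" "set (leaves (g i)) = K i" if "i \<in> L" for i
    using assms(2)[OF that] by (auto simp: ltrees_def)
  have t: "labelled_by E t" "distinct (leaves t)" "set (leaves t) = L"
    using assms(1) by (auto simp: ltrees_def)
  have "distinct (concat (map (\<lambda>i. leaves (g i)) (leaves t)))"
    using g t assms(3) by (intro distinct_concat_map) auto
  then show ?thesis
    unfolding ltrees_def using g t by (auto simp: leaves_tsubst labelled_by_tsubst)
qed

lemma relabel_ltrees:
  assumes "t \<in> ltrees E L" "inj_on h L"
  shows "relabel h t \<in> ltrees E (h ` L)"
proof -
  have "relabel h t \<in> ltrees E (\<Union>i\<in>L. {h i})"
    unfolding relabel_def
    by (rule tsubst_ltrees[OF assms(1)]) (use inj_onD[OF assms(2)] in auto)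
  then show ?thesis by (simp add: UNION_singleton_eq_range)
qed

definition ltree_relators :: "('k::field, 'e) smodule \<Rightarrow> nat set \<Rightarrow> ('e ltree \<Rightarrow>\<^sub>0 'k) set" where
  "ltree_relators E L =
     {bas (Node (a \<oplus>\<^bsub>sp E (length ts)\<^esub> b) ts) - bas (Node a ts) - bas (Node b ts) |a b ts.
        Node a ts \<in> ltrees E L \<and> Node b ts \<in> ltrees E L} \<union>
     {bas (Node (c \<odot>\<^bsub>sp E (length ts)\<^esub> a) ts) - single (Node a ts) c |a c ts.
        Node a ts \<in> ltrees E L} \<union>
     {bas (Node (act E (length ts) a \<sigma>) ts) - bas (Node a (permute_subtrees \<sigma> ts)) |a \<sigma> ts.
        \<sigma> permutes {1..length ts} \<and> Node a ts \<in> ltrees E L}"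

lemma ltree_relators_addI:
  "Node a ts \<in> ltrees E L \<Longrightarrow> Node b ts \<in> ltrees E L \<Longrightarrow>
    bas (Node (a \<oplus>\<^bsub>sp E (length ts)\<^esub> b) ts) - bas (Node a ts) - bas (Node b ts) \<in> ltree_relators E L"
  unfolding ltree_relators_def by blast

lemma ltree_relators_smultI:
  "Node a ts \<in> ltrees E L \<Longrightarrow>
    bas (Node (c \<odot>\<^bsub>sp E (length ts)\<^esub> a) ts) - single (Node a ts) c \<in> ltree_relators E L"
  unfolding ltree_relators_def by blast

lemma ltree_relators_actI:
  "\<sigma> permutes {1..length ts} \<Longrightarrow> Node a ts \<in> ltrees E L \<Longrightarrow>
    bas (Node (act E (length ts) a \<sigma>) ts) - bas (Node a (permute_subtrees \<sigma> ts)) \<in> ltree_relators E L"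
  unfolding ltree_relators_def by blast

lemma ltree_relators_cases:
  assumes "r \<in> ltree_relators E L"
  obtains (add) a b ts where "r = bas (Node (a \<oplus>\<^bsub>sp E (length ts)\<^esub> b) ts) - bas (Node a ts) - bas (Node b ts)"
        "Node a ts \<in> ltrees E L" "Node b ts \<in> ltrees E L"
    | (smult) a c ts where "r = bas (Node (c \<odot>\<^bsub>sp E (length ts)\<^esub> a) ts) - single (Node a ts) c"
        "Node a ts \<in> ltrees E L"
    | (act) a \<sigma> ts where "r = bas (Node (act E (length ts) a \<sigma>) ts) - bas (Node a (permute_subtrees \<sigma> ts))"
        "\<sigma> permutes {1..length ts}" "Node a ts \<in> ltrees E L"
  using assms unfolding ltree_relators_def by blast

lemma tree_relators_ltree_relators: "tree_relators E n = ltree_relators E {1..n}"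
  by (simp add: tree_relators_def ltree_relators_def trees_ltrees)

text \<open>These elements are the relators placed at some vertex of a larger tree. They turn the
  tree ideal, an intersection by definition, into something spanned by explicit elements:
  \<open>tree_ideal_lin_span\<close> and \<open>crel_tree_ideal\<close> give the two inclusions. The
  context is built one vertex at a time, from the relator towards the root.\<close>

inductive crel :: "('k::field, 'e) smodule \<Rightarrow> nat set \<Rightarrow> ('e ltree \<Rightarrow>\<^sub>0 'k) \<Rightarrow> bool" for E where
  root: "r \<in> ltree_relators E L \<Longrightarrow> crel E L r"
| ctx: "crel E L r \<Longrightarrow> e \<in> carrier (sp E (Suc (length pre + length post))) \<Longrightarrow>
    list_all (labelled_by E) (pre @ post) \<Longrightarrow> distinct (concat (map leaves (pre @ post))) \<Longrightarrow>
    set (concat (map leaves (pre @ post))) \<inter> L = {} \<Longrightarrow>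
    crel E (L \<union> set (concat (map leaves (pre @ post)))) (push (\<lambda>t. Node e (pre @ t # post)) r)"

lemma permute_subtrees_map:
  assumes "\<sigma> permutes {1..length ts}"
  shows "permute_subtrees \<sigma> (map f ts) = map f (permute_subtrees \<sigma> ts)"
proof -
  have "inv_into UNIV \<sigma> (Suc j) - 1 < length ts" if "j < length ts" for j
    using permutes_in_image[OF permutes_inv[OF assms], of "Suc j"] that by auto
  then show ?thesis by (simp add: permute_subtrees_def)
qed

lemma Node_ltrees_cong: "Node a ts \<in> ltrees E L \<Longrightarrow> b \<in> carrier (sp E (length ts)) \<Longrightarrow> Node b ts \<in> ltrees E L"
  by (simp add: Node_ltrees)

lemma permute_subtrees_ltrees:
  assumes "\<sigma> permutes {1..length ts}" "Node a ts \<in> ltrees E L"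
  shows "Node a (permute_subtrees \<sigma> ts) \<in> ltrees E L"
proof -
  have 1: "set (permute_subtrees \<sigma> ts) = set ts"
    using mset_permute_subtrees[OF assms(1)] by (metis set_mset_mset)
  have 2: "distinct (leaves (Node a (permute_subtrees \<sigma> ts)))"
      "set (leaves (Node a (permute_subtrees \<sigma> ts))) = L"
    using mset_eq_imp_distinct_iff[OF leaves_permute_subtrees[OF assms(1), of a a]]
      mset_eq_setD[OF leaves_permute_subtrees[OF assms(1), of a a]] assms(2)
    by (simp_all only: ltrees_def mem_Collect_eq simp_thms)
  show ?thesis
    unfolding ltrees_def mem_Collect_eq using 2 assms(2) 1 by (auto simp: ltrees_def list_all_iff)
qed

lemma keys_diff_subset:
  "keys x \<subseteq> T \<Longrightarrow> keys y \<subseteq> T \<Longrightarrow> keys (x - y) \<subseteq> T"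
  using keys_diff[of x y] by blast

lemma keys_add_subset:
  "keys x \<subseteq> T \<Longrightarrow> keys y \<subseteq> T \<Longrightarrow> keys (x + y) \<subseteq> T"
  using keys_add[of x y] by blast

context free_operad_smodule
begin

lemma ltree_relators_keys:
  assumes "r \<in> ltree_relators E L"
  shows "keys r \<subseteq> ltrees E L"
proof -
  from assms show ?thesis
  proof (cases rule: ltree_relators_cases)
    case (add a b ts)
    interpret L: module kring "sp E (length ts)" by (rule vspace_sp)
    have "Node (a \<oplus>\<^bsub>sp E (length ts)\<^esub> b) ts \<in> ltrees E L"
      using add(2,3) by (intro Node_ltrees_cong[OF add(2)]) (simp add: Node_ltrees)
    then show ?thesis unfolding add(1) using add by (intro keys_diff_subset) auto
  next
    case (smult a c ts)
    interpret L: module kring "sp E (length ts)" by (rule vspace_sp)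
    have "Node (c \<odot>\<^bsub>sp E (length ts)\<^esub> a) ts \<in> ltrees E L"
      using smult(2) by (intro Node_ltrees_cong[OF smult(2)]) (simp add: Node_ltrees)
    then show ?thesis unfolding smult(1) using smult by (intro keys_diff_subset) auto
  next
    case (act a \<sigma> ts)
    have "Node (act E (length ts) a \<sigma>) ts \<in> ltrees E L"
      using act(2,3) linear_mapD(1)[OF act_linear[OF act(2)]]
      by (intro Node_ltrees_cong[OF act(3)]) (simp add: Node_ltrees)
    then show ?thesis unfolding act(1) using permute_subtrees_ltrees[OF act(2,3)] by (intro keys_diff_subset) auto
  qed
qed

lemma ctx_ltrees:
  assumes "t \<in> ltrees E L" "e \<in> carrier (sp E (Suc (length pre + length post)))"
    "list_all (labelled_by E) (pre @ post)" "distinct (concat (map leaves (pre @ post)))"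
    "set (concat (map leaves (pre @ post))) \<inter> L = {}"
  shows "Node e (pre @ t # post) \<in> ltrees E (L \<union> set (concat (map leaves (pre @ post))))"
  using assms unfolding Node_ltrees by (auto simp: ltrees_def)

lemma crel_keys: "crel E L r \<Longrightarrow> keys r \<subseteq> ltrees E L"
proof (induction rule: crel.induct)
  case (root r L)
  then show ?case by (rule ltree_relators_keys)
next
  case (ctx L r e pre post)
  show ?case
    using keys_push[of "\<lambda>t. Node e (pre @ t # post)" r] ctx.IH ctx_ltrees[OF _ ctx.hyps(2-5)] by blast
qed

lemma ltree_relators_tsubst:
  assumes "r \<in> ltree_relators E L" "\<And>i. i \<in> L \<Longrightarrow> g i \<in> ltrees E (K i)"
    and "\<And>i j. i \<in> L \<Longrightarrow> j \<in> L \<Longrightarrow> i \<noteq> j \<Longrightarrow> K i \<inter> K j = {}"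
  shows "push (tsubst g) r \<in> ltree_relators E (\<Union>i\<in>L. K i)"
proof -
  note T = tsubst_ltrees[OF _ assms(2,3)]
  from assms(1) show ?thesis
  proof (cases rule: ltree_relators_cases)
    case (add a b ts)
    have "push (tsubst g) r = bas (Node (a \<oplus>\<^bsub>sp E (length (map (tsubst g) ts))\<^esub> b) (map (tsubst g) ts))
        - bas (Node a (map (tsubst g) ts)) - bas (Node b (map (tsubst g) ts))"
      unfolding add(1) by (simp add: push_diff)
    then show ?thesis using ltree_relators_addI[OF T[OF add(2), simplified] T[OF add(3), simplified]] by simp
  next
    case (smult a c ts)
    have "push (tsubst g) r = bas (Node (c \<odot>\<^bsub>sp E (length (map (tsubst g) ts))\<^esub> a) (map (tsubst g) ts))
        - single (Node a (map (tsubst g) ts)) c"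
      unfolding smult(1) by (simp add: push_diff)
    then show ?thesis using ltree_relators_smultI[OF T[OF smult(2), simplified]] by simp
  next
    case (act a \<sigma> ts)
    have "push (tsubst g) r = bas (Node (act E (length (map (tsubst g) ts)) a \<sigma>) (map (tsubst g) ts))
        - bas (Node a (permute_subtrees \<sigma> (map (tsubst g) ts)))"
      unfolding act(1) by (simp add: push_diff permute_subtrees_map[OF act(2)])
    then show ?thesis using ltree_relators_actI[of \<sigma> "map (tsubst g) ts", OF _ T[OF act(3), simplified]] act(2) by simp
  qed
qed

text \<open>Substitution at leaves does not touch the vertex at which the relator sits; it only
  enlarges the subtrees below and beside it. Disjointness of the sets \<open>K i\<close> keeps the
  leaf labels distinct.\<close>

lemma crel_tsubst:
  assumes "crel E L r" "\<And>i. i \<in> L \<Longrightarrow> g i \<in> ltrees E (K i)"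
    and "\<And>i j. i \<in> L \<Longrightarrow> j \<in> L \<Longrightarrow> i \<noteq> j \<Longrightarrow> K i \<inter> K j = {}"
  shows "crel E (\<Union>i\<in>L. K i) (push (tsubst g) r)"
  using assms
proof (induction rule: crel.induct)
  case (root r L)
  then show ?case by (intro crel.root ltree_relators_tsubst)
next
  case (ctx L r e pre post)
  let ?M = "set (concat (map leaves (pre @ post)))"
  let ?S = "map (tsubst g)"
  have IH: "crel E (\<Union>i\<in>L. K i) (push (tsubst g) r)"
    by (rule ctx.IH) (use ctx.prems in auto)
  have g: "labelled_by E (g i)" "distinct (leaves (g i))" "set (leaves (g i)) = K i" if "i \<in> ?M" for i
    using ctx.prems(1)[of i] that by (auto simp: ltrees_def)
  have l: "concat (map leaves (?S ts)) = concat (map (\<lambda>i. leaves (g i)) (concat (map leaves ts)))" for ts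
    by (induction ts) (simp_all add: leaves_tsubst)
  have lM: "set (concat (map leaves (?S pre @ ?S post))) = (\<Union>i\<in>?M. K i)"
  proof -
    have "set (concat (map leaves (?S pre @ ?S post))) = (\<Union>i\<in>?M. set (leaves (g i)))"
      unfolding map_append[symmetric] l by (simp only: set_concat set_map image_image)
    then show ?thesis using g(3) by simp
  qed
  have disj: "K i \<inter> K j = {}" if "i \<in> ?M" "j \<in> L" for i j
    by (rule ctx.prems(2)) (use that ctx.hyps(5) in blast)+
  have "crel E ((\<Union>i\<in>L. K i) \<union> set (concat (map leaves (?S pre @ ?S post))))
      (push (\<lambda>t. Node e (?S pre @ t # ?S post)) (push (tsubst g) r))"
  proof (rule crel.ctx[OF IH])
    show "e \<in> carrier (sp E (Suc (length (?S pre) + length (?S post))))" using ctx by simp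
    show "list_all (labelled_by E) (?S pre @ ?S post)"
      using ctx.hyps(3) g(1) by (fastforce simp: list_all_iff labelled_by_tsubst)
    show "distinct (concat (map leaves (?S pre @ ?S post)))"
      unfolding map_append[symmetric] l
      by (rule distinct_concat_map[OF ctx.hyps(4)]) (use g ctx.prems(2) in auto)
    show "set (concat (map leaves (?S pre @ ?S post))) \<inter> (\<Union>i\<in>L. K i) = {}"
      unfolding lM using disj by blast
  qed
  then show ?case
    unfolding lM by (simp add: push_push UN_Un)
qed

lemma crel_relabel:
  assumes "crel E L r" "inj_on h L"
  shows "crel E (h ` L) (push (relabel h) r)"
proof -
  have "crel E (\<Union>i\<in>L. {h i}) (push (relabel h) r)"
    unfolding relabel_def[abs_def]
    by (rule crel_tsubst[OF assms(1)]) (use inj_onD[OF assms(2)] in auto)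
  then show ?thesis by (simp add: UNION_singleton_eq_range)
qed

abbreviation plug :: "nat \<Rightarrow> 'e ltree \<Rightarrow> 'e ltree \<Rightarrow> 'e ltree" where
  "plug h C t \<equiv> tsubst (\<lambda>j. if j = h then t else Leaf j) C"

lemma plug_ident: "h \<notin> set (leaves C) \<Longrightarrow> plug h C t = C"
proof -
  assume "h \<notin> set (leaves C)"
  then have "plug h C t = tsubst Leaf C" by (intro tsubst_cong) auto
  then show ?thesis by simp
qed

text \<open>The induction on C follows the path from the root to the hole h. Only the subtree that
  contains h depends on the plugged tree, and the rule \<open>ctx\<close> supplies the vertex above
  it; the siblings are unchanged because h occurs once.\<close>

lemma crel_plug:
  assumes "crel E L r" "C \<in> ltrees E K" "h \<in> K" "L \<inter> (K - {h}) = {}"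
  shows "crel E (L \<union> (K - {h})) (push (plug h C) r)"
  using assms(2-4)
proof (induction C arbitrary: K)
  case (Leaf i)
  then show ?case using assms(1) by (simp add: push_ident)
next
  case (Node e ts)
  obtain u where u: "u \<in> set ts" "h \<in> set (leaves u)"
    using Node.prems by (auto simp: Node_ltrees)
  then obtain pre post where ts: "ts = pre @ u # post" by (meson split_list)
  let ?M = "set (concat (map leaves (pre @ post)))"
  have d: "distinct (concat (map leaves (pre @ u # post)))" and K: "K = set (leaves u) \<union> ?M"
    using Node.prems(1) unfolding Node_ltrees ts by auto
  have uL: "u \<in> ltrees E (set (leaves u))" and all: "list_all (labelled_by E) (pre @ post)"
    using Node.prems(1) unfolding Node_ltrees ts by (auto simp: ltrees_def)
  have disj: "set (leaves u) \<inter> ?M = {}" "distinct (concat (map leaves (pre @ post)))" using d by auto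
  then have h: "h \<notin> ?M" using u by auto
  have IH: "crel E (L \<union> (set (leaves u) - {h})) (push (plug h u) r)"
    by (rule Node.IH[OF u(1) uL u(2)]) (use Node.prems(3) K in auto)
  have "crel E ((L \<union> (set (leaves u) - {h})) \<union> ?M) (push (\<lambda>t. Node e (pre @ t # post)) (push (plug h u) r))"
    by (rule crel.ctx[OF IH _ all disj(2)])
      (use Node.prems(1,3) K h disj(1) in \<open>auto simp: Node_ltrees ts\<close>)
  moreover have "(L \<union> (set (leaves u) - {h})) \<union> ?M = L \<union> (K - {h})" using K h by auto
  moreover have "Node e (pre @ plug h u t # post) = plug h (Node e ts) t" for t
  proof -
    have "map (\<lambda>x. plug h x t) pre = pre" "map (\<lambda>x. plug h x t) post = post"
      using h by (auto intro!: map_idI plug_ident)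
    then show ?thesis by (simp add: ts)
  qed
  ultimately show ?case by (simp add: push_push)
qed

end

declare One_nat_def [simp del]

lemma free_linear_submodule:
  assumes "vspace N" "linear_map (free_module X) N h" "submodule K kring N"
    and "\<And>x. x \<in> X \<Longrightarrow> h (bas x) \<in> K" and "keys z \<subseteq> X"
  shows "h z \<in> K"
  using assms(5)
proof (induction rule: free_module_induct)
  case zero
  show ?case
    using linear_map_zero[OF vspace_free_module assms(1,2)] vspace_submoduleD(2)[OF assms(1,3)] by simp
next
  case (add z x c)
  have "h (single x c \<oplus>\<^bsub>free_module X\<^esub> z) = c \<odot>\<^bsub>N\<^esub> h (bas x) \<oplus>\<^bsub>N\<^esub> h z"
    using add linear_mapD(2)[OF assms(2), of "single x c" z] linear_mapD(3)[OF assms(2), of "bas x" c]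
    by (simp add: bas_def split: if_splits)
  then show ?case
    using add assms(4) vspace_submoduleD(3,4)[OF assms(1,3)] by simp
qed

definition block :: "nat \<Rightarrow> nat \<Rightarrow> nat \<Rightarrow> nat set" where
  "block i n j = (if j = i then {i..<i + n} else {slot i n j})"

lemma UN_block: "i \<in> {1..m} \<Longrightarrow> (\<Union>j\<in>{1..m}. block i n j) = {1..m + n - 1}"
proof (intro equalityI subsetI)
  fix l assume i: "i \<in> {1..m}" and "l \<in> (\<Union>j\<in>{1..m}. block i n j)"
  then show "l \<in> {1..m + n - 1}"
    using slot_range[OF i, of _ n] by (auto simp: block_def split: if_splits)
next
  fix l assume i: "i \<in> {1..m}" and "l \<in> {1..m + n - 1}"
  then show "l \<in> (\<Union>j\<in>{1..m}. block i n j)"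
  proof (cases rule: slot_cases)
    case (1 k)
    then show ?thesis by (intro UN_I[of k]) (auto simp: block_def)
  next
    case (2 p)
    then show ?thesis using i by (intro UN_I[of i]) (auto simp: block_def)
  qed
qed

lemma block_disjoint:
  "i \<in> {1..m} \<Longrightarrow> j \<in> {1..m} \<Longrightarrow> k \<in> {1..m} \<Longrightarrow> j \<noteq> k \<Longrightarrow> block i n j \<inter> block i n k = {}"
  by (auto simp: block_def slot_def split: if_splits)

lemma shift_image: "i \<ge> (1::nat) \<Longrightarrow> (\<lambda>l. l + i - 1) ` {1..n} = {i..<i + n}"
proof -
  assume "i \<ge> 1"
  have "x \<in> (\<lambda>l. l + i - 1) ` {1..n}" if "x \<in> {i..<i + n}" for x
  proof (rule image_eqI)
    show "x = (x + 1 - i) + i - 1" using that by simp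
    show "x + 1 - i \<in> {1..n}" using that \<open>i \<ge> 1\<close> by (simp, arith)
  qed
  then show ?thesis using \<open>i \<ge> 1\<close> by auto
qed

lemma shift_inj: "i \<ge> (1::nat) \<Longrightarrow> inj_on (\<lambda>l. l + i - 1) A"
  by (auto simp: inj_on_def)

context free_operad_smodule
begin

lemma crel_graft_left:
  assumes "crel E {1..m} r" "i \<in> {1..m}" "t \<in> trees E n"
  shows "crel E {1..m + n - 1} (push (\<lambda>s. graft n i s t) r)"
proof -
  have "relabel (\<lambda>l. l + i - 1) t \<in> ltrees E {i..<i + n}"
    using relabel_ltrees[of t E "{1..n}" "\<lambda>l. l + i - 1"] assms(2,3) shift_image[of i n] shift_inj[of i]
    by (simp add: trees_ltrees)
  then have "crel E (\<Union>j\<in>{1..m}. block i n j)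
      (push (tsubst (\<lambda>j. if j = i then relabel (\<lambda>l. l + i - 1) t else Leaf (slot i n j))) r)"
    by (intro crel_tsubst[OF assms(1)] block_disjoint[OF assms(2)]) (auto simp: block_def)
  then show ?thesis
    unfolding UN_block[OF assms(2)] graft_def[abs_def] .
qed

lemma crel_graft_right:
  assumes "crel E {1..n} r" "i \<in> {1..m}" "s \<in> trees E m"
  shows "crel E {1..m + n - 1} (push (graft n i s) r)"
proof -
  \<comment> \<open>The labels of the composite end at m + n - 1, so m + n is a fresh name for the
    hole that replaces the leaf i of s.\<close>
  let ?h = "\<lambda>j. if j = i then m + n else slot i n j"
  let ?C = "relabel ?h s"
  have sl: "slot i n j \<noteq> m + n" if "j \<in> {1..m}" "j \<noteq> i" for j
    using slot_range[OF assms(2) that, of n] assms(2) by auto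
  have "inj_on ?h {1..m}"
    using assms(2) sl by (auto simp: inj_on_def slot_def split: if_splits)
  then have C: "?C \<in> ltrees E (?h ` {1..m})"
    using assms(3) by (intro relabel_ltrees) (simp_all add: trees_ltrees)
  have K: "?h ` {1..m} - {m + n} = slot i n ` ({1..m} - {i})"
    using sl by auto
  have U: "{i..<i + n} \<union> (?h ` {1..m} - {m + n}) = {1..m + n - 1}"
    unfolding K UN_block[OF assms(2), symmetric] using assms(2) by (auto simp: block_def split: if_splits)
  have r: "crel E {i..<i + n} (push (relabel (\<lambda>l. l + i - 1)) r)"
    using crel_relabel[OF assms(1) shift_inj[of i]] shift_image[of i n] assms(2) by simp
  have "crel E ({i..<i + n} \<union> (?h ` {1..m} - {m + n})) (push (plug (m + n) ?C) (push (relabel (\<lambda>l. l + i - 1)) r))"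
  proof (rule crel_plug[OF r C])
    show "m + n \<in> ?h ` {1..m}" using assms(2) by force
    show "{i..<i + n} \<inter> (?h ` {1..m} - {m + n}) = {}"
      unfolding K using assms(2) by (auto simp: slot_def)
  qed
  moreover have "plug (m + n) ?C (relabel (\<lambda>l. l + i - 1) t) = graft n i s t" for t
    unfolding graft_def tsubst_relabel
    by (rule tsubst_cong) (use sl assms(3) in \<open>auto simp: trees_def\<close>)
  ultimately show ?thesis
    unfolding U push_push by simp
qed

text \<open>Each operation of the tree operad preserves relators in context: permutations relabel
  them, composition with a relator on the left substitutes into its leaves, and composition with a
  relator on the right plugs it into a tree. Linearity extends this to the spans.\<close>

lemma operad_ideal_crel:
  "operad_ideal (tree_operad E) (\<lambda>n. lin_span (free_module (trees E n)) {r. crel E {1..n} r})"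
proof (rule operad_idealI)
  let ?I = "\<lambda>n. lin_span (free_module (trees E n)) {r. crel E {1..n} r}"
  have S: "{r. crel E {1..n} r} \<subseteq> carrier (free_module (trees E n))" for n
    using crel_keys by (auto simp: trees_ltrees)
  have sub: "submodule (?I n) kring (free_module (trees E n))" for n
    by (rule lin_span_submodule[OF vspace_free_module S])
  have I: "r \<in> ?I n" if "crel E {1..n} r" for r n
    using that by (intro subsetD[OF lin_span_superset]) blast
  note span = linear_map_lin_span[OF vspace_free_module vspace_free_module _ S sub]
  show "submodule (?I n) kring (sp (tree_operad E) n)" for n
    using sub by simp
  show "act (tree_operad E) n x \<sigma> \<in> ?I n" if "\<sigma> permutes {1..n}" "x \<in> ?I n" for n x \<sigma>
  proof -
    have inj: "inj_on (inv_into UNIV \<sigma>) {1..n}" "inv_into UNIV \<sigma> ` {1..n} = {1..n}"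
      using permutes_inv[OF that(1)] by (auto simp: permutes_image intro: inj_on_subset[OF permutes_inj])
    have "push (relabel (inv_into UNIV \<sigma>)) x \<in> ?I n"
    proof (rule span[OF push_linear _ that(2)])
      show "push (relabel (inv_into UNIV \<sigma>)) r \<in> ?I n" if "r \<in> {r. crel E {1..n} r}" for r
        using crel_relabel[OF _ inj(1), of r] that inj(2) by (intro I) simp
    qed (use relabel_trees[OF that(1)] in auto)
    then show ?thesis by simp
  qed
  show "pcomp (tree_operad E) m n i x y \<in> ?I (m + n - 1)"
    if "i \<in> {1..m}" "x \<in> ?I m" "x \<in> carrier (sp (tree_operad E) m)" "y \<in> carrier (sp (tree_operad E) n)" for m n i x y
  proof -
    have "push2 (graft n i) x (bas t) \<in> ?I (m + n - 1)" if t: "t \<in> trees E n" for t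
      unfolding push2_bas_right
    proof (rule span[OF push_linear _ \<open>x \<in> ?I m\<close>])
      show "push (\<lambda>s. graft n i s t) r \<in> ?I (m + n - 1)" if "r \<in> {r. crel E {1..m} r}" for r
        using crel_graft_left[OF _ \<open>i \<in> _\<close> t, of r] that by (intro I) simp
    qed (use graft_trees[OF \<open>i \<in> _\<close> _ t] in auto)
    note 1 = this
    have "linear_map (free_module (trees E n)) (free_module (trees E (m + n - 1))) (\<lambda>y. push2 (graft n i) x y)"
      by (rule push2_linear(2)[where X = "trees E m"], rule graft_trees[OF that(1)]) (use that(3) in auto)
    from free_linear_submodule[OF vspace_free_module this sub 1, of y]
    have "push2 (graft n i) x y \<in> ?I (m + n - 1)" using that(4) by simp
    then show ?thesis by simp
  qed
  show "pcomp (tree_operad E) m n i x y \<in> ?I (m + n - 1)"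
    if "i \<in> {1..m}" "x \<in> carrier (sp (tree_operad E) m)" "y \<in> ?I n" "y \<in> carrier (sp (tree_operad E) n)" for m n i x y
  proof -
    have "push2 (graft n i) (bas s) y \<in> ?I (m + n - 1)" if s: "s \<in> trees E m" for s
      unfolding push2_bas_left
    proof (rule span[OF push_linear _ \<open>y \<in> ?I n\<close>])
      show "push (graft n i s) r \<in> ?I (m + n - 1)" if "r \<in> {r. crel E {1..n} r}" for r
        using crel_graft_right[OF _ \<open>i \<in> _\<close> s, where r = r] that by (intro I) simp
    qed (use graft_trees[OF \<open>i \<in> _\<close> s] in auto)
    note 1 = this
    have "linear_map (free_module (trees E m)) (free_module (trees E (m + n - 1))) (\<lambda>x. push2 (graft n i) x y)"
      by (rule push2_linear(1)[where Y = "trees E n"], rule graft_trees[OF that(1)]) (use that(4) in auto)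
    from free_linear_submodule[OF vspace_free_module this sub 1, of x]
    have "push2 (graft n i) x y \<in> ?I (m + n - 1)" using that(2) by simp
    then show ?thesis by simp
  qed
qed

text \<open>The spans form an ideal and contain the relators, so they contain the smallest such
  ideal. The converse inclusion is obtained from \<open>crel_tree_ideal\<close>.\<close>

lemma tree_ideal_lin_span:
  "tree_ideal E n \<subseteq> lin_span (free_module (trees E n)) {r. crel E {1..n} r}"
  unfolding tree_ideal_def
proof (rule gen_ideal_least[OF operad_ideal_crel])
  show "tree_relators E m \<subseteq> lin_span (free_module (trees E m)) {r. crel E {1..m} r}" for m
    unfolding tree_relators_ltree_relators
    by (rule order.trans[OF _ lin_span_superset]) (auto intro: crel.root)
qed

text \<open>This is the criterion for maps in a single arity that are not part of a morphism of
  operads, such as the decoration by J and the coordinates on T(V)(3): they have to be tested on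
  relators in all contexts.\<close>

lemma linear_map_tree_ideal:
  assumes "vspace N" "linear_map (free_module (trees E n)) N h" "submodule K kring N"
    and "\<And>r. crel E {1..n} r \<Longrightarrow> h r \<in> K" and "x \<in> tree_ideal E n"
  shows "h x \<in> K"
proof (rule linear_map_lin_span[OF vspace_free_module assms(1,2) _ assms(3), where S = "{r. crel E {1..n} r}"])
  show "{r. crel E {1..n} r} \<subseteq> carrier (free_module (trees E n))"
    using crel_keys by (auto simp: trees_ltrees)
qed (use assms(4,5) tree_ideal_lin_span in blast)+

end

subsection \<open>Ideals and trees with arbitrary leaf labels\<close>

locale tree_operad_ideal =
  fixes E :: "('k::field, 'e) smodule" and I :: "nat \<Rightarrow> ('e ltree \<Rightarrow>\<^sub>0 'k) set"
  assumes ideal: "operad_ideal (tree_operad E) I"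
begin

lemma submodule_ideal: "submodule (I n) kring (free_module (trees E n))"
  using operad_idealD(1)[OF ideal, of n] by simp

lemmas idealD = vspace_submoduleD[OF vspace_free_module submodule_ideal, simplified]

text \<open>\<open>gid L r\<close>: relabelling the leaves \<open>L\<close> of the trees in \<open>r\<close> by \<open>{1..card L}\<close> sends \<open>r\<close> into the ideal.
  The choice of the relabelling does not matter, since ideals are stable under permutations.\<close>

definition gid :: "nat set \<Rightarrow> ('e ltree \<Rightarrow>\<^sub>0 'k) \<Rightarrow> bool" where
  "gid L r \<longleftrightarrow> finite L \<and> keys r \<subseteq> ltrees E L \<and>
    (\<exists>\<beta>. bij_betw \<beta> L {1..card L} \<and> push (relabel \<beta>) r \<in> I (card L))"

lemma gidD: "gid L r \<Longrightarrow> finite L" "gid L r \<Longrightarrow> keys r \<subseteq> ltrees E L"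
  by (auto simp: gid_def)

text \<open>Two numberings of L differ by a permutation \<tau> of \<open>{1..card L}\<close>, and
  ideals are stable under the action. Thus the existential quantifier in \<open>gid\<close> can be
  read as a universal one.\<close>

lemma gid_bij:
  assumes "gid L r" "bij_betw \<beta>' L {1..card L}"
  shows "push (relabel \<beta>') r \<in> I (card L)"
proof -
  let ?k = "card L"
  obtain \<beta> where \<beta>: "bij_betw \<beta> L {1..?k}" "push (relabel \<beta>) r \<in> I ?k"
    using assms(1) by (auto simp: gid_def)
  define \<tau> where "\<tau> x = (if x \<in> {1..?k} then \<beta>' (inv_into L \<beta> x) else x)" for x
  have "bij_betw (\<beta>' \<circ> inv_into L \<beta>) {1..?k} {1..?k}"
    by (rule bij_betw_trans[OF bij_betw_inv_into[OF \<beta>(1)] assms(2)])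
  then have "bij_betw \<tau> {1..?k} {1..?k}"
    by (rule bij_betw_cong[THEN iffD1, rotated]) (simp add: \<tau>_def)
  then have \<tau>: "\<tau> permutes {1..?k}"
    by (rule bij_imp_permutes) (auto simp: \<tau>_def)
  \<comment> \<open>The action relabels by the inverse permutation, so the inverse of \<tau> is what
    relabels by \<tau>.\<close>
  have "act (tree_operad E) ?k (push (relabel \<beta>) r) (inv_into UNIV \<tau>) \<in> I ?k"
    by (rule operad_idealD(2)[OF ideal permutes_inv[OF \<tau>] \<beta>(2)])
  moreover have "inv_into UNIV (inv_into UNIV \<tau>) = \<tau>"
    by (rule inv_inv_eq[OF permutes_bij[OF \<tau>]])
  moreover have "push (relabel \<tau>) (push (relabel \<beta>) r) = push (relabel \<beta>') r"
    unfolding push_push relabel_relabel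
  proof (rule push_cong, rule relabel_cong)
    fix t i assume "t \<in> keys r" "i \<in> set (leaves t)"
    then have "i \<in> L" using gidD(2)[OF assms(1)] by (auto simp: ltrees_def)
    then show "\<tau> (\<beta> i) = \<beta>' i"
      using bij_betwE[OF \<beta>(1)] bij_betw_inv_into_left[OF \<beta>(1)] by (simp add: \<tau>_def)
  qed
  ultimately show ?thesis by simp
qed

lemma gid_ideal: "gid {1..n} r \<longleftrightarrow> r \<in> I n"
proof
  have e: "push (relabel (\<lambda>x. x)) r = r" by (simp add: push_ident relabel_ident)
  have b: "bij_betw (\<lambda>x. x) {1..n} {1..card {1..n}}" by (simp add: bij_betw_def)
  show "r \<in> I n" if "gid {1..n} r" using gid_bij[OF that b] e by simp
  show "gid {1..n} r" if "r \<in> I n"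
    unfolding gid_def using b e that operad_ideal_subset[OF operad_tree_operad ideal, of n]
    by (auto simp: trees_ltrees intro!: exI[of _ "\<lambda>x. x"])
qed

lemma ex_bij: "finite L \<Longrightarrow> \<exists>\<beta>. bij_betw \<beta> L {1..card L}"
  by (rule finite_same_card_bij) auto

lemma gid_relabel:
  assumes "gid L r" "inj_on h L"
  shows "gid (h ` L) (push (relabel h) r)"
proof -
  obtain \<beta> where \<beta>: "bij_betw \<beta> L {1..card L}" "push (relabel \<beta>) r \<in> I (card L)"
    using assms(1) by (auto simp: gid_def)
  have c: "card (h ` L) = card L" by (rule card_image[OF assms(2)])
  have "bij_betw (\<beta> \<circ> inv_into L h) (h ` L) {1..card L}"
    using bij_betw_trans[OF bij_betw_inv_into[OF inj_on_imp_bij_betw[OF assms(2)]] \<beta>(1)] .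
  moreover have "push (relabel (\<beta> \<circ> inv_into L h)) (push (relabel h) r) = push (relabel \<beta>) r"
    unfolding push_push relabel_relabel
    by (intro push_cong relabel_cong) (use gidD(2)[OF assms(1)] assms(2) in \<open>auto simp: ltrees_def\<close>)
  moreover have "keys (push (relabel h) r) \<subseteq> ltrees E (h ` L)"
    using keys_push[of "relabel h" r] relabel_ltrees[OF _ assms(2)] gidD(2)[OF assms(1)] by blast
  ultimately show ?thesis
    unfolding gid_def c using gidD(1)[OF assms(1)] \<beta>(2) by (metis finite_imageI)
qed

lemma gid_zero: "finite L \<Longrightarrow> gid L 0"
  unfolding gid_def
  using ex_bij[of L] idealD(2) by fastforce

lemma gid_add:
  assumes "gid L r" "gid L s"
  shows "gid L (r + s)"
proof -
  obtain \<beta> where \<beta>: "bij_betw \<beta> L {1..card L}" using ex_bij gidD(1)[OF assms(1)] by blast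
  have "push (relabel \<beta>) r + push (relabel \<beta>) s \<in> I (card L)"
    by (rule idealD(3)[OF gid_bij[OF assms(1) \<beta>] gid_bij[OF assms(2) \<beta>]])
  then show ?thesis
    unfolding gid_def push_add[symmetric]
    using \<beta> gidD(1)[OF assms(1)] keys_add_subset[OF gidD(2)[OF assms(1)] gidD(2)[OF assms(2)]] by blast
qed

lemma gid_smult:
  assumes "gid L r"
  shows "gid L (Poly_Mapping.map ((*) c) r)"
proof -
  obtain \<beta> where \<beta>: "bij_betw \<beta> L {1..card L}" using ex_bij gidD(1)[OF assms(1)] by blast
  have "Poly_Mapping.map ((*) c) (push (relabel \<beta>) r) \<in> I (card L)"
    by (rule idealD(4)[OF gid_bij[OF assms(1) \<beta>]])
  then show ?thesis
    unfolding gid_def push_smult[symmetric]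
    using \<beta> gidD(1)[OF assms(1)] order.trans[OF keys_map_mult gidD(2)[OF assms(1)]] by blast
qed

lemma gid_uminus: "gid L r \<Longrightarrow> gid L (- r)"
proof -
  assume "gid L r"
  from gid_smult[OF this, of "-1"] show ?thesis
    by (rule back_subst[where P = "gid L"]) (auto intro!: poly_mapping_eqI)
qed

lemma gid_diff: "gid L r \<Longrightarrow> gid L s \<Longrightarrow> gid L (r - s)"
  using gid_add[of L r "- s"] gid_uminus[of L s] by simp

text \<open>Plugging r into the hole h of C is an operadic composition once the leaves are numbered
  suitably. The other leaves of C receive the numbers \<open>1..?p\<close>, the hole comes last, and
  the labels in L are numbered after \<open>?p\<close>.\<close>

lemma gid_plug:
  assumes "gid L r" "C \<in> ltrees E K" "h \<in> K" "L \<inter> (K - {h}) = {}"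
  shows "gid (L \<union> (K - {h})) (push (\<lambda>t. tsubst (\<lambda>j. if j = h then t else Leaf j) C) r)"
proof -
  let ?K = "K - {h}" and ?ctx = "\<lambda>t. tsubst (\<lambda>j. if j = h then t else Leaf j) C"
  let ?p = "card ?K" and ?k = "card L"
  have fin: "finite L" "finite ?K" using gidD(1)[OF assms(1)] finite_ltrees[OF assms(2)] by auto
  obtain \<beta> where \<beta>: "bij_betw \<beta> L {1..?k}" using ex_bij[OF fin(1)] by blast
  obtain \<alpha> where \<alpha>: "bij_betw \<alpha> ?K {1..?p}" using ex_bij[OF fin(2)] by blast
  define \<gamma> where "\<gamma> x = (if x \<in> L then \<beta> x + ?p else \<alpha> x)" for x
  have c: "card (L \<union> ?K) = ?k + ?p" using card_Un_disjoint[OF fin assms(4)] by simp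
  have \<gamma>: "bij_betw \<gamma> (L \<union> ?K) {1..card (L \<union> ?K)}"
  proof -
    have "bij_betw (\<lambda>l. l + ?p) {1..?k} {?p + 1..?p + ?k}"
      by (rule bij_betwI[of _ _ _ "\<lambda>l. l - ?p"]) auto
    then have "bij_betw ((\<lambda>l. l + ?p) \<circ> \<beta>) L {?p + 1..?p + ?k}" by (rule bij_betw_trans[OF \<beta>])
    then have "bij_betw \<gamma> L {?p + 1..?p + ?k}"
      by (rule bij_betw_cong[THEN iffD1, rotated]) (simp add: \<gamma>_def)
    moreover have "bij_betw \<gamma> ?K {1..?p}"
      using \<alpha> by (rule bij_betw_cong[THEN iffD1, rotated]) (use assms(4) in \<open>auto simp: \<gamma>_def\<close>)
    ultimately have "bij_betw \<gamma> (L \<union> ?K) ({?p + 1..?p + ?k} \<union> {1..?p})"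
      by (rule bij_betw_combine) auto
    moreover have "{?p + 1..?p + ?k} \<union> {1..?p} = {1..card (L \<union> ?K)}"
      unfolding c by auto
    ultimately show ?thesis by simp
  qed
  \<comment> \<open>With the hole at the last position, grafting does not shift the numbers of the
    other leaves of C.\<close>
  define \<alpha>' where "\<alpha>' x = (if x = h then ?p + 1 else \<alpha> x)" for x
  have "inj_on \<alpha>' K" "\<alpha>' ` K = {1..?p + 1}"
  proof -
    have "bij_betw \<alpha>' ?K {1..?p}"
      using \<alpha> by (rule bij_betw_cong[THEN iffD1, rotated]) (auto simp: \<alpha>'_def)
    then have "bij_betw \<alpha>' (?K \<union> {h}) ({1..?p} \<union> {?p + 1})"
      by (rule bij_betw_combine) (auto simp: \<alpha>'_def)
    moreover have "?K \<union> {h} = K" "{1..?p} \<union> {?p + 1} = {1..?p + 1}" using assms(3) by auto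
    ultimately have "bij_betw \<alpha>' K {1..?p + 1}" by (simp only:)
    then show "inj_on \<alpha>' K" "\<alpha>' ` K = {1..?p + 1}" by (simp_all only: bij_betw_def)
  qed
  then have C: "relabel \<alpha>' C \<in> trees E (?p + 1)"
    using relabel_ltrees[OF assms(2)] by (metis trees_ltrees)
  have g: "graft ?k (?p + 1) (relabel \<alpha>' C) (relabel \<beta> t) = relabel \<gamma> (?ctx t)" if t: "t \<in> ltrees E L" for t
    unfolding graft_def tsubst_relabel relabel_tsubst
  proof (rule tsubst_cong)
    fix j assume "j \<in> set (leaves C)"
    then have j: "j \<in> K" using assms(2) by (auto simp: ltrees_def)
    show "(if \<alpha>' j = ?p + 1 then relabel (\<lambda>l. l + (?p + 1) - 1) (relabel \<beta> t) else Leaf (slot (?p + 1) ?k (\<alpha>' j)))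
        = relabel \<gamma> (if j = h then t else Leaf j)"
    proof (cases "j = h")
      case True
      have "relabel (\<lambda>l. l + (?p + 1) - 1) (relabel \<beta> t) = relabel \<gamma> t"
        unfolding relabel_relabel using t by (intro relabel_cong) (auto simp: ltrees_def \<gamma>_def)
      then show ?thesis using True by (simp add: \<alpha>'_def)
    next
      case False
      then have "\<alpha> j \<in> {1..?p}" using bij_betwE[OF \<alpha>] j by blast
      moreover have "j \<notin> L" using j False assms(4) by blast
      ultimately show ?thesis using False by (simp add: \<alpha>'_def \<gamma>_def slot_def)
    qed
  qed
  have r: "push (relabel \<beta>) r \<in> I ?k" by (rule gid_bij[OF assms(1) \<beta>])
  have "pcomp (tree_operad E) (?p + 1) ?k (?p + 1) (bas (relabel \<alpha>' C)) (push (relabel \<beta>) r) \<in> I (?p + 1 + ?k - 1)"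
    by (rule operad_idealD(4)[OF ideal _ _ r])
      (use C operad_ideal_subset[OF operad_tree_operad ideal] r in auto)
  moreover have "pcomp (tree_operad E) (?p + 1) ?k (?p + 1) (bas (relabel \<alpha>' C)) (push (relabel \<beta>) r)
      = push (relabel \<gamma>) (push ?ctx r)"
    unfolding pcomp_tree_operad push2_bas_left push_push
    by (rule push_cong) (use g gidD(2)[OF assms(1)] in auto)
  moreover have "keys (push ?ctx r) \<subseteq> ltrees E (L \<union> ?K)"
  proof (rule order.trans[OF keys_push], rule image_subsetI)
    fix t assume "t \<in> keys r"
    then have t: "t \<in> ltrees E L" using gidD(2)[OF assms(1)] by blast
    have "?ctx t \<in> ltrees E (\<Union>j\<in>K. if j = h then L else {j})"
      by (rule tsubst_ltrees[OF assms(2)]) (use t assms(4) in \<open>auto split: if_splits\<close>)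
    moreover have "(\<Union>j\<in>K. if j = h then L else {j}) = L \<union> ?K" using assms(3) by auto
    ultimately show "?ctx t \<in> ltrees E (L \<union> ?K)" by simp
  qed
  ultimately show ?thesis
    unfolding gid_def using \<gamma> fin c by (auto simp: add.commute)
qed

text \<open>A vertex with fixed siblings is a context whose hole is a new leaf h. Since h avoids the
  labels of the siblings, filling the hole changes nothing else.\<close>

lemma gid_Node:
  assumes "gid L r" "e \<in> carrier (sp E (Suc (length pre + length post)))"
    "list_all (labelled_by E) (pre @ post)" "distinct (concat (map leaves (pre @ post)))"
    "set (concat (map leaves (pre @ post))) \<inter> L = {}"
  shows "gid (L \<union> set (concat (map leaves (pre @ post)))) (push (\<lambda>t. Node e (pre @ t # post)) r)"
proof -
  let ?M = "set (concat (map leaves (pre @ post)))"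
  obtain h where h: "h \<notin> ?M" using ex_new_if_finite[of ?M] by blast
  let ?C = "Node e (pre @ Leaf h # post)"
  have C: "?C \<in> ltrees E (insert h ?M)"
    using assms(2-4) h unfolding Node_ltrees by auto
  have "tsubst (\<lambda>j. if j = h then t else Leaf j) ?C = Node e (pre @ t # post)" for t
  proof -
    have "tsubst (\<lambda>j. if j = h then t else Leaf j) u = u" if "u \<in> set (pre @ post)" for u
    proof -
      have "tsubst (\<lambda>j. if j = h then t else Leaf j) u = tsubst Leaf u"
        using that h by (intro tsubst_cong) auto
      then show ?thesis by simp
    qed
    then show ?thesis by (auto intro!: map_idI)
  qed
  moreover have "insert h ?M - {h} = ?M" using h by blast
  moreover have "L \<inter> (insert h ?M - {h}) = {}" using assms(5) by blast
  ultimately show ?thesis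
    using gid_plug[OF assms(1) C, of h] by simp
qed

end

subsection \<open>Free operads and operad ideals\<close>

context free_operad_smodule
begin

lemma ltree_relators_crel_ideal: "r \<in> ltree_relators E {1..n} \<Longrightarrow> r \<in> tree_ideal E n"
  using tree_relators_ideal by (auto simp: tree_relators_ltree_relators)

sublocale ctxt: tree_operad_ideal E "tree_ideal E"
  by (rule tree_operad_ideal.intro) (rule quot.ideal)

text \<open>A relator at the root stays a relator after its leaves are renumbered, and membership up
  to renumbering survives the addition of a vertex. Restricted to leaf sets \<open>{1..n}\<close>,
  this places the relators in context inside the tree ideal.\<close>

lemma crel_gid: "crel E L r \<Longrightarrow> ctxt.gid L r"
proof (induction rule: crel.induct)
  case (root r L)
  have k: "keys r \<subseteq> ltrees E L" by (rule ltree_relators_keys[OF root])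
  show ?case
  proof (cases "finite L")
    case True
    obtain \<beta> where \<beta>: "bij_betw \<beta> L {1..card L}" using ctxt.ex_bij[OF True] by blast
    have "push (tsubst (\<lambda>i. Leaf (\<beta> i))) r \<in> ltree_relators E (\<Union>i\<in>L. {\<beta> i})"
      by (rule ltree_relators_tsubst[OF root]) (use \<beta> in \<open>auto simp: bij_betw_def inj_on_def\<close>)
    moreover have "(\<Union>i\<in>L. {\<beta> i}) = {1..card L}" using \<beta> by (auto simp: bij_betw_def)
    ultimately have "push (relabel \<beta>) r \<in> tree_ideal E (card L)"
      unfolding relabel_def[abs_def] by (simp add: ltree_relators_crel_ideal)
    then show ?thesis using True k \<beta> unfolding ctxt.gid_def by blast
  next
    case False
    \<comment> \<open>An infinite L is impossible: a relator involves a tree, and trees have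
      finitely many leaves.\<close>
    from root obtain t where "t \<in> ltrees E L" by (cases rule: ltree_relators_cases) auto
    then show ?thesis using finite_ltrees False by blast
  qed
next
  case (ctx L r e pre post)
  show ?case by (rule ctxt.gid_Node[OF ctx.IH ctx.hyps(2-5)])
qed

lemma crel_tree_ideal: "crel E {1..n} r \<Longrightarrow> r \<in> tree_ideal E n"
  using crel_gid ctxt.gid_ideal by blast

lemma class_diff_zero:
  assumes "keys x \<subseteq> trees E n" "keys y \<subseteq> trees E n" "x - y \<in> tree_ideal E n"
  shows "tree_class E n x = tree_class E n y"
  using tree_class_eq_iff assms by blast

lemma class_plus:
  assumes "keys x \<subseteq> trees E n" "keys y \<subseteq> trees E n"
  shows "tree_class E n (x + y) = tree_class E n x \<oplus>\<^bsub>sp (free_operad E) n\<^esub> tree_class E n y"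
  using linear_mapD(2)[OF tree_class_linear, of x n y] assms by simp

lemma class_smult:
  assumes "keys x \<subseteq> trees E n"
  shows "tree_class E n (Poly_Mapping.map ((*) c) x) = c \<odot>\<^bsub>sp (free_operad E) n\<^esub> tree_class E n x"
  using linear_mapD(3)[OF tree_class_linear, of x n c] assms by simp

lemma class_minus:
  assumes "keys x \<subseteq> trees E n" "keys y \<subseteq> trees E n"
  shows "tree_class E n (x - y) = tree_class E n x \<ominus>\<^bsub>sp (free_operad E) n\<^esub> tree_class E n y"
    "tree_class E n (- x) = \<ominus>\<^bsub>sp (free_operad E) n\<^esub> tree_class E n x"
  using linear_map_minus[OF vspace_free_module free.vspace_sp tree_class_linear, of x n] assms
  by (simp_all del: One_nat_def)

lemma add_trees:
  assumes "Node a ts \<in> trees E n" "Node b ts \<in> trees E n"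
  shows "Node (a \<oplus>\<^bsub>sp E (length ts)\<^esub> b) ts \<in> trees E n"
proof -
  interpret module kring "sp E (length ts)" by (rule vspace_sp)
  show ?thesis using assms by (intro relabel_root_trees[OF assms(1)]) (simp add: trees_def)
qed

lemma smult_trees:
  assumes "Node a ts \<in> trees E n"
  shows "Node (c \<odot>\<^bsub>sp E (length ts)\<^esub> a) ts \<in> trees E n"
proof -
  interpret module kring "sp E (length ts)" by (rule vspace_sp)
  show ?thesis using assms by (intro relabel_root_trees[OF assms(1)]) (simp add: trees_def)
qed

lemma act_trees:
  assumes "Node a ts \<in> trees E n" "\<sigma> permutes {1..length ts}"
  shows "Node (act E (length ts) a \<sigma>) ts \<in> trees E n"
  using assms linear_mapD(1)[OF act_linear[OF assms(2)]]
  by (intro relabel_root_trees[OF assms(1)]) (simp add: trees_def)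

lemma class_Node_add:
  assumes "Node a ts \<in> trees E n" "Node b ts \<in> trees E n"
  shows "tree_class E n (bas (Node (a \<oplus>\<^bsub>sp E (length ts)\<^esub> b) ts)) =
    tree_class E n (bas (Node a ts)) \<oplus>\<^bsub>sp (free_operad E) n\<^esub> tree_class E n (bas (Node b ts))"
proof -
  have "bas (Node (a \<oplus>\<^bsub>sp E (length ts)\<^esub> b) ts) - (bas (Node a ts) + bas (Node b ts)) \<in> tree_ideal E n"
    using ltree_relators_crel_ideal[OF ltree_relators_addI[of a ts E "{1..n}" b]] assms
    by (simp add: trees_ltrees algebra_simps)
  then have "tree_class E n (bas (Node (a \<oplus>\<^bsub>sp E (length ts)\<^esub> b) ts)) = tree_class E n (bas (Node a ts) + bas (Node b ts))"
    using assms add_trees[OF assms] by (intro class_diff_zero keys_add_subset) auto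
  then show ?thesis using class_plus[of "bas (Node a ts)" n "bas (Node b ts)"] assms by simp
qed

lemma class_Node_smult:
  assumes "Node a ts \<in> trees E n"
  shows "tree_class E n (bas (Node (c \<odot>\<^bsub>sp E (length ts)\<^esub> a) ts)) = c \<odot>\<^bsub>sp (free_operad E) n\<^esub> tree_class E n (bas (Node a ts))"
proof -
  have "bas (Node (c \<odot>\<^bsub>sp E (length ts)\<^esub> a) ts) - Poly_Mapping.map ((*) c) (bas (Node a ts)) \<in> tree_ideal E n"
    using ltree_relators_crel_ideal[OF ltree_relators_smultI[of a ts E "{1..n}" c]] assms
    by (simp add: trees_ltrees bas_def)
  then have "tree_class E n (bas (Node (c \<odot>\<^bsub>sp E (length ts)\<^esub> a) ts)) = tree_class E n (Poly_Mapping.map ((*) c) (bas (Node a ts)))"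
    using assms smult_trees[OF assms] by (intro class_diff_zero order.trans[OF keys_map_mult]) auto
  then show ?thesis using class_smult[of "bas (Node a ts)" n c] assms by simp
qed

lemma class_Node_act:
  assumes "Node a ts \<in> trees E n" "\<sigma> permutes {1..length ts}"
  shows "tree_class E n (bas (Node (act E (length ts) a \<sigma>) ts)) = tree_class E n (bas (Node a (permute_subtrees \<sigma> ts)))"
  using ltree_relators_crel_ideal[OF ltree_relators_actI[of \<sigma> ts a E "{1..n}"]] assms
    act_trees[OF assms] permute_subtrees_trees[OF assms(2,1)]
  by (intro class_diff_zero) (simp_all add: trees_ltrees)

end

subsection \<open>Functoriality of the free operad\<close>

definition smodule_hom :: "('k::field, 'e) smodule \<Rightarrow> ('k, 'f) smodule \<Rightarrow> ('e \<Rightarrow> 'f) \<Rightarrow> bool" where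
  "smodule_hom E F g \<longleftrightarrow> (\<forall>n. linear_map (sp E n) (sp F n) g) \<and>
     (\<forall>n \<sigma>. \<sigma> permutes {1..n} \<longrightarrow> (\<forall>x\<in>carrier (sp E n). g (act E n x \<sigma>) = act F n (g x) \<sigma>))"

lemma leaves_map_labels [simp]: "leaves (map_labels g t) = leaves t"
  by (induction t) (auto simp: comp_def intro!: arg_cong[where f = concat])

lemma map_labels_tsubst: "map_labels g (tsubst h t) = tsubst (\<lambda>i. map_labels g (h i)) (map_labels g t)"
  by (induction t) auto

lemma map_labels_relabel: "map_labels g (relabel h t) = relabel h (map_labels g t)"
  by (simp add: relabel_def map_labels_tsubst)

lemma map_labels_graft: "map_labels g (graft n i s t) = graft n i (map_labels g s) (map_labels g t)"
  unfolding graft_def map_labels_tsubst by (rule tsubst_cong) (simp add: map_labels_relabel)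

lemma map_labels_ltrees:
  assumes "\<And>n x. x \<in> carrier (sp E n) \<Longrightarrow> g x \<in> carrier (sp F n)" "t \<in> ltrees E L"
  shows "map_labels g t \<in> ltrees F L"
proof -
  have "labelled_by E t \<Longrightarrow> labelled_by F (map_labels g t)"
    using assms(1) by (induction t) (auto simp: list_all_iff)
  then show ?thesis using assms(2) by (simp add: ltrees_def)
qed

text \<open>The universal property supplies the morphism, while \<open>tree_induced\<close> is the
  form in which relations are transported along T(V) into T(V_P). Both descriptions are recorded
  because they have to be identified on the relations of the quadratic operad.\<close>

lemma smodule_hom_free:
  assumes "smodule E" "smodule F" "smodule_hom E F g"
  shows "\<exists>f. operad_hom (free_operad E) (free_operad F) f \<and>
    (\<forall>n x. keys x \<subseteq> trees E n \<longrightarrow>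
      f n (tree_class E n x) = tree_class F n (push (map_labels g) x) \<and>
      f n (tree_class E n x) = tree_induced F n (map_labels g) (tree_class E n x))"
proof -
  interpret E: free_operad_smodule E using assms(1) by (rule free_operad_smodule.intro)
  interpret F: free_operad_smodule F using assms(2) by (rule free_operad_smodule.intro)
  have g: "linear_map (sp E n) (sp F n) g" for n using assms(3) by (auto simp: smodule_hom_def)
  have ga: "g (act E n x \<sigma>) = act F n (g x) \<sigma>" if "\<sigma> permutes {1..n}" "x \<in> carrier (sp E n)" for n x \<sigma>
    using assms(3) that by (auto simp: smodule_hom_def)
  have T: "map_labels g t \<in> trees F n" if "t \<in> trees E n" for t n
    using map_labels_ltrees[of E g F t] linear_mapD(1)[OF g] that by (auto simp: trees_ltrees)
  have "\<exists>f. operad_hom (free_operad E) (free_operad F) f \<and>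
      (\<forall>n. \<forall>t\<in>trees E n. f n (tree_class E n (bas t)) = tree_class F n (bas (map_labels g t)))"
  proof (rule E.free_operad_hom[OF F.free.operad_axioms])
    show "tree_class F n (bas (map_labels g t)) \<in> carrier (sp (free_operad F) n)" if "t \<in> trees E n" for n t
      using T[OF that] by auto
    show "tree_class F n (bas (map_labels g (relabel (inv_into UNIV \<sigma>) t)))
        = act (free_operad F) n (tree_class F n (bas (map_labels g t))) \<sigma>"
      if "t \<in> trees E n" "\<sigma> permutes {1..n}" for n t \<sigma>
      using F.act_free[OF that(2), of "bas (map_labels g t)"] T[OF that(1)] by (simp add: map_labels_relabel)
    show "tree_class F 1 (bas (map_labels g (Leaf 1))) = opunit (free_operad F)"
      by (simp add: F.opunit_free)
    show "tree_class F (m + n - 1) (bas (map_labels g (graft n i s t)))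
        = pcomp (free_operad F) m n i (tree_class F m (bas (map_labels g s))) (tree_class F n (bas (map_labels g t)))"
      if "i \<in> {1..m}" "s \<in> trees E m" "t \<in> trees E n" for m n i s t
      using F.pcomp_free[OF that(1), of "bas (map_labels g s)" "bas (map_labels g t)" n] T[OF that(2)] T[OF that(3)]
      by (simp add: map_labels_graft)
    { fix n a ts assume a: "Node a ts \<in> trees E n"
      note Ta = T[OF a, simplified]
      have ac: "a \<in> carrier (sp E (length ts))" using a by (simp add: trees_def)
      show "tree_class F n (bas (map_labels g (Node (a \<oplus>\<^bsub>sp E (length ts)\<^esub> b) ts)))
        = tree_class F n (bas (map_labels g (Node a ts))) \<oplus>\<^bsub>sp (free_operad F) n\<^esub> tree_class F n (bas (map_labels g (Node b ts)))"
        if "Node b ts \<in> trees E n" for b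
        using F.class_Node_add[OF Ta T[OF that, simplified]] linear_mapD(2)[OF g ac, of b] that
        by (simp add: trees_def)
      show "tree_class F n (bas (map_labels g (Node (c \<odot>\<^bsub>sp E (length ts)\<^esub> a) ts)))
        = c \<odot>\<^bsub>sp (free_operad F) n\<^esub> tree_class F n (bas (map_labels g (Node a ts)))" for c
        using F.class_Node_smult[OF Ta] linear_mapD(3)[OF g ac, of c] by simp
      show "tree_class F n (bas (map_labels g (Node (act E (length ts) a \<sigma>) ts)))
        = tree_class F n (bas (map_labels g (Node a (permute_subtrees \<sigma> ts))))"
        if "\<sigma> permutes {1..length ts}" for \<sigma>
        using F.class_Node_act[OF Ta] ga[OF that ac] that permute_subtrees_map[OF that, of "map_labels g"] by simp }
  qed
  then obtain f where f: "operad_hom (free_operad E) (free_operad F) f"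
    "\<And>n t. t \<in> trees E n \<Longrightarrow> f n (tree_class E n (bas t)) = tree_class F n (bas (map_labels g t))" by blast
  interpret f: operad_hom "free_operad E" "free_operad F" f by fact
  have pl: "linear_map (free_module (trees E n)) (free_module (trees F n)) (push (map_labels g))" for n
    using T by (intro push_linear) auto
  have fx: "f n (tree_class E n x) = tree_class F n (push (map_labels g) x)"
    if "keys x \<subseteq> trees E n" for n x
    by (rule free_linear_eqI[OF F.free.vspace_sp linear_map_compose[OF E.tree_class_linear f.hom_linear]
          linear_map_compose[OF pl F.tree_class_linear] _ that]) (simp add: f(2))
  \<comment> \<open>No inspection of the ideal is needed here: x represents zero, f sends zero to
    zero, and f is computed by relabelling.\<close>
  have "push (map_labels g) x \<in> tree_ideal F n" if "x \<in> tree_ideal E n" for x n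
  proof -
    have k: "keys x \<subseteq> trees E n" "keys (push (map_labels g) x) \<subseteq> trees F n"
      using that operad_ideal_subset[OF operad_tree_operad E.quot.ideal, of n] linear_mapD(1)[OF pl, of x n] by auto
    have "tree_class F n (push (map_labels g) x) = f n \<zero>\<^bsub>sp (free_operad E) n\<^esub>"
      using fx[OF k(1)] E.tree_class_ideal[OF that] by simp
    also have "\<dots> = tree_class F n 0"
      using linear_map_zero[OF E.free.vspace_sp F.free.vspace_sp f.hom_linear] by (simp add: F.zero_free)
    finally show ?thesis using F.tree_class_eq_iff[OF k(2), of 0] by simp
  qed
  note pi = this
  have "tree_induced F n (map_labels g) (tree_class E n x) = tree_class F n (push (map_labels g) x)"
    if "keys x \<subseteq> trees E n" for n x
  proof -
    have "linear_map (sp (tree_operad E) n) (sp (tree_operad F) n) (push (map_labels g))" using pl by simp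
    from induced_coset[OF E.quot.vspace_sp E.quot.submod F.quot.vspace_sp F.quot.submod this pi]
    show ?thesis using that by (simp add: tree_induced_def tree_class_def)
  qed
  then show ?thesis using f(1) fx by (intro exI[of _ f]) simp
qed

subsection \<open>Modules in arity two\<close>

lemma arity2_simps [simp]:
  "sp (arity2 V) n = (if n = 2 then vsp V else zero_module (vsp V))"
  "act (arity2 V) n v \<sigma> = (if n = 2 \<and> \<sigma> 1 = 2 then swp V v else v)"
  by (simp_all add: arity2_def)

lemma zero_module_simps [simp]:
  "carrier (zero_module M) = {\<zero>\<^bsub>M\<^esub>}" "\<zero>\<^bsub>zero_module M\<^esub> = \<zero>\<^bsub>M\<^esub>" "x \<oplus>\<^bsub>zero_module M\<^esub> y = x \<oplus>\<^bsub>M\<^esub> y"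
  "c \<odot>\<^bsub>zero_module M\<^esub> x = c \<odot>\<^bsub>M\<^esub> x"
  by (simp_all add: zero_module_def)

lemma vspace_zero_module: "vspace M \<Longrightarrow> vspace (zero_module M)"
  unfolding zero_module_def using submodule.submodule_is_module[OF submodule_zero] by blast

lemma permutes_two:
  assumes "\<sigma> permutes {1..2::nat}"
  obtains "\<sigma> = id" "\<sigma> 1 = 1" "\<sigma> 2 = 2" | "\<sigma> 1 = 2" "\<sigma> 2 = 1" "inv_into UNIV \<sigma> 1 = 2" "inv_into UNIV \<sigma> 2 = 1"
proof -
  have "\<sigma> 1 \<in> {1,2}" "\<sigma> 2 \<in> {1,2}" "\<sigma> 1 \<noteq> \<sigma> 2"
    using permutes_in_image[OF assms, of 1] permutes_in_image[OF assms, of 2] permutes_inj[OF assms]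
    by (auto simp: inj_eq)
  then consider "\<sigma> 1 = 1" "\<sigma> 2 = 2" | "\<sigma> 1 = 2" "\<sigma> 2 = 1" by auto
  then show ?thesis
  proof cases
    case 1
    have "\<sigma> x = x" for x
      using 1 permutes_not_in[OF assms, of x] by (cases "x = 1 \<or> x = 2") auto
    then have "\<sigma> = id" by auto
    then show ?thesis using 1 by (rule that(1))
  next
    case 2
    then show ?thesis using inv_perm(1)[OF assms, of 1] inv_perm(1)[OF assms, of 2] by (intro that(2)) auto
  qed
qed

locale s2mod =
  fixes V :: "('k::field, 'v) s2mod"
  assumes s2: "s2_module V"
begin

lemma vspace_vsp: "vspace (vsp V)" and swp_linear: "linear_map (vsp V) (vsp V) (swp V)"
  and swp_swp: "v \<in> elts V \<Longrightarrow> swp V (swp V v) = v"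
  using s2 by (auto simp: s2_module_def)

sublocale VS: module kring "vsp V" by (rule vspace_vsp)

lemma swp_closed [simp]: "v \<in> elts V \<Longrightarrow> swp V v \<in> elts V"
  by (rule linear_mapD(1)[OF swp_linear])

lemma smodule_arity2: "smodule (arity2 V)"
proof (rule smodule.intro)
  fix n \<sigma> \<tau> x
  show "vspace (sp (arity2 V) n)" using vspace_vsp vspace_zero_module[OF vspace_vsp] by simp
  show "linear_map (sp (arity2 V) n) (sp (arity2 V) n) (\<lambda>x. act (arity2 V) n x \<sigma>)"
    using swp_linear linear_map_id by (cases "\<sigma> 1 = 2") auto
  show "act (arity2 V) n x id = x" by simp
  show "act (arity2 V) n (act (arity2 V) n x \<sigma>) \<tau> = act (arity2 V) n x (\<sigma> \<circ> \<tau>)"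
    if "\<sigma> permutes {1..n}" "\<tau> permutes {1..n}" "x \<in> carrier (sp (arity2 V) n)"
  proof (cases "n = 2")
    case True
    with that have "\<sigma> permutes {1..2}" "\<tau> permutes {1..2}" "x \<in> elts V" by auto
    then show ?thesis using True
      by (elim permutes_two) (auto simp: swp_swp)
  qed auto
qed

sublocale T: free_operad_smodule "arity2 V"
  by (rule free_operad_smodule.intro[OF smodule_arity2])

end

subsection \<open>Arity three\<close>

primrec binary :: "'e ltree \<Rightarrow> bool" where
  "binary (Leaf i) \<longleftrightarrow> True"
| "binary (Node e ts) \<longleftrightarrow> length ts = 2 \<and> list_all binary ts"

lemma leaves_nonempty: "binary t \<Longrightarrow> leaves t \<noteq> []"
proof (induction t)
  case (Node e ts)
  then obtain s u where "ts = [s, u]" by (auto simp: length_Suc_conv numeral_2_eq_2)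
  then show ?case using Node by auto
qed simp

lemma length_two: "length ts = 2 \<longleftrightarrow> (\<exists>s u. ts = [s, u])"
  by (auto simp: length_Suc_conv numeral_2_eq_2)

lemma binary_one_leaf: "binary t \<Longrightarrow> leaves t = [i] \<Longrightarrow> t = Leaf i"
proof (cases t)
  case (Node e ts)
  assume t: "binary t" "leaves t = [i]"
  then obtain s u where su: "ts = [s, u]" "binary s" "binary u" using Node by (auto simp: length_two)
  have "leaves s \<noteq> []" "leaves u \<noteq> []" using leaves_nonempty su(2,3) by auto
  then show ?thesis using t Node su(1) by (simp add: append_eq_Cons_conv)
qed simp

lemma binary_two_leaves: "binary t \<Longrightarrow> leaves t = [i, j] \<Longrightarrow> \<exists>c. t = Node c [Leaf i, Leaf j]"
proof (cases t)
  case (Node e ts)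
  assume t: "binary t" "leaves t = [i, j]"
  then obtain s u where su: "ts = [s, u]" "binary s" "binary u" using Node by (auto simp: length_two)
  have "leaves s \<noteq> []" "leaves u \<noteq> []" using leaves_nonempty su(2,3) by auto
  then have "leaves s = [i]" "leaves u = [j]" using t Node su(1)
    by (auto simp: append_eq_Cons_conv)
  then show ?thesis using binary_one_leaf su Node by blast
qed simp

lemma binary_three_leaves:
  assumes "binary t" "leaves t = [i, j, k]"
  shows "(\<exists>a c. t = Node a [Node c [Leaf i, Leaf j], Leaf k]) \<or> (\<exists>a c. t = Node a [Leaf i, Node c [Leaf j, Leaf k]])"
proof (cases t)
  case (Node e ts)
  then obtain s u where su: "ts = [s, u]" "binary s" "binary u" using assms by (auto simp: length_two)
  have "leaves s \<noteq> []" "leaves u \<noteq> []" using leaves_nonempty su(2,3) by auto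
  then consider "leaves s = [i]" "leaves u = [j, k]" | "leaves s = [i, j]" "leaves u = [k]"
    using assms(2) Node su(1) by (auto simp: append_eq_Cons_conv)
  then show ?thesis
    using binary_one_leaf binary_two_leaves su Node by cases blast+
qed (use assms in simp)

lemma permute_subtrees_swap: "permute_subtrees (transpose 1 2) [s, u] = [u, s]"
proof -
  have "inv_into UNIV (transpose 1 (2::nat)) = transpose 1 2" by simp
  then show ?thesis by (simp add: permute_subtrees_def numeral_2_eq_2 transpose_def One_nat_def)
qed

lemma transpose_permutes: "transpose 1 2 permutes {1..2::nat}"
  by (rule permutes_swap_id) auto

context s2mod
begin

text \<open>In a module concentrated in arity two, a vertex with any other number of inputs is
  labelled by zero, and a tree with a zero label is itself a relator. A bad vertex deeper in the
  tree is reached through contexts.\<close>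

lemma crel_nonbinary: "t \<in> ltrees (arity2 V) L \<Longrightarrow> \<not> binary t \<Longrightarrow> crel (arity2 V) L (bas t)"
proof (induction t arbitrary: L)
  case (Node e ts)
  show ?case
  proof (cases "length ts = 2")
    case False
    then have "e = \<zero>\<^bsub>vsp V\<^esub>" using Node.prems(1) by (simp add: Node_ltrees)
    \<comment> \<open>For the scalar 0 the homogeneity relator loses its second term, and 0 e equals
      e because e is zero.\<close>
    then have "bas (Node e ts) = bas (Node (0 \<odot>\<^bsub>sp (arity2 V) (length ts)\<^esub> e) ts) - single (Node e ts) 0"
      using False VS.smult_r_null[of 0] by simp
    also have "\<dots> \<in> ltree_relators (arity2 V) L" by (rule ltree_relators_smultI[OF Node.prems(1)])
    finally show ?thesis by (rule crel.root)
  next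
    case True
    then obtain s u where su: "ts = [s, u]" by (auto simp: length_two)
    have N: "e \<in> elts V" "s \<in> ltrees (arity2 V) (set (leaves s))" "u \<in> ltrees (arity2 V) (set (leaves u))"
      "set (leaves s) \<inter> set (leaves u) = {}" "distinct (leaves s)" "distinct (leaves u)"
      "labelled_by (arity2 V) s" "labelled_by (arity2 V) u" "L = set (leaves s) \<union> set (leaves u)"
      using Node.prems(1) unfolding su Node_ltrees by (auto simp: ltrees_def)
    consider "\<not> binary s" | "\<not> binary u" using Node.prems(2) su by auto
    then show ?thesis
    proof cases
      case 1
      then have "crel (arity2 V) (set (leaves s)) (bas s)" using Node.IH[of s] N(2) su by simp
      from crel.ctx[OF this, of e "[]" "[u]"] show ?thesis
        using N by (simp add: su numeral_2_eq_2 Un_commute Int_commute)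
    next
      case 2
      then have "crel (arity2 V) (set (leaves u)) (bas u)" using Node.IH[of u] N(3) su by simp
      from crel.ctx[OF this, of e "[s]" "[]"] show ?thesis
        using N by (simp add: su numeral_2_eq_2 Un_commute Int_commute)
    qed
  qed
qed simp

lemma class_nonbinary:
  assumes "t \<in> trees (arity2 V) n" "\<not> binary t"
  shows "clV V n (bas t) = \<zero>\<^bsub>sp (TV V) n\<^esub>"
  using T.crel_tree_ideal crel_nonbinary[of t "{1..n}"] assms
  by (intro T.tree_class_ideal) (simp add: trees_ltrees)

lemma swap_relator:
  assumes "Node a [s, u] \<in> ltrees (arity2 V) L"
  shows "bas (Node (swp V a) [s, u]) - bas (Node a [u, s]) \<in> ltree_relators (arity2 V) L"
proof -
  have "transpose 1 2 permutes {1..length [s, u]}" using transpose_permutes by (simp add: numeral_2_eq_2)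
  from ltree_relators_actI[OF this assms] show ?thesis by (simp add: permute_subtrees_swap)
qed

lemma class_swap:
  assumes "Node a [s, u] \<in> trees (arity2 V) n"
  shows "clV V n (bas (Node (swp V a) [s, u])) = clV V n (bas (Node a [u, s]))"
proof (rule T.class_diff_zero)
  show "bas (Node (swp V a) [s, u]) - bas (Node a [u, s]) \<in> tree_ideal (arity2 V) n"
    using T.ltree_relators_crel_ideal[OF swap_relator[of a s u "{1..n}"]] assms by (simp add: trees_ltrees)
qed (use assms in \<open>auto simp: trees_def\<close>)

text \<open>The symmetry is used at a vertex below the root, so the difference is a relator in a
  context rather than one of the generating relators.\<close>

lemma class_swap_inner:
  assumes "Node a [Node c [s, u], v] \<in> trees (arity2 V) n"
  shows "clV V n (bas (Node a [Node (swp V c) [s, u], v])) = clV V n (bas (Node a [Node c [u, s], v]))"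
proof -
  let ?r = "bas (Node (swp V c) [s, u]) - bas (Node c [u, s])"
  have d: "set (leaves v) \<inter> (set (leaves s) \<union> set (leaves u)) = {}" using assms by (auto simp: trees_def)
  have "Node c [s, u] \<in> ltrees (arity2 V) (set (leaves (Node c [s, u])))"
    using assms by (auto simp: trees_def ltrees_def)
  from crel.ctx[OF crel.root[OF swap_relator[OF this]], of a "[]" "[v]"] assms d
  have "crel (arity2 V) {1..n} (push (\<lambda>t. Node a ([] @ t # [v])) ?r)"
    by (simp add: trees_def Un_ac Int_commute numeral_2_eq_2)
  then have "bas (Node a [Node (swp V c) [s, u], v]) - bas (Node a [Node c [u, s], v]) \<in> tree_ideal (arity2 V) n"
    using T.crel_tree_ideal by (simp add: push_diff)
  then show ?thesis
    using assms by (intro T.class_diff_zero) (auto simp: trees_def)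
qed

lemma shape_tree_trees:
  "\<omega> \<in> elts V \<Longrightarrow> \<nu> \<in> elts V \<Longrightarrow> shape_tree u \<omega> \<nu> \<in> trees (arity2 V) 3"
  by (cases u) (auto simp: trees_def)

lemma circ_u_closed:
  "\<omega> \<in> elts V \<Longrightarrow> \<nu> \<in> elts V \<Longrightarrow> circ_u V u \<omega> \<nu> \<in> carrier (sp (TV V) 3)"
  unfolding circ_u_def using shape_tree_trees by (intro T.tree_class_closed) simp

text \<open>The leaf k attached to the root selects the shape. The two inner leaves are then either
  in the cyclic order fixed by that shape or reversed, and \<open>swp\<close> on the inner label
  repairs the second case.\<close>

lemma class_left_comb:
  assumes "Node a [Node c [Leaf i, Leaf j], Leaf k] \<in> trees (arity2 V) 3"
  shows "\<exists>u. \<exists>\<omega>\<in>elts V. \<exists>\<nu>\<in>elts V.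
    clV V 3 (bas (Node a [Node c [Leaf i, Leaf j], Leaf k])) = circ_u V u \<omega> \<nu>"
proof -
  have three: "{1..3::nat} = {1, 2, 3}" by auto
  have ac: "a \<in> elts V" "c \<in> elts V" "{i, j, k} = {1, 2, 3}" "distinct [i, j, k]"
    using assms unfolding trees_def three by (simp_all add: One_nat_def)
  have t': "Node a [Node c [Leaf j, Leaf i], Leaf k] \<in> trees (arity2 V) 3"
    unfolding trees_def three ac(3)[symmetric] using ac(1,2,4) by auto
  have sw: "clV V 3 (bas (Node a [Node c [Leaf i, Leaf j], Leaf k]))
     = clV V 3 (bas (Node a [Node (swp V c) [Leaf j, Leaf i], Leaf k]))"
    by (rule class_swap_inner[OF t', symmetric])
  have "i \<in> {1, 2, 3}" "j \<in> {1, 2, 3}" "k \<in> {1, 2, 3}" using ac(3) by blast+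
  then consider "i = 1 \<and> j = 2 \<and> k = 3" | "i = 2 \<and> j = 1 \<and> k = 3" | "i = 2 \<and> j = 3 \<and> k = 1"
    | "i = 3 \<and> j = 2 \<and> k = 1" | "i = 3 \<and> j = 1 \<and> k = 2" | "i = 1 \<and> j = 3 \<and> k = 2"
    using ac(4) by auto
  then show ?thesis
  proof cases
    case 1 then show ?thesis using ac by (intro exI[of _ ShI] bexI[of _ a] bexI[of _ c]) (simp_all add: circ_u_def)
  next
    case 2 then show ?thesis unfolding sw using ac by (intro exI[of _ ShI] bexI[of _ a] bexI[of _ "swp V c"]) (simp_all add: circ_u_def)
  next
    case 3 then show ?thesis using ac by (intro exI[of _ ShII] bexI[of _ a] bexI[of _ c]) (simp_all add: circ_u_def)
  next
    case 4 then show ?thesis unfolding sw using ac by (intro exI[of _ ShII] bexI[of _ a] bexI[of _ "swp V c"]) (simp_all add: circ_u_def)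
  next
    case 5 then show ?thesis using ac by (intro exI[of _ ShIII] bexI[of _ a] bexI[of _ c]) (simp_all add: circ_u_def)
  next
    case 6 then show ?thesis unfolding sw using ac by (intro exI[of _ ShIII] bexI[of _ a] bexI[of _ "swp V c"]) (simp_all add: circ_u_def)
  qed
qed

text \<open>Trees with a non-binary vertex vanish. In a binary tree with three leaves one subtree of
  the root is a leaf, and the action of (12) on the root label moves it to the right.\<close>

lemma class_circ_cases:
  assumes "t \<in> trees (arity2 V) 3"
  shows "clV V 3 (bas t) = \<zero>\<^bsub>sp (TV V) 3\<^esub> \<or>
    (\<exists>u. \<exists>\<omega>\<in>elts V. \<exists>\<nu>\<in>elts V. clV V 3 (bas t) = circ_u V u \<omega> \<nu>)"
proof (cases "binary t")
  case False
  then show ?thesis using class_nonbinary[OF assms] by blast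
next
  case True
  have "length (leaves t) = 3" using assms distinct_card[of "leaves t"] by (simp add: trees_def)
  then obtain i j k where l: "leaves t = [i, j, k]"
    by (auto simp: numeral_3_eq_3 length_Suc_conv)
  from binary_three_leaves[OF True l] show ?thesis
  proof (elim disjE exE)
    fix a c assume t: "t = Node a [Node c [Leaf i, Leaf j], Leaf k]"
    then show ?thesis using class_left_comb assms by blast
  next
    fix a c assume t: "t = Node a [Leaf i, Node c [Leaf j, Leaf k]]"
    have ac: "a \<in> elts V" using assms by (auto simp: t trees_def)
    have t': "Node (swp V a) [Node c [Leaf j, Leaf k], Leaf i] \<in> trees (arity2 V) 3"
      using assms by (auto simp: t trees_def)
    have "clV V 3 (bas (Node (swp V a) [Node c [Leaf j, Leaf k], Leaf i])) = clV V 3 (bas t)"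
      unfolding t by (rule class_swap) (use assms in \<open>auto simp: t trees_def\<close>)
    then show ?thesis using class_left_comb[OF t'] by simp
  qed
qed

text \<open>This is the spanning half of the decomposition of T(V)(3) into the three components; the
  independence half is contained in \<open>ex_component\<close>.\<close>

lemma linear_circ_eqI:
  assumes "vspace N" "linear_map (sp (TV V) 3) N f" "linear_map (sp (TV V) 3) N g"
    and "\<And>u \<omega> \<nu>. \<omega> \<in> elts V \<Longrightarrow> \<nu> \<in> elts V \<Longrightarrow> f (circ_u V u \<omega> \<nu>) = g (circ_u V u \<omega> \<nu>)"
    and "x \<in> carrier (sp (TV V) 3)"
  shows "f x = g x"
proof (rule T.linear_free_eqI[OF assms(1-3) _ assms(5)])
  fix t assume "t \<in> trees (arity2 V) 3"
  from class_circ_cases[OF this] show "f (clV V 3 (bas t)) = g (clV V 3 (bas t))"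
    using assms(4) linear_map_zero[OF T.free.vspace_sp assms(1,2)] linear_map_zero[OF T.free.vspace_sp assms(1,3)]
    by (elim disjE exE bexE) simp_all
qed

end

subsection \<open>The trisuccessor\<close>

context s2mod
begin

lemma hat_simps [simp]:
  "elts (hat V) = {f. \<forall>d. f d \<in> elts V}" "\<zero>\<^bsub>vsp (hat V)\<^esub> = (\<lambda>d. \<zero>\<^bsub>vsp V\<^esub>)"
  "f \<oplus>\<^bsub>vsp (hat V)\<^esub> g = (\<lambda>d. f d \<oplus>\<^bsub>vsp V\<^esub> g d)" "c \<odot>\<^bsub>vsp (hat V)\<^esub> f = (\<lambda>d. c \<odot>\<^bsub>vsp V\<^esub> f d)"
  "swp (hat V) f Prec = swp V (f Succ)" "swp (hat V) f Succ = swp V (f Prec)" "swp (hat V) f Dot = swp V (f Dot)"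
  by (simp_all add: hat_def mk_module_def)

lemma tri_all: "(\<forall>d::tri. P d) \<longleftrightarrow> P Prec \<and> P Succ \<and> P Dot"
  by (metis tri.exhaust)

lemma tri_eqI: "f Prec = g Prec \<Longrightarrow> f Succ = g Succ \<Longrightarrow> f Dot = g Dot \<Longrightarrow> f = g"
  by (rule ext, case_tac x) auto

lemma s2_module_hat: "s2_module (hat V)"
proof -
  have "vspace (vsp (hat V))"
    by (rule vspaceI)
      (auto intro!: ext simp: VS.a_ac VS.smult_r_distr VS.smult_l_distr[simplified] VS.smult_assoc1[simplified]
        VS.smult_l_null[simplified] VS.smult_one[simplified])
  moreover have "linear_map (vsp (hat V)) (vsp (hat V)) (swp (hat V))"
    using linear_mapD[OF swp_linear] by (intro linear_mapI) (auto simp: tri_all intro!: tri_eqI)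
  ultimately show ?thesis
    by (auto simp: s2_module_def swp_swp intro!: tri_eqI)
qed

lemma dec_closed [simp]: "\<omega> \<in> elts V \<Longrightarrow> dec V \<omega> d d' \<in> elts V"
  by (simp add: dec_def)

lemma dec_star_eq: "\<omega> \<in> elts V \<Longrightarrow> dec_star V \<omega> = (\<lambda>d. \<omega>)"
  by (rule tri_eqI) (simp_all add: dec_star_def dec_def)

lemma tsu_label_other: "length bs \<noteq> 2 \<Longrightarrow> tsu_label V bs \<omega> = \<zero>\<^bsub>vsp (hat V)\<^esub>"
  by (cases "(V, bs, \<omega>)" rule: tsu_label.cases) auto

lemma dec_linear: "linear_map (vsp V) (vsp (hat V)) (\<lambda>\<omega>. dec V \<omega> d)"
  by (rule linear_mapI) (auto simp: dec_def VS.smult_r_null[simplified])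

lemma tsu_label_linear:
  assumes "length bs = n"
  shows "linear_map (sp (arity2 V) n) (sp (arity2 (hat V)) n) (tsu_label V bs)"
proof (cases "n = 2")
  case True
  then obtain x y where bs: "bs = [x, y]" using assms by (auto simp: length_two)
  have "linear_map (vsp V) (vsp (hat V)) (dec_star V)"
    by (rule linear_mapI) (auto simp: dec_star_eq)
  then have "linear_map (vsp V) (vsp (hat V)) (tsu_label V bs)"
    using dec_linear[of Prec] dec_linear[of Succ] dec_linear[of Dot] unfolding bs
    by (cases x; cases y) (simp_all add: linear_map_def Pi_iff)
  then show ?thesis using True by simp
next
  case False
  then show ?thesis using assms tsu_label_other[of bs]
    by (intro linear_mapI) (auto simp: VS.smult_r_null[simplified])
qed

lemma leaves_tsu_tree [simp]: "leaves (tsu_tree V J t) = leaves t"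
  by (induction t) (auto simp: comp_def intro!: arg_cong[where f = concat])

lemma labelled_tsu_tree: "labelled_by (arity2 V) t \<Longrightarrow> labelled_by (arity2 (hat V)) (tsu_tree V J t)"
proof (induction t)
  case (Node e ts)
  then show ?case
    using linear_mapD(1)[OF tsu_label_linear[of "map (\<lambda>t. J \<inter> set (leaves t) \<noteq> {}) ts" "length ts"], of e]
    by (auto simp: list_all_iff simp del: arity2_simps)
qed simp

lemma tsu_tree_ltrees: "t \<in> ltrees (arity2 V) L \<Longrightarrow> tsu_tree V J t \<in> ltrees (arity2 (hat V)) L"
  using labelled_tsu_tree by (simp add: ltrees_def)

text \<open>Exchanging the two subtrees exchanges the sides on which leaves of J occur. Therefore
  \<open>Prec\<close> and \<open>Succ\<close> are swapped by the action on \<open>hat V\<close>,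
  while the dot and the star label are preserved up to \<open>swp V\<close>.\<close>

lemma tsu_label_act:
  assumes "\<sigma> permutes {1..length ts}" "a \<in> carrier (sp (arity2 V) (length ts))"
  shows "tsu_label V (map p ts) (act (arity2 V) (length ts) a \<sigma>)
    = act (arity2 (hat V)) (length ts) (tsu_label V (map p (permute_subtrees \<sigma> ts)) a) \<sigma>"
proof (cases "length ts = 2")
  case False
  then show ?thesis by (simp add: tsu_label_other)
next
  case True
  then obtain s u where ts: "ts = [s, u]" by (auto simp: length_two)
  have a: "a \<in> elts V" using assms(2) True by simp
  have "\<sigma> permutes {1..2}" using assms(1) True by simp
  then show ?thesis
  proof (cases rule: permutes_two)
    case 1
    have "permute_subtrees id ts = ts" by (simp add: permute_subtrees_def ts numeral_2_eq_2 inv_id[unfolded id_def] id_def)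
    then show ?thesis using 1 True by simp
  next
    case 2
    have "permute_subtrees \<sigma> ts = [u, s]"
      using 2 by (simp add: permute_subtrees_def ts numeral_2_eq_2 One_nat_def)
    then show ?thesis
      using 2 True a linear_map_zero[OF vspace_vsp vspace_vsp swp_linear] unfolding ts
      by (cases "p s"; cases "p u") (auto simp: dec_star_eq dec_def intro!: tri_eqI)
  qed
qed

text \<open>Decoration depends on a subtree only through its leaf set. The trees occurring in one
  relator have the same leaf set, so they are decorated alike, and linearity and equivariance of
  \<open>tsu_label\<close> carry relators to relators.\<close>

lemma crel_tsu:
  assumes "crel (arity2 V) L r"
  shows "crel (arity2 (hat V)) L (push (tsu_tree V J) r)"
  using assms
proof (induction rule: crel.induct)
  case (root r L)
  let ?bl = "map (\<lambda>t. J \<inter> set (leaves t) \<noteq> {})"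
  have lin: "linear_map (sp (arity2 V) (length ts)) (sp (arity2 (hat V)) (length ts)) (tsu_label V (?bl ts))" for ts :: "'b ltree list"
    by (rule tsu_label_linear) simp
  from root have "push (tsu_tree V J) r \<in> ltree_relators (arity2 (hat V)) L"
  proof (cases rule: ltree_relators_cases)
    case (add a b ts)
    have ab: "a \<in> carrier (sp (arity2 V) (length ts))" "b \<in> carrier (sp (arity2 V) (length ts))"
      using add(2,3) by (simp_all only: Node_ltrees)
    show ?thesis
      using ltree_relators_addI[OF tsu_tree_ltrees[OF add(2), of J, unfolded tsu_tree.simps]
          tsu_tree_ltrees[OF add(3), of J, unfolded tsu_tree.simps]] linear_mapD(2)[OF lin ab]
      unfolding add(1) by (simp add: push_diff del: arity2_simps hat_simps)
  next
    case (smult a c ts)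
    have a: "a \<in> carrier (sp (arity2 V) (length ts))"
      using smult(2) by (simp only: Node_ltrees)
    show ?thesis
      using ltree_relators_smultI[OF tsu_tree_ltrees[OF smult(2), of J, unfolded tsu_tree.simps], of c]
        linear_mapD(3)[OF lin a, of c]
      unfolding smult(1) by (simp add: push_diff del: arity2_simps hat_simps)
  next
    case (act a \<sigma> ts)
    have a: "a \<in> carrier (sp (arity2 V) (length ts))"
      using act(3) by (simp only: Node_ltrees)
    \<comment> \<open>The new relator needs a label before the action, which is the label computed
      from the permuted subtrees. By \<open>tsu_label_act\<close> its image under the action is the
      label that decoration gives to the first tree.\<close>
    let ?b = "tsu_label V (?bl (permute_subtrees \<sigma> ts)) a"
    have b: "?b \<in> carrier (sp (arity2 (hat V)) (length ts))"
      using linear_mapD(1)[OF tsu_label_linear[of "?bl (permute_subtrees \<sigma> ts)" "length ts"] a] by simp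
    have "Node ?b (map (tsu_tree V J) ts) \<in> ltrees (arity2 (hat V)) L"
      by (rule Node_ltrees_cong[OF tsu_tree_ltrees[OF act(3), of J, unfolded tsu_tree.simps]])
        (use b in \<open>simp del: arity2_simps\<close>)
    from ltree_relators_actI[OF _ this, of \<sigma>] show ?thesis
      using act(2) tsu_label_act[OF act(2) a] permute_subtrees_map[OF act(2), of "tsu_tree V J"]
      unfolding act(1) by (simp add: push_diff del: arity2_simps hat_simps)
  qed
  then show ?case by (rule crel.root)
next
  case (ctx L r e pre post)
  let ?bl = "map (\<lambda>t. J \<inter> set (leaves t) \<noteq> {})"
  \<comment> \<open>All trees t in r have leaf set L, so the vertex added by the context gets one
    and the same label for all of them.\<close>
  let ?l = "tsu_label V (?bl pre @ (J \<inter> L \<noteq> {}) # ?bl post) e"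
  let ?S = "map (tsu_tree V J)"
  have "push (tsu_tree V J) (push (\<lambda>t. Node e (pre @ t # post)) r)
      = push (\<lambda>t. Node ?l (?S pre @ t # ?S post)) (push (tsu_tree V J) r)"
    unfolding push_push
  proof (rule push_cong)
    fix t assume "t \<in> keys r"
    then have "set (leaves t) = L" using T.crel_keys[OF ctx.hyps(1)] by (auto simp: ltrees_def)
    then show "tsu_tree V J (Node e (pre @ t # post)) = Node ?l (?S pre @ tsu_tree V J t # ?S post)" by simp
  qed
  moreover have "crel (arity2 (hat V)) (L \<union> set (concat (map leaves (?S pre @ ?S post))))
      (push (\<lambda>t. Node ?l (?S pre @ t # ?S post)) (push (tsu_tree V J) r))"
  proof (rule crel.ctx[OF ctx.IH])
    show "?l \<in> carrier (sp (arity2 (hat V)) (Suc (length (?S pre) + length (?S post))))"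
      using linear_mapD(1)[OF tsu_label_linear[of "?bl pre @ (J \<inter> L \<noteq> {}) # ?bl post" "Suc (length pre + length post)"] ctx.hyps(2)]
      by (simp del: arity2_simps hat_simps)
  qed (use ctx.hyps labelled_tsu_tree in \<open>auto simp: comp_def list_all_iff\<close>)
  moreover have "concat (map leaves (?S pre @ ?S post)) = concat (map leaves (pre @ post))"
    by (simp add: comp_def)
  ultimately show ?case by simp
qed

lemma s2mod_hat: "s2mod (hat V)"
  by (rule s2mod.intro[OF s2_module_hat])

interpretation H: s2mod "hat V"
  by (rule s2mod_hat)

lemma tsu_tree_trees: "t \<in> trees (arity2 V) n \<Longrightarrow> tsu_tree V J t \<in> trees (arity2 (hat V)) n"
  using tsu_tree_ltrees by (simp add: trees_ltrees)

lemma push_tsu_linear: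
  "linear_map (free_module (trees (arity2 V) n)) (free_module (trees (arity2 (hat V)) n)) (push (tsu_tree V J))"
  using tsu_tree_trees by (intro push_linear) auto

text \<open>For fixed J the decoration is not compatible with grafting, as a star label can turn
  into another one when leaves are added. So the criterion for single arities is applied instead of
  the universal property.\<close>

lemma push_tsu_ideal: "x \<in> tree_ideal (arity2 V) n \<Longrightarrow> push (tsu_tree V J) x \<in> tree_ideal (arity2 (hat V)) n"
proof (rule T.linear_map_tree_ideal[OF vspace_free_module push_tsu_linear])
  show "submodule (tree_ideal (arity2 (hat V)) n) kring (free_module (trees (arity2 (hat V)) n))"
    using H.T.quot.submod[of n] by (simp only: sp_tree_operad)
  show "push (tsu_tree V J) r \<in> tree_ideal (arity2 (hat V)) n" if "crel (arity2 V) {1..n} r" for r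
    by (rule H.T.crel_tree_ideal[OF crel_tsu[OF that]])
qed

lemma TSu_map_class:
  assumes "keys x \<subseteq> trees (arity2 V) n"
  shows "TSu_map V n J (clV V n x) = clV (hat V) n (push (tsu_tree V J) x)"
proof -
  have "linear_map (sp (tree_operad (arity2 V)) n) (sp (tree_operad (arity2 (hat V))) n) (push (tsu_tree V J))"
    using push_tsu_linear by simp
  from induced_coset[OF T.quot.vspace_sp T.quot.submod H.T.quot.vspace_sp H.T.quot.submod this push_tsu_ideal]
  show ?thesis using assms by (simp add: TSu_map_def tree_induced_def tree_class_def del: arity2_simps hat_simps)
qed

lemma TSu_map_linear: "linear_map (sp (TV V) n) (sp (TV (hat V)) n) (TSu_map V n J)"
  unfolding T.sp_free
proof (rule linear_map_quotI[OF vspace_free_module])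
  show "submodule (tree_ideal (arity2 V) n) kring (free_module (trees (arity2 V) n))"
    using T.quot.submod[of n] by simp
  have "linear_map (free_module (trees (arity2 V) n)) (sp (TV (hat V)) n)
      (\<lambda>x. clV (hat V) n (push (tsu_tree V J) x))"
    by (rule linear_map_compose[OF push_tsu_linear H.T.tree_class_linear])
  then show "linear_map (free_module (trees (arity2 V) n)) (sp (TV (hat V)) n)
      (\<lambda>x. TSu_map V n J (tree_ideal (arity2 V) n +>\<^bsub>free_module (trees (arity2 V) n)\<^esub> x))"
    by (rule linear_map_cong[OF vspace_free_module])
      (simp add: TSu_map_class[unfolded tree_class_def[of "arity2 V"], simplified] del: arity2_simps hat_simps)
qed

lemma tsu_tree_relabel:
  assumes "inj h"
  shows "tsu_tree V (h ` J) (relabel h t) = relabel h (tsu_tree V J t)"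
proof (induction t)
  case (Node e ts)
  have "h ` J \<inter> h ` S = {} \<longleftrightarrow> J \<inter> S = {}" for S
    using image_Int[OF assms, of J S] by (metis image_is_empty)
  then show ?case using Node by (simp add: comp_def)
qed simp

text \<open>Permuting the leaves moves J along with them. Consequently one J of each cardinality
  determines all relations of the trisuccessor, as the relations of the given operad are stable
  under permutations.\<close>

lemma TSu_map_act:
  assumes "\<sigma> permutes {1..n}" "r \<in> carrier (sp (TV V) n)"
  shows "act (TV (hat V)) n (TSu_map V n J r) \<sigma>
    = TSu_map V n (inv_into UNIV \<sigma> ` J) (act (TV V) n r \<sigma>)"
proof -
  obtain x where x: "keys x \<subseteq> trees (arity2 V) n" "r = clV V n x"
    using assms(2) by (auto simp: T.carrier_free simp del: arity2_simps)
  have k: "keys (push (tsu_tree V J) x) \<subseteq> trees (arity2 (hat V)) n"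
    using linear_mapD(1)[OF push_tsu_linear, of x n J] x(1) by (simp del: arity2_simps hat_simps)
  have k2: "keys (push (relabel (inv_into UNIV \<sigma>)) x) \<subseteq> trees (arity2 V) n"
    using keys_push[of "relabel (inv_into UNIV \<sigma>)" x] relabel_trees[OF assms(1)] x(1) by blast
  have "inj (inv_into UNIV \<sigma>)" using permutes_inj[OF permutes_inv[OF assms(1)]] .
  then show ?thesis
    unfolding x(2) TSu_map_class[OF x(1)] H.T.act_free[OF assms(1) k] T.act_free[OF assms(1) x(1)] TSu_map_class[OF k2]
    by (simp add: push_push tsu_tree_relabel del: arity2_simps hat_simps)
qed

end

subsection \<open>Tensor products\<close>

lemma linear_map_add:
  assumes "vspace M" "vspace N" "linear_map M N f" "linear_map M N g"
  shows "linear_map M N (\<lambda>x. f x \<oplus>\<^bsub>N\<^esub> g x)"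
proof -
  interpret N: module kring N by fact
  show ?thesis
    using linear_mapD[OF assms(3)] linear_mapD[OF assms(4)]
    by (intro linear_mapI) (auto simp: N.a_ac N.smult_r_distr)
qed

lemma linear_map_smult:
  assumes "vspace N" "linear_map M N f"
  shows "linear_map M N (\<lambda>x. c \<odot>\<^bsub>N\<^esub> f x)"
proof -
  interpret N: module kring N by fact
  show ?thesis
    using linear_mapD[OF assms(2)] N.smult_assoc1[simplified, symmetric]
    by (intro linear_mapI) (auto simp: N.smult_r_distr mult.commute)
qed

lemma linear_map_uminus:
  assumes "vspace N" "linear_map M N f"
  shows "linear_map M N (\<lambda>x. \<ominus>\<^bsub>N\<^esub> f x)"
proof -
  interpret N: module kring N by fact
  show ?thesis
    using linear_mapD[OF assms(2)] by (intro linear_mapI) (auto simp: N.minus_add N.smult_r_minus)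
qed

definition bilinear_map :: "('k::field, 'a) module \<Rightarrow> ('k, 'b) module \<Rightarrow> ('k, 'c) module \<Rightarrow> ('a \<Rightarrow> 'b \<Rightarrow> 'c) \<Rightarrow> bool" where
  "bilinear_map M N L b \<longleftrightarrow> (\<forall>y\<in>carrier N. linear_map M L (\<lambda>x. b x y)) \<and> (\<forall>x\<in>carrier M. linear_map N L (b x))"

locale tensor_product =
  fixes M :: "('k::field, 'a) module" and N :: "('k, 'b) module"
  assumes vspace_M: "vspace M" and vspace_N: "vspace N"
begin

sublocale M: module kring M by (rule vspace_M)
sublocale N: module kring N by (rule vspace_N)

abbreviation "X \<equiv> carrier M \<times> carrier N"

abbreviation tn :: "'a \<Rightarrow> 'b \<Rightarrow> ('a \<times> 'b \<Rightarrow>\<^sub>0 'k) set" where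
  "tn v w \<equiv> tensor_null M N +>\<^bsub>free_module X\<^esub> bas (v, w)"

lemma tensor_relators_carrier: "tensor_relators M N \<subseteq> carrier (free_module X)"
  unfolding tensor_relators_def
  by (auto simp: bas_def dest!: subsetD[OF keys_diff] split: if_splits)

lemma tensor_null_submodule: "submodule (tensor_null M N) kring (free_module X)"
  unfolding tensor_null_def by (rule lin_span_submodule[OF vspace_free_module tensor_relators_carrier])

lemma vspace_tensor: "vspace (tensor M N)"
  unfolding tensor_def by (rule vspace_quot_module[OF vspace_free_module tensor_null_submodule])

lemma tn_closed: "v \<in> carrier M \<Longrightarrow> w \<in> carrier N \<Longrightarrow> tn v w \<in> carrier (tensor M N)"
  unfolding tensor_def carrier_quot_module by auto

lemma relator_null: "r \<in> tensor_relators M N \<Longrightarrow> r \<in> tensor_null M N"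
  unfolding tensor_null_def using lin_span_superset by (rule subsetD)

lemma coset_eqI:
  assumes "keys x \<subseteq> X" "keys y \<subseteq> X" "x - y \<in> tensor_null M N"
  shows "tensor_null M N +>\<^bsub>free_module X\<^esub> x = tensor_null M N +>\<^bsub>free_module X\<^esub> y"
  using coset_eq_iff[OF vspace_free_module tensor_null_submodule, of x y] assms by simp

lemma coset_linear: "linear_map (free_module X) (tensor M N) (\<lambda>x. tensor_null M N +>\<^bsub>free_module X\<^esub> x)"
  unfolding tensor_def by (rule linear_map_coset[OF vspace_free_module tensor_null_submodule])

lemma tn_bilinear: "bilinear_map M N (tensor M N) tn"
proof -
  note add = linear_mapD(2)[OF coset_linear, simplified] and sm = linear_mapD(3)[OF coset_linear, simplified]
  have 1: "tn (a \<oplus>\<^bsub>M\<^esub> b) w = tn a w \<oplus>\<^bsub>tensor M N\<^esub> tn b w"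
    if "a \<in> carrier M" "b \<in> carrier M" "w \<in> carrier N" for a b w
  proof -
    have "bas (a \<oplus>\<^bsub>M\<^esub> b, w) - (bas (a, w) + bas (b, w)) \<in> tensor_null M N"
      by (rule relator_null) (use that in \<open>auto simp: tensor_relators_def algebra_simps\<close>)
    then have "tensor_null M N +>\<^bsub>free_module X\<^esub> bas (a \<oplus>\<^bsub>M\<^esub> b, w) = tensor_null M N +>\<^bsub>free_module X\<^esub> (bas (a, w) + bas (b, w))"
      by (rule coset_eqI[rotated 2]) (use that in \<open>auto dest!: subsetD[OF keys_add]\<close>)
    then show ?thesis using add[of "bas (a, w)" "bas (b, w)"] that by simp
  qed
  have 2: "tn v (a \<oplus>\<^bsub>N\<^esub> b) = tn v a \<oplus>\<^bsub>tensor M N\<^esub> tn v b"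
    if "a \<in> carrier N" "b \<in> carrier N" "v \<in> carrier M" for a b v
  proof -
    have "bas (v, a \<oplus>\<^bsub>N\<^esub> b) - (bas (v, a) + bas (v, b)) \<in> tensor_null M N"
      by (rule relator_null) (use that in \<open>auto simp: tensor_relators_def algebra_simps\<close>)
    then have "tensor_null M N +>\<^bsub>free_module X\<^esub> bas (v, a \<oplus>\<^bsub>N\<^esub> b) = tensor_null M N +>\<^bsub>free_module X\<^esub> (bas (v, a) + bas (v, b))"
      by (rule coset_eqI[rotated 2]) (use that in \<open>auto dest!: subsetD[OF keys_add]\<close>)
    then show ?thesis using add[of "bas (v, a)" "bas (v, b)"] that by simp
  qed
  have 3: "tn (c \<odot>\<^bsub>M\<^esub> v) w = c \<odot>\<^bsub>tensor M N\<^esub> tn v w" if "v \<in> carrier M" "w \<in> carrier N" for c v w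
  proof -
    have "bas (c \<odot>\<^bsub>M\<^esub> v, w) - single (v, w) c \<in> tensor_null M N"
      by (rule relator_null) (use that in \<open>auto simp: tensor_relators_def\<close>)
    then have "tensor_null M N +>\<^bsub>free_module X\<^esub> bas (c \<odot>\<^bsub>M\<^esub> v, w) = tensor_null M N +>\<^bsub>free_module X\<^esub> single (v, w) c"
      by (rule coset_eqI[rotated 2]) (use that in auto)
    then show ?thesis using sm[of "bas (v, w)" c] that by (simp add: bas_def)
  qed
  have 4: "tn v (c \<odot>\<^bsub>N\<^esub> w) = c \<odot>\<^bsub>tensor M N\<^esub> tn v w" if "v \<in> carrier M" "w \<in> carrier N" for c v w
  proof -
    have "bas (v, c \<odot>\<^bsub>N\<^esub> w) - single (v, w) c \<in> tensor_null M N"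
      by (rule relator_null) (use that in \<open>auto simp: tensor_relators_def\<close>)
    then have "tensor_null M N +>\<^bsub>free_module X\<^esub> bas (v, c \<odot>\<^bsub>N\<^esub> w) = tensor_null M N +>\<^bsub>free_module X\<^esub> single (v, w) c"
      by (rule coset_eqI[rotated 2]) (use that in auto)
    then show ?thesis using sm[of "bas (v, w)" c] that by (simp add: bas_def)
  qed
  show ?thesis
    unfolding bilinear_map_def using tn_closed 1 2 3 4 by (auto intro!: linear_mapI)
qed

lemma tensor_linear_eqI:
  assumes "vspace L" "linear_map (tensor M N) L f" "linear_map (tensor M N) L g"
    and "\<And>v w. v \<in> carrier M \<Longrightarrow> w \<in> carrier N \<Longrightarrow> f (tn v w) = g (tn v w)" and "z \<in> carrier (tensor M N)"
  shows "f z = g z"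
proof -
  obtain x where x: "keys x \<subseteq> X" "z = tensor_null M N +>\<^bsub>free_module X\<^esub> x"
    using assms(5) by (auto simp: tensor_def carrier_quot_module)
  show ?thesis
    unfolding x(2)
    by (rule free_linear_eqI[OF assms(1) linear_map_compose[OF coset_linear assms(2)]
          linear_map_compose[OF coset_linear assms(3)] _ x(1)]) (use assms(4) in auto)
qed

lemma tensor_universal:
  assumes "vspace L" "bilinear_map M N L b"
  shows "\<exists>f. linear_map (tensor M N) L f \<and> (\<forall>v\<in>carrier M. \<forall>w\<in>carrier N. f (tn v w) = b v w)"
proof -
  interpret L: module kring L by fact
  let ?h = "lext L (\<lambda>(v, w). b v w)"
  note bl = linear_mapD[OF bspec[OF conjunct1[OF assms(2)[unfolded bilinear_map_def]]]]
  note br = linear_mapD[OF bspec[OF conjunct2[OF assms(2)[unfolded bilinear_map_def]]]]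
  have lin: "linear_map (free_module X) L ?h"
    by (rule lext_linear[OF assms(1)]) (use bl(1) in auto)
  have h: "?h (bas (v, w)) = b v w" if "v \<in> carrier M" "w \<in> carrier N" for v w
    using lext_bas[of L "\<lambda>(v, w). b v w" "(v, w)"] assms(1) bl(1) that by simp
  note minus = linear_map_minus(2)[OF vspace_free_module assms(1) lin, simplified]
  have minus: "?h (x - y) = ?h x \<ominus>\<^bsub>L\<^esub> ?h y" if "keys x \<subseteq> X" "keys y \<subseteq> X" for x y
    using linear_map_minus(2)[OF vspace_free_module assms(1) lin, of x y] that by simp
  have sg: "?h (single (v, w) c) = c \<odot>\<^bsub>L\<^esub> b v w" if "v \<in> carrier M" "w \<in> carrier N" for v w c
    using linear_mapD(3)[OF lin, of "bas (v, w)" c] h[OF that] that by (simp add: bas_def)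
  have "?h r \<in> {\<zero>\<^bsub>L\<^esub>}" if rel: "r \<in> tensor_relators M N" for r
  proof -
    have z: "(x \<oplus>\<^bsub>L\<^esub> y) \<ominus>\<^bsub>L\<^esub> x \<ominus>\<^bsub>L\<^esub> y = \<zero>\<^bsub>L\<^esub>" if "x \<in> carrier L" "y \<in> carrier L" for x y
      using that by (simp add: a_minus_def L.a_assoc flip: L.minus_add) (simp add: L.r_neg flip: L.a_assoc)
    have z2: "x \<ominus>\<^bsub>L\<^esub> x = \<zero>\<^bsub>L\<^esub>" if "x \<in> carrier L" for x using that by (simp add: a_minus_def L.r_neg)
    consider a c w where "r = bas (a \<oplus>\<^bsub>M\<^esub> c, w) - bas (a, w) - bas (c, w)" "a \<in> carrier M" "c \<in> carrier M" "w \<in> carrier N"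
      | v a c where "r = bas (v, a \<oplus>\<^bsub>N\<^esub> c) - bas (v, a) - bas (v, c)" "v \<in> carrier M" "a \<in> carrier N" "c \<in> carrier N"
      | c v w where "r = bas (c \<odot>\<^bsub>M\<^esub> v, w) - single (v, w) c" "v \<in> carrier M" "w \<in> carrier N"
      | c v w where "r = bas (v, c \<odot>\<^bsub>N\<^esub> w) - single (v, w) c" "v \<in> carrier M" "w \<in> carrier N"
      using rel unfolding tensor_relators_def by blast
    then show ?thesis
    proof cases
      case 1
      then show ?thesis using bl(1) by (simp add: minus keys_diff_subset h bl(2) z)
    next
      case 2
      then show ?thesis using br(1) by (simp add: minus keys_diff_subset h br(2) z)
    next
      case 3
      then show ?thesis using bl(1) by (simp add: minus sg h bl(3) z2)
    next
      case 4
      then show ?thesis using br(1) by (simp add: minus sg h br(3) z2)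
    qed
  qed
  then have "?h x = \<zero>\<^bsub>L\<^esub>" if "x \<in> tensor_null M N" for x
    using linear_map_lin_span[OF vspace_free_module assms(1) lin tensor_relators_carrier submodule_zero[OF assms(1)]]
      that unfolding tensor_null_def by blast
  from linear_map_factor[OF vspace_free_module tensor_null_submodule assms(1) lin this]
  obtain g where g: "linear_map (tensor M N) L g"
    "\<And>x. x \<in> carrier (free_module X) \<Longrightarrow> g (tensor_null M N +>\<^bsub>free_module X\<^esub> x) = ?h x"
    unfolding tensor_def by blast
  show ?thesis using g(1) g(2)[of "bas (_, _)"] h by (intro exI[of _ g]) auto
qed

end

locale tensor_s2 = V: s2mod V + W: s2mod W
  for V :: "('k::field, 'v) s2mod" and W :: "('k, 'w) s2mod"
begin

sublocale tensor_product "vsp V" "vsp W"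
  by (rule tensor_product.intro[OF V.vspace_vsp W.vspace_vsp])

sublocale TP: module kring "tensor (vsp V) (vsp W)"
  by (rule vspace_tensor)

lemma ten_eq: "ten V W v w = tn v w"
  by (simp add: ten_def)

lemma vsp_tensor_sgn [simp]: "vsp (tensor_sgn V W) = tensor (vsp V) (vsp W)"
  by (simp add: tensor_sgn_def)

lemmas ten_linear_left = bspec[OF conjunct1[OF tn_bilinear[unfolded bilinear_map_def]], folded ten_eq]
lemmas ten_linear_right = bspec[OF conjunct2[OF tn_bilinear[unfolded bilinear_map_def]], folded ten_eq]

lemma ten_closed: "v \<in> elts V \<Longrightarrow> w \<in> elts W \<Longrightarrow> ten V W v w \<in> carrier (tensor (vsp V) (vsp W))"
  by (simp add: ten_eq tn_closed)

lemma ex_tensor_swap: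
  "\<exists>f. linear_map (tensor (vsp V) (vsp W)) (tensor (vsp V) (vsp W)) f \<and>
    (\<forall>v\<in>elts V. \<forall>w\<in>elts W. f (tn v w) = tn (swp V v) (swp W w)) "
  using tensor_universal[OF vspace_tensor, of "\<lambda>v w. tn (swp V v) (swp W w)"]
    linear_map_compose[OF V.swp_linear ten_linear_left] linear_map_compose[OF W.swp_linear ten_linear_right]
  by (simp add: bilinear_map_def ten_eq)

text \<open>The relators are not inspected: the universal property already gives a linear map that
  swaps both factors on the tensor product, and it agrees on basis elements with \<open>push\<close>
  followed by the passage to classes. A null element has class zero, so its image does too.\<close>

lemma push_swap_null:
  assumes "x \<in> tensor_null (vsp V) (vsp W)"
  shows "push (map_prod (swp V) (swp W)) x \<in> tensor_null (vsp V) (vsp W)"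
proof -
  let ?c = "\<lambda>x. tensor_null (vsp V) (vsp W) +>\<^bsub>free_module X\<^esub> x"
  obtain f where f: "linear_map (tensor (vsp V) (vsp W)) (tensor (vsp V) (vsp W)) f"
    "\<And>v w. v \<in> elts V \<Longrightarrow> w \<in> elts W \<Longrightarrow> f (tn v w) = tn (swp V v) (swp W w)"
    using ex_tensor_swap by blast
  have pl: "linear_map (free_module X) (free_module X) (push (map_prod (swp V) (swp W)))"
    by (rule push_linear) auto
  have k: "keys x \<subseteq> X"
    using assms vspace_submoduleD(1)[OF vspace_free_module tensor_null_submodule] by auto
  have "f (?c x) = ?c (push (map_prod (swp V) (swp W)) x)"
    by (rule free_linear_eqI[OF vspace_tensor linear_map_compose[OF coset_linear f(1)]
          linear_map_compose[OF pl coset_linear] _ k]) (use f(2) in auto)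
  moreover have "?c x = \<zero>\<^bsub>tensor (vsp V) (vsp W)\<^esub>"
    using coset_eq_self_iff[OF vspace_free_module tensor_null_submodule, of x] k assms by (simp add: tensor_def)
  ultimately have "?c (push (map_prod (swp V) (swp W)) x) = tensor_null (vsp V) (vsp W)"
    using linear_map_zero[OF vspace_tensor vspace_tensor f(1)] by (simp add: tensor_def)
  then show ?thesis
    using coset_eq_self_iff[OF vspace_free_module tensor_null_submodule, of "push (map_prod (swp V) (swp W)) x"]
      linear_mapD(1)[OF pl, of x] k by simp
qed

lemma swp_tensor_linear: "linear_map (tensor (vsp V) (vsp W)) (tensor (vsp V) (vsp W)) (swp (tensor_sgn V W))"
proof -
  have pl: "linear_map (free_module X) (free_module X) (push (map_prod (swp V) (swp W)))"
    by (rule push_linear) auto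
  have "linear_map (tensor (vsp V) (vsp W)) (tensor (vsp V) (vsp W))
      (induced (free_module X) (tensor_null (vsp V) (vsp W)) (push (map_prod (swp V) (swp W))))"
    unfolding tensor_def
    by (rule linear_map_induced[OF vspace_free_module tensor_null_submodule vspace_free_module tensor_null_submodule pl push_swap_null])
  from linear_map_uminus[OF vspace_tensor this] show ?thesis
    by (simp add: tensor_sgn_def)
qed

lemma swp_ten:
  assumes "v \<in> elts V" "w \<in> elts W"
  shows "swp (tensor_sgn V W) (ten V W v w) = \<ominus>\<^bsub>tensor (vsp V) (vsp W)\<^esub> ten V W (swp V v) (swp W w)"
proof -
  have pl: "linear_map (free_module X) (free_module X) (push (map_prod (swp V) (swp W)))"
    by (rule push_linear) auto
  from induced_coset[OF vspace_free_module tensor_null_submodule vspace_free_module tensor_null_submodule pl push_swap_null, of "bas (v, w)"]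
  show ?thesis using assms by (simp add: tensor_sgn_def ten_def)
qed

text \<open>The sign enters once with each application of (12), so it cancels in the square.\<close>

lemma s2_module_tensor_sgn: "s2_module (tensor_sgn V W)"
proof -
  have "swp (tensor_sgn V W) (swp (tensor_sgn V W) z) = z" if "z \<in> carrier (tensor (vsp V) (vsp W))" for z
  proof (rule tensor_linear_eqI[OF vspace_tensor linear_map_compose[OF swp_tensor_linear swp_tensor_linear] linear_map_id _ that])
    show "swp (tensor_sgn V W) (swp (tensor_sgn V W) (tn v w)) = tn v w"
      if "v \<in> elts V" "w \<in> elts W" for v w
      using that linear_map_minus(1)[OF vspace_tensor vspace_tensor swp_tensor_linear] ten_closed
      by (simp add: swp_ten V.swp_swp W.swp_swp flip: ten_eq)
  qed
  then show ?thesis using swp_tensor_linear vspace_tensor by (simp add: s2_module_def)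
qed

end

subsection \<open>The components of arity three\<close>

lemma lext_cong:
  assumes "vspace N" "\<And>t. t \<in> keys r \<Longrightarrow> F t = G t" "\<And>t. t \<in> keys r \<Longrightarrow> G t \<in> carrier N"
  shows "lext N F r = lext N G r"
proof -
  interpret N: module kring N by fact
  show ?thesis unfolding lext_def using assms(2,3) by (intro N.finsum_cong') auto
qed

lemma lext_zero:
  assumes "vspace N" "\<And>t. t \<in> keys r \<Longrightarrow> F t = \<zero>\<^bsub>N\<^esub>"
  shows "lext N F r = \<zero>\<^bsub>N\<^esub>"
proof -
  interpret N: module kring N by fact
  show ?thesis
    unfolding lext_def using assms(2) N.smult_r_null
    by (subst N.finsum_cong'[of _ _ "\<lambda>_. \<zero>\<^bsub>N\<^esub>"]) auto
qed

lemma lext_push: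
  assumes "vspace N" "\<And>t. t \<in> keys r \<Longrightarrow> F (h t) \<in> carrier N"
  shows "lext N F (push h r) = lext N (\<lambda>t. F (h t)) r"
proof (rule free_linear_eqI[OF assms(1), where X = "keys r"])
  have "linear_map (free_module (h ` keys r)) N (lext N F)"
    by (rule lext_linear[OF assms(1)]) (use assms(2) in auto)
  then show "linear_map (free_module (keys r)) N (\<lambda>r. lext N F (push h r))"
    by (rule linear_map_compose[OF push_linear, rotated]) auto
  show "linear_map (free_module (keys r)) N (lext N (\<lambda>t. F (h t)))"
    by (rule lext_linear[OF assms(1)]) (use assms(2) in auto)
qed (use assms in auto)

context free_operad_smodule
begin

text \<open>The counterpart of the last three premises of \<open>free_operad_hom\<close> for values
  in a vector space and for arbitrary leaf sets. The latter is needed because a relator below a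
  context carries only some of the labels.\<close>

lemma lext_ltree_relators:
  assumes N: "vspace N" and F: "\<And>t. t \<in> ltrees E L \<Longrightarrow> F t \<in> carrier N"
    and add: "\<And>a b ts. Node a ts \<in> ltrees E L \<Longrightarrow> Node b ts \<in> ltrees E L \<Longrightarrow>
      F (Node (a \<oplus>\<^bsub>sp E (length ts)\<^esub> b) ts) = F (Node a ts) \<oplus>\<^bsub>N\<^esub> F (Node b ts)"
    and smult: "\<And>a c ts. Node a ts \<in> ltrees E L \<Longrightarrow> F (Node (c \<odot>\<^bsub>sp E (length ts)\<^esub> a) ts) = c \<odot>\<^bsub>N\<^esub> F (Node a ts)"
    and act: "\<And>a \<sigma> ts. Node a ts \<in> ltrees E L \<Longrightarrow> \<sigma> permutes {1..length ts} \<Longrightarrow>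
      F (Node (act E (length ts) a \<sigma>) ts) = F (Node a (permute_subtrees \<sigma> ts))"
    and r: "r \<in> ltree_relators E L"
  shows "lext N F r = \<zero>\<^bsub>N\<^esub>"
proof -
  interpret N: module kring N by fact
  let ?f = "lext N F"
  have lin: "linear_map (free_module (ltrees E L)) N ?f"
    by (rule lext_linear[OF N]) (use F in auto)
  have bas: "?f (bas t) = F t" if "t \<in> ltrees E L" for t
    by (rule lext_bas[OF N]) (rule F[OF that])
  have minus: "?f (x - y) = ?f x \<ominus>\<^bsub>N\<^esub> ?f y"
    if "keys x \<subseteq> ltrees E L" "keys y \<subseteq> ltrees E L" for x y
    using linear_map_minus(2)[OF vspace_free_module N lin, of x y] that by simp
  have sg: "?f (single t c) = c \<odot>\<^bsub>N\<^esub> F t" if "t \<in> ltrees E L" for t c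
    using linear_mapD(3)[OF lin, of "bas t" c] that bas[OF that] by (simp add: bas_def)
  from r show ?thesis
  proof (cases rule: ltree_relators_cases)
    case (add a b ts)
    interpret S: module kring "sp E (length ts)" by (rule vspace_sp)
    have t: "Node (a \<oplus>\<^bsub>sp E (length ts)\<^esub> b) ts \<in> ltrees E L"
      using add(2,3) by (intro Node_ltrees_cong[OF add(2)]) (simp add: Node_ltrees)
    have "?f r = (F (Node a ts) \<oplus>\<^bsub>N\<^esub> F (Node b ts)) \<ominus>\<^bsub>N\<^esub> F (Node a ts) \<ominus>\<^bsub>N\<^esub> F (Node b ts)"
      unfolding add(1) using t add(2,3) by (simp add: minus keys_diff_subset bas assms(3))
    then show ?thesis
      using F[OF add(2)] F[OF add(3)]
      by (simp add: a_minus_def N.a_assoc flip: N.minus_add) (simp add: N.r_neg flip: N.a_assoc)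
  next
    case (smult a c ts)
    interpret S: module kring "sp E (length ts)" by (rule vspace_sp)
    have t: "Node (c \<odot>\<^bsub>sp E (length ts)\<^esub> a) ts \<in> ltrees E L"
      using smult(2) by (intro Node_ltrees_cong[OF smult(2)]) (simp add: Node_ltrees)
    have "?f r = c \<odot>\<^bsub>N\<^esub> F (Node a ts) \<ominus>\<^bsub>N\<^esub> c \<odot>\<^bsub>N\<^esub> F (Node a ts)"
      unfolding smult(1) using t smult(2) by (simp add: minus sg bas assms(4))
    then show ?thesis using F[OF smult(2)] by (simp add: a_minus_def N.r_neg)
  next
    case (act a \<sigma> ts)
    have t: "Node (act E (length ts) a \<sigma>) ts \<in> ltrees E L"
      using act(2,3) linear_mapD(1)[OF act_linear[OF act(2)]]
      by (intro Node_ltrees_cong[OF act(3)]) (simp add: Node_ltrees)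
    have "?f r = F (Node a (permute_subtrees \<sigma> ts)) \<ominus>\<^bsub>N\<^esub> F (Node a (permute_subtrees \<sigma> ts))"
      unfolding act(1) using t permute_subtrees_ltrees[OF act(2,3)] by (simp add: minus bas assms(5)[OF act(3,2)])
    then show ?thesis using F[OF permute_subtrees_ltrees[OF act(2,3)]] by (simp add: a_minus_def N.r_neg)
  qed
qed

end

text \<open>A coordinate of the trees with one vertex and leaves i, j. Reversed leaves are corrected
  by \<open>swp\<close>, which makes the function constant on symmetry classes; z is meant to be the
  zero of the target.\<close>

definition inner_fun :: "('k, 'v) s2mod \<Rightarrow> 'n \<Rightarrow> ('v \<Rightarrow> 'n) \<Rightarrow> nat \<Rightarrow> nat \<Rightarrow> 'v ltree \<Rightarrow> 'n" where
  "inner_fun V z g i j t = (case t of Leaf _ \<Rightarrow> z | Node c ts \<Rightarrow>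
     if ts = [Leaf i, Leaf j] then g c else if ts = [Leaf j, Leaf i] then g (swp V c) else z)"

text \<open>The projection of T(V)(3) to the component whose root carries the leaf k, followed by
  the bilinear map b. The root is normalised by \<open>swp\<close> in the same way as the inner
  vertex.\<close>

definition outer_fun :: "('k, 'v) s2mod \<Rightarrow> 'n \<Rightarrow> ('v \<Rightarrow> 'v \<Rightarrow> 'n) \<Rightarrow> nat \<Rightarrow> nat \<Rightarrow> nat \<Rightarrow> 'v ltree \<Rightarrow> 'n" where
  "outer_fun V z b i j k t = (case t of Leaf _ \<Rightarrow> z | Node a ts \<Rightarrow>
     if length ts \<noteq> 2 then z
     else if ts ! 1 = Leaf k then inner_fun V z (b a) i j (ts ! 0)
     else if ts ! 0 = Leaf k then inner_fun V z (b (swp V a)) i j (ts ! 1) else z)"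

lemma inner_fun_simps [simp]:
  "inner_fun V z g i j (Leaf l) = z"
  "inner_fun V z g i j (Node c ts) =
     (if ts = [Leaf i, Leaf j] then g c else if ts = [Leaf j, Leaf i] then g (swp V c) else z)"
  by (simp_all add: inner_fun_def)

lemma outer_fun_simps [simp]:
  "outer_fun V z b i j k (Node a [s, u]) =
     (if u = Leaf k then inner_fun V z (b a) i j s
      else if s = Leaf k then inner_fun V z (b (swp V a)) i j u else z)"
  "length ts \<noteq> 2 \<Longrightarrow> outer_fun V z b i j k (Node a ts) = z"
  "outer_fun V z b i j k (Leaf l) = z"
  by (simp_all add: outer_fun_def)

context s2mod
begin

lemma crel_Node: "crel (arity2 V) L r \<Longrightarrow> t \<in> keys r \<Longrightarrow> \<exists>a ts. t = Node a ts"
proof (induction arbitrary: t rule: crel.induct)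
  case (root r L)
  then show ?case
    by (cases rule: ltree_relators_cases) (auto dest!: subsetD[OF keys_diff] split: if_splits)
next
  case (ctx L r e pre post)
  then show ?case using keys_push[of "\<lambda>t. Node e (pre @ t # post)" r] by blast
qed

lemma swap_cases:
  assumes "\<sigma> permutes {1..length ts}" "length ts = 2"
  obtains s u where "ts = [s, u]" "permute_subtrees \<sigma> ts = [s, u]" "\<sigma> 1 = 1"
    | s u where "ts = [s, u]" "permute_subtrees \<sigma> ts = [u, s]" "\<sigma> 1 = 2"
proof -
  obtain s u where ts: "ts = [s, u]" using assms(2) by (auto simp: length_two)
  have "\<sigma> permutes {1..2}" using assms by simp
  then show ?thesis
  proof (cases rule: permutes_two)
    case 1
    have "permute_subtrees \<sigma> ts = [s, u]"
      unfolding 1(1) by (simp add: permute_subtrees_def ts numeral_2_eq_2 inv_id[unfolded id_def] id_def)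
    then show ?thesis using ts 1 that(1) by blast
  next
    case 2
    have "permute_subtrees \<sigma> ts = [u, s]"
      using 2 by (simp add: permute_subtrees_def ts numeral_2_eq_2 One_nat_def)
    then show ?thesis using ts 2 that(2) by blast
  qed
qed

lemma inner_fun_closed:
  assumes "vspace N" "linear_map (vsp V) N g" "labelled_by (arity2 V) t"
  shows "inner_fun V \<zero>\<^bsub>N\<^esub> g i j t \<in> carrier N"
proof -
  interpret N: module kring N by fact
  show ?thesis using assms(3) linear_mapD(1)[OF assms(2)] by (cases t) auto
qed

text \<open>At the root the relators are respected because g is linear and \<open>swp\<close> is an
  involution. Under a further vertex, every tree of the relator has a vertex below its root, and
  \<open>inner_fun\<close> vanishes on such trees.\<close>

lemma inner_fun_crel:
  assumes N: "vspace N" and g: "linear_map (vsp V) N g" and ij: "i \<noteq> j" and r: "crel (arity2 V) L r"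
  shows "lext N (inner_fun V \<zero>\<^bsub>N\<^esub> g i j) r = \<zero>\<^bsub>N\<^esub>"
  using r
proof (cases rule: crel.cases)
  case root
  interpret N: module kring N by fact
  note g' = linear_mapD[OF g]
  show ?thesis
  proof (rule T.lext_ltree_relators[OF N _ _ _ _ root])
    show "inner_fun V \<zero>\<^bsub>N\<^esub> g i j t \<in> carrier N" if "t \<in> ltrees (arity2 V) L" for t
      using inner_fun_closed[OF N g] that by (auto simp: ltrees_def)
    { fix a ts assume a: "Node a ts \<in> ltrees (arity2 V) L"
      have ac: "length ts = 2 \<Longrightarrow> a \<in> elts V" using a by (simp add: Node_ltrees)
      show "inner_fun V \<zero>\<^bsub>N\<^esub> g i j (Node (a \<oplus>\<^bsub>sp (arity2 V) (length ts)\<^esub> b) ts)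
          = inner_fun V \<zero>\<^bsub>N\<^esub> g i j (Node a ts) \<oplus>\<^bsub>N\<^esub> inner_fun V \<zero>\<^bsub>N\<^esub> g i j (Node b ts)"
        if b: "Node b ts \<in> ltrees (arity2 V) L" for b
      proof (cases "ts = [Leaf i, Leaf j] \<or> ts = [Leaf j, Leaf i]")
        case True
        then have "length ts = 2" by auto
        then have "a \<in> elts V" "b \<in> elts V" using ac b by (simp_all add: Node_ltrees)
        then show ?thesis using True linear_mapD(2)[OF swp_linear] ij by (elim disjE) (simp_all add: g')
      next
        case False
        then have "inner_fun V \<zero>\<^bsub>N\<^esub> g i j (Node c ts) = \<zero>\<^bsub>N\<^esub>" for c by simp
        then show ?thesis by (simp del: inner_fun_simps)
      qed
      show "inner_fun V \<zero>\<^bsub>N\<^esub> g i j (Node (c \<odot>\<^bsub>sp (arity2 V) (length ts)\<^esub> a) ts) = c \<odot>\<^bsub>N\<^esub> inner_fun V \<zero>\<^bsub>N\<^esub> g i j (Node a ts)" for c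
      proof (cases "ts = [Leaf i, Leaf j] \<or> ts = [Leaf j, Leaf i]")
        case True
        then have "length ts = 2" by auto
        then have "a \<in> elts V" using ac by simp
        then show ?thesis using True linear_mapD(3)[OF swp_linear] ij by (elim disjE) (simp_all add: g')
      next
        case False
        then have "inner_fun V \<zero>\<^bsub>N\<^esub> g i j (Node c ts) = \<zero>\<^bsub>N\<^esub>" for c by simp
        then show ?thesis using N.smult_r_null by (simp del: inner_fun_simps)
      qed
      show "inner_fun V \<zero>\<^bsub>N\<^esub> g i j (Node (act (arity2 V) (length ts) a \<sigma>) ts) = inner_fun V \<zero>\<^bsub>N\<^esub> g i j (Node a (permute_subtrees \<sigma> ts))"
        if "\<sigma> permutes {1..length ts}" for \<sigma>
      proof (cases "length ts = 2")
        case True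
        show ?thesis using that True
          by (cases rule: swap_cases) (use ac ij in \<open>auto simp: swp_swp\<close>)
      next
        case False
        then have "ts \<noteq> [Leaf p, Leaf q]" "permute_subtrees \<sigma> ts \<noteq> [Leaf p, Leaf q]" for p q
          using length_permute_subtrees[of \<sigma> ts] by (auto simp del: length_permute_subtrees)
        then show ?thesis by simp
      qed }
  qed
next
  case (ctx L' r' e pre post)
  have "inner_fun V \<zero>\<^bsub>N\<^esub> g i j (Node e (pre @ t # post)) = \<zero>\<^bsub>N\<^esub>" if "t \<in> keys r'" for t
    using crel_Node[OF ctx(3) that] by (auto simp: append_eq_Cons_conv Cons_eq_append_conv)
  then show ?thesis
    unfolding ctx(2) using keys_push[of "\<lambda>t. Node e (pre @ t # post)" r'] by (intro lext_zero[OF N]) auto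
qed

text \<open>Relators at the root are respected by linearity of b in its first argument. For a
  relator one level below, the root label is fixed and the function reduces to
  \<open>inner_fun\<close>, which kills relators; in the remaining contexts it is zero.\<close>

lemma outer_fun_crel:
  assumes N: "vspace N" and b: "bilinear_map (vsp V) (vsp V) N b" and ij: "i \<noteq> j" and r: "crel (arity2 V) L r"
  shows "lext N (outer_fun V \<zero>\<^bsub>N\<^esub> b i j k) r = \<zero>\<^bsub>N\<^esub>"
  using r
proof (cases rule: crel.cases)
  case root
  interpret N: module kring N by fact
  have b1: "linear_map (vsp V) N (\<lambda>a. b a c)" if "c \<in> elts V" for c using b that by (auto simp: bilinear_map_def)
  have b2: "linear_map (vsp V) N (b a)" if "a \<in> elts V" for a using b that by (auto simp: bilinear_map_def)
  have zero: "inner_fun V \<zero>\<^bsub>N\<^esub> g i j s = \<zero>\<^bsub>N\<^esub>" if "s = Leaf l" for g s l using that by simp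
  have in_add: "inner_fun V \<zero>\<^bsub>N\<^esub> (b (a \<oplus>\<^bsub>vsp V\<^esub> a')) i j s = inner_fun V \<zero>\<^bsub>N\<^esub> (b a) i j s \<oplus>\<^bsub>N\<^esub> inner_fun V \<zero>\<^bsub>N\<^esub> (b a') i j s"
    if "a \<in> elts V" "a' \<in> elts V" "labelled_by (arity2 V) s" for a a' s
    using that linear_mapD(2)[OF b1] by (cases s) auto
  have in_smult: "inner_fun V \<zero>\<^bsub>N\<^esub> (b (c \<odot>\<^bsub>vsp V\<^esub> a)) i j s = c \<odot>\<^bsub>N\<^esub> inner_fun V \<zero>\<^bsub>N\<^esub> (b a) i j s"
    if "a \<in> elts V" "labelled_by (arity2 V) s" for a c s
    using that linear_mapD(3)[OF b1] N.smult_r_null by (cases s) auto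
  show ?thesis
  proof (rule T.lext_ltree_relators[OF N _ _ _ _ root])
    show "outer_fun V \<zero>\<^bsub>N\<^esub> b i j k t \<in> carrier N" if t: "t \<in> ltrees (arity2 V) L" for t
    proof (cases t)
      case (Node a ts)
      show ?thesis
      proof (cases "length ts = 2")
        case True
        then obtain s u where "ts = [s, u]" by (auto simp: length_two)
        then show ?thesis using t Node inner_fun_closed[OF N b2] by (simp add: ltrees_def)
      qed (simp add: Node)
    qed simp
    { fix a ts assume a: "Node a ts \<in> ltrees (arity2 V) L"
      show "outer_fun V \<zero>\<^bsub>N\<^esub> b i j k (Node (a \<oplus>\<^bsub>sp (arity2 V) (length ts)\<^esub> a') ts)
          = outer_fun V \<zero>\<^bsub>N\<^esub> b i j k (Node a ts) \<oplus>\<^bsub>N\<^esub> outer_fun V \<zero>\<^bsub>N\<^esub> b i j k (Node a' ts)"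
        if a': "Node a' ts \<in> ltrees (arity2 V) L" for a'
      proof (cases "length ts = 2")
        case True
        then obtain s u where "ts = [s, u]" by (auto simp: length_two)
        then show ?thesis using a a' in_add linear_mapD(2)[OF swp_linear] by (simp add: ltrees_def)
      qed simp
      show "outer_fun V \<zero>\<^bsub>N\<^esub> b i j k (Node (c \<odot>\<^bsub>sp (arity2 V) (length ts)\<^esub> a) ts) = c \<odot>\<^bsub>N\<^esub> outer_fun V \<zero>\<^bsub>N\<^esub> b i j k (Node a ts)" for c
      proof (cases "length ts = 2")
        case True
        then obtain s u where "ts = [s, u]" by (auto simp: length_two)
        then show ?thesis using a in_smult linear_mapD(3)[OF swp_linear] N.smult_r_null by (simp add: ltrees_def)
      qed (use N.smult_r_null in simp)
      show "outer_fun V \<zero>\<^bsub>N\<^esub> b i j k (Node (act (arity2 V) (length ts) a \<sigma>) ts) = outer_fun V \<zero>\<^bsub>N\<^esub> b i j k (Node a (permute_subtrees \<sigma> ts))"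
        if "\<sigma> permutes {1..length ts}" for \<sigma>
      proof (cases "length ts = 2")
        case True
        show ?thesis using that True
          by (cases rule: swap_cases) (use a in \<open>auto simp: swp_swp ltrees_def\<close>)
      qed simp }
  qed
next
  case (ctx L' r' e pre post)
  interpret N: module kring N by fact
  have b2: "linear_map (vsp V) N (b a)" if "a \<in> elts V" for a using b that by (auto simp: bilinear_map_def)
  let ?F = "outer_fun V \<zero>\<^bsub>N\<^esub> b i j k" and ?ctx = "\<lambda>t. Node e (pre @ t # post)"
  have nl: "t \<noteq> Leaf l" if "t \<in> keys r'" for t l using crel_Node[OF ctx(3) that] by auto
  have lab: "labelled_by (arity2 V) t" if "t \<in> keys r'" for t
    using T.crel_keys[OF ctx(3)] that by (auto simp: ltrees_def)
  have kill: "lext N (\<lambda>t. inner_fun V \<zero>\<^bsub>N\<^esub> (b a) i j t) r' = \<zero>\<^bsub>N\<^esub>" if "a \<in> elts V" for a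
    by (rule inner_fun_crel[OF N b2[OF that] ij ctx(3)])
  consider w where "pre = []" "post = [w]" | w where "pre = [w]" "post = []" | "Suc (length pre + length post) \<noteq> 2"
    by (cases pre; cases post) auto
  \<comment> \<open>A tree occurring in a relator is never a leaf, so the leaf k can only be the
    sibling w. Hence the same branch of \<open>outer_fun\<close> is taken for all t in r'.\<close>
  then have "\<exists>a\<in>elts V. (\<forall>t\<in>keys r'. ?F (?ctx t) = inner_fun V \<zero>\<^bsub>N\<^esub> (b a) i j t) \<or>
      (\<forall>t\<in>keys r'. ?F (?ctx t) = \<zero>\<^bsub>N\<^esub>)"
  proof cases
    case 1
    then have "e \<in> elts V" using ctx(4) by simp
    then show ?thesis using 1 nl by (intro bexI[of _ e]) auto
  next
    case 2
    then have "e \<in> elts V" using ctx(4) by simp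
    then show ?thesis using 2 nl by (intro bexI[of _ "swp V e"]) auto
  next
    case 3
    then show ?thesis by (intro bexI[of _ "\<zero>\<^bsub>vsp V\<^esub>"]) auto
  qed
  then obtain a where a: "a \<in> elts V" and
    "(\<forall>t\<in>keys r'. ?F (?ctx t) = inner_fun V \<zero>\<^bsub>N\<^esub> (b a) i j t) \<or> (\<forall>t\<in>keys r'. ?F (?ctx t) = \<zero>\<^bsub>N\<^esub>)" by blast
  then have F: "(\<forall>t\<in>keys r'. ?F (?ctx t) = inner_fun V \<zero>\<^bsub>N\<^esub> (b a) i j t) \<or> (\<forall>t\<in>keys r'. ?F (?ctx t) = \<zero>\<^bsub>N\<^esub>)"
    by blast
  have cl: "?F (?ctx t) \<in> carrier N" if "t \<in> keys r'" for t
    using F inner_fun_closed[OF N b2[OF a] lab[OF that], of i j] that by auto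
  have "lext N ?F r = lext N (\<lambda>t. ?F (?ctx t)) r'"
    unfolding ctx(2) by (rule lext_push[OF N]) (rule cl)
  also from F have "\<dots> = \<zero>\<^bsub>N\<^esub>"
  proof
    assume *: "\<forall>t\<in>keys r'. ?F (?ctx t) = inner_fun V \<zero>\<^bsub>N\<^esub> (b a) i j t"
    then have "lext N (\<lambda>t. ?F (?ctx t)) r' = lext N (\<lambda>t. inner_fun V \<zero>\<^bsub>N\<^esub> (b a) i j t) r'"
      using inner_fun_closed[OF N b2[OF a] lab] by (intro lext_cong[OF N]) auto
    then show ?thesis using kill[OF a] by simp
  qed (rule lext_zero[OF N], blast)
  finally show ?thesis .
qed

text \<open>A linear map that sees only one of the three components, which shows that they are
  independent. Existence of \<Psi> rests on this, since it must be zero on pairs of different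
  shapes.\<close>

lemma ex_component:
  assumes N: "vspace N" and b: "bilinear_map (vsp V) (vsp V) N b"
  shows "\<exists>f. linear_map (sp (TV V) 3) N f \<and>
    (\<forall>v. \<forall>\<omega>\<in>elts V. \<forall>\<nu>\<in>elts V. f (circ_u V v \<omega> \<nu>) = (if v = u then b \<omega> \<nu> else \<zero>\<^bsub>N\<^esub>))"
proof -
  interpret N: module kring N by fact
  \<comment> \<open>The triple is read off from the shape: i, j are the inner leaves in its cyclic
    order and k is the leaf at the root.\<close>
  obtain i j k where ijk: "i \<noteq> j" "\<And>v \<omega> \<nu>. outer_fun V \<zero>\<^bsub>N\<^esub> b i j k (shape_tree v \<omega> \<nu>) = (if v = u then b \<omega> \<nu> else \<zero>\<^bsub>N\<^esub>)"
  proof (cases u)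
    case ShI
    have "outer_fun V \<zero>\<^bsub>N\<^esub> b 1 2 3 (shape_tree v \<omega> \<nu>) = (if v = u then b \<omega> \<nu> else \<zero>\<^bsub>N\<^esub>)" for v \<omega> \<nu>
      unfolding ShI by (cases v) auto
    then show ?thesis by (intro that[of 1 2 3]) auto
  next
    case ShII
    have "outer_fun V \<zero>\<^bsub>N\<^esub> b 2 3 1 (shape_tree v \<omega> \<nu>) = (if v = u then b \<omega> \<nu> else \<zero>\<^bsub>N\<^esub>)" for v \<omega> \<nu>
      unfolding ShII by (cases v) auto
    then show ?thesis by (intro that[of 2 3 1]) auto
  next
    case ShIII
    have "outer_fun V \<zero>\<^bsub>N\<^esub> b 3 1 2 (shape_tree v \<omega> \<nu>) = (if v = u then b \<omega> \<nu> else \<zero>\<^bsub>N\<^esub>)" for v \<omega> \<nu>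
      unfolding ShIII by (cases v) auto
    then show ?thesis by (intro that[of 3 1 2]) auto
  qed
  let ?F = "outer_fun V \<zero>\<^bsub>N\<^esub> b i j k"
  have b2: "linear_map (vsp V) N (b a)" if "a \<in> elts V" for a using b that by (auto simp: bilinear_map_def)
  have F: "?F t \<in> carrier N" if t: "t \<in> trees (arity2 V) 3" for t
  proof (cases t)
    case (Node a ts)
    show ?thesis
    proof (cases "length ts = 2")
      case True
      then obtain s u where "ts = [s, u]" by (auto simp: length_two)
      then show ?thesis using t Node inner_fun_closed[OF N b2] by (simp add: trees_def)
    qed (simp add: Node)
  qed simp
  have lin: "linear_map (free_module (trees (arity2 V) 3)) N (lext N ?F)"
    by (rule lext_linear[OF N]) (use F in auto)
  have "lext N ?F x = \<zero>\<^bsub>N\<^esub>" if "x \<in> tree_ideal (arity2 V) 3" for x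
    using T.linear_map_tree_ideal[OF N lin submodule_zero[OF N] _ that] outer_fun_crel[OF N b ijk(1)] by blast
  from linear_map_factor[OF vspace_free_module _ N lin this] T.quot.submod[of 3]
  obtain f where f: "linear_map (sp (TV V) 3) N f"
    "\<And>x. x \<in> carrier (free_module (trees (arity2 V) 3)) \<Longrightarrow> f (clV V 3 x) = lext N ?F x"
    unfolding T.sp_free tree_class_def sp_tree_operad by blast
  have "f (circ_u V v \<omega> \<nu>) = (if v = u then b \<omega> \<nu> else \<zero>\<^bsub>N\<^esub>)"
    if "\<omega> \<in> elts V" "\<nu> \<in> elts V" for v \<omega> \<nu>
  proof -
    have t: "shape_tree v \<omega> \<nu> \<in> trees (arity2 V) 3" by (rule shape_tree_trees[OF that])
    show ?thesis
      unfolding circ_u_def using f(2)[of "bas (shape_tree v \<omega> \<nu>)"] t lext_bas[of N ?F "shape_tree v \<omega> \<nu>", OF N F[OF t]] ijk(2) by simp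
  qed
  then show ?thesis using f(1) by (intro exI[of _ f]) blast
qed

end

context s2mod
begin

text \<open>The sum of the three maps of \<open>ex_component\<close>; on an element of one component
  two of the summands vanish.\<close>

lemma ex_linear_circ:
  assumes N: "vspace N" and b: "\<And>u. bilinear_map (vsp V) (vsp V) N (b u)"
  shows "\<exists>f. linear_map (sp (TV V) 3) N f \<and>
    (\<forall>u. \<forall>\<omega>\<in>elts V. \<forall>\<nu>\<in>elts V. f (circ_u V u \<omega> \<nu>) = b u \<omega> \<nu>)"
proof -
  interpret N: module kring N by fact
  have "\<exists>f. linear_map (sp (TV V) 3) N f \<and>
    (\<forall>v. \<forall>\<omega>\<in>elts V. \<forall>\<nu>\<in>elts V. f (circ_u V v \<omega> \<nu>) = (if v = u then b u \<omega> \<nu> else \<zero>\<^bsub>N\<^esub>))" for u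
    by (rule ex_component[OF N b])
  then obtain f where f: "\<And>u. linear_map (sp (TV V) 3) N (f u)"
    "\<And>u v \<omega> \<nu>. \<omega> \<in> elts V \<Longrightarrow> \<nu> \<in> elts V \<Longrightarrow> f u (circ_u V v \<omega> \<nu>) = (if v = u then b u \<omega> \<nu> else \<zero>\<^bsub>N\<^esub>)"
    by metis
  have bc: "b u \<omega> \<nu> \<in> carrier N" if "\<omega> \<in> elts V" "\<nu> \<in> elts V" for u \<omega> \<nu>
    using b[of u] that linear_mapD(1) by (fastforce simp: bilinear_map_def)
  let ?g = "\<lambda>x. f ShI x \<oplus>\<^bsub>N\<^esub> (f ShII x \<oplus>\<^bsub>N\<^esub> f ShIII x)"
  have "linear_map (sp (TV V) 3) N ?g"
    by (intro linear_map_add[OF T.free.vspace_sp N] f(1))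
  moreover have "?g (circ_u V u \<omega> \<nu>) = b u \<omega> \<nu>" if "\<omega> \<in> elts V" "\<nu> \<in> elts V" for u \<omega> \<nu>
    using bc[OF that] by (cases u) (simp_all add: f(2)[OF that])
  ultimately show ?thesis by (intro exI[of _ ?g]) blast
qed

lemma inner_relator:
  assumes "r \<in> ltree_relators (arity2 V) {i, j}" "a \<in> elts V" "distinct [i, j, k]" "{i, j, k} = {1, 2, 3}"
  shows "push (\<lambda>t. Node a [t, Leaf k]) r \<in> tree_ideal (arity2 V) 3"
proof -
  have three: "{1..3::nat} = {1, 2, 3}" by auto
  have "{i, j} \<union> {k} = {1..3}" unfolding three using assms(4) by auto
  then show ?thesis
    using crel.ctx[OF crel.root[OF assms(1)], of a "[]" "[Leaf k]"] assms(2,3)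
    by (intro T.crel_tree_ideal) (simp add: numeral_2_eq_2)
qed

text \<open>Linearity in the root label is a relator at the root. Linearity in the inner label is a
  relator under one context, supplied by \<open>inner_relator\<close>.\<close>

lemma circ_bilinear: "bilinear_map (vsp V) (vsp V) (sp (TV V) 3) (circ_u V u)"
proof -
  obtain i j k where ijk: "distinct [i, j, k]" "{i, j, k} = {1, 2, 3::nat}"
    "\<And>\<omega> \<nu>. shape_tree u \<omega> \<nu> = Node \<omega> [Node (\<nu> :: 'v) [Leaf i, Leaf j], Leaf k]"
  proof (cases u)
    case ShI then show ?thesis by (intro that[of 1 2 3]) auto
  next
    case ShII then show ?thesis by (intro that[of 2 3 1]) auto
  next
    case ShIII then show ?thesis by (intro that[of 3 1 2]) auto
  qed
  have three: "{1..3::nat} = {1, 2, 3}" by auto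
  have t: "Node \<omega> [Node \<nu> [Leaf i, Leaf j], Leaf k] \<in> trees (arity2 V) 3"
    if "\<omega> \<in> elts V" "\<nu> \<in> elts V" for \<omega> \<nu>
    using shape_tree_trees[OF that, of u] unfolding ijk(3) .
  have i: "Node \<nu> [Leaf i, Leaf j] \<in> ltrees (arity2 V) {i, j}" if "\<nu> \<in> elts V" for \<nu>
    using that ijk(1) by (auto simp: ltrees_def)
  show ?thesis
    unfolding bilinear_map_def
  proof (intro conjI ballI linear_mapI)
    fix \<nu> assume \<nu>: "\<nu> \<in> elts V"
    fix \<omega> assume \<omega>: "\<omega> \<in> elts V"
    show "circ_u V u \<omega> \<nu> \<in> carrier (sp (TV V) 3)" by (rule circ_u_closed[OF \<omega> \<nu>])
    show "circ_u V u (\<omega> \<oplus>\<^bsub>vsp V\<^esub> \<omega>') \<nu> = circ_u V u \<omega> \<nu> \<oplus>\<^bsub>sp (TV V) 3\<^esub> circ_u V u \<omega>' \<nu>"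
      if "\<omega>' \<in> elts V" for \<omega>'
      using T.class_Node_add[OF t[OF \<omega> \<nu>] t[OF that \<nu>]] by (simp add: circ_u_def ijk(3))
    show "circ_u V u (c \<odot>\<^bsub>vsp V\<^esub> \<omega>) \<nu> = c \<odot>\<^bsub>sp (TV V) 3\<^esub> circ_u V u \<omega> \<nu>" for c
      using T.class_Node_smult[OF t[OF \<omega> \<nu>], of c] by (simp add: circ_u_def ijk(3))
  next
    fix \<omega> assume \<omega>: "\<omega> \<in> elts V"
    fix \<nu> assume \<nu>: "\<nu> \<in> elts V"
    show "circ_u V u \<omega> \<nu> \<in> carrier (sp (TV V) 3)" by (rule circ_u_closed[OF \<omega> \<nu>])
    show "circ_u V u \<omega> (\<nu> \<oplus>\<^bsub>vsp V\<^esub> \<nu>') = circ_u V u \<omega> \<nu> \<oplus>\<^bsub>sp (TV V) 3\<^esub> circ_u V u \<omega> \<nu>'"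
      if \<nu>': "\<nu>' \<in> elts V" for \<nu>'
    proof -
      have "bas (Node \<omega> [Node (\<nu> \<oplus>\<^bsub>vsp V\<^esub> \<nu>') [Leaf i, Leaf j], Leaf k])
          - (bas (Node \<omega> [Node \<nu> [Leaf i, Leaf j], Leaf k]) + bas (Node \<omega> [Node \<nu>' [Leaf i, Leaf j], Leaf k])) \<in> tree_ideal (arity2 V) 3"
        using inner_relator[OF ltree_relators_addI[OF i[OF \<nu>] i[OF \<nu>']] \<omega> ijk(1,2)] by (simp add: push_diff push_add algebra_simps)
      then have "circ_u V u \<omega> (\<nu> \<oplus>\<^bsub>vsp V\<^esub> \<nu>')
          = clV V 3 (bas (Node \<omega> [Node \<nu> [Leaf i, Leaf j], Leaf k]) + bas (Node \<omega> [Node \<nu>' [Leaf i, Leaf j], Leaf k]))"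
        unfolding circ_u_def ijk(3) using t[OF \<omega> \<nu>] t[OF \<omega> \<nu>'] t[OF \<omega> VS.a_closed[OF \<nu> \<nu>']]
        by (intro T.class_diff_zero keys_add_subset) simp_all
      then show ?thesis
        using T.class_plus[of "bas (Node \<omega> [Node \<nu> [Leaf i, Leaf j], Leaf k])" 3 "bas (Node \<omega> [Node \<nu>' [Leaf i, Leaf j], Leaf k])"]
          t[OF \<omega> \<nu>] t[OF \<omega> \<nu>'] by (simp add: circ_u_def ijk(3))
    qed
    show "circ_u V u \<omega> (c \<odot>\<^bsub>vsp V\<^esub> \<nu>) = c \<odot>\<^bsub>sp (TV V) 3\<^esub> circ_u V u \<omega> \<nu>" for c
    proof -
      have "bas (Node \<omega> [Node (c \<odot>\<^bsub>vsp V\<^esub> \<nu>) [Leaf i, Leaf j], Leaf k])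
          - Poly_Mapping.map ((*) c) (bas (Node \<omega> [Node \<nu> [Leaf i, Leaf j], Leaf k])) \<in> tree_ideal (arity2 V) 3"
        using inner_relator[OF ltree_relators_smultI[OF i[OF \<nu>], of c] \<omega> ijk(1,2)] by (simp add: push_diff bas_def)
      then have "circ_u V u \<omega> (c \<odot>\<^bsub>vsp V\<^esub> \<nu>)
          = clV V 3 (Poly_Mapping.map ((*) c) (bas (Node \<omega> [Node \<nu> [Leaf i, Leaf j], Leaf k])))"
        unfolding circ_u_def ijk(3) using t[OF \<omega> \<nu>] t[OF \<omega> VS.smult_closed[OF _ \<nu>, of c]]
        by (intro T.class_diff_zero order.trans[OF keys_map_mult]) simp_all
      then show ?thesis
        using T.class_smult[of "bas (Node \<omega> [Node \<nu> [Leaf i, Leaf j], Leaf k])" 3 c] t[OF \<omega> \<nu>]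
        by (simp add: circ_u_def ijk(3))
    qed
  qed
qed

end

subsection \<open>The map Psi\<close>

context tensor_s2
begin

interpretation TS: s2mod "tensor_sgn V W"
  by (rule s2mod.intro[OF s2_module_tensor_sgn])

text \<open>Existence is what gives the choice in \<open>Psi\<close> a meaning. The map is built one
  factor at a time: for fixed \<omega>, \<nu> of the first factor, \<open>M\<close> extends over
  T(W)(3); then, for fixed y, \<open>F\<close> extends the bilinear map (\<omega>, \<nu>) to M u
  \<omega> \<nu> y over T(V)(3).\<close>

lemma is_Psi_Psi: "is_Psi V W (Psi V W)"
proof -
  let ?TV = "sp (TV V) 3" and ?TW = "sp (TV W) 3"
    and ?T = "sp (TV (tensor_sgn V W)) 3"
  have vT: "vspace ?T" by (rule TS.T.free.vspace_sp)
  interpret TT: module kring ?T by (rule vT)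
  define c where "c u \<omega> \<nu> \<omega>' \<nu>' = circ_u (tensor_sgn V W) u (ten V W \<omega> \<omega>') (ten V W \<nu> \<nu>')" for u \<omega> \<nu> \<omega>' \<nu>'
  note cb = TS.circ_bilinear[unfolded bilinear_map_def, simplified]
  have c1: "linear_map (vsp V) ?T (\<lambda>\<omega>. c u \<omega> \<nu> \<omega>' \<nu>')" and c2: "linear_map (vsp W) ?T (\<lambda>\<omega>'. c u \<omega> \<nu> \<omega>' \<nu>')"
    and c3: "linear_map (vsp V) ?T (\<lambda>\<nu>. c u \<omega> \<nu> \<omega>' \<nu>')" and c4: "linear_map (vsp W) ?T (\<lambda>\<nu>'. c u \<omega> \<nu> \<omega>' \<nu>')"
    if "\<omega> \<in> elts V" "\<nu> \<in> elts V" "\<omega>' \<in> elts W" "\<nu>' \<in> elts W" for u \<omega> \<nu> \<omega>' \<nu>'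
    unfolding c_def using that cb ten_closed
    by (auto intro!: linear_map_compose[OF ten_linear_left] linear_map_compose[OF ten_linear_right])
  have "\<exists>f. linear_map ?TW ?T f \<and> (\<forall>v. \<forall>\<omega>'\<in>elts W. \<forall>\<nu>'\<in>elts W.
      f (circ_u W v \<omega>' \<nu>') = (if v = u then c u \<omega> \<nu> \<omega>' \<nu>' else \<zero>\<^bsub>?T\<^esub>))"
    if "\<omega> \<in> elts V" "\<nu> \<in> elts V" for u \<omega> \<nu>
    by (rule W.ex_component[OF vT]) (use that c2 c4 in \<open>auto simp: bilinear_map_def\<close>)
  note exM = this
  define M where "M u \<omega> \<nu> = (SOME f. linear_map ?TW ?T f \<and> (\<forall>v. \<forall>\<omega>'\<in>elts W. \<forall>\<nu>'\<in>elts W.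
      f (circ_u W v \<omega>' \<nu>') = (if v = u then c u \<omega> \<nu> \<omega>' \<nu>' else \<zero>\<^bsub>?T\<^esub>)))" for u \<omega> \<nu>
  have M: "linear_map ?TW ?T (M u \<omega> \<nu>)"
    "\<And>v \<omega>' \<nu>'. \<omega>' \<in> elts W \<Longrightarrow> \<nu>' \<in> elts W \<Longrightarrow>
      M u \<omega> \<nu> (circ_u W v \<omega>' \<nu>') = (if v = u then c u \<omega> \<nu> \<omega>' \<nu>' else \<zero>\<^bsub>?T\<^esub>)"
    if "\<omega> \<in> elts V" "\<nu> \<in> elts V" for u \<omega> \<nu>
    using someI_ex[OF exM[OF that, of u]] unfolding M_def[symmetric] by blast+
  \<comment> \<open>\<open>M\<close> was chosen separately for each pair of labels. It is
    nevertheless bilinear in them, because a linear map on T(W)(3) is determined by its values on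
    the elements \<open>circ_u\<close>, where bilinearity is visible.\<close>
  have Mb: "bilinear_map (vsp V) (vsp V) ?T (\<lambda>\<omega> \<nu>. M u \<omega> \<nu> y)" if y: "y \<in> carrier ?TW" for u y
    unfolding bilinear_map_def
  proof (intro conjI ballI linear_mapI)
    fix \<nu> \<omega> assume \<nu>: "\<nu> \<in> elts V" and \<omega>: "\<omega> \<in> elts V"
    show "M u \<omega> \<nu> y \<in> carrier ?T" "M u \<omega> \<nu> y \<in> carrier ?T" using linear_mapD(1)[OF M(1)[OF \<omega> \<nu>] y] by auto
    show "M u (\<omega> \<oplus>\<^bsub>vsp V\<^esub> \<omega>') \<nu> y = M u \<omega> \<nu> y \<oplus>\<^bsub>?T\<^esub> M u \<omega>' \<nu> y" if \<omega>': "\<omega>' \<in> elts V" for \<omega>'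
      by (rule W.linear_circ_eqI[OF vT M(1) linear_map_add[OF W.T.free.vspace_sp vT M(1) M(1)] _ y])
        (use \<omega> \<omega>' \<nu> in \<open>simp_all add: M(2) linear_mapD(2)[OF c1]\<close>)
    show "M u \<omega> (\<nu> \<oplus>\<^bsub>vsp V\<^esub> \<nu>') y = M u \<omega> \<nu> y \<oplus>\<^bsub>?T\<^esub> M u \<omega> \<nu>' y" if \<nu>': "\<nu>' \<in> elts V" for \<nu>'
      by (rule W.linear_circ_eqI[OF vT M(1) linear_map_add[OF W.T.free.vspace_sp vT M(1) M(1)] _ y])
        (use \<omega> \<nu>' \<nu> in \<open>simp_all add: M(2) linear_mapD(2)[OF c3]\<close>)
    show "M u (k \<odot>\<^bsub>vsp V\<^esub> \<omega>) \<nu> y = k \<odot>\<^bsub>?T\<^esub> M u \<omega> \<nu> y" for k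
      by (rule W.linear_circ_eqI[OF vT M(1) linear_map_smult[OF vT M(1)] _ y])
        (use \<omega> \<nu> TT.smult_r_null in \<open>simp_all add: M(2) linear_mapD(3)[OF c1]\<close>)
    show "M u \<omega> (k \<odot>\<^bsub>vsp V\<^esub> \<nu>) y = k \<odot>\<^bsub>?T\<^esub> M u \<omega> \<nu> y" for k
      by (rule W.linear_circ_eqI[OF vT M(1) linear_map_smult[OF vT M(1)] _ y])
        (use \<omega> \<nu> TT.smult_r_null in \<open>simp_all add: M(2) linear_mapD(3)[OF c3]\<close>)
  qed
  have "\<exists>f. linear_map ?TV ?T f \<and> (\<forall>u. \<forall>\<omega>\<in>elts V. \<forall>\<nu>\<in>elts V. f (circ_u V u \<omega> \<nu>) = M u \<omega> \<nu> y)"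
    if "y \<in> carrier ?TW" for y
    by (rule V.ex_linear_circ[OF vT Mb[OF that]])
  note exF = this
  define F where "F y = (SOME f. linear_map ?TV ?T f \<and>
      (\<forall>u. \<forall>\<omega>\<in>elts V. \<forall>\<nu>\<in>elts V. f (circ_u V u \<omega> \<nu>) = M u \<omega> \<nu> y))" for y
  have F: "linear_map ?TV ?T (F y)"
    "\<And>u \<omega> \<nu>. \<omega> \<in> elts V \<Longrightarrow> \<nu> \<in> elts V \<Longrightarrow> F y (circ_u V u \<omega> \<nu>) = M u \<omega> \<nu> y"
    if "y \<in> carrier ?TW" for y
    using someI_ex[OF exF[OF that]] unfolding F_def[symmetric] by blast+
  interpret TW: module kring ?TW by (rule W.T.free.vspace_sp)
  have "linear_map ?TW ?T (\<lambda>y. F y x)" if x: "x \<in> carrier ?TV" for x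
  proof (rule linear_mapI)
    fix y assume y: "y \<in> carrier ?TW"
    show "F y x \<in> carrier ?T" by (rule linear_mapD(1)[OF F(1)[OF y] x])
    show "F (y \<oplus>\<^bsub>?TW\<^esub> z) x = F y x \<oplus>\<^bsub>?T\<^esub> F z x" if z: "z \<in> carrier ?TW" for z
      by (rule V.linear_circ_eqI[OF vT F(1) linear_map_add[OF V.T.free.vspace_sp vT F(1) F(1)] _ x])
        (use y z in \<open>simp_all add: F(2) linear_mapD(2)[OF M(1)]\<close>)
    show "F (k \<odot>\<^bsub>?TW\<^esub> y) x = k \<odot>\<^bsub>?T\<^esub> F y x" for k
      by (rule V.linear_circ_eqI[OF vT F(1) linear_map_smult[OF vT F(1)] _ x])
        (use y in \<open>simp_all add: F(2) linear_mapD(3)[OF M(1)]\<close>)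
  qed
  then have "is_Psi V W (\<lambda>x y. F y x)"
    unfolding is_Psi_def Let_def using F W.circ_u_closed by (auto simp: M(2) c_def simp del: arity2_simps)
  then show ?thesis
    unfolding Psi_def by (rule someI[of "is_Psi V W"])
qed

lemma Psi_linear_left: "y \<in> carrier (sp (TV W) 3) \<Longrightarrow>
    linear_map (sp (TV V) 3) (sp (TV (tensor_sgn V W)) 3) (\<lambda>x. Psi V W x y)"
  and Psi_linear_right: "x \<in> carrier (sp (TV V) 3) \<Longrightarrow>
    linear_map (sp (TV W) 3) (sp (TV (tensor_sgn V W)) 3) (\<lambda>y. Psi V W x y)"
  and Psi_circ: "\<omega> \<in> elts V \<Longrightarrow> \<nu> \<in> elts V \<Longrightarrow> \<omega>' \<in> elts W \<Longrightarrow> \<nu>' \<in> elts W \<Longrightarrow>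
    Psi V W (circ_u V u \<omega> \<nu>) (circ_u W v \<omega>' \<nu>') =
      (if u = v then circ_u (tensor_sgn V W) u (ten V W \<omega> \<omega>') (ten V W \<nu> \<nu>')
       else \<zero>\<^bsub>sp (TV (tensor_sgn V W)) 3\<^esub>)"
  using is_Psi_Psi unfolding is_Psi_def Let_def by blast+

end

subsection \<open>The action of permutations on the components\<close>

text \<open>A shape is determined by the leaf attached to the root, namely 3, 1, 2 for I, II, III.
  The action of \<sigma> sends this leaf through the inverse of \<sigma>.\<close>

definition shp :: "(nat \<Rightarrow> nat) \<Rightarrow> shape \<Rightarrow> shape" where
  "shp \<sigma> u = (let k = inv_into UNIV \<sigma> (case u of ShI \<Rightarrow> 3 | ShII \<Rightarrow> 1 | ShIII \<Rightarrow> 2) in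
     if k = 3 then ShI else if k = 1 then ShII else ShIII)"

text \<open>The three transpositions, which are the odd permutations of three letters, listed by the
  first two values of the inverse.\<close>

definition odd3 :: "(nat \<Rightarrow> nat) \<Rightarrow> bool" where
  "odd3 \<sigma> \<longleftrightarrow> inv_into UNIV \<sigma> 1 = 1 \<and> inv_into UNIV \<sigma> 2 = 3 \<or> inv_into UNIV \<sigma> 1 = 2 \<and> inv_into UNIV \<sigma> 2 = 1
     \<or> inv_into UNIV \<sigma> 1 = 3 \<and> inv_into UNIV \<sigma> 2 = 2"

lemma permutes_three_cases:
  assumes "\<sigma> permutes {1..3::nat}"
  obtains "\<sigma> 1 = 1" "\<sigma> 2 = 2" "\<sigma> 3 = 3" | "\<sigma> 1 = 2" "\<sigma> 2 = 3" "\<sigma> 3 = 1" | "\<sigma> 1 = 3" "\<sigma> 2 = 1" "\<sigma> 3 = 2"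
    | "\<sigma> 1 = 1" "\<sigma> 2 = 3" "\<sigma> 3 = 2" | "\<sigma> 1 = 2" "\<sigma> 2 = 1" "\<sigma> 3 = 3" | "\<sigma> 1 = 3" "\<sigma> 2 = 2" "\<sigma> 3 = 1"
proof -
  have three: "{1..3::nat} = {1, 2, 3}" by auto
  have "\<sigma> x \<in> {1, 2, 3}" if "x \<in> {1, 2, 3}" for x
    using permutes_in_image[OF assms, of x] that unfolding three by blast
  then have "\<sigma> 1 \<in> {1, 2, 3}" "\<sigma> 2 \<in> {1, 2, 3}" "\<sigma> 3 \<in> {1, 2, 3}" by auto
  moreover have "\<sigma> 1 \<noteq> \<sigma> 2" "\<sigma> 1 \<noteq> \<sigma> 3" "\<sigma> 2 \<noteq> \<sigma> 3"
    using permutes_inj[OF assms] by (auto simp: inj_eq)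
  ultimately show ?thesis using that by (elim insertE emptyE) simp_all
qed

lemma shp_inj: "\<sigma> permutes {1..3} \<Longrightarrow> shp \<sigma> u = shp \<sigma> v \<longleftrightarrow> u = v"
  by (rule permutes_three_cases[OF permutes_inv], assumption; cases u; cases v; simp add: shp_def)

text \<open>In each shape the inner leaves followed by the root leaf form the cyclic order 1, 2, 3.
  Even permutations preserve this order; odd ones reverse the inner pair, which costs one
  application of \<open>swp\<close> to the inner label.\<close>

lemma (in s2mod) act_circ:
  assumes \<sigma>: "\<sigma> permutes {1..3}" and \<omega>: "\<omega> \<in> elts V" and \<nu>: "\<nu> \<in> elts V"
  shows "act (TV V) 3 (circ_u V u \<omega> \<nu>) \<sigma>
    = circ_u V (shp \<sigma> u) \<omega> (if odd3 \<sigma> then swp V \<nu> else \<nu>)"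
proof -
  let ?p = "inv_into UNIV \<sigma>"
  have three: "{1..3::nat} = {1, 2, 3}" by auto
  have a: "act (TV V) 3 (circ_u V u \<omega> \<nu>) \<sigma> = clV V 3 (bas (relabel ?p (shape_tree u \<omega> \<nu>)))"
    unfolding circ_u_def using T.act_free[OF \<sigma>, of "bas (shape_tree u \<omega> \<nu>)"] shape_tree_trees[OF \<omega> \<nu>, of u] by simp
  have sw: "clV V 3 (bas (Node \<omega> [Node \<nu> [Leaf i, Leaf j], Leaf k]))
      = clV V 3 (bas (Node \<omega> [Node (swp V \<nu>) [Leaf j, Leaf i], Leaf k]))"
    if "{i, j, k} = {1, 2, 3}" "distinct [i, j, k]" for i j k
  proof -
    have "Node \<omega> [Node \<nu> [Leaf j, Leaf i], Leaf k] \<in> trees (arity2 V) 3"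
      unfolding trees_def three that(1)[symmetric] using that(2) \<omega> \<nu> by auto
    from class_swap_inner[OF this] show ?thesis by simp
  qed
  from permutes_inv[OF \<sigma>] have "clV V 3 (bas (relabel ?p (shape_tree u \<omega> \<nu>)))
    = circ_u V (shp \<sigma> u) \<omega> (if odd3 \<sigma> then swp V \<nu> else \<nu>)"
  proof (cases rule: permutes_three_cases)
    case 1 then show ?thesis by (cases u) (simp_all add: shp_def odd3_def circ_u_def)
  next
    case 2 then show ?thesis by (cases u) (simp_all add: shp_def odd3_def circ_u_def)
  next
    case 3 then show ?thesis by (cases u) (simp_all add: shp_def odd3_def circ_u_def)
  next
    case 4
    have "odd3 \<sigma>" using 4 by (simp add: odd3_def)
    then show ?thesis using 4 sw[of 1 3 2] sw[of 3 2 1] sw[of 2 1 3] by (cases u) (simp_all add: shp_def circ_u_def insert_commute)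
  next
    case 5
    have "odd3 \<sigma>" using 5 by (simp add: odd3_def)
    then show ?thesis using 5 sw[of 1 3 2] sw[of 3 2 1] sw[of 2 1 3] by (cases u) (simp_all add: shp_def circ_u_def insert_commute)
  next
    case 6
    have "odd3 \<sigma>" using 6 by (simp add: odd3_def)
    then show ?thesis using 6 sw[of 1 3 2] sw[of 3 2 1] sw[of 2 1 3] by (cases u) (simp_all add: shp_def circ_u_def insert_commute)
  qed
  then show ?thesis unfolding a .
qed

context tensor_s2
begin

interpretation TS: s2mod "tensor_sgn V W"
  by (rule s2mod.intro[OF s2_module_tensor_sgn])

text \<open>An odd permutation puts \<open>swp\<close> on the inner label of each factor. In the
  target, (12) acts on the tensor product of the inner labels with an additional minus sign, so the
  two sides differ by the sign of the permutation. Conditions that say an image lies in a subspace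
  are not affected.\<close>

lemma Psi_act:
  assumes \<sigma>: "\<sigma> permutes {1..3}" and r: "r \<in> carrier (sp (TV V) 3)" and s: "s \<in> carrier (sp (TV W) 3)"
  shows "Psi V W (act (TV V) 3 r \<sigma>) (act (TV W) 3 s \<sigma>) =
    (if odd3 \<sigma> then (-1) else 1) \<odot>\<^bsub>sp (TV (tensor_sgn V W)) 3\<^esub>
      act (TV (tensor_sgn V W)) 3 (Psi V W r s) \<sigma>"
proof -
  let ?TV = "sp (TV V) 3" and ?TW = "sp (TV W) 3"
    and ?T = "sp (TV (tensor_sgn V W)) 3"
  have vT: "vspace ?T" by (rule TS.T.free.vspace_sp)
  interpret TT: module kring ?T by (rule vT)
  note aV = V.T.free.act_linear[OF \<sigma>] and aW = W.T.free.act_linear[OF \<sigma>] and aT = TS.T.free.act_linear[OF \<sigma>]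
  let ?e = "if odd3 \<sigma> then (-1) else 1 :: 'k"
  have circ: "Psi V W (act (TV V) 3 (circ_u V u \<omega> \<nu>) \<sigma>) (act (TV W) 3 (circ_u W v \<omega>' \<nu>') \<sigma>) =
      ?e \<odot>\<^bsub>?T\<^esub> act (TV (tensor_sgn V W)) 3 (Psi V W (circ_u V u \<omega> \<nu>) (circ_u W v \<omega>' \<nu>')) \<sigma>"
    if "\<omega> \<in> elts V" "\<nu> \<in> elts V" "\<omega>' \<in> elts W" "\<nu>' \<in> elts W" for u v \<omega> \<nu> \<omega>' \<nu>'
  proof (cases "u = v")
    case False
    then show ?thesis
      using that linear_map_zero[OF vT vT aT] TT.smult_r_null[of ?e]
      by (simp add: V.act_circ[OF \<sigma>] W.act_circ[OF \<sigma>] Psi_circ shp_inj[OF \<sigma>])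
  next
    case True
    have sm: "circ_u (tensor_sgn V W) u' (ten V W \<omega> \<omega>') (\<ominus>\<^bsub>tensor (vsp V) (vsp W)\<^esub> x) = (-1) \<odot>\<^bsub>?T\<^esub> circ_u (tensor_sgn V W) u' (ten V W \<omega> \<omega>') x"
      if "x \<in> carrier (tensor (vsp V) (vsp W))" for u' x
    proof -
      have "linear_map (tensor (vsp V) (vsp W)) ?T (circ_u (tensor_sgn V W) u' (ten V W \<omega> \<omega>'))"
        using TS.circ_bilinear[of u'] ten_closed[of \<omega> \<omega>'] \<open>\<omega> \<in> _\<close> \<open>\<omega>' \<in> _\<close> by (simp add: bilinear_map_def)
      from linear_mapD(3)[OF this that, of "-1"] show ?thesis
        using smult_minus_one[OF vspace_tensor that] by simp
    qed
    \<comment> \<open>This is the origin of the sign: the diagonal action equals minus the action on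
      the space twisted by sgn.\<close>
    have neg: "ten V W (swp V \<nu>) (swp W \<nu>') = \<ominus>\<^bsub>tensor (vsp V) (vsp W)\<^esub> swp (tensor_sgn V W) (ten V W \<nu> \<nu>')"
      using that ten_closed by (simp add: swp_ten)
    show ?thesis
      using that True TS.circ_u_closed[OF _ , simplified] ten_closed linear_mapD(1)[OF swp_tensor_linear] TT.smult_one
      by (simp add: V.act_circ[OF \<sigma>] W.act_circ[OF \<sigma>] Psi_circ TS.act_circ[OF \<sigma>] neg sm)
  qed
  have 1: "Psi V W (act (TV V) 3 (circ_u V u \<omega> \<nu>) \<sigma>) (act (TV W) 3 s \<sigma>) =
      ?e \<odot>\<^bsub>?T\<^esub> act (TV (tensor_sgn V W)) 3 (Psi V W (circ_u V u \<omega> \<nu>) s) \<sigma>"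
    if "\<omega> \<in> elts V" "\<nu> \<in> elts V" for u \<omega> \<nu>
  proof (rule W.linear_circ_eqI[OF vT _ _ _ s, where f = "\<lambda>s. Psi V W (act (TV V) 3 (circ_u V u \<omega> \<nu>) \<sigma>) (act (TV W) 3 s \<sigma>)"])
    show "linear_map ?TW ?T (\<lambda>s. Psi V W (act (TV V) 3 (circ_u V u \<omega> \<nu>) \<sigma>) (act (TV W) 3 s \<sigma>))"
      by (rule linear_map_compose[OF aW Psi_linear_right]) (rule V.T.free.act_closed[OF \<sigma> V.circ_u_closed[OF that]])
    show "linear_map ?TW ?T (\<lambda>s. ?e \<odot>\<^bsub>?T\<^esub> act (TV (tensor_sgn V W)) 3 (Psi V W (circ_u V u \<omega> \<nu>) s) \<sigma>)"
      by (rule linear_map_smult[OF vT linear_map_compose[OF Psi_linear_right aT]]) (rule V.circ_u_closed[OF that])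
  qed (rule circ[OF that])
  show ?thesis
  proof (rule V.linear_circ_eqI[OF vT _ _ _ r, where f = "\<lambda>r. Psi V W (act (TV V) 3 r \<sigma>) (act (TV W) 3 s \<sigma>)"])
    show "linear_map ?TV ?T (\<lambda>r. Psi V W (act (TV V) 3 r \<sigma>) (act (TV W) 3 s \<sigma>))"
      by (rule linear_map_compose[OF aV Psi_linear_left]) (rule W.T.free.act_closed[OF \<sigma> s])
    show "linear_map ?TV ?T (\<lambda>r. ?e \<odot>\<^bsub>?T\<^esub> act (TV (tensor_sgn V W)) 3 (Psi V W r s) \<sigma>)"
      by (rule linear_map_smult[OF vT linear_map_compose[OF Psi_linear_left aT]]) (rule s)
  qed (rule 1)
qed

end

subsection \<open>PostLie\<close>

lemma s2_module_PL: "s2_module (PL :: ('k::field, plgen \<Rightarrow>\<^sub>0 'k) s2mod)"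
proof -
  let ?s = "swp (PL :: ('k, plgen \<Rightarrow>\<^sub>0 'k) s2mod)"
  have l: "lookup (?s f) Bracket = - lookup f Bracket"
    "lookup (?s f) Circ = lookup f CircOp"
    "lookup (?s f) CircOp = lookup f Circ" for f
    by (simp_all add: PL_def lookup_add lookup_single)
  have eqI: "f = g" if "lookup f Bracket = lookup g Bracket"
    "lookup f Circ = lookup g Circ"
    "lookup f CircOp = lookup g CircOp" for f g :: "plgen \<Rightarrow>\<^sub>0 'k"
    using that by (intro poly_mapping_eqI) (metis plgen.exhaust)
  have v: "vsp (PL :: ('k, plgen \<Rightarrow>\<^sub>0 'k) s2mod) = free_module UNIV" by (simp add: PL_def)
  have "linear_map (free_module UNIV) (free_module UNIV) ?s"
    by (intro linear_mapI) (auto simp: l lookup_add intro!: eqI)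
  moreover have "?s (?s f) = f" for f by (intro eqI) (simp_all add: l)
  ultimately show ?thesis using vspace_free_module by (simp add: s2_module_def v)
qed

lemma PL_simps [simp]:
  "vsp PL = free_module UNIV"
  "swp PL (bas Bracket) = - bas Bracket" "swp PL (bas Circ) = bas CircOp" "swp PL (bas CircOp) = bas Circ"
  by (simp_all add: PL_def bas_def lookup_single single_uminus)

lemma (in s2mod) smodule_hom_arity2:
  assumes "s2_module W" "linear_map (vsp V) (vsp W) g"
    and "\<And>v. v \<in> elts V \<Longrightarrow> g (swp V v) = swp W (g v)"
  shows "smodule_hom (arity2 V) (arity2 W) g"
proof -
  interpret W: s2mod W by (rule s2mod.intro[OF assms(1)])
  have z: "g \<zero>\<^bsub>vsp V\<^esub> = \<zero>\<^bsub>vsp W\<^esub>" by (rule linear_map_zero[OF vspace_vsp W.vspace_vsp assms(2)])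
  have "linear_map (zero_module (vsp V)) (zero_module (vsp W)) g"
    using z VS.smult_r_null W.VS.smult_r_null by (intro linear_mapI) auto
  then show ?thesis
    unfolding smodule_hom_def using assms(2,3) by auto
qed

context s2mod
begin

interpretation PL: s2mod "PL :: ('k, plgen \<Rightarrow>\<^sub>0 'k) s2mod"
  by (rule s2mod.intro[OF s2_module_PL])

interpretation PV: tensor_s2 "PL :: ('k, plgen \<Rightarrow>\<^sub>0 'k) s2mod" V
  by (rule tensor_s2.intro) unfold_locales

interpretation TS: s2mod "tensor_sgn (PL :: ('k, plgen \<Rightarrow>\<^sub>0 'k) s2mod) V"
  by (rule s2mod.intro[OF PV.s2_module_tensor_sgn])

interpretation H: s2mod "hat V"
  by (rule s2mod_hat)

abbreviation tens :: "plgen \<Rightarrow> 'v \<Rightarrow> ((plgen \<Rightarrow>\<^sub>0 'k) \<times> 'v \<Rightarrow>\<^sub>0 'k) set" where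
  "tens p \<omega> \<equiv> ten PL V (bas p) \<omega>"

abbreviation TM :: "('k, ((plgen \<Rightarrow>\<^sub>0 'k) \<times> 'v \<Rightarrow>\<^sub>0 'k) set) module" where
  "TM \<equiv> tensor (free_module UNIV) (vsp V)"

interpretation TM: module kring TM
  using PV.vspace_tensor by simp

text \<open>The sign in front of \<open>CircOp\<close> is forced by equivariance: (12) sends
  \<open>Prec\<close> to \<open>Succ\<close>, whereas it sends the tensor with \<open>Circ\<close>
  to minus the tensor with \<open>CircOp\<close>. The bracket needs no sign, since its antisymmetry
  cancels the sign of the twist.\<close>

definition theta :: "(tri \<Rightarrow> 'v) \<Rightarrow> ((plgen \<Rightarrow>\<^sub>0 'k) \<times> 'v \<Rightarrow>\<^sub>0 'k) set" where
  "theta h = tens Bracket (h Dot) \<oplus>\<^bsub>TM\<^esub> (tens Circ (h Prec) \<oplus>\<^bsub>TM\<^esub> (\<ominus>\<^bsub>TM\<^esub> tens CircOp (h Succ)))"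

lemma tens_closed: "\<omega> \<in> elts V \<Longrightarrow> ten PL V p \<omega> \<in> carrier TM"
  using PV.ten_closed[of p \<omega>] by simp

lemma tens_linear: "linear_map (vsp V) TM (ten PL V p)"
  using PV.ten_linear_right[of p] by simp

lemma tens_linear_left: "\<omega> \<in> elts V \<Longrightarrow> linear_map (free_module UNIV) TM (\<lambda>p. ten PL V p \<omega>)"
  using PV.ten_linear_left[of \<omega>] by simp

lemma theta_linear: "linear_map (vsp (hat V)) TM theta"
proof -
  have p: "linear_map (vsp (hat V)) (vsp V) (\<lambda>h. h d)" for d
    by (rule linear_mapI) auto
  show ?thesis
    unfolding theta_def
    using H.vspace_vsp PV.vspace_tensor
    by (intro linear_map_add linear_map_uminus linear_map_compose[OF p tens_linear]) (simp_all del: hat_simps)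
qed

lemma theta_swp: "h \<in> elts (hat V) \<Longrightarrow> theta (swp (hat V) h) = swp (tensor_sgn PL V) (theta h)"
proof -
  assume h: "h \<in> elts (hat V)"
  let ?s = "swp (tensor_sgn PL V)"
  have s: "linear_map TM TM ?s" using PV.swp_tensor_linear by simp
  have vT: "vspace TM" using PV.vspace_tensor by simp
  have neg: "ten PL V (- bas Bracket) \<omega> = \<ominus>\<^bsub>TM\<^esub> tens Bracket \<omega>" if "\<omega> \<in> elts V" for \<omega>
    using linear_map_minus(1)[OF vspace_free_module vT tens_linear_left[OF that], of "bas Bracket"] by simp
  have 1: "?s (tens Bracket \<omega>) = tens Bracket (swp V \<omega>)" "?s (tens Circ \<omega>) = \<ominus>\<^bsub>TM\<^esub> tens CircOp (swp V \<omega>)"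
    "?s (\<ominus>\<^bsub>TM\<^esub> tens CircOp \<omega>) = tens Circ (swp V \<omega>)" if "\<omega> \<in> elts V" for \<omega>
    using that PV.swp_ten[of _ \<omega>] tens_closed linear_map_minus(1)[OF vT vT s]
    by (simp_all add: neg)
  have "?s (theta h) = tens Bracket (swp V (h Dot)) \<oplus>\<^bsub>TM\<^esub> (\<ominus>\<^bsub>TM\<^esub> tens CircOp (swp V (h Prec)) \<oplus>\<^bsub>TM\<^esub> tens Circ (swp V (h Succ)))"
    unfolding theta_def using h tens_closed by (simp add: linear_mapD(2)[OF s] 1)
  then show ?thesis
    unfolding theta_def using h tens_closed by (simp add: TM.a_ac)
qed

text \<open>The generators of PostLie have three basis elements, so tensoring with V gives three
  copies of V. The coordinates are the coefficients of p, with the sign of \<open>theta\<close> at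
  \<open>CircOp\<close>.\<close>

lemma ex_theta_inverse:
  "\<exists>\<psi>. linear_map TM (vsp (hat V)) \<psi> \<and> (\<forall>p. \<forall>\<omega>\<in>elts V. \<psi> (ten PL V p \<omega>) =
    (\<lambda>d. case d of Prec \<Rightarrow> lookup p Circ \<odot>\<^bsub>vsp V\<^esub> \<omega> | Succ \<Rightarrow> (- lookup p CircOp) \<odot>\<^bsub>vsp V\<^esub> \<omega>
      | Dot \<Rightarrow> lookup p Bracket \<odot>\<^bsub>vsp V\<^esub> \<omega>))"
proof -
  let ?b = "\<lambda>p \<omega> d. case d of Prec \<Rightarrow> lookup p Circ \<odot>\<^bsub>vsp V\<^esub> \<omega> | Succ \<Rightarrow> (- lookup p CircOp) \<odot>\<^bsub>vsp V\<^esub> \<omega>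
      | Dot \<Rightarrow> lookup p Bracket \<odot>\<^bsub>vsp V\<^esub> \<omega>"
  have m: "(- (c + d)) \<odot>\<^bsub>vsp V\<^esub> y = (- c) \<odot>\<^bsub>vsp V\<^esub> y \<oplus>\<^bsub>vsp V\<^esub> (- d) \<odot>\<^bsub>vsp V\<^esub> y"
    if "y \<in> elts V" for c d y
    using VS.smult_l_distr[of "- c" "- d" y] that by simp
  have "bilinear_map (vsp PL) (vsp V) (vsp (hat V)) ?b"
    unfolding bilinear_map_def
    by (intro conjI ballI linear_mapI)
      (auto simp: m tri_all lookup_add VS.smult_r_distr VS.smult_l_distr[simplified] VS.smult_assoc1[simplified, symmetric] mult.commute
        intro!: tri_eqI simp flip: minus_add_distrib split: tri.splits)
  from PV.tensor_universal[OF H.vspace_vsp this] show ?thesis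
    by (simp add: PV.ten_eq del: hat_simps)
qed

text \<open>Compatibility with (12) is not computed for \<psi> directly but inherited from its
  inverse \<open>theta\<close>, for which it was checked on formulas.\<close>

lemma ex_psi:
  obtains \<psi> where "linear_map TM (vsp (hat V)) \<psi>"
    "\<And>\<omega>. \<omega> \<in> elts V \<Longrightarrow> \<psi> (tens Bracket \<omega>) = dec V \<omega> Dot"
    "\<And>\<omega>. \<omega> \<in> elts V \<Longrightarrow> \<psi> (tens Circ \<omega>) = dec V \<omega> Prec"
    "\<And>\<omega>. \<omega> \<in> elts V \<Longrightarrow> \<psi> (tens CircOp \<omega>) = \<ominus>\<^bsub>vsp (hat V)\<^esub> dec V \<omega> Succ"
    "\<And>h. h \<in> elts (hat V) \<Longrightarrow> \<psi> (theta h) = h"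
    "\<And>z. z \<in> carrier TM \<Longrightarrow> theta (\<psi> z) = z"
    "\<And>z. z \<in> carrier TM \<Longrightarrow> \<psi> (swp (tensor_sgn PL V) z) = swp (hat V) (\<psi> z)"
proof -
  have vT: "vspace TM" using PV.vspace_tensor by simp
  obtain \<psi> where \<psi>: "linear_map TM (vsp (hat V)) \<psi>"
    "\<And>p \<omega>. \<omega> \<in> elts V \<Longrightarrow> \<psi> (ten PL V p \<omega>) =
    (\<lambda>d. case d of Prec \<Rightarrow> lookup p Circ \<odot>\<^bsub>vsp V\<^esub> \<omega> | Succ \<Rightarrow> (- lookup p CircOp) \<odot>\<^bsub>vsp V\<^esub> \<omega>
      | Dot \<Rightarrow> lookup p Bracket \<odot>\<^bsub>vsp V\<^esub> \<omega>)"
    using ex_theta_inverse by blast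
  note D = linear_mapD[OF \<psi>(1)]
  have uh: "\<ominus>\<^bsub>vsp (hat V)\<^esub> h = (\<lambda>d. \<ominus>\<^bsub>vsp V\<^esub> h d)" if "h \<in> elts (hat V)" for h
    using smult_minus_one[OF H.vspace_vsp that] smult_minus_one[OF vspace_vsp] that by auto
  have mm: "(- 1) \<odot>\<^bsub>vsp V\<^esub> \<omega> = \<ominus>\<^bsub>vsp V\<^esub> \<omega>" if "\<omega> \<in> elts V" for \<omega>
    using smult_minus_one[OF vspace_vsp that] .
  have mz: "\<ominus>\<^bsub>vsp V\<^esub> \<zero>\<^bsub>vsp V\<^esub> = \<zero>\<^bsub>vsp V\<^esub>"
    using mm[of "\<zero>\<^bsub>vsp V\<^esub>"] VS.smult_r_null[of "-1"] by simp
  note sm = VS.smult_l_null[simplified] VS.smult_one[simplified]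
  have p: "\<psi> (tens Bracket \<omega>) = dec V \<omega> Dot" "\<psi> (tens Circ \<omega>) = dec V \<omega> Prec"
    "\<psi> (tens CircOp \<omega>) = \<ominus>\<^bsub>vsp (hat V)\<^esub> dec V \<omega> Succ" if "\<omega> \<in> elts V" for \<omega>
    using that by (auto simp: \<psi>(2) bas_def lookup_single dec_def sm mm mz uh intro!: tri_eqI)
  have p1: "\<psi> (theta h) = h" if h: "h \<in> elts (hat V)" for h
  proof -
    have "\<psi> (\<ominus>\<^bsub>TM\<^esub> tens CircOp (h Succ)) = dec V (h Succ) Succ"
      using linear_map_minus(1)[OF vT H.vspace_vsp \<psi>(1) tens_closed] h p(3)
      by (simp add: uh del: hat_simps(2-4))
    then have "\<psi> (theta h) = dec V (h Dot) Dot \<oplus>\<^bsub>vsp (hat V)\<^esub> (dec V (h Prec) Prec \<oplus>\<^bsub>vsp (hat V)\<^esub> dec V (h Succ) Succ)"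
      unfolding theta_def using h tens_closed by (simp add: D(2) p del: hat_simps(3))
    then show ?thesis using h by (auto simp: dec_def intro!: tri_eqI)
  qed
  have p2: "theta (\<psi> z) = z" if z: "z \<in> carrier TM" for z
  proof -
    have "theta (\<psi> (ten PL V p \<omega>)) = ten PL V p \<omega>" if \<omega>: "\<omega> \<in> elts V" for p \<omega>
    proof -
      let ?l = "lookup p" and ?m = "\<lambda>c x. Poly_Mapping.map ((*) c) (bas x)"
      note L = linear_mapD[OF tens_linear_left[OF \<omega>], simplified] and R = linear_mapD[OF tens_linear]
      have pe: "p = ?m (?l Bracket) Bracket + (?m (?l Circ) Circ + ?m (?l CircOp) CircOp)"
      proof (rule poly_mapping_eqI)
        show "?l k = lookup (?m (?l Bracket) Bracket + (?m (?l Circ) Circ + ?m (?l CircOp) CircOp)) k" for k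
          by (cases k) (simp_all add: lookup_add bas_def lookup_single)
      qed
      have "theta (\<psi> (ten PL V p \<omega>)) = ?l Bracket \<odot>\<^bsub>TM\<^esub> tens Bracket \<omega> \<oplus>\<^bsub>TM\<^esub>
          (?l Circ \<odot>\<^bsub>TM\<^esub> tens Circ \<omega> \<oplus>\<^bsub>TM\<^esub> \<ominus>\<^bsub>TM\<^esub> ((- ?l CircOp) \<odot>\<^bsub>TM\<^esub> tens CircOp \<omega>))"
        unfolding theta_def \<psi>(2)[OF \<omega>] using \<omega> by (simp add: R(3))
      also have "\<ominus>\<^bsub>TM\<^esub> ((- ?l CircOp) \<odot>\<^bsub>TM\<^esub> tens CircOp \<omega>) = ?l CircOp \<odot>\<^bsub>TM\<^esub> tens CircOp \<omega>"
        using smult_minus_one[OF vT, of "(- ?l CircOp) \<odot>\<^bsub>TM\<^esub> tens CircOp \<omega>"] tens_closed[OF \<omega>]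
          TM.smult_assoc1[of "-1" "- ?l CircOp" "tens CircOp \<omega>"] by simp
      also have "?l Bracket \<odot>\<^bsub>TM\<^esub> tens Bracket \<omega> \<oplus>\<^bsub>TM\<^esub> (?l Circ \<odot>\<^bsub>TM\<^esub> tens Circ \<omega> \<oplus>\<^bsub>TM\<^esub> ?l CircOp \<odot>\<^bsub>TM\<^esub> tens CircOp \<omega>)
          = ten PL V (?m (?l Bracket) Bracket + (?m (?l Circ) Circ + ?m (?l CircOp) CircOp)) \<omega>"
        by (simp only: L)
      finally show ?thesis unfolding pe[symmetric] .
    qed
    then show ?thesis
      using PV.tensor_linear_eqI[OF vT, where f = "\<lambda>z. theta (\<psi> z)" and g = "\<lambda>z. z" and z = z]
        linear_map_compose[OF \<psi>(1) theta_linear] linear_map_id[of TM] z by (simp add: PV.ten_eq)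
  qed
  have "\<psi> (swp (tensor_sgn PL V) z) = swp (hat V) (\<psi> z)" if z: "z \<in> carrier TM" for z
  proof -
    have c: "\<psi> z \<in> elts (hat V)" by (rule D(1)[OF z])
    have "swp (tensor_sgn PL V) z = theta (swp (hat V) (\<psi> z))"
      using theta_swp[OF c] p2[OF z] by simp
    then show ?thesis using p1[OF H.swp_closed[OF c]] by simp
  qed
  then show ?thesis using that[OF \<psi>(1) p p1 p2] by blast
qed

lemma quad_quotient:
  assumes "R \<subseteq> carrier (sp (TV V) 3)"
  shows "operad_quotient (TV V) (quad_ideal V R)"
  unfolding quad_ideal_def
  by (intro operad_quotient.intro operad_quotient_axioms.intro T.free.operad_axioms operad_ideal_gen_ideal)
    (use assms in auto)

text \<open>\<Psi> is known only on the elements \<open>circ_u\<close>, so the defining relations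
  are brought into that form. A leaf to the left of the root and a reversed inner pair are moved
  into position by \<open>swp\<close>, which exchanges \<open>Circ\<close> with
  \<open>CircOp\<close> and negates \<open>Bracket\<close>; thus -[x, y \<circ> z] turns into
  +[y \<circ> z, x].\<close>

lemma PL_relators:
  fixes J :: "nat set"
  defines "x \<equiv> Leaf 1" and "y \<equiv> Leaf 2" and "z \<equiv> Leaf 3"
  shows "clV PL 3 (bas (pl_br (pl_br x y) z) + bas (pl_br (pl_br z x) y) + bas (pl_br (pl_br y z) x)
      :: (plgen \<Rightarrow>\<^sub>0 'k) ltree \<Rightarrow>\<^sub>0 'k) =
    circ_u PL ShI (bas Bracket) (bas Bracket) \<oplus>\<^bsub>sp (TV PL) 3\<^esub> circ_u PL ShIII (bas Bracket) (bas Bracket)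
      \<oplus>\<^bsub>sp (TV PL) 3\<^esub> circ_u PL ShII (bas Bracket) (bas Bracket)" (is ?A)
    "clV PL 3 (bas (pl_circ (pl_circ x y) z) - bas (pl_circ x (pl_circ y z))
         - bas (pl_circ (pl_circ x z) y) + bas (pl_circ x (pl_circ z y)) - bas (pl_circ x (pl_br y z))
      :: (plgen \<Rightarrow>\<^sub>0 'k) ltree \<Rightarrow>\<^sub>0 'k) =
    circ_u PL ShI (bas Circ) (bas Circ) \<ominus>\<^bsub>sp (TV PL) 3\<^esub> circ_u PL ShII (bas CircOp) (bas Circ)
      \<ominus>\<^bsub>sp (TV PL) 3\<^esub> circ_u PL ShIII (bas Circ) (bas CircOp)
      \<oplus>\<^bsub>sp (TV PL) 3\<^esub> circ_u PL ShII (bas CircOp) (bas CircOp)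
      \<ominus>\<^bsub>sp (TV PL) 3\<^esub> circ_u PL ShII (bas CircOp) (bas Bracket)" (is ?B)
    "clV PL 3 (bas (pl_circ (pl_br x y) z) - bas (pl_br (pl_circ x z) y) - bas (pl_br x (pl_circ y z))
      :: (plgen \<Rightarrow>\<^sub>0 'k) ltree \<Rightarrow>\<^sub>0 'k) =
    circ_u PL ShI (bas Circ) (bas Bracket) \<ominus>\<^bsub>sp (TV PL) 3\<^esub> circ_u PL ShIII (bas Bracket) (bas CircOp)
      \<oplus>\<^bsub>sp (TV PL) 3\<^esub> circ_u PL ShII (bas Bracket) (bas Circ)" (is ?C)
proof -
  let ?T = "sp (TV (PL :: ('k, plgen \<Rightarrow>\<^sub>0 'k) s2mod)) 3"
  let ?cl = "\<lambda>t :: (plgen \<Rightarrow>\<^sub>0 'k) ltree. clV PL 3 (bas t)"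
  interpret TT: module kring ?T by (rule PL.T.free.vspace_sp)
  have three: "{1..3::nat} = {1, 2, 3}" by auto
  have tr: "Node a [Node c [Leaf i, Leaf j], Leaf k] \<in> trees (arity2 PL) 3"
    "Node a [Leaf k, Node c [Leaf i, Leaf j]] \<in> trees (arity2 PL) 3"
    if "{i, j, k} = {1, 2, 3}" "distinct [i, j, k]" for a c :: "plgen \<Rightarrow>\<^sub>0 'k" and i j k
    unfolding trees_def three using that by (auto simp: insert_commute)
  have root: "?cl (Node a [Leaf k, Node c [Leaf i, Leaf j]]) = ?cl (Node (swp PL a) [Node c [Leaf i, Leaf j], Leaf k])"
    if "{i, j, k} = {1, 2, 3}" "distinct [i, j, k]" for a c :: "plgen \<Rightarrow>\<^sub>0 'k" and i j k
    by (rule PL.class_swap[symmetric]) (use tr(1)[OF that] in \<open>simp add: trees_def; blast\<close>)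
  have inner: "?cl (Node a [Node c [Leaf j, Leaf i], Leaf k]) = ?cl (Node a [Node (swp PL c) [Leaf i, Leaf j], Leaf k])"
    if "{i, j, k} = {1, 2, 3}" "distinct [i, j, k]" for a c :: "plgen \<Rightarrow>\<^sub>0 'k" and i j k
    by (rule PL.class_swap_inner[symmetric]) (rule tr(1)[OF that])
  have k: "keys (bas t :: _ \<Rightarrow>\<^sub>0 'k) \<subseteq> trees (arity2 PL) 3" if "t \<in> trees (arity2 PL) 3" for t
    using that by simp
  note T = k[OF tr(1)] k[OF tr(2)]
  have neg: "circ_u PL ShII (- bas Bracket) (bas Circ) = \<ominus>\<^bsub>?T\<^esub> circ_u PL ShII (bas Bracket) (bas Circ)"
  proof -
    have "linear_map (free_module UNIV) ?T (\<lambda>p. circ_u PL ShII p (bas Circ))"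
      using PL.circ_bilinear[of ShII] by (simp add: bilinear_map_def)
    from linear_map_minus(1)[OF vspace_free_module PL.T.free.vspace_sp this, of "bas Bracket"] show ?thesis by simp
  qed
  have cc: "circ_u PL u a c \<in> carrier ?T" for u a c using PL.circ_u_closed[of a c u] by simp
  show ?A
    unfolding x_def y_def z_def pl_br_def
    by (subst PL.T.class_plus, (intro keys_add_subset T; auto)+)+ (simp add: circ_u_def)
  show ?B
    unfolding x_def y_def z_def pl_br_def pl_circ_def
    apply (subst PL.T.class_minus(1), (intro keys_diff_subset keys_add_subset T; auto)+)
    apply (subst PL.T.class_plus, (intro keys_diff_subset keys_add_subset T; auto)+)
    apply (subst PL.T.class_minus(1), (intro keys_diff_subset keys_add_subset T; auto)+)
    apply (subst PL.T.class_minus(1), (intro keys_diff_subset keys_add_subset T; auto)+)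
    using root[of 2 3 1 "bas Circ" "bas Circ"] root[of 3 2 1 "bas Circ" "bas Circ"] root[of 2 3 1 "bas Circ" "bas Bracket"]
      inner[of 2 3 1 "bas CircOp" "bas Circ"] inner[of 3 1 2 "bas Circ" "bas Circ"]
    by (simp add: circ_u_def insert_commute)
  show ?C
    unfolding x_def y_def z_def pl_br_def pl_circ_def
    apply (subst PL.T.class_minus(1), (intro keys_diff_subset keys_add_subset T; auto)+)
    apply (subst PL.T.class_minus(1), (intro keys_diff_subset keys_add_subset T; auto)+)
    using root[of 2 3 1 "bas Bracket" "bas Circ"] inner[of 3 1 2 "bas Bracket" "bas Circ"] neg cc[of ShII "bas Bracket" "bas Circ"]
    by (simp add: circ_u_def insert_commute a_minus_def)
qed

end

section \<open>The isomorphism of the black product with the trisuccessor\<close>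

lemma vs_ker_submoduleI:
  assumes "vspace M" "vspace N" "\<And>s. s \<in> S \<Longrightarrow> linear_map M N (h s)" "submodule K kring N"
  shows "submodule {x \<in> carrier M. \<forall>s\<in>S. h s x \<in> K} kring M"
proof -
  interpret M: module kring M by fact
  note K = vspace_submoduleD[OF assms(2,4)]
  show ?thesis
    using K(2-4) linear_mapD[OF assms(3)] linear_map_zero[OF assms(1,2) assms(3)]
    by (intro vspace_submoduleI[OF assms(1)]) auto
qed

text \<open>The symmetric group is transitive on subsets of a given size, and for three letters a
  transposition, possibly trivial, reaches every nonempty J from {1}, {1,2} or {1,2,3}.\<close>

lemma permutes_image_three:
  assumes "J \<noteq> {}" "J \<subseteq> {1, 2, 3::nat}"
  obtains \<sigma> J0 where "\<sigma> permutes {1..3}" "J0 \<in> {{1}, {1, 2}, {1, 2, 3}}" "J = inv_into UNIV \<sigma> ` J0"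
proof -
  note witness = that
  have t: "transpose a b permutes {1..3}" "inv_into UNIV (transpose a b) = transpose a b" if "a \<in> {1..3}" "b \<in> {1..3}" for a b :: nat
    using permutes_swap_id[OF that] by auto
  have t: thesis if ab: "a \<in> {1..3}" "b \<in> {1..3}" "J = transpose a b ` J0" "J0 \<in> {{1}, {1, 2}, {1, 2, 3}}" for a b :: nat and J0
    using t[OF ab(1,2)] ab(3,4) by (intro witness[of "transpose a b" J0]) simp_all
  have "J \<in> Pow {1, 2, 3}" using assms by blast
  then have "J \<in> {{1}, {2}, {3}, {1, 2}, {1, 3}, {2, 3}, {1, 2, 3}}"
    using assms(1) by (auto simp: Pow_insert)
  then consider "J = {1}" | "J = {2}" | "J = {3}" | "J = {1, 2}" | "J = {1, 3}" | "J = {2, 3}" | "J = {1, 2, 3}" by auto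
  then show ?thesis
  proof cases
    case 1 then show ?thesis by (intro t[of 1 1 "{1}"]) auto
  next
    case 2 then show ?thesis by (intro t[of 1 2 "{1}"]) auto
  next
    case 3 then show ?thesis by (intro t[of 1 3 "{1}"]) auto
  next
    case 4 then show ?thesis by (intro t[of 1 1 "{1, 2}"]) auto
  next
    case 5 then show ?thesis by (intro t[of 2 3 "{1, 2}"]) (auto simp: transpose_def)
  next
    case 6 then show ?thesis by (intro t[of 1 3 "{1, 2}"]) (auto simp: transpose_def)
  next
    case 7 then show ?thesis by (intro t[of 1 1 "{1, 2, 3}"]) auto
  qed
qed

context s2mod
begin

interpretation PL: s2mod "PL :: ('k, plgen \<Rightarrow>\<^sub>0 'k) s2mod"
  by (rule s2mod.intro[OF s2_module_PL])

interpretation PV: tensor_s2 "PL :: ('k, plgen \<Rightarrow>\<^sub>0 'k) s2mod" V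
  by (rule tensor_s2.intro) unfold_locales

interpretation TS: s2mod "tensor_sgn (PL :: ('k, plgen \<Rightarrow>\<^sub>0 'k) s2mod) V"
  by (rule s2mod.intro[OF PV.s2_module_tensor_sgn])

interpretation H: s2mod "hat V"
  by (rule s2mod_hat)

interpretation TM: module kring TM
  using PV.vspace_tensor by simp

lemma shape_eval:
  assumes f: "\<And>n x. keys x \<subseteq> trees (arity2 (tensor_sgn PL V)) n \<Longrightarrow>
      f n (clV (tensor_sgn PL V) n x) = clV (hat V) n (push (map_labels \<psi>) x)"
    and "a \<in> carrier TM" "b \<in> carrier TM"
  shows "f 3 (circ_u (tensor_sgn PL V) u a b) = circ_u (hat V) u (\<psi> a) (\<psi> b)"
  using f[of "bas (shape_tree u a b)" 3] TS.shape_tree_trees[of a b u] assms(2,3)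
  unfolding circ_u_def by (cases u) auto

lemma TSu_circ:
  assumes "\<omega> \<in> elts V" "\<nu> \<in> elts V"
  shows "TSu_map V 3 J (circ_u V u \<omega> \<nu>) = clV (hat V) 3 (bas (tsu_tree V J (shape_tree u \<omega> \<nu>)))"
  unfolding circ_u_def using TSu_map_class[of "bas (shape_tree u \<omega> \<nu>)" 3 J] shape_tree_trees[OF assms, of u] by simp

text \<open>The maps \<psi> and \<open>theta\<close> extend to mutually inverse morphisms f and g of
  free operads, so it remains to carry the ideals into each other. For f, the elements r with
  f(\<Psi>(r, s)) in the ideal for all s form a submodule stable under permutations, which contains
  the three defining relations. For g, a relation TSu_J(r) is, up to a permutation, the f-image of
  some \<Psi>(q, r') with q a defining relation.\<close>

lemma black_product_TSu_iso:
  assumes R: "s3_submodule V R"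
  shows "\<exists>\<phi>. operad_iso (black_product PL PL_rel V R) (TSu V R) \<phi> \<and>
    (\<forall>\<omega>\<in>elts V.
       \<phi> 2 (black_gen PL PL_rel V R (bas Bracket) \<omega>) = TSu_gen V R \<omega> Dot \<and>
       \<phi> 2 (black_gen PL PL_rel V R (bas Circ) \<omega>) = TSu_gen V R \<omega> Prec)"
proof -
  let ?W = "tensor_sgn (PL :: ('k, plgen \<Rightarrow>\<^sub>0 'k) s2mod) V"
  let ?FP = "TV (PL :: ('k, plgen \<Rightarrow>\<^sub>0 'k) s2mod)" and ?FV = "TV V"
    and ?FW = "TV ?W" and ?FH = "TV (hat V)"
  let ?PLrel = "PL_rel :: ('k, plgen \<Rightarrow>\<^sub>0 'k) free_elem set"
  let ?B = "black_rel PL ?PLrel V R"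
  let ?IB = "quad_ideal ?W ?B" and ?IT = "quad_ideal (hat V) (TSu_rel V R)"
  obtain \<psi> where \<psi>: "linear_map TM (vsp (hat V)) \<psi>"
    "\<And>\<omega>. \<omega> \<in> elts V \<Longrightarrow> \<psi> (tens Bracket \<omega>) = dec V \<omega> Dot"
    "\<And>\<omega>. \<omega> \<in> elts V \<Longrightarrow> \<psi> (tens Circ \<omega>) = dec V \<omega> Prec"
    "\<And>\<omega>. \<omega> \<in> elts V \<Longrightarrow> \<psi> (tens CircOp \<omega>) = \<ominus>\<^bsub>vsp (hat V)\<^esub> dec V \<omega> Succ"
    "\<And>h. h \<in> elts (hat V) \<Longrightarrow> \<psi> (theta h) = h"
    "\<And>z. z \<in> carrier TM \<Longrightarrow> theta (\<psi> z) = z"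
    "\<And>z. z \<in> carrier TM \<Longrightarrow> \<psi> (swp (tensor_sgn PL V) z) = swp (hat V) (\<psi> z)"
    using ex_psi by blast
  have \<psi>h: "smodule_hom (arity2 ?W) (arity2 (hat V)) \<psi>"
    by (rule TS.smodule_hom_arity2[OF s2_module_hat]) (use \<psi>(1,7) in \<open>simp_all del: hat_simps\<close>)
  have \<theta>h: "smodule_hom (arity2 (hat V)) (arity2 ?W) theta"
    by (rule H.smodule_hom_arity2[OF PV.s2_module_tensor_sgn]) (use theta_linear theta_swp in \<open>simp_all del: hat_simps\<close>)
  obtain f where f: "operad_hom ?FW ?FH f"
    "\<And>n x. keys x \<subseteq> trees (arity2 ?W) n \<Longrightarrow> f n (clV ?W n x) = clV (hat V) n (push (map_labels \<psi>) x)"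
    using smodule_hom_free[OF TS.smodule_arity2 H.smodule_arity2 \<psi>h] by blast
  obtain g where g: "operad_hom ?FH ?FW g"
    "\<And>n x. keys x \<subseteq> trees (arity2 (hat V)) n \<Longrightarrow> g n (clV (hat V) n x) = clV ?W n (push (map_labels theta) x)"
    using smodule_hom_free[OF H.smodule_arity2 TS.smodule_arity2 \<theta>h] by blast
  interpret f: operad_hom ?FW ?FH f by (rule f(1))
  interpret g: operad_hom ?FH ?FW g by (rule g(1))
  have \<psi>n: "\<psi> x \<in> carrier (sp (arity2 (hat V)) n)" if "x \<in> carrier (sp (arity2 ?W) n)" for n x
    using \<psi>h that linear_mapD(1) by (fastforce simp: smodule_hom_def simp del: arity2_simps hat_simps)
  have \<theta>n: "theta x \<in> carrier (sp (arity2 ?W) n)" if "x \<in> carrier (sp (arity2 (hat V)) n)" for n x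
    using \<theta>h that linear_mapD(1) by (fastforce simp: smodule_hom_def simp del: arity2_simps hat_simps)
  have z0: "\<psi> \<zero>\<^bsub>TM\<^esub> = \<zero>\<^bsub>vsp (hat V)\<^esub>"
    using linear_map_zero[OF _ H.vspace_vsp \<psi>(1)] PV.vspace_tensor by simp
  have t0: "theta \<zero>\<^bsub>vsp (hat V)\<^esub> = \<zero>\<^bsub>TM\<^esub>"
    using linear_map_zero[OF H.vspace_vsp _ theta_linear] PV.vspace_tensor by simp
  have \<psi>\<theta>: "theta (\<psi> x) = x" if "x \<in> carrier (sp (arity2 ?W) n)" for x n
    using that z0 t0 \<psi>(6) by (cases "n = 2") (auto simp del: hat_simps)
  have \<theta>\<psi>: "\<psi> (theta x) = x" if "x \<in> carrier (sp (arity2 (hat V)) n)" for x n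
    using that z0 t0 \<psi>(5) by (cases "n = 2") (auto simp del: hat_simps)
  \<comment> \<open>The two label maps are inverse to each other only on admissible labels; outside
    arity two this means on the zero label, which both preserve.\<close>
  have m1: "map_labels theta (map_labels \<psi> t) = t" if "labelled_by (arity2 ?W) t" for t
    using that \<psi>\<theta> by (induction t) (auto simp: list_all_iff intro!: map_idI simp del: arity2_simps)
  have m2: "map_labels \<psi> (map_labels theta t) = t" if "labelled_by (arity2 (hat V)) t" for t
    using that \<theta>\<psi> by (induction t) (auto simp: list_all_iff intro!: map_idI simp del: arity2_simps hat_simps)
  have t\<psi>: "map_labels \<psi> t \<in> trees (arity2 (hat V)) n" if "t \<in> trees (arity2 ?W) n" for t n
    using map_labels_ltrees[of "arity2 ?W" \<psi> "arity2 (hat V)" t "{1..n}"] \<psi>n that by (simp only: trees_ltrees)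
  have t\<theta>: "map_labels theta t \<in> trees (arity2 ?W) n" if "t \<in> trees (arity2 (hat V)) n" for t n
    using map_labels_ltrees[of "arity2 (hat V)" theta "arity2 ?W" t "{1..n}"] \<theta>n that by (simp only: trees_ltrees)
  have gf: "g n (f n x) = x" if x: "x \<in> carrier (sp ?FW n)" for n x
  proof -
    obtain y where y: "keys y \<subseteq> trees (arity2 ?W) n" "x = clV ?W n y"
      using x unfolding TS.T.carrier_free by blast
    have k: "keys (push (map_labels \<psi>) y) \<subseteq> trees (arity2 (hat V)) n"
      using keys_push[of "map_labels \<psi>" y] y(1) t\<psi> by blast
    have "push (map_labels theta) (push (map_labels \<psi>) y) = y"
      unfolding push_push by (rule push_ident) (use m1 y(1) in \<open>auto simp: trees_def simp del: arity2_simps\<close>)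
    then show ?thesis unfolding y(2) f(2)[OF y(1)] g(2)[OF k] by simp
  qed
  have fg: "f n (g n x) = x" if x: "x \<in> carrier (sp ?FH n)" for n x
  proof -
    obtain y where y: "keys y \<subseteq> trees (arity2 (hat V)) n" "x = clV (hat V) n y"
      using x unfolding H.T.carrier_free by blast
    have k: "keys (push (map_labels theta) y) \<subseteq> trees (arity2 ?W) n"
      using keys_push[of "map_labels theta" y] y(1) t\<theta> by blast
    have "push (map_labels \<psi>) (push (map_labels theta) y) = y"
      unfolding push_push by (rule push_ident) (use m2 y(1) in \<open>auto simp: trees_def simp del: arity2_simps hat_simps\<close>)
    then show ?thesis unfolding y(2) g(2)[OF y(1)] f(2)[OF k] by simp
  qed
  have Rsub: "submodule R kring (sp ?FV 3)" and Ract: "\<And>\<sigma> r. \<sigma> permutes {1..3} \<Longrightarrow> r \<in> R \<Longrightarrow> act ?FV 3 r \<sigma> \<in> R"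
    using R by (auto simp: s3_submodule_def)
  have Rc: "r \<in> carrier (sp ?FV 3)" if "r \<in> R" for r
    using that vspace_submoduleD(1)[OF T.free.vspace_sp Rsub] by blast
  have TSuc: "TSu_rel V R \<subseteq> carrier (sp ?FH 3)"
    unfolding TSu_rel_def using linear_mapD(1)[OF TSu_map_linear Rc] by blast
  interpret QT: operad_quotient ?FH ?IT by (rule H.quad_quotient[OF TSuc])
  have TSuI: "TSu_map V 3 J r \<in> ?IT 3" if "r \<in> R" "J \<noteq> {}" "J \<subseteq> {1, 2, 3}" for J r
    unfolding quad_ideal_def by (rule subsetD[OF gen_ideal_superset]) (use that in \<open>auto simp: TSu_rel_def\<close>)
  let ?N = "sp ?FH 3"
  interpret N: module kring ?N by (rule H.T.free.vspace_sp)
  have Psi_f: "linear_map (sp ?FP 3) ?N (\<lambda>r. f 3 (Psi PL V r s))" if "s \<in> carrier (sp ?FV 3)" for s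
    by (rule linear_map_compose[OF PV.Psi_linear_left[OF that] f.hom_linear])
  have Psi_f2: "linear_map (sp ?FV 3) ?N (\<lambda>s. f 3 (Psi PL V r s))" if "r \<in> carrier (sp ?FP 3)" for r
    by (rule linear_map_compose[OF PV.Psi_linear_right[OF that] f.hom_linear])
  let ?r1 = "clV PL 3 (bas (pl_br (pl_br (Leaf 1) (Leaf 2)) (Leaf 3)) + bas (pl_br (pl_br (Leaf 3) (Leaf 1)) (Leaf 2))
      + bas (pl_br (pl_br (Leaf 2) (Leaf 3)) (Leaf 1)) :: (plgen \<Rightarrow>\<^sub>0 'k) ltree \<Rightarrow>\<^sub>0 'k)"
  let ?r2 = "clV PL 3 (bas (pl_circ (pl_circ (Leaf 1) (Leaf 2)) (Leaf 3)) - bas (pl_circ (Leaf 1) (pl_circ (Leaf 2) (Leaf 3)))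
         - bas (pl_circ (pl_circ (Leaf 1) (Leaf 3)) (Leaf 2)) + bas (pl_circ (Leaf 1) (pl_circ (Leaf 3) (Leaf 2)))
         - bas (pl_circ (Leaf 1) (pl_br (Leaf 2) (Leaf 3))) :: (plgen \<Rightarrow>\<^sub>0 'k) ltree \<Rightarrow>\<^sub>0 'k)"
  let ?r3 = "clV PL 3 (bas (pl_circ (pl_br (Leaf 1) (Leaf 2)) (Leaf 3)) - bas (pl_br (pl_circ (Leaf 1) (Leaf 3)) (Leaf 2))
         - bas (pl_br (Leaf 1) (pl_circ (Leaf 2) (Leaf 3))) :: (plgen \<Rightarrow>\<^sub>0 'k) ltree \<Rightarrow>\<^sub>0 'k)"
  have PLrel: "?PLrel = s3_span PL {?r1, ?r2, ?r3}"
    by (simp add: PL_rel_def Let_def)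
  have cP: "circ_u PL u a b \<in> carrier (sp ?FP 3)" for u and a b :: "plgen \<Rightarrow>\<^sub>0 'k" using PL.circ_u_closed[of a b u] by simp
  have rc: "?r1 \<in> carrier (sp ?FP 3)" "?r2 \<in> carrier (sp ?FP 3)" "?r3 \<in> carrier (sp ?FP 3)"
  proof -
    interpret P: module kring "sp ?FP 3" by (rule PL.T.free.vspace_sp)
    show "?r1 \<in> carrier (sp ?FP 3)" "?r2 \<in> carrier (sp ?FP 3)" "?r3 \<in> carrier (sp ?FP 3)"
      unfolding PL_relators using cP by (simp_all add: a_minus_def)
  qed
  \<comment> \<open>The dictionary between relations and subsets: with all leaves in J every vertex
    is a dot, as in the Jacobi identity; one leaf in J leaves a vertex off the path to it, as in the
    second relation; two leaves give one dot and one side, as in the third.\<close>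
  have rel: "f 3 (Psi PL V ?r1 s) = TSu_map V 3 {1, 2, 3} s" "f 3 (Psi PL V ?r2 s) = TSu_map V 3 {1} s"
    "f 3 (Psi PL V ?r3 s) = TSu_map V 3 {1, 2} s" if s: "s \<in> carrier (sp ?FV 3)" for s
  proof -
    have main: "f 3 (Psi PL V ?r1 (circ_u V v \<omega> \<nu>)) = TSu_map V 3 {1, 2, 3} (circ_u V v \<omega> \<nu>)"
      "f 3 (Psi PL V ?r2 (circ_u V v \<omega> \<nu>)) = TSu_map V 3 {1} (circ_u V v \<omega> \<nu>)"
      "f 3 (Psi PL V ?r3 (circ_u V v \<omega> \<nu>)) = TSu_map V 3 {1, 2} (circ_u V v \<omega> \<nu>)"
      if \<omega>: "\<omega> \<in> elts V" and \<nu>: "\<nu> \<in> elts V" for v \<omega> \<nu>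
    proof -
      let ?F = "\<lambda>r. f 3 (Psi PL V r (circ_u V v \<omega> \<nu>))" and ?C = "circ_u (hat V)"
      note lin = Psi_f[OF circ_u_closed[OF \<omega> \<nu>], of v]
      note Fadd = linear_mapD(2)[OF lin] and Fmin = linear_map_minus(2)[OF PL.T.free.vspace_sp H.T.free.vspace_sp lin]
      have F: "?F (circ_u PL u (bas p) (bas q)) = (if u = v then ?C u (\<psi> (tens p \<omega>)) (\<psi> (tens q \<nu>)) else \<zero>\<^bsub>?N\<^esub>)" for u p q
        using PV.Psi_circ[of "bas p" "bas q" \<omega> \<nu> u v] \<omega> \<nu> shape_eval[OF f(2), of "tens p \<omega>" "tens q \<nu>" v] tens_closed
          linear_map_zero[OF TS.T.free.vspace_sp H.T.free.vspace_sp f.hom_linear] by simp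
      have dh: "dec V x d \<in> elts (hat V)" if "x \<in> elts V" for x d using that by simp
      have Cc: "?C u a b \<in> carrier ?N" if "a \<in> elts (hat V)" "b \<in> elts (hat V)" for u a b
        by (rule H.circ_u_closed[OF that])
      have Cl: "linear_map (vsp (hat V)) ?N (\<lambda>a. ?C u a b)" "linear_map (vsp (hat V)) ?N (\<lambda>a. ?C u b a)"
        if "b \<in> elts (hat V)" for u b
        using H.circ_bilinear[of u] that by (auto simp: bilinear_map_def simp del: hat_simps)
      have Cneg: "?C u (\<ominus>\<^bsub>vsp (hat V)\<^esub> a) b = \<ominus>\<^bsub>?N\<^esub> ?C u a b" "?C u b (\<ominus>\<^bsub>vsp (hat V)\<^esub> a) = \<ominus>\<^bsub>?N\<^esub> ?C u b a"
        if "a \<in> elts (hat V)" "b \<in> elts (hat V)" for u a b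
        using linear_map_minus(1)[OF H.vspace_vsp H.T.free.vspace_sp Cl(1)[OF that(2)] that(1)]
          linear_map_minus(1)[OF H.vspace_vsp H.T.free.vspace_sp Cl(2)[OF that(2)] that(1)] by auto
      have Cstar: "?C u b (dec_star V \<nu>) = ?C u b (dec V \<nu> Prec) \<oplus>\<^bsub>?N\<^esub> ?C u b (dec V \<nu> Succ) \<oplus>\<^bsub>?N\<^esub> ?C u b (dec V \<nu> Dot)"
        if b: "b \<in> elts (hat V)" for u b
        unfolding dec_star_def using dh[OF \<nu>] H.VS.a_closed linear_mapD(2)[OF Cl(2)[OF b]] by (simp del: hat_simps)
      interpret P: module kring "sp ?FP 3" by (rule PL.T.free.vspace_sp)
      have Pm: "x \<ominus>\<^bsub>sp ?FP 3\<^esub> y \<in> carrier (sp ?FP 3)" if "x \<in> carrier (sp ?FP 3)" "y \<in> carrier (sp ?FP 3)" for x y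
        using that by (simp add: a_minus_def)
      have ce: "?C ShI a b = clV (hat V) 3 (bas (Node a [Node b [Leaf 1, Leaf 2], Leaf 3]))"
        "?C ShII a b = clV (hat V) 3 (bas (Node a [Node b [Leaf 2, Leaf 3], Leaf 1]))"
        "?C ShIII a b = clV (hat V) 3 (bas (Node a [Node b [Leaf 3, Leaf 1], Leaf 2]))" for a b
        by (simp_all add: circ_u_def)
      have uhc: "\<ominus>\<^bsub>vsp (hat V)\<^esub> a \<in> elts (hat V)" if "a \<in> elts (hat V)" for a
        using H.VS.a_inv_closed[OF that] .
      have mz: "\<ominus>\<^bsub>?N\<^esub> \<zero>\<^bsub>?N\<^esub> = \<zero>\<^bsub>?N\<^esub>"
        using smult_minus_one[OF H.T.free.vspace_sp N.zero_closed] N.smult_r_null[of "-1"] by simp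
      then have m0: "x \<ominus>\<^bsub>?N\<^esub> \<zero>\<^bsub>?N\<^esub> = x" "\<zero>\<^bsub>?N\<^esub> \<ominus>\<^bsub>?N\<^esub> x = \<ominus>\<^bsub>?N\<^esub> x" if "x \<in> carrier ?N" for x
        using that by (simp_all add: a_minus_def)
      have mc: "x \<ominus>\<^bsub>?N\<^esub> y \<in> carrier ?N" if "x \<in> carrier ?N" "y \<in> carrier ?N" for x y
        using that by (simp add: a_minus_def)
      let ?G = "\<lambda>u p q. ?F (circ_u PL u (bas p) (bas q))"
      have r1: "?F ?r1 = ?G ShI Bracket Bracket \<oplus>\<^bsub>?N\<^esub> ?G ShIII Bracket Bracket \<oplus>\<^bsub>?N\<^esub> ?G ShII Bracket Bracket"
        unfolding PL_relators by (simp add: Fadd cP)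
      \<comment> \<open>For J = {1} the inner vertex of shape II lies on no path to 1 and has to be
        labelled by star. Its three summands come from the three terms of shape II, and their signs
        are absorbed by sending \<open>CircOp\<close> to minus \<open>Succ\<close>.\<close>
      have r2: "?F ?r2 = ?G ShI Circ Circ \<ominus>\<^bsub>?N\<^esub> ?G ShII CircOp Circ \<ominus>\<^bsub>?N\<^esub> ?G ShIII Circ CircOp
          \<oplus>\<^bsub>?N\<^esub> ?G ShII CircOp CircOp \<ominus>\<^bsub>?N\<^esub> ?G ShII CircOp Bracket"
        unfolding PL_relators by (simp add: Fadd Fmin cP Pm)
      have r3: "?F ?r3 = ?G ShI Circ Bracket \<ominus>\<^bsub>?N\<^esub> ?G ShIII Bracket CircOp \<oplus>\<^bsub>?N\<^esub> ?G ShII Bracket Circ"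
        unfolding PL_relators by (simp add: Fadd Fmin cP Pm)
      note simps = TSu_circ[OF \<omega> \<nu>] \<psi>(2-4)[OF \<omega>] \<psi>(2-4)[OF \<nu>] dh[OF \<omega>] dh[OF \<nu>] Cc Cneg uhc ce[symmetric] Cstar m0 mc mz
      show "?F ?r1 = TSu_map V 3 {1, 2, 3} (circ_u V v \<omega> \<nu>)"
        unfolding r1 F by (cases v) (simp_all add: simps del: arity2_simps hat_simps)
      show "?F ?r2 = TSu_map V 3 {1} (circ_u V v \<omega> \<nu>)"
        unfolding r2 F by (cases v) (simp_all add: simps a_minus_def N.a_ac del: arity2_simps hat_simps)
      show "?F ?r3 = TSu_map V 3 {1, 2} (circ_u V v \<omega> \<nu>)"
        unfolding r3 F by (cases v) (simp_all add: simps a_minus_def N.a_ac del: arity2_simps hat_simps)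
    qed
    note eq = linear_circ_eqI[OF H.T.free.vspace_sp Psi_f2 TSu_map_linear _ s]
    show "f 3 (Psi PL V ?r1 s) = TSu_map V 3 {1, 2, 3} s" by (rule eq[OF rc(1)]) (rule main(1))
    show "f 3 (Psi PL V ?r2 s) = TSu_map V 3 {1} s" by (rule eq[OF rc(2)]) (rule main(2))
    show "f 3 (Psi PL V ?r3 s) = TSu_map V 3 {1, 2} s" by (rule eq[OF rc(3)]) (rule main(3))
  qed
  \<comment> \<open>The condition is imposed for all s in R at once; this is what makes the set
    stable under permutations, since R is.\<close>
  let ?R' = "{r \<in> carrier (sp ?FP 3). \<forall>s\<in>R. f 3 (Psi PL V r s) \<in> ?IT 3}"
  have "s3_submodule PL ?R'"
    unfolding s3_submodule_def
  proof (intro conjI allI impI)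
    show "submodule ?R' kring (sp ?FP 3)"
      by (rule vs_ker_submoduleI[OF PL.T.free.vspace_sp H.T.free.vspace_sp Psi_f[OF Rc] QT.submod])
    fix \<sigma> r assume \<sigma>: "\<sigma> permutes {1..3::nat}" and r: "r \<in> ?R'"
    have rcar: "r \<in> carrier (sp ?FP 3)" using r by simp
    have "f 3 (Psi PL V (act ?FP 3 r \<sigma>) s) \<in> ?IT 3" if s: "s \<in> R" for s
    proof -
      \<comment> \<open>Writing s as the image of ?s under \<sigma> lets \<open>Psi_act\<close> move
        \<sigma> out of both arguments simultaneously.\<close>
      let ?s = "act ?FV 3 s (inv_into UNIV \<sigma>)"
      have s': "?s \<in> R" by (rule Ract[OF permutes_inv[OF \<sigma>] s])
      have "act ?FV 3 ?s \<sigma> = s"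
        using T.free.act_act[OF permutes_inv[OF \<sigma>] \<sigma> Rc[OF s]] T.free.act_id[OF Rc[OF s]] permutes_inv_o(2)[OF \<sigma>] by simp
      then have "Psi PL V (act ?FP 3 r \<sigma>) s = (if odd3 \<sigma> then (-1) else 1) \<odot>\<^bsub>sp ?FW 3\<^esub> act ?FW 3 (Psi PL V r ?s) \<sigma>"
        using PV.Psi_act[OF \<sigma> rcar Rc[OF s']] by simp
      moreover have P: "Psi PL V r ?s \<in> carrier (sp ?FW 3)"
        by (rule linear_mapD(1)[OF PV.Psi_linear_left[OF Rc[OF s']] rcar])
      ultimately have "f 3 (Psi PL V (act ?FP 3 r \<sigma>) s) = (if odd3 \<sigma> then (-1) else 1) \<odot>\<^bsub>?N\<^esub> act ?FH 3 (f 3 (Psi PL V r ?s)) \<sigma>"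
        using linear_mapD(3)[OF f.hom_linear TS.T.free.act_closed[OF \<sigma> P]] f.hom_act[OF \<sigma> P] by simp
      moreover have "act ?FH 3 (f 3 (Psi PL V r ?s)) \<sigma> \<in> ?IT 3"
        by (rule operad_idealD(2)[OF QT.ideal \<sigma>]) (use r s' in blast)
      ultimately show ?thesis
        using vspace_submoduleD(4)[OF H.T.free.vspace_sp QT.submod] by metis
    qed
    then show "act ?FP 3 r \<sigma> \<in> ?R'" using PL.T.free.act_closed[OF \<sigma> rcar] by blast
  qed
  moreover have "{?r1, ?r2, ?r3} \<subseteq> ?R'"
    using rc rel[OF Rc] TSuI by auto
  ultimately have PLR': "?PLrel \<subseteq> ?R'"
    unfolding PLrel s3_span_def by blast
  let ?G = "{Psi PL V r s |r s. r \<in> ?PLrel \<and> s \<in> R}"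
  have Gc: "?G \<subseteq> carrier (sp ?FW 3)"
    using linear_mapD(1)[OF PV.Psi_linear_left[OF Rc]] PLR' by blast
  have Bsub: "submodule ?B kring (sp ?FW 3)"
    unfolding black_rel_def by (rule lin_span_submodule[OF TS.T.free.vspace_sp Gc])
  interpret QB: operad_quotient ?FW ?IB
    by (rule TS.quad_quotient[OF vspace_submoduleD(1)[OF TS.T.free.vspace_sp Bsub]])
  have fB: "f n x \<in> ?IT n" if "x \<in> ?IB n" for n x
  proof (rule gen_ideal_hom_zero[OF f(1) _ QT.ideal that[unfolded quad_ideal_def]])
    fix m :: nat and y assume "y \<in> (if m = 3 then ?B else {})"
    then have m: "m = 3" and y: "y \<in> ?B" by (auto split: if_splits)
    have "f 3 y \<in> ?IT 3"
      by (rule linear_map_lin_span[OF TS.T.free.vspace_sp H.T.free.vspace_sp f.hom_linear Gc QT.submod _ y[unfolded black_rel_def]])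
        (use PLR' in blast)
    then show "y \<in> carrier (sp ?FW m) \<and> f m y \<in> ?IT m"
      using m y vspace_submoduleD(1)[OF TS.T.free.vspace_sp Bsub] by auto
  qed
  have BI: "?B \<subseteq> ?IB 3"
    unfolding quad_ideal_def by (rule order.trans[OF _ gen_ideal_superset]) simp
  have rPL: "?r1 \<in> ?PLrel" "?r2 \<in> ?PLrel" "?r3 \<in> ?PLrel"
    unfolding PLrel s3_span_def by blast+
  \<comment> \<open>For the three representatives J the relation is literally f of some \<Psi>(q,
    r), and g inverts f.\<close>
  have base: "g 3 (TSu_map V 3 J r) \<in> ?IB 3" if "J \<in> {{1}, {1, 2}, {1, 2, 3}}" and r: "r \<in> R" for J r
  proof -
    have "\<exists>q\<in>?PLrel. f 3 (Psi PL V q r) = TSu_map V 3 J r"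
      using that(1) rPL rel[OF Rc[OF r]] by auto
    then obtain q where q: "q \<in> ?PLrel" "f 3 (Psi PL V q r) = TSu_map V 3 J r" by blast
    have "Psi PL V q r \<in> ?B"
      unfolding black_rel_def by (rule subsetD[OF lin_span_superset]) (use q r in blast)
    moreover have "Psi PL V q r \<in> carrier (sp ?FW 3)" using Gc q r by blast
    ultimately show ?thesis using gf[of "Psi PL V q r" 3] q(2) BI by auto
  qed
  have gT: "g n x \<in> ?IB n" if "x \<in> ?IT n" for n x
  proof (rule gen_ideal_hom_zero[OF g(1) _ QB.ideal that[unfolded quad_ideal_def]])
    fix m :: nat and y assume "y \<in> (if m = 3 then TSu_rel V R else {})"
    then have m: "m = 3" and y: "y \<in> TSu_rel V R" by (auto split: if_splits)
    obtain J r where J: "r \<in> R" "J \<noteq> {}" "J \<subseteq> {1, 2, 3}" "y = TSu_map V 3 J r"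
      using y by (auto simp: TSu_rel_def)
    \<comment> \<open>Here the general J is reduced to a representative; the permutation is moved to
      r, which stays in R.\<close>
    obtain \<sigma> J0 where \<sigma>: "\<sigma> permutes {1..3}" "J0 \<in> {{1}, {1, 2}, {1, 2, 3}}" "J = inv_into UNIV \<sigma> ` J0"
      using permutes_image_three[OF J(2,3)] by blast
    let ?r = "act ?FV 3 r (inv_into UNIV \<sigma>)"
    have r': "?r \<in> R" by (rule Ract[OF permutes_inv[OF \<sigma>(1)] J(1)])
    have "act ?FV 3 ?r \<sigma> = r"
      using T.free.act_act[OF permutes_inv[OF \<sigma>(1)] \<sigma>(1) Rc[OF J(1)]] T.free.act_id[OF Rc[OF J(1)]] permutes_inv_o(2)[OF \<sigma>(1)] by simp
    then have "y = act ?FH 3 (TSu_map V 3 J0 ?r) \<sigma>"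
      using TSu_map_act[OF \<sigma>(1) Rc[OF r'], of J0] J(4) \<sigma>(3) by simp
    then have "g 3 y = act ?FW 3 (g 3 (TSu_map V 3 J0 ?r)) \<sigma>"
      using g.hom_act[OF \<sigma>(1) linear_mapD(1)[OF TSu_map_linear Rc[OF r']]] by simp
    then have "g 3 y \<in> ?IB 3"
      using operad_idealD(2)[OF QB.ideal \<sigma>(1) base[OF \<sigma>(2) r']] by simp
    then show "y \<in> carrier (sp ?FH m) \<and> g m y \<in> ?IB m" using m y TSuc by auto
  qed
  have clT: "QT.cl n x = \<zero>\<^bsub>sp (quot_operad ?FH ?IT) n\<^esub>" if "x \<in> ?IT n" for n x
    using coset_eq_self_iff[OF H.T.free.vspace_sp QT.submod, of x n] that operad_ideal_subset[OF H.T.free.operad_axioms QT.ideal, of n]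
    by auto
  have clB: "QB.cl n x = \<zero>\<^bsub>sp (quot_operad ?FW ?IB) n\<^esub>" if "x \<in> ?IB n" for n x
    using coset_eq_self_iff[OF TS.T.free.vspace_sp QB.submod, of x n] that operad_ideal_subset[OF TS.T.free.operad_axioms QB.ideal, of n]
    by auto
  have "\<exists>\<phi>. operad_hom (quot_operad ?FW ?IB) (quot_operad ?FH ?IT) \<phi> \<and>
      (\<forall>n. \<forall>x\<in>carrier (sp ?FW n). \<phi> n (QB.cl n x) = QT.cl n (f n x))"
    by (rule QB.hom_factor[OF operad_hom_compose[OF f(1) QT.hom_cl]]) (rule clT[OF fB])
  then obtain \<phi> where \<phi>: "operad_hom (quot_operad ?FW ?IB) (quot_operad ?FH ?IT) \<phi>"
    "\<And>n x. x \<in> carrier (sp ?FW n) \<Longrightarrow> \<phi> n (QB.cl n x) = QT.cl n (f n x)"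
    by blast
  have "\<exists>\<gamma>. operad_hom (quot_operad ?FH ?IT) (quot_operad ?FW ?IB) \<gamma> \<and>
      (\<forall>n. \<forall>x\<in>carrier (sp ?FH n). \<gamma> n (QT.cl n x) = QB.cl n (g n x))"
    by (rule QT.hom_factor[OF operad_hom_compose[OF g(1) QB.hom_cl]]) (rule clB[OF gT])
  then obtain \<gamma> where \<gamma>: "operad_hom (quot_operad ?FH ?IT) (quot_operad ?FW ?IB) \<gamma>"
    "\<And>n x. x \<in> carrier (sp ?FH n) \<Longrightarrow> \<gamma> n (QT.cl n x) = QB.cl n (g n x)"
    by blast
  have fc: "f n x \<in> carrier (sp ?FH n)" if "x \<in> carrier (sp ?FW n)" for n x by (rule linear_mapD(1)[OF f.hom_linear that])
  have gc: "g n x \<in> carrier (sp ?FW n)" if "x \<in> carrier (sp ?FH n)" for n x by (rule linear_mapD(1)[OF g.hom_linear that])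
  have "bij_betw (\<phi> n) (carrier (sp (quot_operad ?FW ?IB) n)) (carrier (sp (quot_operad ?FH ?IT) n))" for n
    by (rule bij_betw_byWitness[where f' = "\<gamma> n"])
      (use \<phi>(2) \<gamma>(2) fc gc fg gf in \<open>auto simp: QB.carrier_quot QT.carrier_quot\<close>)
  then have "operad_iso (black_product PL PL_rel V R) (TSu V R) \<phi>"
    unfolding black_product_def TSu_def quad_operad_def
    by (intro operad_iso.intro operad_iso_axioms.intro \<phi>(1))
  moreover have "\<phi> 2 (black_gen PL PL_rel V R (bas p) \<omega>) = TSu_gen V R \<omega> d"
    if "\<omega> \<in> elts V" "\<psi> (tens p \<omega>) = dec V \<omega> d" for p \<omega> d
  proof -
    have t: "Node (tens p \<omega>) [Leaf 1, Leaf 2] \<in> trees (arity2 ?W) 2"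
      using tens_closed[OF that(1)] by (auto simp: trees_def)
    show ?thesis
      unfolding black_gen_def TSu_gen_def quad_gen_def gen2_def
      using \<phi>(2)[OF TS.T.tree_class_closed, of "bas (Node (tens p \<omega>) [Leaf 1, Leaf 2])" 2]
        f(2)[of "bas (Node (tens p \<omega>) [Leaf 1, Leaf 2])" 2] t that(2) by simp
  qed
  ultimately show ?thesis using \<psi>(2,3) by blast
qed

end

subsection \<open>The free Rota-Baxter operad\<close>

lemma map_mult_diff: "Poly_Mapping.map ((*) (c::'k::field)) (f - g) = Poly_Mapping.map ((*) c) f - Poly_Mapping.map ((*) c) g"
  by (rule poly_mapping_eqI) (simp add: lookup_minus algebra_simps)

lemma bilinear_free_eqI:
  assumes "vspace N" "bilinear_map (free_module X) (free_module Y) N f" "bilinear_map (free_module X) (free_module Y) N g"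
    and "\<And>s t. s \<in> X \<Longrightarrow> t \<in> Y \<Longrightarrow> f (bas s) (bas t) = g (bas s) (bas t)"
    and x: "keys x \<subseteq> X" and y: "keys y \<subseteq> Y"
  shows "f x y = g x y"
proof (rule free_linear_eqI[OF assms(1), where X = X and z = x and f = "\<lambda>x. f x y" and g = "\<lambda>x. g x y"])
  show "linear_map (free_module X) N (\<lambda>x. f x y)" "linear_map (free_module X) N (\<lambda>x. g x y)"
    using assms(2,3) y by (auto simp: bilinear_map_def)
  show "f (bas s) y = g (bas s) y" if "s \<in> X" for s
  proof (rule free_linear_eqI[OF assms(1), where X = Y and z = y and f = "f (bas s)" and g = "g (bas s)"])
    show "linear_map (free_module Y) N (f (bas s))" "linear_map (free_module Y) N (g (bas s))"
      using assms(2,3) that by (auto simp: bilinear_map_def)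
  qed (use assms(4) that y in auto)
qed (rule x)

lemma bilinear_map_add:
  assumes "vspace M" "vspace M'" "vspace N" "bilinear_map M M' N f" "bilinear_map M M' N g"
  shows "bilinear_map M M' N (\<lambda>x y. f x y \<oplus>\<^bsub>N\<^esub> g x y)"
  using assms(4,5) by (auto simp: bilinear_map_def intro!: linear_map_add[OF assms(1,3)] linear_map_add[OF assms(2,3)])

lemma bilinear_map_smult:
  assumes "vspace N" "bilinear_map M M' N f"
  shows "bilinear_map M M' N (\<lambda>x y. c \<odot>\<^bsub>N\<^esub> f x y)"
  using assms(2) by (auto simp: bilinear_map_def intro!: linear_map_smult[OF assms(1)])

section \<open>Expansion of decorated trees into trees with vertices P\<close>

definition Pn :: "('k::field, 'v) s2mod \<Rightarrow> ('k \<times> 'v) ltree \<Rightarrow> ('k \<times> 'v) ltree" where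
  "Pn V t = Node (1, \<zero>\<^bsub>vsp V\<^esub>) [t]"

definition n2 :: "'v \<Rightarrow> ('k::field \<times> 'v) ltree \<Rightarrow> ('k \<times> 'v) ltree \<Rightarrow> ('k \<times> 'v) ltree" where
  "n2 \<omega> s t = Node (0, \<omega>) [s, t]"

text \<open>The morphism that extends \<open>\<eta>\<close> sends the class of a tree \<open>t\<close> to the class of \<open>rbt V t\<close>.  The value zero at a
  vertex that is not binary is correct because such a vertex is labelled by zero.\<close>

definition rb_node :: "('k::field, 'v) s2mod \<Rightarrow> (tri \<Rightarrow> 'v) \<Rightarrow> (('k \<times> 'v) ltree \<Rightarrow>\<^sub>0 'k) \<Rightarrow> (('k \<times> 'v) ltree \<Rightarrow>\<^sub>0 'k) \<Rightarrow> (('k \<times> 'v) ltree \<Rightarrow>\<^sub>0 'k)" where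
  "rb_node V f x y = push2 (n2 (f Dot)) x y + push2 (n2 (f Prec)) x (push (Pn V) y) + push2 (n2 (f Succ)) (push (Pn V) x) y"

primrec rbt :: "('k::field, 'v) s2mod \<Rightarrow> (tri \<Rightarrow> 'v) ltree \<Rightarrow> (('k \<times> 'v) ltree \<Rightarrow>\<^sub>0 'k)" where
  "rbt V (Leaf i) = bas (Leaf i)"
| "rbt V (Node f ts) = (let xs = map (rbt V) ts in if length xs = 2 then rb_node V f (xs ! 0) (xs ! 1) else 0)"

lemma rbt_Node2 [simp]: "rbt V (Node f [s, t]) = rb_node V f (rbt V s) (rbt V t)"
  by simp

lemma rbt_other: "length ts \<noteq> 2 \<Longrightarrow> rbt V (Node f ts) = 0"
  by simp

declare rbt.simps(2) [simp del]

lemma leaves_Pn [simp]: "leaves (Pn V t) = leaves t" and leaves_n2 [simp]: "leaves (n2 \<omega> s t) = leaves s @ leaves t"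
  by (simp_all add: Pn_def n2_def)

lemma tsubst_Pn [simp]: "tsubst g (Pn V t) = Pn V (tsubst g t)"
  and tsubst_n2 [simp]: "tsubst g (n2 \<omega> s t) = n2 \<omega> (tsubst g s) (tsubst g t)"
  by (simp_all add: Pn_def n2_def)

lemma relabel_Pn [simp]: "relabel g (Pn V t) = Pn V (relabel g t)"
  and relabel_n2 [simp]: "relabel g (n2 \<omega> s t) = n2 \<omega> (relabel g s) (relabel g t)"
  by (simp_all add: relabel_def)

lemma tree2_induct [case_names Leaf Node2 other]:
  assumes "\<And>i. P (Leaf i)" "\<And>f s t. P s \<Longrightarrow> P t \<Longrightarrow> P (Node f [s, t])" "\<And>f ts. length ts \<noteq> 2 \<Longrightarrow> P (Node f ts)"
  shows "P t"
proof (induction t)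
  case (Node f ts)
  show ?case
  proof (cases "length ts = 2")
    case True
    then obtain s u where "ts = [s, u]" by (auto simp: length_two)
    then show ?thesis using Node assms(2) by simp
  qed (rule assms(3))
qed (rule assms(1))

text \<open>Inserting P never moves a leaf. Distinctness of the leaves thus passes from t to every
  tree of its expansion, which the substitution argument relies on.\<close>

lemma leaves_rbt: "s \<in> keys (rbt V t) \<Longrightarrow> leaves s = leaves t"
proof (induction t arbitrary: s rule: tree2_induct)
  case (Node2 f t u)
  have P: "leaves p = leaves a" if "p \<in> keys (push (Pn V) (rbt V a))" "\<And>s. s \<in> keys (rbt V a) \<Longrightarrow> leaves s = leaves a" for p a
    using that keys_push[of "Pn V" "rbt V a"] by fastforce
  have "s \<in> keys (push2 (n2 (f Dot)) (rbt V t) (rbt V u)) \<union> keys (push2 (n2 (f Prec)) (rbt V t) (push (Pn V) (rbt V u)))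
      \<union> keys (push2 (n2 (f Succ)) (push (Pn V) (rbt V t)) (rbt V u))"
    using Node2(3) unfolding rbt_Node2 rb_node_def by (auto dest!: subsetD[OF keys_add])
  then obtain \<omega> x y where s: "s \<in> keys (push2 (n2 \<omega>) x y)"
    and x: "x = rbt V t \<or> x = push (Pn V) (rbt V t)" and y: "y = rbt V u \<or> y = push (Pn V) (rbt V u)"
    by (elim UnE) simp_all
  obtain p q where pq: "s = n2 \<omega> p q" "p \<in> keys x" "q \<in> keys y"
    using subsetD[OF keys_push2 s] by auto
  have "leaves p = leaves t" using x pq(2) P[OF _ Node2(1)] Node2(1) by blast
  moreover have "leaves q = leaves u" using y pq(3) P[OF _ Node2(2)] Node2(2) by blast
  ultimately show ?case using pq(1) by simp
qed (simp_all add: rbt_other)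

lemma push2_push_left: "push2 h (push f x) y = push2 (\<lambda>a b. h (f a) b) x y"
  using push2_push[of h f x "\<lambda>b. b" y] by (simp add: push_ident)

lemma push2_push_right: "push2 h x (push g y) = push2 (\<lambda>a b. h a (g b)) x y"
  using push2_push[of h "\<lambda>a. a" x g y] by (simp add: push_ident)

lemma rb_node_push:
  assumes "\<And>s. g (Pn V s) = Pn V (g s)" "\<And>\<omega> s t. g (n2 \<omega> s t) = n2 \<omega> (g s) (g t)"
  shows "push g (rb_node V f x y) = rb_node V f (push g x) (push g y)"
  unfolding rb_node_def by (simp add: push_add push_push2 push2_push_left push2_push_right assms)

lemma rbt_relabel: "rbt V (relabel h t) = push (relabel h) (rbt V t)"
  by (induction t rule: tree2_induct) (simp_all add: rb_node_push rbt_other)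

text \<open>Substitution in the left subtree commutes with adding the root, because the right
  subtree does not contain the leaf in question and is only relabelled, by \<open>r\<close>.\<close>

lemma push2_substitute_left:
  assumes "\<And>a b c. a \<in> keys x \<Longrightarrow> b \<in> keys y \<Longrightarrow> N (G a c) (r b) = G (N a b) c"
  shows "push2 N (push2 G x z) (push r y) = push2 G (push2 N x y) z"
proof -
  have "push2 N (push2 G x z) (push r y) = push2 (\<lambda>p b. N p (r b)) (push2 G x z) y"
    by (rule push2_push_right)
  also have "\<dots> = push2 G (push2 N x y) z"
    by (rule push2_parallel[of "keys x" UNIV "keys y"]) (use assms in auto)
  finally show ?thesis .
qed

lemma push2_substitute_right:
  assumes "\<And>a b c. a \<in> keys x \<Longrightarrow> b \<in> keys y \<Longrightarrow> N (r a) (G b c) = G (N a b) c"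
  shows "push2 N (push r x) (push2 G y z) = push2 G (push2 N x y) z"
proof -
  have "push2 N (push r x) (push2 G y z) = push2 (\<lambda>a p. N (r a) p) x (push2 G y z)"
    by (rule push2_push_left)
  also have "\<dots> = push2 G (push2 N x y) z"
    by (rule push2_assoc[symmetric, of "keys x" "keys y" UNIV]) (use assms in auto)
  finally show ?thesis .
qed

lemma tsubst_fresh:
  "i \<notin> set (leaves b) \<Longrightarrow> tsubst (\<lambda>j. if j = i then c else Leaf (h j)) b = relabel h b"
  unfolding relabel_def by (rule tsubst_cong) auto

text \<open>The leaf i lies in exactly one of the two subtrees of a vertex; there the induction
  hypothesis applies, while the other subtree is just relabelled by h. The general relabelling h
  covers the shift of labels in \<open>graft\<close>. Since i occurs once in every tree of the
  expansion of s, the result is bilinear in the two expansions.\<close>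

lemma rbt_substitute:
  assumes "distinct (leaves s)" "i \<in> set (leaves s)"
  shows "rbt V (tsubst (\<lambda>j. if j = i then t else Leaf (h j)) s)
    = push2 (\<lambda>s' t'. tsubst (\<lambda>j. if j = i then t' else Leaf (h j)) s') (rbt V s) (rbt V t)"
  using assms
proof (induction s rule: tree2_induct)
  case (Leaf j)
  then show ?case by (simp add: push2_bas_left push_ident)
next
  case (Node2 f s u)
  let ?G = "\<lambda>s' t'. tsubst (\<lambda>j. if j = i then t' else Leaf (h j)) s'"
  have G_push: "push2 ?G (push (Pn V) x) z = push (Pn V) (push2 ?G x z)" for x z
    by (simp add: push2_push_left push_push2)
  have dis: "set (leaves s) \<inter> set (leaves u) = {}" using Node2.prems by auto
  from Node2.prems(2) consider "i \<in> set (leaves s)" "i \<notin> set (leaves u)" | "i \<in> set (leaves u)" "i \<notin> set (leaves s)"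
    using dis by auto
  then show ?case
  proof cases
    case 1
    have IH: "rbt V (?G s t) = push2 ?G (rbt V s) (rbt V t)" using Node2 1 by simp
    have u: "rbt V (?G u t) = push (relabel h) (rbt V u)" by (simp add: tsubst_fresh[OF 1(2)] rbt_relabel)
    have L: "push2 (n2 \<omega>) (push2 ?G x z) (push (relabel h) y) = push2 ?G (push2 (n2 \<omega>) x y) z"
      if "\<And>b. b \<in> keys y \<Longrightarrow> i \<notin> set (leaves b)" for \<omega> x y z
      by (rule push2_substitute_left) (use that in \<open>simp add: tsubst_fresh\<close>)
    have y: "i \<notin> set (leaves b)" if "b \<in> keys (rbt V u)" for b
      using leaves_rbt[OF that] 1 by simp
    have y': "i \<notin> set (leaves b)" if "b \<in> keys (push (Pn V) (rbt V u))" for b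
      using y that keys_push[of "Pn V" "rbt V u"] by fastforce
    have c: "push (Pn V) (push (relabel h) y) = push (relabel h) (push (Pn V) y)" for y by (simp add: push_push)
    show ?thesis
      by (simp add: IH u rb_node_def push2_add_left c L[OF y] L[OF y'] flip: G_push)
  next
    case 2
    have IH: "rbt V (?G u t) = push2 ?G (rbt V u) (rbt V t)" using Node2 2 by simp
    have s: "rbt V (?G s t) = push (relabel h) (rbt V s)" by (simp add: tsubst_fresh[OF 2(2)] rbt_relabel)
    have L: "push2 (n2 \<omega>) (push (relabel h) x) (push2 ?G y z) = push2 ?G (push2 (n2 \<omega>) x y) z"
      if "\<And>b. b \<in> keys x \<Longrightarrow> i \<notin> set (leaves b)" for \<omega> x y z
      by (rule push2_substitute_right) (use that in \<open>simp add: tsubst_fresh\<close>)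
    have x: "i \<notin> set (leaves b)" if "b \<in> keys (rbt V s)" for b
      using leaves_rbt[OF that] 2 by simp
    have x': "i \<notin> set (leaves b)" if "b \<in> keys (push (Pn V) (rbt V s))" for b
      using x that keys_push[of "Pn V" "rbt V s"] by fastforce
    have c: "push (Pn V) (push (relabel h) y) = push (relabel h) (push (Pn V) y)" for y by (simp add: push_push)
    show ?thesis
      by (simp add: IH s rb_node_def push2_add_left c L[OF x] L[OF x'] flip: G_push)
  qed
qed (simp add: rbt_other)

lemma rbt_graft:
  assumes "distinct (leaves s)" "i \<in> set (leaves s)"
  shows "rbt V (graft n i s t) = push2 (graft n i) (rbt V s) (rbt V t)"
  unfolding graft_def rbt_substitute[OF assms] rbt_relabel
  by (simp add: push2_push_right graft_def[abs_def])

context s2mod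
begin

lemma VP_simps [simp]:
  "carrier (sp (VP V) n) = (if n = 1 then UNIV else {0}) \<times> (if n = 2 then elts V else {\<zero>\<^bsub>vsp V\<^esub>})"
  "\<zero>\<^bsub>sp (VP V) n\<^esub> = (0, \<zero>\<^bsub>vsp V\<^esub>)" "x \<oplus>\<^bsub>sp (VP V) n\<^esub> y = (fst x + fst y, snd x \<oplus>\<^bsub>vsp V\<^esub> snd y)"
  "c \<odot>\<^bsub>sp (VP V) n\<^esub> x = (c * fst x, c \<odot>\<^bsub>vsp V\<^esub> snd x)"
  "act (VP V) n x \<sigma> = (if n = 2 \<and> \<sigma> 1 = 2 then (fst x, swp V (snd x)) else x)"
  by (simp_all add: VP_def mk_module_def)

lemma smodule_VP: "smodule (VP V)"
proof (rule smodule.intro)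
  fix n \<sigma> \<tau> x
  note S = VS.smult_r_null[simplified] VS.smult_l_null[simplified] VS.smult_one[simplified]
  show "vspace (sp (VP V) n)"
    by (rule vspaceI)
      (auto simp: VS.a_ac VS.smult_r_distr VS.smult_l_distr[simplified] VS.smult_assoc1[simplified] S algebra_simps split: if_splits)
  show "linear_map (sp (VP V) n) (sp (VP V) n) (\<lambda>x. act (VP V) n x \<sigma>)"
    using linear_mapD[OF swp_linear] by (intro linear_mapI) (auto split: if_splits)
  show "act (VP V) n x id = x" by simp
  show "act (VP V) n (act (VP V) n x \<sigma>) \<tau> = act (VP V) n x (\<sigma> \<circ> \<tau>)"
    if "\<sigma> permutes {1..n}" "\<tau> permutes {1..n}" "x \<in> carrier (sp (VP V) n)"
  proof (cases "n = 2")
    case True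
    with that have "\<sigma> permutes {1..2}" "\<tau> permutes {1..2}" "snd x \<in> elts V" by auto
    then show ?thesis using True
      by (elim permutes_two) (auto simp: swp_swp)
  qed auto
qed

sublocale R: free_operad_smodule "VP V"
  by (rule free_operad_smodule.intro[OF smodule_VP])

interpretation H: s2mod "hat V"
  by (rule s2mod_hat)

lemma Pn_ltrees [intro]: "t \<in> ltrees (VP V) L \<Longrightarrow> Pn V t \<in> ltrees (VP V) L"
  by (simp add: Pn_def ltrees_def)

lemma n2_ltrees [intro]:
  "\<omega> \<in> elts V \<Longrightarrow> s \<in> ltrees (VP V) L \<Longrightarrow> t \<in> ltrees (VP V) M \<Longrightarrow> L \<inter> M = {} \<Longrightarrow> n2 \<omega> s t \<in> ltrees (VP V) (L \<union> M)"
  by (auto simp: n2_def ltrees_def)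

lemma push_Pn_linear: "linear_map (free_module (ltrees (VP V) L)) (free_module (ltrees (VP V) L)) (push (Pn V))"
  by (rule push_linear) auto

lemma push_Pn_keys: "keys x \<subseteq> ltrees (VP V) L \<Longrightarrow> keys (push (Pn V) x) \<subseteq> ltrees (VP V) L"
  using linear_mapD(1)[OF push_Pn_linear, of x L] by simp

lemma push_n2_bilinear:
  assumes "\<omega> \<in> elts V" "L \<inter> M = {}"
  shows "bilinear_map (free_module (ltrees (VP V) L) :: ('k, _) module) (free_module (ltrees (VP V) M)) (free_module (ltrees (VP V) (L \<union> M))) (push2 (n2 \<omega>))"
proof -
  note h = n2_ltrees[OF assms(1) _ _ assms(2)]
  show ?thesis unfolding bilinear_map_def by (intro conjI ballI push2_linear) (use h in \<open>simp_all\<close>)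
qed

lemma push_n2_keys:
  fixes x y :: "('k \<times> 'v) ltree \<Rightarrow>\<^sub>0 'k"
  assumes "\<omega> \<in> elts V" "L \<inter> M = {}" "keys x \<subseteq> ltrees (VP V) L" "keys y \<subseteq> ltrees (VP V) M"
  shows "keys (push2 (n2 \<omega>) x y) \<subseteq> ltrees (VP V) (L \<union> M)"
proof -
  have "linear_map (free_module (ltrees (VP V) M)) (free_module (ltrees (VP V) (L \<union> M))) (push2 (n2 \<omega>) x)"
    using push_n2_bilinear[OF assms(1,2)] assms(3) by (simp add: bilinear_map_def)
  from linear_mapD(1)[OF this, of y] show ?thesis using assms(4) by simp
qed

lemma rb_node_keys:
  assumes "f \<in> elts (hat V)" "L \<inter> M = {}" "keys x \<subseteq> ltrees (VP V) L" "keys y \<subseteq> ltrees (VP V) M"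
  shows "keys (rb_node V f x y) \<subseteq> ltrees (VP V) (L \<union> M)"
  unfolding rb_node_def using assms by (intro keys_add_subset push_n2_keys push_Pn_keys) auto

lemma Node2_ltreesE:
  assumes "Node a [s, u] \<in> ltrees (arity2 W) L"
  shows "a \<in> elts W" "s \<in> ltrees (arity2 W) (set (leaves s))" "u \<in> ltrees (arity2 W) (set (leaves u))"
    "set (leaves s) \<inter> set (leaves u) = {}" "L = set (leaves s) \<union> set (leaves u)"
  using assms by (auto simp: ltrees_def)

lemma rbt_ltrees: "t \<in> ltrees (arity2 (hat V)) L \<Longrightarrow> keys (rbt V t) \<subseteq> ltrees (VP V) L"
proof (induction t arbitrary: L rule: tree2_induct)
  case (Node2 f s u)
  note E = Node2_ltreesE[OF Node2.prems]
  show ?case unfolding rbt_Node2 E(5) by (rule rb_node_keys[OF E(1,4) Node2.IH(1)[OF E(2)] Node2.IH(2)[OF E(3)]])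
qed (auto simp: rbt_other)

end

context s2mod
begin

interpretation H: s2mod "hat V"
  by (rule s2mod_hat)

lemma class_n2_bilinear:
  assumes "\<omega> \<in> elts V" "L \<inter> M = {}" "L \<union> M = {1..n}"
  shows "bilinear_map (free_module (ltrees (VP V) L)) (free_module (ltrees (VP V) M)) (sp (TP V) n)
    (\<lambda>x y. clP V n (push2 (n2 \<omega>) x y))"
proof -
  have "linear_map (free_module (ltrees (VP V) (L \<union> M))) (sp (TP V) n) (clP V n)"
    unfolding assms(3) trees_ltrees[symmetric] by (rule R.tree_class_linear)
  from linear_map_compose[OF _ this] show ?thesis
    using push_n2_bilinear[OF assms(1,2)] unfolding bilinear_map_def by auto
qed

lemma bas_n2_trees:
  assumes "\<omega> \<in> elts V" "L \<inter> M = {}" "L \<union> M = {1..n}" "s \<in> ltrees (VP V) L" "t \<in> ltrees (VP V) M"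
  shows "Node (0, \<omega>) [s, t] \<in> trees (VP V) n"
  using n2_ltrees[OF assms(1,4,5,2)] assms(3) by (simp add: n2_def trees_ltrees)

lemma class_n2_add:
  assumes "\<omega> \<in> elts V" "\<nu> \<in> elts V" "L \<inter> M = {}" "L \<union> M = {1..n}"
    and "keys x \<subseteq> ltrees (VP V) L" "keys y \<subseteq> ltrees (VP V) M"
  shows "clP V n (push2 (n2 (\<omega> \<oplus>\<^bsub>vsp V\<^esub> \<nu>)) x y) =
    clP V n (push2 (n2 \<omega>) x y) \<oplus>\<^bsub>sp (TP V) n\<^esub> clP V n (push2 (n2 \<nu>) x y)"
proof (rule bilinear_free_eqI[OF R.free.vspace_sp _ _ _ assms(5,6)])
  show "bilinear_map (free_module (ltrees (VP V) L)) (free_module (ltrees (VP V) M)) (sp (TP V) n)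
    (\<lambda>x y. clP V n (push2 (n2 (\<omega> \<oplus>\<^bsub>vsp V\<^esub> \<nu>)) x y))"
    by (rule class_n2_bilinear) (use assms in auto)
  show "bilinear_map (free_module (ltrees (VP V) L)) (free_module (ltrees (VP V) M)) (sp (TP V) n)
    (\<lambda>x y. clP V n (push2 (n2 \<omega>) x y) \<oplus>\<^bsub>sp (TP V) n\<^esub> clP V n (push2 (n2 \<nu>) x y))"
    by (intro bilinear_map_add vspace_free_module R.free.vspace_sp class_n2_bilinear assms)
  show "clP V n (push2 (n2 (\<omega> \<oplus>\<^bsub>vsp V\<^esub> \<nu>)) (bas s) (bas t)) =
      clP V n (push2 (n2 \<omega>) (bas s) (bas t)) \<oplus>\<^bsub>sp (TP V) n\<^esub> clP V n (push2 (n2 \<nu>) (bas s) (bas t))"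
    if "s \<in> ltrees (VP V) L" "t \<in> ltrees (VP V) M" for s t
    using R.class_Node_add[OF bas_n2_trees[OF assms(1,3,4) that] bas_n2_trees[OF assms(2,3,4) that]]
    by (simp add: push2_bas_left n2_def)
qed

lemma class_n2_smult:
  assumes "\<omega> \<in> elts V" "L \<inter> M = {}" "L \<union> M = {1..n}"
    and "keys x \<subseteq> ltrees (VP V) L" "keys y \<subseteq> ltrees (VP V) M"
  shows "clP V n (push2 (n2 (c \<odot>\<^bsub>vsp V\<^esub> \<omega>)) x y) =
    c \<odot>\<^bsub>sp (TP V) n\<^esub> clP V n (push2 (n2 \<omega>) x y)"
proof (rule bilinear_free_eqI[OF R.free.vspace_sp _ _ _ assms(4,5)])
  show "bilinear_map (free_module (ltrees (VP V) L)) (free_module (ltrees (VP V) M)) (sp (TP V) n)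
    (\<lambda>x y. clP V n (push2 (n2 (c \<odot>\<^bsub>vsp V\<^esub> \<omega>)) x y))"
    by (rule class_n2_bilinear) (use assms in auto)
  show "bilinear_map (free_module (ltrees (VP V) L)) (free_module (ltrees (VP V) M)) (sp (TP V) n)
    (\<lambda>x y. c \<odot>\<^bsub>sp (TP V) n\<^esub> clP V n (push2 (n2 \<omega>) x y))"
    by (intro bilinear_map_smult R.free.vspace_sp class_n2_bilinear assms)
  show "clP V n (push2 (n2 (c \<odot>\<^bsub>vsp V\<^esub> \<omega>)) (bas s) (bas t)) =
      c \<odot>\<^bsub>sp (TP V) n\<^esub> clP V n (push2 (n2 \<omega>) (bas s) (bas t))"
    if "s \<in> ltrees (VP V) L" "t \<in> ltrees (VP V) M" for s t
    using R.class_Node_smult[OF bas_n2_trees[OF assms(1,2,3) that], of c]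
    by (simp add: push2_bas_left n2_def)
qed

lemma class_n2_swp:
  assumes "\<omega> \<in> elts V" "L \<inter> M = {}" "L \<union> M = {1..n}"
    and "keys x \<subseteq> ltrees (VP V) L" "keys y \<subseteq> ltrees (VP V) M"
  shows "clP V n (push2 (n2 (swp V \<omega>)) x y) = clP V n (push2 (n2 \<omega>) y x)"
proof (rule bilinear_free_eqI[OF R.free.vspace_sp _ _ _ assms(4,5)])
  show "bilinear_map (free_module (ltrees (VP V) L)) (free_module (ltrees (VP V) M)) (sp (TP V) n)
    (\<lambda>x y. clP V n (push2 (n2 (swp V \<omega>)) x y))"
    by (rule class_n2_bilinear) (use assms in auto)
  show "bilinear_map (free_module (ltrees (VP V) L)) (free_module (ltrees (VP V) M)) (sp (TP V) n)
    (\<lambda>x y. clP V n (push2 (n2 \<omega>) y x))"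
    using class_n2_bilinear[of \<omega> M L n] assms unfolding bilinear_map_def by (auto simp: Int_commute Un_commute)
  show "clP V n (push2 (n2 (swp V \<omega>)) (bas s) (bas t)) = clP V n (push2 (n2 \<omega>) (bas t) (bas s))"
    if "s \<in> ltrees (VP V) L" "t \<in> ltrees (VP V) M" for s t
  proof -
    have "transpose 1 2 permutes {1..length [s, t]}" using transpose_permutes by (simp only: list.size One_nat_def[symmetric] numeral_2_eq_2 add_0_left add_0_right plus_1_eq_Suc add_Suc_right)
    from R.class_Node_act[OF bas_n2_trees[OF assms(1,2,3) that] this]
    show ?thesis unfolding permute_subtrees_swap by (simp add: push2_bas_left n2_def)
  qed
qed

lemma class_rb_node:
  assumes "f \<in> elts (hat V)" "L \<inter> M = {}" "L \<union> M = {1..n}"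
    and "keys x \<subseteq> ltrees (VP V) L" "keys y \<subseteq> ltrees (VP V) M"
  shows "clP V n (rb_node V f x y) =
    clP V n (push2 (n2 (f Dot)) x y) \<oplus>\<^bsub>sp (TP V) n\<^esub>
    clP V n (push2 (n2 (f Prec)) x (push (Pn V) y)) \<oplus>\<^bsub>sp (TP V) n\<^esub>
    clP V n (push2 (n2 (f Succ)) (push (Pn V) x) y)"
    "keys (push2 (n2 (f Dot)) x y) \<subseteq> trees (VP V) n"
    "keys (push2 (n2 (f Prec)) x (push (Pn V) y)) \<subseteq> trees (VP V) n"
    "keys (push2 (n2 (f Succ)) (push (Pn V) x) y) \<subseteq> trees (VP V) n"
proof -
  show k: "keys (push2 (n2 (f Dot)) x y) \<subseteq> trees (VP V) n"
    "keys (push2 (n2 (f Prec)) x (push (Pn V) y)) \<subseteq> trees (VP V) n"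
    "keys (push2 (n2 (f Succ)) (push (Pn V) x) y) \<subseteq> trees (VP V) n"
    unfolding trees_ltrees assms(3)[symmetric]
    by (intro push_n2_keys push_Pn_keys assms; use assms(1) in simp)+
  then show "clP V n (rb_node V f x y) =
    clP V n (push2 (n2 (f Dot)) x y) \<oplus>\<^bsub>sp (TP V) n\<^esub>
    clP V n (push2 (n2 (f Prec)) x (push (Pn V) y)) \<oplus>\<^bsub>sp (TP V) n\<^esub>
    clP V n (push2 (n2 (f Succ)) (push (Pn V) x) y)"
    unfolding rb_node_def using keys_add_subset[OF k(1,2)] by (simp add: R.class_plus)
qed

text \<open>The summands of \<open>rb_node\<close> are linear in the label up to relators at the
  root. The action of (12) on \<open>hat V\<close> swaps \<open>Prec\<close> and
  \<open>Succ\<close>, in accordance with the fact that exchanging the subtrees turns a P on the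
  right into a P on the left.\<close>

lemma ex_Phi0:
  "\<exists>\<Phi>. operad_hom (TV (hat V)) (TP V) \<Phi> \<and>
    (\<forall>n. \<forall>t\<in>trees (arity2 (hat V)) n. \<Phi> n (clV (hat V) n (bas t)) = clP V n (rbt V t))"
proof (rule H.T.free_operad_hom)
  let ?Q = "TP V"
  have keys: "keys (rbt V t) \<subseteq> trees (VP V) n" if "t \<in> trees (arity2 (hat V)) n" for n t
    using rbt_ltrees that by (simp add: trees_ltrees)
  show "operad ?Q" by (rule R.free.operad_axioms)
  show "clP V n (rbt V t) \<in> carrier (sp ?Q n)" if "t \<in> trees (arity2 (hat V)) n" for n t
    by (rule R.tree_class_closed) (rule keys[OF that])
  show "clP V n (rbt V (relabel (inv_into UNIV \<sigma>) t)) = act ?Q n (clP V n (rbt V t)) \<sigma>"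
    if "t \<in> trees (arity2 (hat V)) n" "\<sigma> permutes {1..n}" for n t \<sigma>
    by (simp add: R.act_free[OF that(2) keys[OF that(1)]] rbt_relabel)
  show "clP V 1 (rbt V (Leaf 1)) = opunit ?Q"
    by (simp add: R.opunit_free)
  show "clP V (m + n - 1) (rbt V (graft n i s t)) =
      pcomp ?Q m n i (clP V m (rbt V s)) (clP V n (rbt V t))"
    if "i \<in> {1..m}" "s \<in> trees (arity2 (hat V)) m" "t \<in> trees (arity2 (hat V)) n" for m n i s t
  proof -
    have "distinct (leaves s)" "i \<in> set (leaves s)" using that(1,2) by (auto simp: trees_def)
    then show ?thesis by (simp add: R.pcomp_free[OF that(1) keys[OF that(2)] keys[OF that(3)]] rbt_graft)
  qed
  interpret N: module kring "sp ?Q n" for n by (rule R.free.vspace_sp)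
  have split: "\<exists>L M. L \<inter> M = {} \<and> L \<union> M = {1..n} \<and> keys (rbt V s) \<subseteq> ltrees (VP V) L \<and> keys (rbt V u) \<subseteq> ltrees (VP V) M"
    if "Node a [s, u] \<in> trees (arity2 (hat V)) n" for a s u n
  proof -
    note E = Node2_ltreesE[OF that[unfolded trees_ltrees]]
    show ?thesis
      by (rule exI[of _ "set (leaves s)"], rule exI[of _ "set (leaves u)"]) (use E(4,5) rbt_ltrees[OF E(2)] rbt_ltrees[OF E(3)] in auto)
  qed
  have lab: "a d \<in> elts V" if "Node a ts \<in> trees (arity2 (hat V)) n" for a d ts n
    using that by (auto simp: trees_def split: if_splits)
  have other: "clP V n (rbt V (Node a ts)) = \<zero>\<^bsub>sp ?Q n\<^esub>" if "length ts \<noteq> 2" for n a ts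
    by (simp add: rbt_other[OF that] R.zero_free)
  show "clP V n (rbt V (Node (a \<oplus>\<^bsub>sp (arity2 (hat V)) (length ts)\<^esub> b) ts)) =
      clP V n (rbt V (Node a ts)) \<oplus>\<^bsub>sp ?Q n\<^esub> clP V n (rbt V (Node b ts))"
    if t: "Node a ts \<in> trees (arity2 (hat V)) n" "Node b ts \<in> trees (arity2 (hat V)) n" for n a b ts
  proof (cases "length ts = 2")
    case True
    then obtain s u where ts: "ts = [s, u]" by (auto simp: length_two)
    obtain L M where LM: "L \<inter> M = {}" "L \<union> M = {1..n}" "keys (rbt V s) \<subseteq> ltrees (VP V) L" "keys (rbt V u) \<subseteq> ltrees (VP V) M"
      using split[OF t(1)[unfolded ts]] by (elim exE conjE) (rule that)
    have ab: "a d \<in> elts V" "b d \<in> elts V" for d using lab t by auto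
    note K = LM(3) LM(4) push_Pn_keys[OF LM(3)] push_Pn_keys[OF LM(4)]
    note cl = class_rb_node(2-4)[OF _ LM, THEN R.tree_class_closed]
    have c: "a \<in> elts (hat V)" "b \<in> elts (hat V)" "a \<oplus>\<^bsub>vsp (hat V)\<^esub> b \<in> elts (hat V)" using ab by auto
    have e: "(a \<oplus>\<^bsub>vsp (hat V)\<^esub> b) d = a d \<oplus>\<^bsub>vsp V\<^esub> b d" for d by simp
    show ?thesis unfolding ts
      using cl[OF c(1)] cl[OF c(2)]
      by (simp add: class_rb_node(1)[OF _ LM] ab class_n2_add[OF ab LM(1,2)] K N.a_ac)
  qed (simp add: other)
  show "clP V n (rbt V (Node (c \<odot>\<^bsub>sp (arity2 (hat V)) (length ts)\<^esub> a) ts)) =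
      c \<odot>\<^bsub>sp ?Q n\<^esub> clP V n (rbt V (Node a ts))"
    if t: "Node a ts \<in> trees (arity2 (hat V)) n" for n a c ts
  proof (cases "length ts = 2")
    case True
    then obtain s u where ts: "ts = [s, u]" by (auto simp: length_two)
    obtain L M where LM: "L \<inter> M = {}" "L \<union> M = {1..n}" "keys (rbt V s) \<subseteq> ltrees (VP V) L" "keys (rbt V u) \<subseteq> ltrees (VP V) M"
      using split[OF t[unfolded ts]] by (elim exE conjE) (rule that)
    have a: "a d \<in> elts V" for d using lab t by auto
    note K = LM(3) LM(4) push_Pn_keys[OF LM(3)] push_Pn_keys[OF LM(4)]
    note cl = class_rb_node(2-4)[OF _ LM, THEN R.tree_class_closed]
    have c: "a \<in> elts (hat V)" using a by auto
    show ?thesis unfolding ts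
      using cl[OF c]
      by (simp add: class_rb_node(1)[OF _ LM] a class_n2_smult[OF a LM(1,2)] K N.smult_r_distr)
  qed (simp add: other N.smult_r_null[simplified])
  show "clP V n (rbt V (Node (act (arity2 (hat V)) (length ts) a \<sigma>) ts)) =
      clP V n (rbt V (Node a (permute_subtrees \<sigma> ts)))"
    if t: "Node a ts \<in> trees (arity2 (hat V)) n" and \<sigma>: "\<sigma> permutes {1..length ts}" for n a \<sigma> ts
  proof (cases "length ts = 2")
    case False
    then have "length (permute_subtrees \<sigma> ts) \<noteq> 2" by (simp add: permute_subtrees_def)
    then show ?thesis by (simp only: rbt_other False not_False_eq_True)
  next
    case True
    from swap_cases[OF \<sigma> True] show ?thesis
    proof cases
      case (1 s u)
      then show ?thesis by simp
    next
      case (2 s u)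
      note ts = 2(1)
      obtain L M where LM: "L \<inter> M = {}" "L \<union> M = {1..n}" "keys (rbt V s) \<subseteq> ltrees (VP V) L" "keys (rbt V u) \<subseteq> ltrees (VP V) M"
        using split[OF t[unfolded ts]] by (elim exE conjE) (rule that)
      then have ml: "M \<inter> L = {}" "M \<union> L = {1..n}" by auto
      have a: "a d \<in> elts V" for d using lab t by auto
      note K = LM(3) LM(4) push_Pn_keys[OF LM(3)] push_Pn_keys[OF LM(4)]
      have c: "a \<in> elts (hat V)" "swp (hat V) a \<in> elts (hat V)" using a H.swp_closed by auto
      note cl = class_rb_node(2-4)[OF c(1) ml LM(4,3), THEN R.tree_class_closed]
      have e: "act (arity2 (hat V)) (length ts) a \<sigma> = swp (hat V) a" using 2 by (simp add: numeral_2_eq_2)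
      have lr: "rbt V (Node (act (arity2 (hat V)) (length ts) a \<sigma>) ts) = rb_node V (swp (hat V) a) (rbt V s) (rbt V u)"
        "rbt V (Node a (permute_subtrees \<sigma> ts)) = rb_node V a (rbt V u) (rbt V s)"
        by (simp_all only: e 2(2) rbt_Node2) (simp only: ts rbt_Node2)
      show ?thesis unfolding lr
        unfolding class_rb_node(1)[OF c(1) ml LM(4,3)] class_rb_node(1)[OF c(2) LM]
        using cl by (simp add: class_n2_swp[OF a LM(1,2)] K N.a_ac)
    qed
  qed
qed

end

section \<open>Substitution into the leaves of elements of an ideal\<close>

context tree_operad_ideal
begin

text \<open>The elements with \<open>gid K\<close> form a subspace, so a linear expression has to be
  examined on basis trees only.\<close>

lemma gid_linear:
  assumes "finite K" "linear_map (free_module X) (free_module (ltrees E K)) h"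
    and "\<And>s. s \<in> X \<Longrightarrow> gid K (h (bas s))" and "keys z \<subseteq> X"
  shows "gid K (h z)"
proof -
  have "submodule {r. gid K r} kring (free_module (ltrees E K))"
    by (rule vspace_submoduleI[OF vspace_free_module]) (use gidD(2) gid_zero[OF assms(1)] gid_add gid_smult in auto)
  from free_linear_submodule[OF vspace_free_module assms(2) this, of z] show ?thesis
    using assms(3,4) by simp
qed

text \<open>Dual to \<open>gid_plug\<close>: now the ideal element is the outer operation. Again the
  leaf i is numbered last, so that grafting there shifts none of the other leaves.\<close>

lemma gid_tsubst_one:
  assumes "gid L r" "i \<in> L" "t \<in> ltrees E M" "M \<inter> (L - {i}) = {}"
  shows "gid ((L - {i}) \<union> M) (push (tsubst (\<lambda>j. if j = i then t else Leaf j)) r)"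
proof -
  let ?L = "L - {i}" and ?S = "tsubst (\<lambda>j. if j = i then t else Leaf j)"
  let ?p = "card ?L" and ?k = "card M"
  have fin: "finite ?L" "finite M" using gidD(1)[OF assms(1)] finite_ltrees[OF assms(3)] by auto
  obtain \<beta> where \<beta>: "bij_betw \<beta> ?L {1..?p}" using ex_bij[OF fin(1)] by blast
  obtain \<alpha> where \<alpha>: "bij_betw \<alpha> M {1..?k}" using ex_bij[OF fin(2)] by blast
  define \<gamma> where "\<gamma> x = (if x \<in> M then \<alpha> x + ?p else \<beta> x)" for x
  have c: "card (?L \<union> M) = ?k + ?p" using card_Un_disjoint[OF fin] assms(4) by (simp add: Int_commute)
  have \<gamma>: "bij_betw \<gamma> (?L \<union> M) {1..card (?L \<union> M)}"
  proof -
    have "bij_betw (\<lambda>l. l + ?p) {1..?k} {?p + 1..?p + ?k}"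
      by (rule bij_betwI[of _ _ _ "\<lambda>l. l - ?p"]) auto
    then have "bij_betw ((\<lambda>l. l + ?p) \<circ> \<alpha>) M {?p + 1..?p + ?k}" by (rule bij_betw_trans[OF \<alpha>])
    then have "bij_betw \<gamma> M {?p + 1..?p + ?k}"
      by (rule bij_betw_cong[THEN iffD1, rotated]) (simp add: \<gamma>_def)
    moreover have "bij_betw \<gamma> ?L {1..?p}"
      using \<beta> by (rule bij_betw_cong[THEN iffD1, rotated]) (use assms(4) in \<open>auto simp: \<gamma>_def\<close>)
    ultimately have "bij_betw \<gamma> (M \<union> ?L) ({?p + 1..?p + ?k} \<union> {1..?p})"
      by (rule bij_betw_combine) auto
    moreover have "{?p + 1..?p + ?k} \<union> {1..?p} = {1..card (?L \<union> M)}"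
      unfolding c by auto
    ultimately show ?thesis by (simp add: Un_commute)
  qed
  define \<beta>' where "\<beta>' x = (if x = i then ?p + 1 else \<beta> x)" for x
  have cL: "card L = ?p + 1" using assms(2) gidD(1)[OF assms(1)] by (metis card_Suc_Diff1 Suc_eq_plus1)
  have \<beta>': "bij_betw \<beta>' L {1..card L}"
  proof -
    have "bij_betw \<beta>' ?L {1..?p}"
      using \<beta> by (rule bij_betw_cong[THEN iffD1, rotated]) (auto simp: \<beta>'_def)
    then have "bij_betw \<beta>' (?L \<union> {i}) ({1..?p} \<union> {?p + 1})"
      by (rule bij_betw_combine) (auto simp: \<beta>'_def)
    moreover have "?L \<union> {i} = L" "{1..?p} \<union> {?p + 1} = {1..?p + 1}" using assms(2) by auto
    ultimately show ?thesis by (simp only: cL)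
  qed
  have r: "push (relabel \<beta>') r \<in> I (?p + 1)" using gid_bij[OF assms(1) \<beta>'] by (simp only: cL)
  have t: "relabel \<alpha> t \<in> trees E ?k"
    using relabel_ltrees[OF assms(3), of \<alpha>] \<alpha> by (simp add: bij_betw_def trees_ltrees)
  have g: "graft ?k (?p + 1) (relabel \<beta>' s) (relabel \<alpha> t) = relabel \<gamma> (?S s)" if s: "s \<in> ltrees E L" for s
    unfolding graft_def tsubst_relabel relabel_tsubst
  proof (rule tsubst_cong)
    fix j assume "j \<in> set (leaves s)"
    then have j: "j \<in> L" using s by (auto simp: ltrees_def)
    show "(if \<beta>' j = ?p + 1 then relabel (\<lambda>l. l + (?p + 1) - 1) (relabel \<alpha> t) else Leaf (slot (?p + 1) ?k (\<beta>' j)))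
        = relabel \<gamma> (if j = i then t else Leaf j)"
    proof (cases "j = i")
      case True
      have "relabel (\<lambda>l. l + (?p + 1) - 1) (relabel \<alpha> t) = relabel \<gamma> t"
        unfolding relabel_relabel using assms(3) by (intro relabel_cong) (auto simp: ltrees_def \<gamma>_def)
      then show ?thesis using True by (simp add: \<beta>'_def)
    next
      case False
      then have "\<beta> j \<in> {1..?p}" using bij_betwE[OF \<beta>] j by blast
      moreover have "j \<notin> M" using j False assms(4) by blast
      ultimately show ?thesis using False by (simp add: \<beta>'_def \<gamma>_def slot_def)
    qed
  qed
  have "pcomp (tree_operad E) (?p + 1) ?k (?p + 1) (push (relabel \<beta>') r) (bas (relabel \<alpha> t)) \<in> I (?p + 1 + ?k - 1)"
    by (rule operad_idealD(3)[OF ideal _ r])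
      (use t operad_ideal_subset[OF operad_tree_operad ideal] r in auto)
  moreover have "pcomp (tree_operad E) (?p + 1) ?k (?p + 1) (push (relabel \<beta>') r) (bas (relabel \<alpha> t))
      = push (relabel \<gamma>) (push ?S r)"
    unfolding pcomp_tree_operad push2_bas_right push_push
    by (rule push_cong) (use g gidD(2)[OF assms(1)] in auto)
  moreover have "keys (push ?S r) \<subseteq> ltrees E (?L \<union> M)"
  proof (rule order.trans[OF keys_push], rule image_subsetI)
    fix s assume "s \<in> keys r"
    then have s: "s \<in> ltrees E L" using gidD(2)[OF assms(1)] by blast
    have "?S s \<in> ltrees E (\<Union>j\<in>L. if j = i then M else {j})"
      by (rule tsubst_ltrees[OF s]) (use assms(3,4) in \<open>auto split: if_splits\<close>)
    moreover have "(\<Union>j\<in>L. if j = i then M else {j}) = ?L \<union> M" using assms(2) by auto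
    ultimately show "?S s \<in> ltrees E (?L \<union> M)" by simp
  qed
  ultimately show ?thesis
    unfolding gid_def using \<gamma> fin c by (auto simp: add.commute)
qed

end

lemma gid_mono:
  assumes "tree_operad_ideal E I" "tree_operad_ideal E I'" "\<And>n. I n \<subseteq> I' n" "tree_operad_ideal.gid E I L r"
  shows "tree_operad_ideal.gid E I' L r"
  using assms(3,4) unfolding tree_operad_ideal.gid_def[OF assms(1)] tree_operad_ideal.gid_def[OF assms(2)] by blast

lemma map_labels_arity2:
  assumes "s2_module V"
  shows "smodule_hom (arity2 V) (VP V) (Pair 0)"
proof -
  interpret s2mod V by (rule s2mod.intro) fact
  show ?thesis
    unfolding smodule_hom_def by (auto intro!: linear_mapI split: if_splits)
qed

section \<open>Rota-Baxter relators written as trees, and the inclusion of T(V)\<close>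

context s2mod
begin

lemma class_n2_zero:
  assumes "L \<inter> M = {}" "L \<union> M = {1..n}"
    and "keys x \<subseteq> ltrees (VP V) L" "keys y \<subseteq> ltrees (VP V) M"
  shows "clP V n (push2 (n2 \<zero>\<^bsub>vsp V\<^esub>) x y) = \<zero>\<^bsub>sp (TP V) n\<^esub>"
proof -
  interpret N: module kring "sp (TP V) n" by (rule R.free.vspace_sp)
  have k: "keys (push2 (n2 \<zero>\<^bsub>vsp V\<^esub>) x y) \<subseteq> trees (VP V) n"
    using push_n2_keys[OF _ assms(1,3,4), of "\<zero>\<^bsub>vsp V\<^esub>"] assms(2) by (simp add: trees_ltrees)
  show ?thesis
    using class_n2_smult[OF _ assms, of "\<zero>\<^bsub>vsp V\<^esub>" 0] N.smult_l_null[simplified, OF R.tree_class_closed[OF k]]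
    by (simp add: VS.smult_r_null[simplified])
qed

text \<open>The relator \<open>RB_relator\<close> with arbitrary trees in place of its two inputs,
  before passing to classes.\<close>

definition rb_tree_relator :: "'v \<Rightarrow> ('k \<times> 'v) ltree \<Rightarrow> ('k \<times> 'v) ltree \<Rightarrow> (('k \<times> 'v) ltree \<Rightarrow>\<^sub>0 'k)" where
  "rb_tree_relator \<omega> s t = bas (n2 \<omega> (Pn V s) (Pn V t)) - bas (Pn V (n2 \<omega> (Pn V s) t))
     - bas (Pn V (n2 \<omega> s (Pn V t))) - bas (Pn V (n2 \<omega> s t))"

lemma push_tsubst_rb_tree_relator:
  "push (tsubst g) (rb_tree_relator \<omega> s t) = rb_tree_relator \<omega> (tsubst g s) (tsubst g t)"
  by (simp add: rb_tree_relator_def push_diff)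

lemma graft_simps:
  "graft 1 1 (n2 \<omega> (Leaf 1) (Leaf 2)) (Pn V (Leaf 1)) = n2 \<omega> (Pn V (Leaf 1)) (Leaf 2)"
  "graft 1 2 (n2 \<omega> (Leaf 1) (Leaf 2)) (Pn V (Leaf 1)) = n2 \<omega> (Leaf 1) (Pn V (Leaf 2))"
  "graft 1 2 (n2 \<omega> (Pn V (Leaf 1)) (Leaf 2)) (Pn V (Leaf 1)) = n2 \<omega> (Pn V (Leaf 1)) (Pn V (Leaf 2))"
  "graft 2 1 (Pn V (Leaf 1)) t = Pn V t"
  by (simp_all add: graft_def slot_def relabel_ident)

lemma two_leaf_trees:
  assumes "\<omega> \<in> elts V"
  shows "n2 \<omega> (Leaf 1) (Leaf 2) \<in> trees (VP V) 2" "n2 \<omega> (Pn V (Leaf 1)) (Leaf 2) \<in> trees (VP V) 2"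
    "n2 \<omega> (Leaf 1) (Pn V (Leaf 2)) \<in> trees (VP V) 2" "n2 \<omega> (Pn V (Leaf 1)) (Pn V (Leaf 2)) \<in> trees (VP V) 2"
    "Pn V (Leaf 1) \<in> trees (VP V) 1" "t \<in> trees (VP V) 2 \<Longrightarrow> Pn V t \<in> trees (VP V) 2"
  using assms by (auto simp: trees_def n2_def Pn_def)

lemma VP_gens: "VP_op V \<omega> = clP V 2 (bas (n2 \<omega> (Leaf 1) (Leaf 2)))" "VP_P V = clP V 1 (bas (Pn V (Leaf 1)))"
  by (simp_all add: VP_op_def VP_P_def n2_def Pn_def)

lemma VP_comp:
  assumes "\<omega> \<in> elts V"
  shows "comp_P_id (TP V) (VP_op V \<omega>) (VP_P V) = clP V 2 (bas (n2 \<omega> (Pn V (Leaf 1)) (Leaf 2)))"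
    "comp_id_P (TP V) (VP_op V \<omega>) (VP_P V) = clP V 2 (bas (n2 \<omega> (Leaf 1) (Pn V (Leaf 2))))"
    "comp_P_P (TP V) (VP_op V \<omega>) (VP_P V) = clP V 2 (bas (n2 \<omega> (Pn V (Leaf 1)) (Pn V (Leaf 2))))"
    "t \<in> trees (VP V) 2 \<Longrightarrow> P_comp (TP V) (VP_P V) (clP V 2 (bas t)) = clP V 2 (bas (Pn V t))"
proof -
  note T = two_leaf_trees[OF assms]
  have p: "pcomp (TP V) m n i (clP V m (bas s)) (clP V n (bas t)) = clP V k (bas (graft n i s t))"
    if "i \<in> {1..m}" "s \<in> trees (VP V) m" "t \<in> trees (VP V) n" "k = m + n - 1" for m n i s t k
    using R.pcomp_free[OF that(1), of "bas s" "bas t" n] that(2-4) by (simp add: push2_bas_left)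
  show 1: "comp_P_id (TP V) (VP_op V \<omega>) (VP_P V) = clP V 2 (bas (n2 \<omega> (Pn V (Leaf 1)) (Leaf 2)))"
    unfolding comp_P_id_def VP_gens by (subst p[OF _ T(1,5), of 1 2]) (simp_all only: graft_simps, simp_all)
  show "comp_id_P (TP V) (VP_op V \<omega>) (VP_P V) = clP V 2 (bas (n2 \<omega> (Leaf 1) (Pn V (Leaf 2))))"
    unfolding comp_id_P_def VP_gens by (subst p[OF _ T(1,5), of 2 2]) (simp_all only: graft_simps, simp_all)
  show "comp_P_P (TP V) (VP_op V \<omega>) (VP_P V) = clP V 2 (bas (n2 \<omega> (Pn V (Leaf 1)) (Pn V (Leaf 2))))"
    unfolding comp_P_P_def 1[unfolded comp_P_id_def] unfolding VP_gens
    by (subst p[OF _ T(2,5), of 2 2]) (simp_all only: graft_simps, simp_all)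
  show "P_comp (TP V) (VP_P V) (clP V 2 (bas t)) = clP V 2 (bas (Pn V t))" if t: "t \<in> trees (VP V) 2"
    unfolding P_comp_def VP_gens by (subst p[OF _ T(5) t, of 1 2]) (simp_all only: graft_simps, simp_all)
qed

lemma RB_relator_class:
  assumes "\<omega> \<in> elts V"
  shows "RB_relator V \<omega> = clP V 2 (rb_tree_relator \<omega> (Leaf 1) (Leaf 2))"
    "keys (rb_tree_relator \<omega> (Leaf 1) (Leaf 2)) \<subseteq> trees (VP V) 2"
proof -
  note T = two_leaf_trees[OF assms]
  have k: "keys (bas t :: ('k \<times> 'v) ltree \<Rightarrow>\<^sub>0 'k) \<subseteq> trees (VP V) 2" if "t \<in> trees (VP V) 2" for t
    using that by simp
  note k = k[OF T(4)] k[OF T(6)[OF T(2)]] k[OF T(6)[OF T(3)]] k[OF T(6)[OF T(1)]]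
  note d = keys_diff_subset[OF k(1,2)] keys_diff_subset[OF keys_diff_subset[OF k(1,2)] k(3)]
  show "RB_relator V \<omega> = clP V 2 (rb_tree_relator \<omega> (Leaf 1) (Leaf 2))"
    unfolding RB_relator_def Let_def VP_comp(1-3)[OF assms]
    unfolding VP_gens(1) VP_comp(4)[OF assms T(1)] VP_comp(4)[OF assms T(2)] VP_comp(4)[OF assms T(3)]
    unfolding rb_tree_relator_def
    by (simp only: R.class_minus(1)[OF d(2) k(4)] R.class_minus(1)[OF d(1) k(3)] R.class_minus(1)[OF k(1,2)])
  show "keys (rb_tree_relator \<omega> (Leaf 1) (Leaf 2)) \<subseteq> trees (VP V) 2"
    unfolding rb_tree_relator_def by (rule keys_diff_subset[OF d(2) k(4)])
qed

text \<open>The relations in \<open>RB_ideal\<close> are transported by \<open>tree_induced\<close>.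
  Knowing that this is the restriction of a morphism shows that the transported relations lie in
  T(V_P)(3) and gives them explicit representatives.\<close>

lemma ex_incl:
  obtains \<iota> where "operad_hom (TV V) (TP V) \<iota>"
    and "\<And>n x. keys x \<subseteq> trees (arity2 V) n \<Longrightarrow>
      \<iota> n (clV V n x) = clP V n (push (map_labels (Pair 0)) x)"
    and "\<And>n x. keys x \<subseteq> trees (arity2 V) n \<Longrightarrow>
      \<iota> n (clV V n x) = tree_induced (VP V) n (map_labels (Pair 0)) (clV V n x)"
proof -
  note witness = that
  obtain f where f: "operad_hom (TV V) (TP V) f"
    "\<forall>n x. keys x \<subseteq> trees (arity2 V) n \<longrightarrow>
      f n (clV V n x) = clP V n (push (map_labels (Pair 0)) x) \<and>
      f n (clV V n x) = tree_induced (VP V) n (map_labels (Pair 0)) (clV V n x)"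
    using smodule_hom_free[OF smodule_arity2 smodule_VP map_labels_arity2[OF s2]] by (elim exE conjE) (rule that)
  show ?thesis
    by (rule witness[OF f(1)]) (use f(2)[rule_format, THEN conjunct1] f(2)[rule_format, THEN conjunct2] in \<open>simp_all only:\<close>)
qed

end

text \<open>The tree \<open>t\<close> with \<open>P\<close> inserted at the leaves outside \<open>J\<close>.\<close>

definition pP :: "('k::field, 'v) s2mod \<Rightarrow> nat set \<Rightarrow> 'v ltree \<Rightarrow> ('k \<times> 'v) ltree" where
  "pP V J t = tsubst (\<lambda>i. if i \<in> J then Leaf i else Pn V (Leaf i)) (map_labels (Pair 0) t)"

lemma pP_simps [simp]:
  "pP V J (Leaf i) = (if i \<in> J then Leaf i else Pn V (Leaf i))"
  "pP V J (Node \<omega> [s, t]) = n2 \<omega> (pP V J s) (pP V J t)"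
  by (simp_all add: pP_def n2_def)

section \<open>Calculation modulo the ideal of the Rota-Baxter operad\<close>

locale rota_baxter_setup = s2mod V for V :: "('k::field, 'v) s2mod" +
  fixes Rel :: "('k, 'v) free_elem set"
  assumes Rel: "Rel \<subseteq> carrier (sp (TV V) 3)"
begin

interpretation H: s2mod "hat V"
  by (rule s2mod_hat)

lemma operad_ideal_RB: "operad_ideal (TP V) (RB_ideal V Rel)"
proof -
  obtain \<iota> where \<iota>: "operad_hom (TV V) (TP V) \<iota>"
    "\<And>n x. keys x \<subseteq> trees (arity2 V) n \<Longrightarrow>
      \<iota> n (clV V n x) = clP V n (push (map_labels (Pair 0)) x)"
    "\<And>n x. keys x \<subseteq> trees (arity2 V) n \<Longrightarrow>
      \<iota> n (clV V n x) = tree_induced (VP V) n (map_labels (Pair 0)) (clV V n x)"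
    by (rule ex_incl) (rule that; assumption)
  interpret \<iota>: operad_hom "TV V" "TP V" \<iota> by (rule \<iota>(1))
  have "tree_induced (VP V) 3 (map_labels (Pair 0)) r \<in> carrier (sp (TP V) 3)" if "r \<in> Rel" for r
  proof -
    have r: "r \<in> carrier (sp (TV V) 3)" using that Rel by blast
    then obtain z where "keys z \<subseteq> trees (arity2 V) 3" "r = clV V 3 z"
      unfolding T.carrier_free by auto
    then show ?thesis using linear_mapD(1)[OF \<iota>.hom_linear r] \<iota>(3) by simp
  qed
  moreover have "RB_relator V \<omega> \<in> carrier (sp (TP V) 2)" if "\<omega> \<in> elts V" for \<omega>
    unfolding RB_relator_class(1)[OF that] by (rule R.tree_class_closed) (rule RB_relator_class(2)[OF that])
  ultimately show ?thesis
    unfolding RB_ideal_def by (intro operad_ideal_gen_ideal R.free.operad_axioms) auto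
qed

sublocale RB: operad_quotient "TP V" "RB_ideal V Rel"
  by (intro operad_quotient.intro operad_quotient_axioms.intro R.free.operad_axioms operad_ideal_RB)

text \<open>RB_1(P) is two quotients away from trees. This preimage merges both: congruence modulo
  it allows linearity and symmetry of labels, the relations of the quadratic operad and the
  Rota-Baxter relation, all on actual trees.\<close>

definition rb_kernel :: "nat \<Rightarrow> (('k \<times> 'v) ltree \<Rightarrow>\<^sub>0 'k) set" where
  "rb_kernel n = {x \<in> carrier (sp (tree_operad (VP V)) n). clP V n x \<in> RB_ideal V Rel n}"

sublocale B: tree_operad_ideal "VP V" rb_kernel
proof
  have "operad_ideal (tree_operad (VP V)) (\<lambda>n. {x \<in> carrier (sp (tree_operad (VP V)) n). R.quot.cl n x \<in> RB_ideal V Rel n})"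
    by (rule operad_ideal_preimage[OF R.quot.hom_cl]) (use operad_ideal_RB in \<open>simp add: free_operad_def\<close>)
  then show "operad_ideal (tree_operad (VP V)) rb_kernel"
    by (simp add: rb_kernel_def[abs_def] tree_class_def)
qed

lemma rb_kernel_iff: "x \<in> rb_kernel n \<longleftrightarrow> keys x \<subseteq> trees (VP V) n \<and> clP V n x \<in> RB_ideal V Rel n"
  by (simp add: rb_kernel_def)

lemma gid_crel: "crel (VP V) L r \<Longrightarrow> B.gid L r"
proof (rule gid_mono[OF R.ctxt.tree_operad_ideal_axioms B.tree_operad_ideal_axioms _ R.crel_gid])
  fix n
  show "tree_ideal (VP V) n \<subseteq> rb_kernel n"
  proof
    fix x assume x: "x \<in> tree_ideal (VP V) n"
    have "keys x \<subseteq> trees (VP V) n"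
      using operad_ideal_subset[OF operad_tree_operad R.quot.ideal] x by auto
    then show "x \<in> rb_kernel n"
      using R.tree_class_ideal[OF x] operad_idealD(1)[OF operad_ideal_RB] vspace_submoduleD(2)[OF R.free.vspace_sp]
      by (simp add: rb_kernel_iff)
  qed
qed

lemma gid_relation:
  assumes "keys z \<subseteq> trees (arity2 V) 3" "clV V 3 z \<in> Rel"
  shows "B.gid {1..3} (push (map_labels (Pair 0)) z)"
proof -
  obtain \<iota> where \<iota>: "operad_hom (TV V) (TP V) \<iota>"
    "\<And>n x. keys x \<subseteq> trees (arity2 V) n \<Longrightarrow>
      \<iota> n (clV V n x) = clP V n (push (map_labels (Pair 0)) x)"
    "\<And>n x. keys x \<subseteq> trees (arity2 V) n \<Longrightarrow>
      \<iota> n (clV V n x) = tree_induced (VP V) n (map_labels (Pair 0)) (clV V n x)"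
    by (rule ex_incl) (rule that; assumption)
  have "clP V 3 (push (map_labels (Pair 0)) z) \<in> tree_induced (VP V) 3 (map_labels (Pair 0)) ` Rel"
    using \<iota>(2)[OF assms(1)] \<iota>(3)[OF assms(1)] assms(2) by (metis imageI)
  also have "\<dots> \<subseteq> RB_ideal V Rel 3"
    unfolding RB_ideal_def by (rule order.trans[OF _ gen_ideal_superset]) simp
  finally have 1: "clP V 3 (push (map_labels (Pair 0)) z) \<in> RB_ideal V Rel 3" .
  have "keys (push (map_labels (Pair 0) :: _ \<Rightarrow> ('k \<times> 'v) ltree) z) \<subseteq> trees (VP V) 3"
  proof (rule order.trans[OF keys_push], rule image_subsetI)
    fix t assume "t \<in> keys z"
    then have "t \<in> ltrees (arity2 V) {1..3}" using assms(1) by (auto simp: trees_ltrees)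
    then show "map_labels (Pair 0) t \<in> trees (VP V) 3"
      unfolding trees_ltrees by (rule map_labels_ltrees[rotated]) (auto split: if_splits)
  qed
  with 1 show ?thesis unfolding B.gid_ideal rb_kernel_iff by blast
qed

text \<open>The two inputs are first renamed to leaves a, b that occur in neither tree. Then s and t
  can be substituted one after the other without a clash, and the second substitution leaves s
  alone.\<close>

lemma gid_rb_tree_relator:
  assumes "\<omega> \<in> elts V" "s \<in> ltrees (VP V) L" "t \<in> ltrees (VP V) M" "L \<inter> M = {}"
  shows "B.gid (L \<union> M) (rb_tree_relator \<omega> s t)"
proof -
  have fin: "finite (L \<union> M)" using finite_ltrees assms by blast
  obtain a where a: "a \<notin> L \<union> M" using ex_new_if_finite[OF infinite_UNIV_nat fin] by blast
  obtain b where b: "b \<notin> insert a (L \<union> M)" using ex_new_if_finite[OF infinite_UNIV_nat] fin by (metis finite_insert)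
  have "RB_relator V \<omega> \<in> RB_ideal V Rel 2"
    unfolding RB_ideal_def using assms(1) by (intro subsetD[OF gen_ideal_superset]) simp
  then have "B.gid {1..2} (rb_tree_relator \<omega> (Leaf 1) (Leaf 2))"
    unfolding B.gid_ideal rb_kernel_iff using RB_relator_class[OF assms(1)] by simp
  then have "B.gid ((\<lambda>i. if i = 1 then a else b) ` {1..2::nat}) (push (relabel (\<lambda>i. if i = 1 then a else b)) (rb_tree_relator \<omega> (Leaf 1) (Leaf 2)))"
    by (rule B.gid_relabel) (use b in \<open>auto simp: inj_on_def\<close>)
  moreover have "(\<lambda>i. if i = 1 then a else b) ` {1..2::nat} = {a, b}"
  proof -
    have "{1..2::nat} = {1, 2}" by auto
    then show ?thesis by (simp add: insert_commute)
  qed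
  ultimately have 1: "B.gid {a, b} (rb_tree_relator \<omega> (Leaf a) (Leaf b))"
    by (simp add: relabel_def push_tsubst_rb_tree_relator)
  have "B.gid ({a, b} - {a} \<union> L) (push (tsubst (\<lambda>j. if j = a then s else Leaf j)) (rb_tree_relator \<omega> (Leaf a) (Leaf b)))"
    by (rule B.gid_tsubst_one[OF 1 _ assms(2)]) (use b in auto)
  moreover have "{a, b} - {a} \<union> L = insert b L" using b by auto
  ultimately have 2: "B.gid (insert b L) (rb_tree_relator \<omega> s (Leaf b))"
    using b by (simp add: push_tsubst_rb_tree_relator)
  have "B.gid (insert b L - {b} \<union> M) (push (tsubst (\<lambda>j. if j = b then t else Leaf j)) (rb_tree_relator \<omega> s (Leaf b)))"
    by (rule B.gid_tsubst_one[OF 2 _ assms(3)]) (use b assms(4) in auto)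
  moreover have "insert b L - {b} \<union> M = L \<union> M" using b by auto
  moreover have "tsubst (\<lambda>j. if j = b then t else Leaf j) s = s"
  proof -
    have "b \<notin> set (leaves s)" using b assms(2) by (auto simp: ltrees_def)
    from tsubst_fresh[OF this, of t "\<lambda>j. j"] show ?thesis by (simp add: relabel_ident)
  qed
  ultimately show ?thesis by (simp add: push_tsubst_rb_tree_relator)
qed

lemma gid_n2_left:
  assumes "\<omega> \<in> elts V" "B.gid L r" "L \<inter> M = {}" "finite M" "keys y \<subseteq> ltrees (VP V) M"
  shows "B.gid (L \<union> M) (push2 (n2 \<omega>) r y)"
proof (rule B.gid_linear[where X = "ltrees (VP V) M" and h = "push2 (n2 \<omega>) r"])
  show "linear_map (free_module (ltrees (VP V) M)) (free_module (ltrees (VP V) (L \<union> M))) (push2 (n2 \<omega>) r)"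
    using push_n2_bilinear[OF assms(1,3)] B.gidD(2)[OF assms(2)] by (simp add: bilinear_map_def)
  show "B.gid (L \<union> M) (push2 (n2 \<omega>) r (bas s))" if "s \<in> ltrees (VP V) M" for s
    using B.gid_Node[OF assms(2), of "(0, \<omega>)" "[]" "[s]"] that assms(1,3)
    by (auto simp: push2_bas_right n2_def ltrees_def Int_commute)
qed (use assms B.gidD(1) in auto)

lemma gid_n2_right:
  assumes "\<omega> \<in> elts V" "B.gid M r" "L \<inter> M = {}" "finite L" "keys x \<subseteq> ltrees (VP V) L"
  shows "B.gid (L \<union> M) (push2 (n2 \<omega>) x r)"
proof (rule B.gid_linear[where X = "ltrees (VP V) L" and h = "\<lambda>x. push2 (n2 \<omega>) x r"])
  show "linear_map (free_module (ltrees (VP V) L)) (free_module (ltrees (VP V) (L \<union> M))) (\<lambda>x. push2 (n2 \<omega>) x r)"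
    using push_n2_bilinear[OF assms(1,3)] B.gidD(2)[OF assms(2)] by (simp add: bilinear_map_def)
  show "B.gid (L \<union> M) (push2 (n2 \<omega>) (bas s) r)" if "s \<in> ltrees (VP V) L" for s
    using B.gid_Node[OF assms(2), of "(0, \<omega>)" "[s]" "[]"] that assms(1,3)
    by (auto simp: push2_bas_left n2_def[abs_def] ltrees_def Un_commute)
qed (use assms B.gidD(1) in auto)

lemma push2_diff_left: "push2 h (f - f') g = push2 h f g - push2 h f' g"
  using push2_add_left[of h "f - f'" f' g] by (simp add: eq_diff_eq)

lemma push2_diff_right: "push2 h f (g - g') = push2 h f g - push2 h f g'"
  using push2_add_right[of h f "g - g'" g'] by (simp add: eq_diff_eq)

text \<open>The bilinear difference telescopes: xy - x'y' = (x - x')y + x'(y - y').\<close>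

lemma gid_n2_cong:
  assumes "\<omega> \<in> elts V" "L \<inter> M = {}" "B.gid L (x - x')" "B.gid M (y - y')"
    and "keys x' \<subseteq> ltrees (VP V) L" "keys y \<subseteq> ltrees (VP V) M"
  shows "B.gid (L \<union> M) (push2 (n2 \<omega>) x y - push2 (n2 \<omega>) x' y')"
proof -
  have "push2 (n2 \<omega>) x y - push2 (n2 \<omega>) x' y' = push2 (n2 \<omega>) (x - x') y + push2 (n2 \<omega>) x' (y - y')"
    by (simp add: push2_diff_left push2_diff_right)
  then show ?thesis
    using gid_n2_left[OF assms(1,3,2) B.gidD(1)[OF assms(4)] assms(6)] gid_n2_right[OF assms(1,4,2) B.gidD(1)[OF assms(3)] assms(5)]
    by (simp add: B.gid_add)
qed

text \<open>A label \<open>dec V \<omega> d\<close> is zero in the two directions other than d; this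
  lemma discards the corresponding summands of \<open>rb_node\<close>.\<close>

lemma gid_n2_zero:
  assumes "L \<inter> M = {}" "finite L" "finite M" "keys x \<subseteq> ltrees (VP V) L" "keys y \<subseteq> ltrees (VP V) M"
  shows "B.gid (L \<union> M) (push2 (n2 \<zero>\<^bsub>vsp V\<^esub>) x y)"
proof (rule B.gid_linear[where X = "ltrees (VP V) L" and h = "\<lambda>x. push2 (n2 \<zero>\<^bsub>vsp V\<^esub>) x y"])
  note lin = push_n2_bilinear[OF VS.zero_closed assms(1), unfolded bilinear_map_def]
  show "linear_map (free_module (ltrees (VP V) L)) (free_module (ltrees (VP V) (L \<union> M))) (\<lambda>x. push2 (n2 \<zero>\<^bsub>vsp V\<^esub>) x y)"
    using lin assms(5) by simp
  show "B.gid (L \<union> M) (push2 (n2 \<zero>\<^bsub>vsp V\<^esub>) (bas s) y)" if s: "s \<in> ltrees (VP V) L" for s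
  proof (rule B.gid_linear[where X = "ltrees (VP V) M" and h = "push2 (n2 \<zero>\<^bsub>vsp V\<^esub>) (bas s)"])
    show "linear_map (free_module (ltrees (VP V) M)) (free_module (ltrees (VP V) (L \<union> M))) (push2 (n2 \<zero>\<^bsub>vsp V\<^esub>) (bas s :: _ \<Rightarrow>\<^sub>0 'k))"
      using lin s by simp
    show "B.gid (L \<union> M) (push2 (n2 \<zero>\<^bsub>vsp V\<^esub>) (bas s) (bas t))" if t: "t \<in> ltrees (VP V) M" for t
    proof -
      have "Node (0, \<zero>\<^bsub>vsp V\<^esub>) [s, t] \<in> ltrees (VP V) (L \<union> M)"
        using n2_ltrees[OF VS.zero_closed s t assms(1)] by (simp add: n2_def)
      from ltree_relators_smultI[OF this, of 0] have "crel (VP V) (L \<union> M) (bas (Node (0, \<zero>\<^bsub>vsp V\<^esub>) [s, t]))"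
        by (intro crel.root) (simp add: VS.smult_r_null[simplified])
      then show ?thesis by (simp add: gid_crel push2_bas_left n2_def)
    qed
  qed (use assms in auto)
qed (use assms in auto)

end

context rota_baxter_setup
begin

interpretation H: s2mod "hat V"
  by (rule s2mod_hat)

lemma gid_sum3:
  assumes "B.gid L (x - x')" "B.gid L y" "B.gid L z"
  shows "B.gid L (x + y + z - x')" "B.gid L (y + x + z - x')" "B.gid L (y + z + x - x')"
proof -
  have "B.gid L ((x - x') + y + z)" using assms by (intro B.gid_add)
  then show "B.gid L (x + y + z - x')" "B.gid L (y + x + z - x')" "B.gid L (y + z + x - x')"
    by (simp_all add: algebra_simps)
qed

text \<open>The relation is used for sums of trees, so both sides are treated as bilinear in x and y
  and checked on pairs of trees. The sum below P is the expansion of a vertex with the star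
  label.\<close>

lemma gid_rb_relator:
  fixes x y :: "('k \<times> 'v) ltree \<Rightarrow>\<^sub>0 'k"
  assumes "\<omega> \<in> elts V" "L \<inter> M = {}" "finite L" "finite M"
    and x: "keys x \<subseteq> ltrees (VP V) L" and y: "keys y \<subseteq> ltrees (VP V) M"
  shows "B.gid (L \<union> M) (push (Pn V) (push2 (n2 \<omega>) x y + push2 (n2 \<omega>) x (push (Pn V) y) + push2 (n2 \<omega>) (push (Pn V) x) y)
    - push2 (n2 \<omega>) (push (Pn V) x) (push (Pn V) y))"
proof -
  let ?D = "\<lambda>x y :: ('k \<times> 'v) ltree \<Rightarrow>\<^sub>0 'k. push2 (n2 \<omega>) (push (Pn V) x) (push (Pn V) y) - push (Pn V) (push2 (n2 \<omega>) (push (Pn V) x) y)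
    - push (Pn V) (push2 (n2 \<omega>) x (push (Pn V) y)) - push (Pn V) (push2 (n2 \<omega>) x y)"
  let ?X = "free_module (ltrees (VP V) L) :: ('k, _) module" and ?Y = "free_module (ltrees (VP V) M) :: ('k, _) module"
    and ?Z = "free_module (ltrees (VP V) (L \<union> M)) :: ('k, _) module"
  note b = push_n2_bilinear[OF assms(1,2)]
  have lin: "bilinear_map ?X ?Y ?Z ?D"
  proof -
    have p: "keys (push (Pn V) x) \<subseteq> ltrees (VP V) K" if "keys x \<subseteq> ltrees (VP V) K" for x :: "('k \<times> 'v) ltree \<Rightarrow>\<^sub>0 'k" and K
      by (rule push_Pn_keys[OF that])
    have k: "keys (?D x y) \<subseteq> ltrees (VP V) (L \<union> M)"
      if "keys x \<subseteq> ltrees (VP V) L" "keys y \<subseteq> ltrees (VP V) M" for x y :: "('k \<times> 'v) ltree \<Rightarrow>\<^sub>0 'k"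
      by (intro keys_diff_subset p push_n2_keys assms that)
    show ?thesis unfolding bilinear_map_def
      by (intro conjI ballI linear_mapI)
        (use k in \<open>simp_all add: push_add push2_add_left push2_add_right push_smult push2_smult_left push2_smult_right map_mult_diff\<close>)
  qed
  have "B.gid (L \<union> M) (?D x y)"
  proof (rule B.gid_linear[where X = "ltrees (VP V) L" and h = "\<lambda>x. ?D x y"])
    show "linear_map ?X ?Z (\<lambda>x. ?D x y)" using lin y by (simp add: bilinear_map_def)
    show "B.gid (L \<union> M) (?D (bas s) y)" if s: "s \<in> ltrees (VP V) L" for s
    proof (rule B.gid_linear[where X = "ltrees (VP V) M" and h = "?D (bas s)"])
      have l: "linear_map ?Y ?Z (?D x)" if "keys x \<subseteq> ltrees (VP V) L" for x
        using lin that by (simp add: bilinear_map_def)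
      show "linear_map ?Y ?Z (?D (bas s))" by (rule l) (use s in simp)
      show "B.gid (L \<union> M) (?D (bas s) (bas t))" if t: "t \<in> ltrees (VP V) M" for t
        using gid_rb_tree_relator[OF assms(1) s t assms(2)] by (simp add: push2_bas_left rb_tree_relator_def)
    qed (use assms in auto)
  qed (use assms in auto)
  from B.gid_uminus[OF this] show ?thesis by (simp add: push_add algebra_simps)
qed

lemma pP_ltrees:
  assumes "t \<in> ltrees (arity2 V) L"
  shows "pP V J t \<in> ltrees (VP V) L"
proof -
  have "map_labels (Pair 0) t \<in> ltrees (VP V) L"
    by (rule map_labels_ltrees[OF _ assms]) (auto split: if_splits)
  then have "pP V J t \<in> ltrees (VP V) (\<Union>i\<in>L. {i})"
    unfolding pP_def by (rule tsubst_ltrees) (auto simp: Pn_def ltrees_def)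
  then show ?thesis by simp
qed

lemma gid_other:
  assumes "Node \<omega> ts \<in> ltrees (arity2 V) L" "length ts \<noteq> 2"
  shows "B.gid L (bas (pP V J (Node \<omega> ts)))"
proof -
  let ?t = "pP V J (Node \<omega> ts)" and ?us = "map (\<lambda>t. pP V J t) ts"
  have \<omega>: "\<omega> = \<zero>\<^bsub>vsp V\<^esub>" using assms by (auto simp: ltrees_def)
  have e: "?t = Node (0, \<zero>\<^bsub>vsp V\<^esub>) ?us" by (simp add: pP_def \<omega>)
  have "Node (0, \<zero>\<^bsub>vsp V\<^esub>) ?us \<in> ltrees (VP V) L" using pP_ltrees[OF assms(1)] e by metis
  from ltree_relators_smultI[OF this, of 0] have "crel (VP V) L (bas (Node (0, \<zero>\<^bsub>vsp V\<^esub>) ?us))"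
    by (intro crel.root) (simp add: VS.smult_r_null[simplified])
  then show ?thesis unfolding e by (rule gid_crel)
qed

text \<open>The two alternatives fit together because a decoration tells on which sides J is missed:
  the surviving summand of \<open>rb_node\<close> puts P exactly on the subtrees without leaves of
  J, which is where the induction hypothesis asks for a P at the root.\<close>

lemma gid_rbt_tsu:
  assumes "t \<in> ltrees (arity2 V) L"
  shows "B.gid L ((if J \<inter> L = {} then push (Pn V) (rbt V (tsu_tree V J t)) else rbt V (tsu_tree V J t)) - bas (pP V J t))"
  using assms
proof (induction t arbitrary: L rule: tree2_induct)
  case (Leaf i)
  then show ?case by (auto intro!: B.gid_zero)
next
  case (other \<omega> ts)
  have fin: "finite L" by (rule finite_ltrees[OF other(2)])
  have z: "rbt V (tsu_tree V J (Node \<omega> ts)) = 0" using other(1) by (simp add: rbt_other)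
  have p0: "push (Pn V) 0 = (0 :: ('k \<times> 'v) ltree \<Rightarrow>\<^sub>0 'k)" by (simp add: push_def)
  show ?case unfolding z p0 using B.gid_diff[OF B.gid_zero[OF fin] gid_other[OF other(2,1)]] by simp
next
  case (Node2 \<omega> s u)
  let ?L = "set (leaves s)" and ?M = "set (leaves u)"
  note E = Node2_ltreesE[OF Node2.prems]
  let ?X = "rbt V (tsu_tree V J s)" and ?Y = "rbt V (tsu_tree V J u)"
  let ?p = "bas (pP V J s) :: _ \<Rightarrow>\<^sub>0 'k" and ?q = "bas (pP V J u) :: _ \<Rightarrow>\<^sub>0 'k"
  note X = rbt_ltrees[OF tsu_tree_ltrees[OF E(2)], of J] and Y = rbt_ltrees[OF tsu_tree_ltrees[OF E(3)], of J]
  note PX = push_Pn_keys[OF X] and PY = push_Pn_keys[OF Y]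
  have p: "keys ?p \<subseteq> ltrees (VP V) ?L" and q: "keys ?q \<subseteq> ltrees (VP V) ?M"
    using pP_ltrees[OF E(2)] pP_ltrees[OF E(3)] by auto
  note IH = Node2.IH(1)[OF E(2)] Node2.IH(2)[OF E(3)]
  have w: "dec V \<omega> d d' \<in> elts V" for d d' using E(1) by simp
  have pq: "bas (pP V J (Node \<omega> [s, u])) = push2 (n2 \<omega>) ?p ?q" by (simp add: push2_bas_left)
  note zero = gid_n2_zero[OF E(4) finite_set finite_set]
  note c = gid_n2_cong[OF E(1) E(4) _ _ p]
  consider "J \<inter> ?L \<noteq> {}" "J \<inter> ?M \<noteq> {}" | "J \<inter> ?L \<noteq> {}" "J \<inter> ?M = {}" | "J \<inter> ?L = {}" "J \<inter> ?M \<noteq> {}" | "J \<inter> ?L = {}" "J \<inter> ?M = {}"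
    by blast
  then show ?case
  proof cases
    \<comment> \<open>Both subtrees meet J, so neither needs a P at its root; the dot keeps the
      summand without P.\<close>
    case 1
    then have J: "J \<inter> L \<noteq> {}" unfolding E(5) by blast
    have "B.gid (?L \<union> ?M) (rb_node V (dec V \<omega> Dot) ?X ?Y - push2 (n2 \<omega>) ?p ?q)"
      unfolding rb_node_def
      using gid_sum3(1)[OF c[OF IH[simplified 1 if_False] Y] zero[OF X PY] zero[OF PX Y]] by (simp add: dec_def)
    then show ?thesis using J 1 E(5) by (simp add: pq[simplified])
  next
    \<comment> \<open>Only the right subtree misses J, and \<open>Prec\<close> keeps the summand
      with P on the right.\<close>
    case 2
    then have J: "J \<inter> L \<noteq> {}" unfolding E(5) by blast
    have i: "B.gid ?L (?X - ?p)" "B.gid ?M (push (Pn V) ?Y - ?q)" using IH 2 by simp_all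
    have "B.gid (?L \<union> ?M) (rb_node V (dec V \<omega> Prec) ?X ?Y - push2 (n2 \<omega>) ?p ?q)"
      unfolding rb_node_def
      using gid_sum3(2)[OF c[OF i PY] zero[OF X Y] zero[OF PX Y]] by (simp add: dec_def)
    then show ?thesis using J 2 E(5) by (simp add: pq[simplified])
  next
    case 3
    then have J: "J \<inter> L \<noteq> {}" unfolding E(5) by blast
    have i: "B.gid ?L (push (Pn V) ?X - ?p)" "B.gid ?M (?Y - ?q)" using IH 3 by simp_all
    have "B.gid (?L \<union> ?M) (rb_node V (dec V \<omega> Succ) ?X ?Y - push2 (n2 \<omega>) ?p ?q)"
      unfolding rb_node_def
      using gid_sum3(3)[OF c[OF i Y] zero[OF X Y] zero[OF X PY]] by (simp add: dec_def)
    then show ?thesis using J 3 E(5) by (simp add: pq[simplified])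
  next
    \<comment> \<open>All three coordinates of the star label equal \<omega>, so all summands
      survive. With P in front they are congruent to \<omega>(P x, P y), after which both induction
      hypotheses apply.\<close>
    case 4
    then have J: "J \<inter> L = {}" unfolding E(5) by blast
    have i: "B.gid ?L (push (Pn V) ?X - ?p)" "B.gid ?M (push (Pn V) ?Y - ?q)" using IH 4 by simp_all
    have "B.gid (?L \<union> ?M) (push (Pn V) (rb_node V (dec_star V \<omega>) ?X ?Y) - push2 (n2 \<omega>) ?p ?q)"
      using B.gid_add[OF gid_rb_relator[OF E(1,4) finite_set finite_set X Y] c[OF i PY]]
      unfolding rb_node_def by (simp add: dec_star_eq[OF E(1)])
    then show ?thesis using J 4 E(5) by (simp add: pq[simplified])
  qed
qed

text \<open>Inserting P at one leaf is a composition with P, which stays in the ideal. The induction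
  runs over the set K of leaves that have already received their P.\<close>

lemma gid_pP:
  assumes "B.gid L (push (map_labels (Pair 0)) z)" "J \<subseteq> L" "keys z \<subseteq> ltrees (arity2 V) L"
  shows "B.gid L (push (pP V J) z)"
proof -
  let ?z = "push (map_labels (Pair 0)) z :: _ \<Rightarrow>\<^sub>0 'k"
  have fin: "finite L" by (rule B.gidD(1)[OF assms(1)])
  have K: "B.gid L (push (tsubst (\<lambda>i. if i \<in> K then Pn V (Leaf i) else Leaf i)) ?z)" if "finite K" "K \<subseteq> L" for K
    using that
  proof (induction K rule: finite_induct)
    case empty
    have "(\<lambda>i. if i \<in> {} then Pn V (Leaf i) else Leaf i) = (\<lambda>i. Leaf i)" by simp
    then show ?case using assms(1) by (simp add: push_ident relabel_ident flip: relabel_def)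
  next
    case (insert k K)
    let ?y = "push (tsubst (\<lambda>i. if i \<in> K then Pn V (Leaf i) else Leaf i)) ?z"
    have y: "B.gid L ?y" using insert by simp
    have "B.gid (L - {k} \<union> {k}) (push (tsubst (\<lambda>j. if j = k then Pn V (Leaf k) else Leaf j)) ?y)"
      by (rule B.gid_tsubst_one[OF y]) (use insert in auto)
    moreover have "L - {k} \<union> {k} = L" using insert by auto
    moreover have "push (tsubst (\<lambda>j. if j = k then Pn V (Leaf k) else Leaf j)) ?y
        = push (tsubst (\<lambda>i. if i \<in> insert k K then Pn V (Leaf i) else Leaf i)) ?z"
      unfolding push_push tsubst_tsubst using insert(2) by (intro push_cong tsubst_cong) auto
    ultimately show ?case by simp
  qed
  have "push (pP V J) z = push (tsubst (\<lambda>i. if i \<in> L - J then Pn V (Leaf i) else Leaf i)) ?z"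
    unfolding push_push pP_def
    by (intro push_cong tsubst_cong) (use assms(3) in \<open>auto simp: ltrees_def\<close>)
  then show ?thesis using K[of "L - J"] fin by simp
qed

end

section \<open>The morphism from the trisuccessor to the Rota-Baxter operad\<close>

lemma (in operad_quotient) cl_zero:
  assumes "x \<in> I n"
  shows "cl n x = \<zero>\<^bsub>sp (quot_operad Q I) n\<^esub>"
proof -
  have "x \<in> carrier (sp Q n)" using operad_ideal_subset[OF operad_axioms ideal] assms by blast
  then show ?thesis
    using coset_eq_self_iff[OF vspace_sp submod, of x n] assms
    by (simp add: quot_operad_def quot_module_def mk_module_def)
qed

context rota_baxter_setup
begin

interpretation H: s2mod "hat V"
  by (rule s2mod_hat)

text \<open>Two linear maps are compared on a representative z of r: decoration followed by \<Phi>,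
  and insertion of P outside J. They are congruent on single trees, hence on z; and the second sends
  z into the ideal because z represents a relation.\<close>

lemma TSu_map_RB_ideal:
  assumes "operad_hom (TV (hat V)) (TP V) \<Phi>"
    and "\<And>n t. t \<in> trees (arity2 (hat V)) n \<Longrightarrow> \<Phi> n (clV (hat V) n (bas t)) = clP V n (rbt V t)"
    and r: "r \<in> Rel" and J: "J \<noteq> {}" "J \<subseteq> {1..3}"
  shows "\<Phi> 3 (TSu_map V 3 J r) \<in> RB_ideal V Rel 3"
proof -
  interpret \<Phi>: operad_hom "TV (hat V)" "TP V" \<Phi> by (rule assms(1))
  let ?N = "sp (TP V) 3"
  interpret N: module kring ?N by (rule R.free.vspace_sp)
  note I = vspace_submoduleD[OF R.free.vspace_sp RB.submod]
  have "r \<in> carrier (sp (TV V) 3)" using r Rel by blast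
  then obtain z where z: "keys z \<subseteq> trees (arity2 V) 3" "r = clV V 3 z"
    unfolding T.carrier_free by auto
  let ?h1 = "\<lambda>z. \<Phi> 3 (clV (hat V) 3 (push (tsu_tree V J) z))"
  let ?h2 = "\<lambda>z. clP V 3 (push (pP V J) z)"
  have h1: "linear_map (free_module (trees (arity2 V) 3)) ?N ?h1"
    by (intro linear_map_compose[OF push_tsu_linear] linear_map_compose[OF H.T.tree_class_linear] \<Phi>.hom_linear)
  have pk: "pP V J t \<in> trees (VP V) 3" if "t \<in> trees (arity2 V) 3" for t
    using pP_ltrees that by (simp add: trees_ltrees)
  have h2: "linear_map (free_module (trees (arity2 V) 3)) ?N ?h2"
    by (rule linear_map_compose[OF push_linear R.tree_class_linear]) (use pk in auto)
  have "?h1 z \<oplus>\<^bsub>?N\<^esub> \<ominus>\<^bsub>?N\<^esub> ?h2 z \<in> RB_ideal V Rel 3"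
  proof (rule free_linear_submodule[OF R.free.vspace_sp _ RB.submod _ z(1), where h = "\<lambda>z. ?h1 z \<oplus>\<^bsub>?N\<^esub> \<ominus>\<^bsub>?N\<^esub> ?h2 z"])
    show "linear_map (free_module (trees (arity2 V) 3)) ?N (\<lambda>z. ?h1 z \<oplus>\<^bsub>?N\<^esub> \<ominus>\<^bsub>?N\<^esub> ?h2 z)"
      by (intro linear_map_add linear_map_uminus vspace_free_module R.free.vspace_sp h1 h2)
    fix t assume t: "t \<in> trees (arity2 V) 3"
    \<comment> \<open>A nonempty J meets the leaf set of the whole tree, so the alternative without
      P at the root applies.\<close>
    have "J \<inter> {1..3} \<noteq> {}" using J by blast
    then have "B.gid {1..3} (rbt V (tsu_tree V J t) - bas (pP V J t))"
      using gid_rbt_tsu[of t "{1..3}" J] t by (simp add: trees_ltrees)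
    then have "clP V 3 (rbt V (tsu_tree V J t) - bas (pP V J t)) \<in> RB_ideal V Rel 3"
      by (simp add: B.gid_ideal rb_kernel_iff)
    moreover have "keys (rbt V (tsu_tree V J t)) \<subseteq> trees (VP V) 3"
      using rbt_ltrees[OF tsu_tree_ltrees] t by (simp add: trees_ltrees)
    ultimately show "?h1 (bas t) \<oplus>\<^bsub>?N\<^esub> \<ominus>\<^bsub>?N\<^esub> ?h2 (bas t) \<in> RB_ideal V Rel 3"
      using pk[OF t] by (simp add: assms(2)[OF tsu_tree_trees[OF t]] R.class_minus(1) a_minus_def)
  qed
  moreover have "?h2 z \<in> RB_ideal V Rel 3"
    using gid_pP[OF gid_relation[OF z(1)] J(2)] r z by (simp add: B.gid_ideal rb_kernel_iff trees_ltrees)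
  ultimately have "(?h1 z \<oplus>\<^bsub>?N\<^esub> \<ominus>\<^bsub>?N\<^esub> ?h2 z) \<oplus>\<^bsub>?N\<^esub> ?h2 z \<in> RB_ideal V Rel 3"
    by (rule I(3))
  moreover have "?h1 z \<in> carrier ?N" "?h2 z \<in> carrier ?N"
    using linear_mapD(1)[OF h1] linear_mapD(1)[OF h2] z(1) by simp_all
  ultimately show ?thesis unfolding z(2) TSu_map_class[OF z(1)] by (simp add: N.a_assoc N.l_neg)
qed

text \<open>Two of the three summands of \<open>rb_node\<close> carry the label zero and vanish,
  which leaves the prescribed value of \<eta> on the generator.\<close>

lemma class_rb_node_dec:
  assumes "\<omega> \<in> elts V"
  shows "clP V 2 (rb_node V (dec V \<omega> Prec) (bas (Leaf 1)) (bas (Leaf 2))) = comp_id_P (TP V) (VP_op V \<omega>) (VP_P V)"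
    "clP V 2 (rb_node V (dec V \<omega> Succ) (bas (Leaf 1)) (bas (Leaf 2))) = comp_P_id (TP V) (VP_op V \<omega>) (VP_P V)"
    "clP V 2 (rb_node V (dec V \<omega> Dot) (bas (Leaf 1)) (bas (Leaf 2))) = VP_op V \<omega>"
proof -
  interpret N: module kring "sp (TP V) 2" by (rule R.free.vspace_sp)
  have LM: "{1} \<inter> {2::nat} = {}" "{1} \<union> {2} = {1..2::nat}" by auto
  have k: "keys (bas (Leaf i) :: ('k \<times> 'v) ltree \<Rightarrow>\<^sub>0 'k) \<subseteq> ltrees (VP V) {i}" for i by simp
  have d: "dec V \<omega> d \<in> elts (hat V)" for d using assms by simp
  note pk = push_Pn_keys[OF k]
  note zero = class_n2_zero[OF LM k k] class_n2_zero[OF LM k pk] class_n2_zero[OF LM pk k]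
  have c: "clP V 2 (bas t) \<in> carrier (sp (TP V) 2)" if "t \<in> trees (VP V) 2" for t
    by (rule R.tree_class_closed) (use that in simp)
  note c = c[OF two_leaf_trees(1)[OF assms]] c[OF two_leaf_trees(2)[OF assms]] c[OF two_leaf_trees(3)[OF assms]]
  have e: "push2 (n2 \<nu>) (bas (Leaf 1)) (bas (Leaf 2)) = (bas (n2 \<nu> (Leaf 1) (Leaf 2)) :: _ \<Rightarrow>\<^sub>0 'k)"
    "push2 (n2 \<nu>) (bas (Leaf 1)) (push (Pn V) (bas (Leaf 2))) = (bas (n2 \<nu> (Leaf 1) (Pn V (Leaf 2))) :: _ \<Rightarrow>\<^sub>0 'k)"
    "push2 (n2 \<nu>) (push (Pn V) (bas (Leaf 1))) (bas (Leaf 2)) = (bas (n2 \<nu> (Pn V (Leaf 1)) (Leaf 2)) :: _ \<Rightarrow>\<^sub>0 'k)" for \<nu>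
    by (simp_all add: push2_bas_left)
  note zero = zero[unfolded e]
  note s = class_rb_node(1)[OF d LM k k, unfolded e]
  show "clP V 2 (rb_node V (dec V \<omega> Prec) (bas (Leaf 1)) (bas (Leaf 2))) = comp_id_P (TP V) (VP_op V \<omega>) (VP_P V)"
    "clP V 2 (rb_node V (dec V \<omega> Succ) (bas (Leaf 1)) (bas (Leaf 2))) = comp_P_id (TP V) (VP_op V \<omega>) (VP_P V)"
    "clP V 2 (rb_node V (dec V \<omega> Dot) (bas (Leaf 1)) (bas (Leaf 2))) = VP_op V \<omega>"
    unfolding s VP_comp[OF assms] using c by (simp_all add: dec_def zero VP_gens(1))
qed

lemma RB1_comp:
  assumes "\<omega> \<in> elts V"
  shows "comp_id_P (RB1 V Rel) (RB1_op V Rel \<omega>) (RB1_P V Rel) = RB.cl 2 (comp_id_P (TP V) (VP_op V \<omega>) (VP_P V))"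
    "comp_P_id (RB1 V Rel) (RB1_op V Rel \<omega>) (RB1_P V Rel) = RB.cl 2 (comp_P_id (TP V) (VP_op V \<omega>) (VP_P V))"
proof -
  have c: "VP_op V \<omega> \<in> carrier (sp (TP V) 2)" "VP_P V \<in> carrier (sp (TP V) 1)"
    unfolding VP_gens by (rule R.tree_class_closed; use two_leaf_trees[OF assms] in simp)+
  show "comp_id_P (RB1 V Rel) (RB1_op V Rel \<omega>) (RB1_P V Rel) = RB.cl 2 (comp_id_P (TP V) (VP_op V \<omega>) (VP_P V))"
    "comp_P_id (RB1 V Rel) (RB1_op V Rel \<omega>) (RB1_P V Rel) = RB.cl 2 (comp_P_id (TP V) (VP_op V \<omega>) (VP_P V))"
    using RB.pcomp_quot[of 2 2 "VP_op V \<omega>" "VP_P V" 1] RB.pcomp_quot[of 1 2 "VP_op V \<omega>" "VP_P V" 1] c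
    by (simp_all add: comp_id_P_def comp_P_id_def RB1_def RB1_op_def RB1_P_def)
qed

lemma TSu_rel_closed: "TSu_rel V Rel \<subseteq> carrier (sp (TV (hat V)) 3)"
  unfolding TSu_rel_def using linear_mapD(1)[OF TSu_map_linear] Rel by blast

text \<open>The relations generating the ideal of TSu(P) sit in arity three and are sent into the
  Rota-Baxter ideal, so the morphism of free operads descends. Its values are those of
  \<open>class_rb_node_dec\<close>, rewritten as compositions in the quotient.\<close>

theorem ex_TSu_RB1:
  "\<exists>\<Phi>. operad_hom (TSu V Rel) (RB1 V Rel) \<Phi> \<and>
     (\<forall>\<omega>\<in>elts V.
        \<Phi> 2 (TSu_gen V Rel \<omega> Prec) = comp_id_P (RB1 V Rel) (RB1_op V Rel \<omega>) (RB1_P V Rel) \<and>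
        \<Phi> 2 (TSu_gen V Rel \<omega> Succ) = comp_P_id (RB1 V Rel) (RB1_op V Rel \<omega>) (RB1_P V Rel) \<and>
        \<Phi> 2 (TSu_gen V Rel \<omega> Dot) = RB1_op V Rel \<omega>)"
proof -
  interpret Q: operad_quotient "TV (hat V)" "quad_ideal (hat V) (TSu_rel V Rel)"
    by (rule H.quad_quotient[OF TSu_rel_closed])
  obtain F where F: "operad_hom (TV (hat V)) (TP V) F"
    and Ft: "\<forall>n. \<forall>t\<in>trees (arity2 (hat V)) n. F n (clV (hat V) n (bas t)) = clP V n (rbt V t)"
    using ex_Phi0 by (elim exE conjE) (rule that)
  have FI: "F n x \<in> RB_ideal V Rel n" if "x \<in> quad_ideal (hat V) (TSu_rel V Rel) n" for n x
  proof (rule gen_ideal_hom_zero[OF F _ operad_ideal_RB that[unfolded quad_ideal_def]])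
    fix m :: nat and y assume y: "y \<in> (if m = 3 then TSu_rel V Rel else {})"
    then have m: "m = 3" and "y \<in> TSu_rel V Rel" by (auto split: if_splits)
    then obtain J r where J: "y = TSu_map V 3 J r" "r \<in> Rel" "J \<noteq> {}" "J \<subseteq> {1,2,3}" by (auto simp: TSu_rel_def)
    have "{1,2,3} \<subseteq> {1..3::nat}" by auto
    with J(4) have "J \<subseteq> {1..3}" by (rule order.trans)
    from TSu_map_RB_ideal[OF F _ J(2,3) this] Ft have "F 3 y \<in> RB_ideal V Rel 3" unfolding J(1) by blast
    with m \<open>y \<in> TSu_rel V Rel\<close> TSu_rel_closed show "y \<in> carrier (sp (TV (hat V)) m) \<and> F m y \<in> RB_ideal V Rel m" by blast
  qed
  have zero: "RB.cl n (F n x) = \<zero>\<^bsub>sp (quot_operad (TP V) (RB_ideal V Rel)) n\<^esub>"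
    if "x \<in> quad_ideal (hat V) (TSu_rel V Rel) n" for n x
    by (rule RB.cl_zero[OF FI[OF that]])
  have "\<exists>\<Phi>. operad_hom (quot_operad (TV (hat V)) (quad_ideal (hat V) (TSu_rel V Rel)))
      (quot_operad (TP V) (RB_ideal V Rel)) \<Phi> \<and>
      (\<forall>n. \<forall>x\<in>carrier (sp (TV (hat V)) n). \<Phi> n (Q.cl n x) = RB.cl n (F n x))"
    by (rule Q.hom_factor[OF operad_hom_compose[OF F RB.hom_cl]]) (rule zero)
  then obtain \<Phi> where \<Phi>: "operad_hom (quot_operad (TV (hat V)) (quad_ideal (hat V) (TSu_rel V Rel)))
      (quot_operad (TP V) (RB_ideal V Rel)) \<Phi>"
    and \<Phi>v: "\<forall>n. \<forall>x\<in>carrier (sp (TV (hat V)) n). \<Phi> n (Q.cl n x) = RB.cl n (F n x)"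
    by (elim exE conjE) (rule that)
  have v: "\<Phi> 2 (TSu_gen V Rel \<omega> d) = RB.cl 2 (clP V 2 (rb_node V (dec V \<omega> d) (bas (Leaf 1)) (bas (Leaf 2))))"
    if "\<omega> \<in> elts V" for \<omega> d
  proof -
    have t: "Node (dec V \<omega> d) [Leaf 1, Leaf 2] \<in> trees (arity2 (hat V)) 2"
      using that by (auto simp: trees_def)
    have "gen2 (hat V) (dec V \<omega> d) \<in> carrier (sp (TV (hat V)) 2)"
      unfolding gen2_def by (rule H.T.tree_class_closed) (use t in simp)
    then show ?thesis
      using \<Phi>v Ft[rule_format, OF t] unfolding TSu_gen_def quad_gen_def by (simp add: gen2_def)
  qed
  show ?thesis
  proof (intro exI conjI ballI)
    show "operad_hom (TSu V Rel) (RB1 V Rel) \<Phi>" using \<Phi> by (simp add: TSu_def quad_operad_def RB1_def)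
    fix \<omega> assume w: "\<omega> \<in> elts V"
    show "\<Phi> 2 (TSu_gen V Rel \<omega> Prec) = comp_id_P (RB1 V Rel) (RB1_op V Rel \<omega>) (RB1_P V Rel)"
      "\<Phi> 2 (TSu_gen V Rel \<omega> Succ) = comp_P_id (RB1 V Rel) (RB1_op V Rel \<omega>) (RB1_P V Rel)"
      "\<Phi> 2 (TSu_gen V Rel \<omega> Dot) = RB1_op V Rel \<omega>"
      unfolding v[OF w] class_rb_node_dec[OF w] RB1_comp[OF w] by (simp_all add: RB1_op_def)
  qed
qed

end

section \<open>Evaluation of trees in an algebra with a Rota-Baxter operator\<close>

lemma End_simps [simp]:
  "carrier (sp (End_operad A) n) = multilinear_maps A n"
  "\<zero>\<^bsub>sp (End_operad A) n\<^esub> = (\<lambda>e\<in>tuples A n. \<zero>\<^bsub>A\<^esub>)"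
  "f \<oplus>\<^bsub>sp (End_operad A) n\<^esub> g = (\<lambda>e\<in>tuples A n. f e \<oplus>\<^bsub>A\<^esub> g e)"
  "c \<odot>\<^bsub>sp (End_operad A) n\<^esub> f = (\<lambda>e\<in>tuples A n. c \<odot>\<^bsub>A\<^esub> f e)"
  "act (End_operad A) n f \<sigma> = (\<lambda>e\<in>tuples A n. f (\<lambda>j\<in>{1..n}. e (inv_into UNIV \<sigma> j)))"
  "opunit (End_operad A) = (\<lambda>e\<in>tuples A 1. e 1)"
  "pcomp (End_operad A) m n i f g = (\<lambda>e\<in>tuples A (m + n - 1).
        f (\<lambda>j\<in>{1..m}. if j = i then g (\<lambda>l\<in>{1..n}. e (l + i - 1)) else e (slot i n j)))"
  by (simp_all add: End_operad_def mk_module_def)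

primrec ev :: "('e \<Rightarrow> 'a list \<Rightarrow> 'a) \<Rightarrow> 'e ltree \<Rightarrow> (nat \<Rightarrow> 'a) \<Rightarrow> 'a" where
  "ev I (Leaf i) e = e i"
| "ev I (Node x ts) e = I x (map (\<lambda>t. ev I t e) ts)"

lemma ev_tsubst: "ev I (tsubst g t) e = ev I t (\<lambda>i. ev I (g i) e)"
  by (induction t) (simp_all add: comp_def cong: map_cong)

lemma ev_cong: "(\<And>i. i \<in> set (leaves t) \<Longrightarrow> e i = e' i) \<Longrightarrow> ev I t e = ev I t e'"
proof (induction t)
  case (Node x ts)
  have "map (\<lambda>t. ev I t e) ts = map (\<lambda>t. ev I t e') ts" using Node by (intro map_cong) auto
  then show ?case by (simp only: ev.simps)
qed simp

text \<open>A label (c, 0) of arity one stands for c times P, so it acts by the corresponding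
  multiple of the operator. In arities other than one and two the only admissible label is zero,
  hence the value zero.\<close>

fun rb_interp :: "('k::field, 'a) module \<Rightarrow> ('a \<Rightarrow> 'a) \<Rightarrow> ('v \<Rightarrow> 'a \<Rightarrow> 'a \<Rightarrow> 'a) \<Rightarrow> 'k \<times> 'v \<Rightarrow> 'a list \<Rightarrow> 'a" where
  "rb_interp A P b x [y] = fst x \<odot>\<^bsub>A\<^esub> P y"
| "rb_interp A P b x [y, z] = b (snd x) y z"
| "rb_interp A P b x _ = \<zero>\<^bsub>A\<^esub>"

abbreviation pair_tuple :: "'a \<Rightarrow> 'a \<Rightarrow> nat \<Rightarrow> 'a" where
  "pair_tuple x y \<equiv> (\<lambda>j\<in>{1..2}. if j = 1 then x else y)"

lemma pair_tuple: "x \<in> carrier A \<Longrightarrow> y \<in> carrier A \<Longrightarrow> pair_tuple x y \<in> tuples A 2"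
  by auto

lemma pair_tuple_cases:
  assumes "e \<in> tuples A 2"
  obtains x y where "x \<in> carrier A" "y \<in> carrier A" "e = pair_tuple x y"
proof -
  have "e = pair_tuple (e 1) (e 2)"
  proof
    fix j
    show "e j = pair_tuple (e 1) (e 2) j"
    proof (cases "j \<in> {1..2}")
      case True
      then have "j = 1 \<or> j = 2" by auto
      then show ?thesis by auto
    qed (use PiE_arb[OF assms] in \<open>auto simp: restrict_def\<close>)
  qed
  moreover have "e 1 \<in> carrier A" "e 2 \<in> carrier A" using PiE_mem[OF assms] by auto
  ultimately show ?thesis using that by blast
qed

locale rota_baxter_algebra = rota_baxter_setup V Rel
  for V :: "('k::field, 'v) s2mod" and Rel +
  fixes A :: "('k, 'a) module" and \<rho> and P
  assumes algebra: "operad_algebra (quad_operad V Rel) A \<rho>"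
    and rota_baxter: "rota_baxter_weight_one (quad_operad V Rel) A \<rho> P"
begin

lemma vspace_A: "vspace A" and rho_hom: "operad_hom (quad_operad V Rel) (End_operad A) \<rho>"
  using algebra by (auto simp: operad_algebra_def)

lemma P_linear: "linear_map A A P"
  using rota_baxter by (simp add: rota_baxter_weight_one_def)

sublocale A: module kring A by (rule vspace_A)
sublocale rho: operad_hom "quad_operad V Rel" "End_operad A" \<rho> by (rule rho_hom)
sublocale Q: operad_quotient "TV V" "quad_ideal V Rel"
  by (rule quad_quotient[OF Rel])

abbreviation op :: "'v \<Rightarrow> 'a \<Rightarrow> 'a \<Rightarrow> 'a" where
  "op \<omega> \<equiv> binop \<rho> (quad_gen V Rel \<omega>)"

lemma gen2_linear: "linear_map (vsp V) (sp (TV V) 2) (gen2 V)"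
proof (rule linear_mapI)
  have t: "Node a [Leaf 1, Leaf 2] \<in> trees (arity2 V) 2" if "a \<in> elts V" for a
    using that by (auto simp: trees_def)
  have l: "length [Leaf 1, Leaf 2] = 2" by simp
  fix a b c assume a: "a \<in> elts V"
  show "gen2 V a \<in> carrier (sp (TV V) 2)"
    unfolding gen2_def by (rule T.tree_class_closed) (use t[OF a] in simp)
  show "gen2 V (c \<odot>\<^bsub>vsp V\<^esub> a) = c \<odot>\<^bsub>sp (TV V) 2\<^esub> gen2 V a"
    unfolding gen2_def using T.class_Node_smult[OF t[OF a], of c] by simp
  assume b: "b \<in> elts V"
  show "gen2 V (a \<oplus>\<^bsub>vsp V\<^esub> b) = gen2 V a \<oplus>\<^bsub>sp (TV V) 2\<^esub> gen2 V b"
    unfolding gen2_def using T.class_Node_add[OF t[OF a] t[OF b]] by simp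
qed

lemma gen_linear: "linear_map (vsp V) (sp (quad_operad V Rel) 2) (quad_gen V Rel)"
  using linear_map_compose[OF gen2_linear Q.linear_map_cl] unfolding quad_gen_def quad_operad_def quot_operad_def by simp

lemmas gen_closed = linear_mapD(1)[OF gen_linear]

lemma rho_gen_linear: "linear_map (vsp V) (sp (End_operad A) 2) (\<lambda>\<omega>. \<rho> 2 (quad_gen V Rel \<omega>))"
  by (rule linear_map_compose[OF gen_linear rho.hom_linear])

lemma op_add:
  assumes "\<omega> \<in> elts V" "\<nu> \<in> elts V" "x \<in> carrier A" "y \<in> carrier A"
  shows "op (\<omega> \<oplus>\<^bsub>vsp V\<^esub> \<nu>) x y = op \<omega> x y \<oplus>\<^bsub>A\<^esub> op \<nu> x y"
  using linear_mapD(2)[OF rho_gen_linear assms(1,2)] pair_tuple[OF assms(3,4)] by (simp add: binop_def)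

lemma op_smult:
  assumes "\<omega> \<in> elts V" "x \<in> carrier A" "y \<in> carrier A"
  shows "op (c \<odot>\<^bsub>vsp V\<^esub> \<omega>) x y = c \<odot>\<^bsub>A\<^esub> op \<omega> x y"
  using linear_mapD(3)[OF rho_gen_linear assms(1)] pair_tuple[OF assms(2,3)] by (simp add: binop_def)

lemma op_linear:
  assumes "\<omega> \<in> elts V" "x \<in> carrier A"
  shows "linear_map A A (op \<omega> x)" "linear_map A A (\<lambda>y. op \<omega> y x)"
proof -
  have m: "\<rho> 2 (quad_gen V Rel \<omega>) \<in> multilinear_maps A 2" using linear_mapD(1)[OF rho_gen_linear assms(1)] by simp
  have e: "(pair_tuple x x)(2 := y) = pair_tuple x y" "(pair_tuple x x)(1 := y) = pair_tuple y x" for y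
    by (auto simp: fun_eq_iff restrict_def)
  have "linear_map A A (\<lambda>y. \<rho> 2 (quad_gen V Rel \<omega>) ((pair_tuple x x)(i := y)))" if "i \<in> {1..2}" for i
    using m pair_tuple[OF assms(2,2)] that unfolding multilinear_maps_def by blast
  from this[of 1] this[of 2] show "linear_map A A (op \<omega> x)" "linear_map A A (\<lambda>y. op \<omega> y x)"
    unfolding e binop_def by simp_all
qed

lemma op_closed [simp]: "\<omega> \<in> elts V \<Longrightarrow> x \<in> carrier A \<Longrightarrow> y \<in> carrier A \<Longrightarrow> op \<omega> x y \<in> carrier A"
  using linear_mapD(1)[OF op_linear(1)] .

lemma P_closed [simp]: "x \<in> carrier A \<Longrightarrow> P x \<in> carrier A"
  by (rule linear_mapD(1)[OF P_linear])

text \<open>The generator with label \<open>swp V \<omega>\<close> is the transposed generator of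
  \<omega>, and \<rho> intertwines the transposition with the exchange of arguments.\<close>

lemma op_swp:
  assumes "\<omega> \<in> elts V" "x \<in> carrier A" "y \<in> carrier A"
  shows "op (swp V \<omega>) x y = op \<omega> y x"
proof -
  let ?\<tau> = "transpose 1 (2::nat)"
  have t: "Node \<omega> [Leaf 1, Leaf 2] \<in> trees (arity2 V) 2" using assms(1) by (auto simp: trees_def)
  have i: "inv_into UNIV ?\<tau> = ?\<tau>" by simp
  have "gen2 V (swp V \<omega>) = act (TV V) 2 (gen2 V \<omega>) ?\<tau>"
    unfolding gen2_def using T.act_free[OF transpose_permutes, of "bas (Node \<omega> [Leaf 1, Leaf 2])"] t class_swap[OF t]
    by (simp add: i relabel_def)
  then have "quad_gen V Rel (swp V \<omega>) = act (quad_operad V Rel) 2 (quad_gen V Rel \<omega>) ?\<tau>"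
    using Q.act_quot[OF transpose_permutes linear_mapD(1)[OF gen2_linear assms(1)]] by (simp add: quad_gen_def quad_operad_def)
  then have "\<rho> 2 (quad_gen V Rel (swp V \<omega>)) = act (End_operad A) 2 (\<rho> 2 (quad_gen V Rel \<omega>)) ?\<tau>"
    using rho.hom_act[OF transpose_permutes gen_closed[OF assms(1)]] by simp
  moreover have "(\<lambda>j\<in>{1..2}. pair_tuple x y (?\<tau> j)) = pair_tuple y x"
    by (auto simp: fun_eq_iff restrict_def transpose_def)
  ultimately show ?thesis using pair_tuple[OF assms(2,3)] by (simp add: binop_def i)
qed

abbreviation evA :: "('k \<times> 'v) ltree \<Rightarrow> (nat \<Rightarrow> 'a) \<Rightarrow> 'a" where
  "evA \<equiv> ev (rb_interp A P op)"

lemma interp_closed: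
  assumes "x \<in> carrier (sp (VP V) (length ys))" "set ys \<subseteq> carrier A"
  shows "rb_interp A P op x ys \<in> carrier A"
  using assms by (cases "(A, P, op, x, ys)" rule: rb_interp.cases) (auto split: if_splits)

lemma interp_add:
  assumes "x \<in> carrier (sp (VP V) (length ys))" "x' \<in> carrier (sp (VP V) (length ys))" "set ys \<subseteq> carrier A"
  shows "rb_interp A P op (x \<oplus>\<^bsub>sp (VP V) (length ys)\<^esub> x') ys = rb_interp A P op x ys \<oplus>\<^bsub>A\<^esub> rb_interp A P op x' ys"
  using assms by (cases "(A, P, op, x, ys)" rule: rb_interp.cases) (auto simp: op_add A.smult_l_distr[simplified] split: if_splits)

lemma interp_smult:
  assumes "x \<in> carrier (sp (VP V) (length ys))" "set ys \<subseteq> carrier A"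
  shows "rb_interp A P op (c \<odot>\<^bsub>sp (VP V) (length ys)\<^esub> x) ys = c \<odot>\<^bsub>A\<^esub> rb_interp A P op x ys"
  using assms by (cases "(A, P, op, x, ys)" rule: rb_interp.cases)
    (auto simp: op_smult A.smult_assoc1[simplified] A.smult_r_null[simplified] split: if_splits)

lemma ev_closed: "labelled_by (VP V) t \<Longrightarrow> e \<in> set (leaves t) \<rightarrow> carrier A \<Longrightarrow> evA t e \<in> carrier A"
proof (induction t)
  case (Node x ts)
  have "evA t e \<in> carrier A" if "t \<in> set ts" for t
    using Node that by (auto simp: list_all_iff)
  then show ?case unfolding ev.simps by (intro interp_closed) (use Node.prems(1) in auto)
qed auto

text \<open>As the leaves are distinct, the variable z enters through one subtree only and the other
  one is constant; so linearity of each operation in a single argument is enough.\<close>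

lemma ev_linear:
  "labelled_by (VP V) t \<Longrightarrow> distinct (leaves t) \<Longrightarrow> e \<in> set (leaves t) \<rightarrow> carrier A \<Longrightarrow> i \<in> set (leaves t) \<Longrightarrow>
    linear_map A A (\<lambda>z. evA t (e(i := z)))"
proof (induction t)
  case (Leaf j)
  then show ?case by (auto intro!: linear_mapI)
next
  case (Node x ts)
  have const: "evA u (e(i := z)) = evA u e" if "i \<notin> set (leaves u)" for u z
    by (rule ev_cong) (use that in auto)
  have lab: "\<forall>u\<in>set ts. labelled_by (VP V) u" using Node.prems by (auto simp: list_all_iff)
  have cl: "evA u e \<in> carrier A" if "u \<in> set ts" for u
    by (rule ev_closed) (use Node.prems that lab in auto)
  have zero: "linear_map A A (\<lambda>z. \<zero>\<^bsub>A\<^esub>)" by (rule linear_mapI) (simp_all add: A.smult_r_null[simplified])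
  have dl: "distinct (leaves u)" if "u \<in> set ts" for u
    using Node.prems(2) that by (auto simp: distinct_concat_iff)
  have IH: "linear_map A A (\<lambda>z. evA u (e(i := z)))" if "u \<in> set ts" "i \<in> set (leaves u)" for u
    by (rule Node.IH) (use that lab dl Node.prems(3) in auto)
  consider "ts = []" | s where "ts = [s]" | s u where "ts = [s, u]" | s u v us where "ts = s # u # v # us"
    by (metis list.exhaust)
  then show ?case
  proof cases
    case 1
    then show ?thesis using Node.prems by simp
  next
    case (2 s)
    have "evA (Node x ts) (e(i := z)) = fst x \<odot>\<^bsub>A\<^esub> P (evA s (e(i := z)))" for z
      by (simp only: 2 ev.simps list.map rb_interp.simps)
    moreover have "linear_map A A (\<lambda>z. fst x \<odot>\<^bsub>A\<^esub> P (evA s (e(i := z))))"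
      by (rule linear_map_smult[OF vspace_A linear_map_compose[OF IH P_linear]]) (use 2 Node.prems(4) in auto)
    ultimately show ?thesis by (simp only:)
  next
    case (3 s u)
    have w: "snd x \<in> elts V" using Node.prems(1) 3 by auto
    have "i \<in> set (leaves s) \<and> i \<notin> set (leaves u) \<or> i \<in> set (leaves u) \<and> i \<notin> set (leaves s)"
      using Node.prems(2,4) 3 by auto
    then consider (left) "i \<in> set (leaves s)" "i \<notin> set (leaves u)" | (right) "i \<in> set (leaves u)" "i \<notin> set (leaves s)"
      by blast
    note cases = this
    have e: "evA (Node x ts) (e(i := z)) = op (snd x) (evA s (e(i := z))) (evA u (e(i := z)))" for z
      by (simp only: 3 ev.simps list.map rb_interp.simps)
    from cases show ?thesis
    proof cases
      case left
      show ?thesis unfolding e const[OF left(2)]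
        by (rule linear_map_compose[OF IH op_linear(2)[OF w cl]]) (use 3 left in auto)
    next
      case right
      show ?thesis unfolding e const[OF right(2)]
        by (rule linear_map_compose[OF IH op_linear(1)[OF w cl]]) (use 3 right in auto)
    qed
  next
    case (4 s u v us)
    then show ?thesis using zero by simp
  qed
qed

end

context rota_baxter_algebra
begin

text \<open>Elements of the endomorphism operad are extensional functions on tuples, hence the
  restriction.\<close>

definition eval_map :: "nat \<Rightarrow> ('k \<times> 'v) ltree \<Rightarrow> (nat \<Rightarrow> 'a) \<Rightarrow> 'a" where
  "eval_map n t = (\<lambda>e\<in>tuples A n. evA t e)"

lemma tuples_leaves:
  assumes "t \<in> trees (VP V) n" "e \<in> tuples A n"
  shows "e \<in> set (leaves t) \<rightarrow> carrier A"
  using assms by (auto simp: trees_def)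

lemma evA_closed:
  assumes "t \<in> trees (VP V) n" "e \<in> tuples A n"
  shows "evA t e \<in> carrier A"
  by (rule ev_closed[OF _ tuples_leaves[OF assms]]) (use assms(1) in \<open>simp add: trees_def\<close>)

lemma eval_map_closed:
  assumes "t \<in> trees (VP V) n"
  shows "eval_map n t \<in> multilinear_maps A n"
proof -
  have "eval_map n t \<in> tuples A n \<rightarrow>\<^sub>E carrier A"
    using evA_closed[OF assms] by (auto simp: eval_map_def)
  moreover have "linear_map A A (\<lambda>x. eval_map n t (e(i := x)))" if e: "e \<in> tuples A n" and i: "i \<in> {1..n}" for e i
  proof (rule linear_map_cong[OF vspace_A])
    show "linear_map A A (\<lambda>x. evA t (e(i := x)))"
      by (rule ev_linear[OF _ _ tuples_leaves[OF assms e]]) (use assms i in \<open>auto simp: trees_def\<close>)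
    fix x assume "x \<in> carrier A"
    then have "e(i := x) \<in> tuples A n" using e i by (auto simp: PiE_iff extensional_def)
    then show "evA t (e(i := x)) = eval_map n t (e(i := x))" by (simp add: eval_map_def)
  qed
  ultimately show ?thesis by (auto simp: multilinear_maps_def)
qed

lemma evA_restrict: "t \<in> trees (VP V) n \<Longrightarrow> evA t (\<lambda>j\<in>{1..n}. e j) = evA t e"
  by (rule ev_cong) (auto simp: trees_def)

text \<open>Grafting corresponds to composing functions because evaluation after a substitution is
  evaluation at substituted arguments; label relators are respected because operations depend
  linearly on their labels. Neither the relations of the quadratic operad nor the Rota-Baxter
  equation enters yet.\<close>

lemma ex_evaluation:
  "\<exists>f. operad_hom (TP V) (End_operad A) f \<and>
    (\<forall>n. \<forall>t\<in>trees (VP V) n. f n (clP V n (bas t)) = eval_map n t)"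
proof (rule R.free_operad_hom)
  show "operad (End_operad A)" by (rule rho.tgt.operad_axioms)
  show "eval_map n t \<in> carrier (sp (End_operad A) n)" if "t \<in> trees (VP V) n" for n t
    using eval_map_closed[OF that] by simp
  show "eval_map n (relabel (inv_into UNIV \<sigma>) t) = act (End_operad A) n (eval_map n t) \<sigma>"
    if t: "t \<in> trees (VP V) n" and \<sigma>: "\<sigma> permutes {1..n}" for n t \<sigma>
  proof -
    have "(\<lambda>j\<in>{1..n}. e (inv_into UNIV \<sigma> j)) \<in> tuples A n" if "e \<in> tuples A n" for e
    proof (rule restrict_PiE_iff[THEN iffD2], rule ballI)
      fix j assume "j \<in> {1..n}"
      then have "inv_into UNIV \<sigma> j \<in> {1..n}" using permutes_in_image[OF permutes_inv[OF \<sigma>]] by blast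
      then show "e (inv_into UNIV \<sigma> j) \<in> carrier A" by (rule PiE_mem[OF that])
    qed
    then show ?thesis
      by (auto simp: eval_map_def evA_restrict[OF t] relabel_def ev_tsubst fun_eq_iff restrict_def[of _ "tuples A n"])
  qed
  show "eval_map 1 (Leaf 1) = opunit (End_operad A)" by (simp add: eval_map_def)
  show "eval_map (m + n - 1) (graft n i s t) = pcomp (End_operad A) m n i (eval_map m s) (eval_map n t)"
    if i: "i \<in> {1..m}" and s: "s \<in> trees (VP V) m" and t: "t \<in> trees (VP V) n" for m n i s t
  proof -
    have "evA (graft n i s t) e = pcomp (End_operad A) m n i (eval_map m s) (eval_map n t) e" if e: "e \<in> tuples A (m + n - 1)" for e
    proof -
      let ?e1 = "\<lambda>l\<in>{1..n}. e (l + i - 1)"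
      let ?e2 = "\<lambda>j\<in>{1..m}. if j = i then eval_map n t ?e1 else e (slot i n j)"
      have e1: "?e1 \<in> tuples A n"
        by (rule restrict_PiE_iff[THEN iffD2], rule ballI, rule PiE_mem[OF e]) (use i in auto)
      have "eval_map n t ?e1 \<in> carrier A" using evA_closed[OF t e1] e1 by (simp add: eval_map_def)
      moreover have "e (slot i n j) \<in> carrier A" if "j \<in> {1..m}" "j \<noteq> i" for j
        by (rule PiE_mem[OF e]) (use that i in \<open>auto simp: slot_def\<close>)
      ultimately have e2: "?e2 \<in> tuples A m" by auto
      have t1: "eval_map n t ?e1 = evA t (\<lambda>l. e (l + i - 1))"
        using e1 by (simp only: eval_map_def restrict_apply' evA_restrict[OF t])
      have "eval_map m s ?e2 = evA s (\<lambda>j. if j = i then eval_map n t ?e1 else e (slot i n j))"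
        using e2 by (simp only: eval_map_def restrict_apply' evA_restrict[OF s])
      also have "\<dots> = evA (graft n i s t) e"
        unfolding graft_def ev_tsubst t1 by (rule ev_cong) (simp add: relabel_def ev_tsubst)
      finally show ?thesis using e by (simp only: End_simps restrict_apply')
    qed
    then have "eval_map (m + n - 1) (graft n i s t) = restrict (pcomp (End_operad A) m n i (eval_map m s) (eval_map n t)) (tuples A (m + n - 1))"
      unfolding eval_map_def[of "m + n - 1"] by (intro restrict_ext) simp
    then show ?thesis by (simp only: End_simps restrict_restrict Int_absorb)
  qed
  have args: "set (map (\<lambda>t. evA t e) ts) \<subseteq> carrier A" if "Node a ts \<in> trees (VP V) n" "e \<in> tuples A n" for a ts e n
  proof -
    have "evA t e \<in> carrier A" if t: "t \<in> set ts" for t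
      by (rule ev_closed) (use \<open>Node a ts \<in> trees (VP V) n\<close> tuples_leaves[OF \<open>Node a ts \<in> trees (VP V) n\<close> \<open>e \<in> tuples A n\<close>] t in \<open>auto simp: trees_def list_all_iff\<close>)
    then show ?thesis by auto
  qed
  have lab: "a \<in> carrier (sp (VP V) (length ts))" if "Node a ts \<in> trees (VP V) n" for a ts n
    using that by (simp add: trees_def)
  show "eval_map n (Node (a \<oplus>\<^bsub>sp (VP V) (length ts)\<^esub> b) ts) = eval_map n (Node a ts) \<oplus>\<^bsub>sp (End_operad A) n\<^esub> eval_map n (Node b ts)"
    if t: "Node a ts \<in> trees (VP V) n" "Node b ts \<in> trees (VP V) n" for n a b ts
  proof -
    have "evA (Node (a \<oplus>\<^bsub>sp (VP V) (length ts)\<^esub> b) ts) e = evA (Node a ts) e \<oplus>\<^bsub>A\<^esub> evA (Node b ts) e" if "e \<in> tuples A n" for e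
      using interp_add[of a "map (\<lambda>t. evA t e) ts" b, unfolded length_map, OF lab[OF t(1)] lab[OF t(2)] args[OF t(1) that]] by (simp only: ev.simps)
    then show ?thesis unfolding eval_map_def End_simps by (intro restrict_ext) (simp only: restrict_apply')
  qed
  show "eval_map n (Node (c \<odot>\<^bsub>sp (VP V) (length ts)\<^esub> a) ts) = c \<odot>\<^bsub>sp (End_operad A) n\<^esub> eval_map n (Node a ts)"
    if t: "Node a ts \<in> trees (VP V) n" for n a c ts
  proof -
    have "evA (Node (c \<odot>\<^bsub>sp (VP V) (length ts)\<^esub> a) ts) e = c \<odot>\<^bsub>A\<^esub> evA (Node a ts) e" if "e \<in> tuples A n" for e
      using interp_smult[of a "map (\<lambda>t. evA t e) ts" c, unfolded length_map, OF lab[OF t] args[OF t that]] by (simp only: ev.simps)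
    then show ?thesis unfolding eval_map_def End_simps by (intro restrict_ext) (simp only: restrict_apply')
  qed
  show "eval_map n (Node (act (VP V) (length ts) a \<sigma>) ts) = eval_map n (Node a (permute_subtrees \<sigma> ts))"
    if t: "Node a ts \<in> trees (VP V) n" and \<sigma>: "\<sigma> permutes {1..length ts}" for n a \<sigma> ts
  proof -
    have "evA (Node (act (VP V) (length ts) a \<sigma>) ts) e = evA (Node a (permute_subtrees \<sigma> ts)) e" if e: "e \<in> tuples A n" for e
    proof (cases "length ts = 2")
      case True
      from swap_cases[OF \<sigma> True] show ?thesis
      proof cases
        case (1 s u)
        then show ?thesis by simp
      next
        case (2 s u)
        have "snd a \<in> elts V" using lab[OF t] True by auto
        then show ?thesis using args[OF t e] op_swp unfolding 2(2) using 2(1,3) by (simp add: numeral_2_eq_2)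
      qed
    next
      case False
      \<comment> \<open>Outside arity two the action on labels is trivial. With one input \<sigma>
        is the identity; with any other number both sides are zero, whatever the order of the
        subtrees.\<close>
      then have a: "act (VP V) (length ts) a \<sigma> = a" by simp
      show ?thesis
      proof (cases "length ts = 1")
        case True
        then obtain s where ts: "ts = [s]" by (auto simp: length_Suc_conv One_nat_def)
        have "\<sigma> = id" using \<sigma> True by (simp del: One_nat_def)
        then have "permute_subtrees \<sigma> ts = ts" by (simp add: ts permute_subtrees_def One_nat_def)
        then show ?thesis by (simp only: a)
      next
        case False2: False
        have z: "rb_interp A P op a ys = \<zero>\<^bsub>A\<^esub>" if "length ys = length ts" for ys
          using that False False2 by (cases "(A, P, op, a, ys)" rule: rb_interp.cases) (auto simp: One_nat_def numeral_2_eq_2)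
        show ?thesis unfolding ev.simps a by (simp add: z permute_subtrees_def)
      qed
    qed
    then show ?thesis unfolding eval_map_def by (intro restrict_ext) simp
  qed
qed

end

context rota_baxter_algebra
begin

lemma ev_n2: "evA (n2 \<omega> s t) e = op \<omega> (evA s e) (evA t e)"
  by (simp add: n2_def)

lemma ev_Pn: "evA s e \<in> carrier A \<Longrightarrow> evA (Pn V s) e = P (evA s e)"
  by (simp add: Pn_def A.smult_one[simplified])

lemma eval_map_n2_Pn:
  assumes "\<omega> \<in> elts V" "x \<in> carrier A" "y \<in> carrier A"
  shows "eval_map 2 (n2 \<omega> (Leaf 1) (Leaf 2)) (pair_tuple x y) = op \<omega> x y"
    "eval_map 2 (n2 \<omega> (Leaf 1) (Pn V (Leaf 2))) (pair_tuple x y) = op \<omega> x (P y)"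
    "eval_map 2 (n2 \<omega> (Pn V (Leaf 1)) (Leaf 2)) (pair_tuple x y) = op \<omega> (P x) y"
    "eval_map 2 (n2 \<omega> (Pn V (Leaf 1)) (Pn V (Leaf 2))) (pair_tuple x y) = op \<omega> (P x) (P y)"
    "eval_map 2 (Pn V (n2 \<omega> (Leaf 1) (Leaf 2))) (pair_tuple x y) = P (op \<omega> x y)"
    "eval_map 2 (Pn V (n2 \<omega> (Leaf 1) (Pn V (Leaf 2)))) (pair_tuple x y) = P (op \<omega> x (P y))"
    "eval_map 2 (Pn V (n2 \<omega> (Pn V (Leaf 1)) (Leaf 2))) (pair_tuple x y) = P (op \<omega> (P x) y)"
  using assms pair_tuple[OF assms(2,3)] by (simp_all add: eval_map_def ev_n2 ev_Pn)

lemma End_eqI: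
  assumes "f \<in> multilinear_maps A 2" "g \<in> multilinear_maps A 2"
    and "\<And>x y. x \<in> carrier A \<Longrightarrow> y \<in> carrier A \<Longrightarrow> f (pair_tuple x y) = g (pair_tuple x y)"
  shows "f = g"
proof (rule PiE_ext)
  show "f \<in> tuples A 2 \<rightarrow>\<^sub>E carrier A" "g \<in> tuples A 2 \<rightarrow>\<^sub>E carrier A"
    using assms(1,2) by (simp_all add: multilinear_maps_def)
  fix e assume "e \<in> tuples A 2"
  then show "f e = g e" by (rule pair_tuple_cases) (use assms(3) in simp)
qed

context
  fixes f
  assumes f: "operad_hom (TP V) (End_operad A) f"
    and ft: "\<And>n t. t \<in> trees (VP V) n \<Longrightarrow> f n (clP V n (bas t)) = eval_map n t"
begin

interpretation f: operad_hom "TP V" "End_operad A" f by (rule f)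

lemma eval_RB_relator:
  assumes "\<omega> \<in> elts V"
  shows "f 2 (RB_relator V \<omega>) = \<zero>\<^bsub>sp (End_operad A) 2\<^esub>"
proof -
  let ?M = "sp (End_operad A) 2" and ?N = "sp (TP V) 2"
  interpret M: module kring ?M by (rule rho.tgt.vspace_sp)
  interpret N: module kring ?N by (rule R.free.vspace_sp)
  note T = two_leaf_trees[OF assms]
  let ?c = "\<lambda>t. clP V 2 (bas t)"
  let ?t0 = "n2 \<omega> (Pn V (Leaf 1)) (Pn V (Leaf 2))" and ?t1 = "Pn V (n2 \<omega> (Pn V (Leaf 1)) (Leaf 2))"
    and ?t2 = "Pn V (n2 \<omega> (Leaf 1) (Pn V (Leaf 2)))" and ?t3 = "Pn V (n2 \<omega> (Leaf 1) (Leaf 2))"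
  have t: "?t0 \<in> trees (VP V) 2" "?t1 \<in> trees (VP V) 2" "?t2 \<in> trees (VP V) 2" "?t3 \<in> trees (VP V) 2"
    using T by blast+
  have c: "?c t \<in> carrier ?N" if "t \<in> trees (VP V) 2" for t
    by (rule R.tree_class_closed) (use that in simp)
  have d: "f 2 (x \<ominus>\<^bsub>?N\<^esub> y) = f 2 x \<ominus>\<^bsub>?M\<^esub> f 2 y" if "x \<in> carrier ?N" "y \<in> carrier ?N" for x y
    by (rule linear_map_minus(2)[OF R.free.vspace_sp rho.tgt.vspace_sp f.hom_linear that])
  have E: "eval_map 2 t \<in> carrier ?M" if "t \<in> trees (VP V) 2" for t using eval_map_closed[OF that] by simp
  have k: "(x \<oplus>\<^bsub>?M\<^esub> y) \<ominus>\<^bsub>?M\<^esub> y = x" if "x \<in> carrier ?M" "y \<in> carrier ?M" for x y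
    using that unfolding a_minus_def by (simp only: M.a_assoc M.a_inv_closed M.r_neg M.r_zero)
  \<comment> \<open>The summands are arranged opposite to the order of subtraction in the relator,
    so that each subtraction cancels the last remaining summand.\<close>
  have "eval_map 2 ?t0 = eval_map 2 ?t3 \<oplus>\<^bsub>?M\<^esub> eval_map 2 ?t2 \<oplus>\<^bsub>?M\<^esub> eval_map 2 ?t1"
  proof (rule End_eqI)
    show "eval_map 2 ?t0 \<in> multilinear_maps A 2" by (rule eval_map_closed[OF t(1)])
    show "eval_map 2 ?t3 \<oplus>\<^bsub>?M\<^esub> eval_map 2 ?t2 \<oplus>\<^bsub>?M\<^esub> eval_map 2 ?t1 \<in> multilinear_maps A 2"
      using M.a_closed[OF M.a_closed[OF E[OF t(4)] E[OF t(3)]] E[OF t(2)]] by (simp only: End_simps)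
    fix x y assume xy: "x \<in> carrier A" "y \<in> carrier A"
    have "op \<omega> (P x) (P y) = P (op \<omega> (P x) y) \<oplus>\<^bsub>A\<^esub> P (op \<omega> x (P y)) \<oplus>\<^bsub>A\<^esub> P (op \<omega> x y)"
      using rota_baxter gen_closed[OF assms] xy by (simp add: rota_baxter_weight_one_def)
    also have "\<dots> = P (op \<omega> x y) \<oplus>\<^bsub>A\<^esub> P (op \<omega> x (P y)) \<oplus>\<^bsub>A\<^esub> P (op \<omega> (P x) y)"
      using xy assms by (simp add: A.a_ac)
    finally show "eval_map 2 ?t0 (pair_tuple x y) = (eval_map 2 ?t3 \<oplus>\<^bsub>?M\<^esub> eval_map 2 ?t2 \<oplus>\<^bsub>?M\<^esub> eval_map 2 ?t1) (pair_tuple x y)"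
      unfolding End_simps restrict_apply'[OF pair_tuple[OF xy]] eval_map_n2_Pn[OF assms xy] .
  qed
  then have "eval_map 2 ?t0 \<ominus>\<^bsub>?M\<^esub> eval_map 2 ?t1 \<ominus>\<^bsub>?M\<^esub> eval_map 2 ?t2 \<ominus>\<^bsub>?M\<^esub> eval_map 2 ?t3 = \<zero>\<^bsub>?M\<^esub>"
    using E[OF t(2)] E[OF t(3)] E[OF t(4)] by (simp only: k M.a_closed M.r_neg a_minus_def[of ?M "eval_map 2 ?t3" "eval_map 2 ?t3"])
  then show ?thesis
    unfolding RB_relator_def Let_def VP_comp(1-3)[OF assms]
    unfolding VP_gens(1) VP_comp(4)[OF assms T(1)] VP_comp(4)[OF assms T(2)] VP_comp(4)[OF assms T(3)]
    by (simp only: d c t N.minus_closed ft)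
qed

text \<open>Two morphisms from T(V) to the endomorphism operad are compared: one passes through
  T(V_P) and evaluation, the other through the given algebra structure, which kills r. They agree on
  generators and therefore on the elements \<open>circ_u\<close>, which span arity three.\<close>

lemma eval_relation:
  assumes r: "r \<in> Rel"
  shows "f 3 (tree_induced (VP V) 3 (map_labels (Pair 0)) r) = \<zero>\<^bsub>sp (End_operad A) 3\<^esub>"
proof -
  obtain \<iota> where \<iota>: "operad_hom (TV V) (TP V) \<iota>"
    "\<And>n x. keys x \<subseteq> trees (arity2 V) n \<Longrightarrow>
      \<iota> n (clV V n x) = clP V n (push (map_labels (Pair 0)) x)"
    "\<And>n x. keys x \<subseteq> trees (arity2 V) n \<Longrightarrow>
      \<iota> n (clV V n x) = tree_induced (VP V) n (map_labels (Pair 0)) (clV V n x)"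
    by (rule ex_incl) (rule that; assumption)
  interpret G1: operad_hom "TV V" "End_operad A" "\<lambda>n x. f n (\<iota> n x)"
    by (rule operad_hom_compose[OF \<iota>(1) f])
  interpret G2: operad_hom "TV V" "End_operad A" "\<lambda>n x. \<rho> n (Q.cl n x)"
    by (rule operad_hom_compose[OF Q.hom_cl]) (use rho_hom in \<open>simp add: quad_operad_def\<close>)
  have gen: "f 2 (\<iota> 2 (gen2 V \<omega>)) = \<rho> 2 (Q.cl 2 (gen2 V \<omega>))" if w: "\<omega> \<in> elts V" for \<omega>
  proof (rule End_eqI)
    note g = linear_mapD(1)[OF gen2_linear w]
    show "f 2 (\<iota> 2 (gen2 V \<omega>)) \<in> multilinear_maps A 2" "\<rho> 2 (Q.cl 2 (gen2 V \<omega>)) \<in> multilinear_maps A 2"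
      using linear_mapD(1)[OF G1.hom_linear g] linear_mapD(1)[OF G2.hom_linear g] by simp_all
    have t: "Node \<omega> [Leaf 1, Leaf 2] \<in> trees (arity2 V) 2" using w by (auto simp: trees_def)
    have "\<iota> 2 (gen2 V \<omega>) = clP V 2 (bas (n2 \<omega> (Leaf 1) (Leaf 2)))"
      unfolding gen2_def using \<iota>(2)[of "bas (Node \<omega> [Leaf 1, Leaf 2])" 2] t by (simp add: n2_def)
    then have e: "f 2 (\<iota> 2 (gen2 V \<omega>)) = eval_map 2 (n2 \<omega> (Leaf 1) (Leaf 2))"
      by (simp only: ft[OF two_leaf_trees(1)[OF w]])
    fix x y assume "x \<in> carrier A" "y \<in> carrier A"
    then show "f 2 (\<iota> 2 (gen2 V \<omega>)) (pair_tuple x y) = \<rho> 2 (Q.cl 2 (gen2 V \<omega>)) (pair_tuple x y)"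
      unfolding e using eval_map_n2_Pn(1)[OF w] by (simp add: binop_def quad_gen_def)
  qed
  have circ: "f 3 (\<iota> 3 (circ_u V u \<omega> \<nu>)) = \<rho> 3 (Q.cl 3 (circ_u V u \<omega> \<nu>))"
    if w: "\<omega> \<in> elts V" "\<nu> \<in> elts V" for u \<omega> \<nu>
  proof -
    have t: "Node a [Leaf 1, Leaf 2] \<in> trees (arity2 V) 2" if "a \<in> elts V" for a
      using that by (auto simp: trees_def)
    note g = linear_mapD(1)[OF gen2_linear w(1)] linear_mapD(1)[OF gen2_linear w(2)]
    \<comment> \<open>The first shape is a composite of two generators; the other two arise from it
      by permuting leaves.\<close>
    have I: "circ_u V ShI \<omega> \<nu> = pcomp (TV V) 2 2 1 (gen2 V \<omega>) (gen2 V \<nu>)"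
      unfolding gen2_def circ_u_def
      using T.pcomp_free[of 1 2 "bas (Node \<omega> [Leaf 1, Leaf 2])" "bas (Node \<nu> [Leaf 1, Leaf 2])" 2] t[OF w(1)] t[OF w(2)]
      by (simp add: push2_bas_left graft_def slot_def relabel_def)
    have 1: "f 3 (\<iota> 3 (circ_u V ShI \<omega> \<nu>)) = \<rho> 3 (Q.cl 3 (circ_u V ShI \<omega> \<nu>))"
      unfolding I using G1.hom_pcomp[of 1 2 _ _ 2, OF _ g] G2.hom_pcomp[of 1 2 _ _ 2, OF _ g]
      by (simp add: gen[OF w(1)] gen[OF w(2)] del: End_simps)
    have a: "f 3 (\<iota> 3 (clV V 3 (bas (relabel h (shape_tree ShI \<omega> \<nu>)))))
        = \<rho> 3 (Q.cl 3 (clV V 3 (bas (relabel h (shape_tree ShI \<omega> \<nu>)))))" if h: "h permutes {1..3}" for h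
    proof -
      have \<sigma>: "inv_into UNIV h permutes {1..3}" "inv_into UNIV (inv_into UNIV h) = h"
        using permutes_inv[OF h] permutes_bij[OF h] by (simp_all add: inv_inv_eq)
      have "clV V 3 (bas (relabel h (shape_tree ShI \<omega> \<nu>)))
          = act (TV V) 3 (circ_u V ShI \<omega> \<nu>) (inv_into UNIV h)"
        unfolding circ_u_def using T.act_free[OF \<sigma>(1), of "bas (shape_tree ShI \<omega> \<nu>)"] shape_tree_trees[OF w, of ShI] by (simp only: \<sigma>(2)) simp
      then show ?thesis
        using G1.hom_act[OF \<sigma>(1) circ_u_closed[OF w, of ShI]] G2.hom_act[OF \<sigma>(1) circ_u_closed[OF w, of ShI]] 1
        by (simp only:)
    qed
    \<comment> \<open>The two cyclic permutations: 1, 2, 3 become 2, 3, 1 and 3, 1, 2, the leaf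
      orders of shapes II and III.\<close>
    have p: "(transpose 1 2 \<circ> transpose 2 3) permutes {1..3::nat}" "(transpose 2 3 \<circ> transpose 1 2) permutes {1..3::nat}"
      by (intro permutes_compose permutes_swap_id; simp)+
    show ?thesis
    proof (cases u)
      case ShI
      then show ?thesis using 1 by simp
    next
      case ShII
      have "relabel (transpose 1 2 \<circ> transpose 2 3) (shape_tree ShI \<omega> \<nu>) = shape_tree ShII \<omega> \<nu>"
        by (simp add: relabel_def transpose_def)
      then show ?thesis using a[OF p(1)] ShII by (simp only: circ_u_def)
    next
      case ShIII
      have "relabel (transpose 2 3 \<circ> transpose 1 2) (shape_tree ShI \<omega> \<nu>) = shape_tree ShIII \<omega> \<nu>"
        by (simp add: relabel_def transpose_def)
      then show ?thesis using a[OF p(2)] ShIII by (simp only: circ_u_def)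
    qed
  qed
  have rc: "r \<in> carrier (sp (TV V) 3)" using r Rel by blast
  have "f 3 (\<iota> 3 r) = \<rho> 3 (Q.cl 3 r)"
    by (rule linear_circ_eqI[OF rho.tgt.vspace_sp G1.hom_linear G2.hom_linear circ rc])
  also have "\<dots> = \<zero>\<^bsub>sp (End_operad A) 3\<^esub>"
  proof -
    have "r \<in> quad_ideal V Rel 3" unfolding quad_ideal_def by (rule subsetD[OF gen_ideal_superset]) (simp add: r)
    from Q.cl_zero[OF this] show ?thesis
      using linear_map_zero[OF rho.src.vspace_sp rho.tgt.vspace_sp rho.hom_linear, of 3] by (simp only: quad_operad_def)
  qed
  finally show ?thesis
  proof -
    assume z: "f 3 (\<iota> 3 r) = \<zero>\<^bsub>sp (End_operad A) 3\<^esub>"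
    obtain x where x: "keys x \<subseteq> trees (arity2 V) 3" "r = clV V 3 x"
      using rc unfolding T.carrier_free by auto
    show ?thesis using z \<iota>(3)[OF x(1)] unfolding x(2) by (simp only:)
  qed
qed

lemma eval_RB_ideal: "x \<in> RB_ideal V Rel n \<Longrightarrow> f n x = \<zero>\<^bsub>sp (End_operad A) n\<^esub>"
proof -
  assume x: "x \<in> RB_ideal V Rel n"
  let ?S = "\<lambda>n::nat. if n = 3 then tree_induced (VP V) 3 (map_labels (Pair 0)) ` Rel
     else if n = 2 then RB_relator V ` elts V else {}"
  have "f n x \<in> {\<zero>\<^bsub>sp (End_operad A) n\<^esub>}"
  proof (rule gen_ideal_hom_zero[OF f _ operad_ideal_zero[OF rho.tgt.operad_axioms] x[unfolded RB_ideal_def]])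
    fix m y assume y: "y \<in> ?S m"
    have "y \<in> RB_ideal V Rel m"
      using gen_ideal_superset[where S = ?S and n = m and Q = "TP V"] y unfolding RB_ideal_def by blast
    then have "y \<in> carrier (sp (TP V) m)"
      using operad_ideal_subset[OF R.free.operad_axioms operad_ideal_RB] by blast
    moreover have "f m y = \<zero>\<^bsub>sp (End_operad A) m\<^esub>"
      using y eval_relation eval_RB_relator by (auto split: if_splits simp del: End_simps)
    ultimately show "y \<in> carrier (sp (TP V) m) \<and> f m y \<in> {\<zero>\<^bsub>sp (End_operad A) m\<^esub>}" by simp
  qed
  then show ?thesis by simp
qed

end

section \<open>Algebras over the Rota-Baxter operad and over the black product\<close>

theorem ex_RB1_algebra:
  "\<exists>g. operad_hom (RB1 V Rel) (End_operad A) g \<and>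
    (\<forall>t\<in>trees (VP V) 2. g 2 (RB.cl 2 (clP V 2 (bas t))) = eval_map 2 t)"
proof -
  obtain f where f: "operad_hom (TP V) (End_operad A) f"
    and ft: "\<forall>n. \<forall>t\<in>trees (VP V) n. f n (clP V n (bas t)) = eval_map n t"
    using ex_evaluation by (elim exE conjE) (rule that)
  have "\<exists>g. operad_hom (quot_operad (TP V) (RB_ideal V Rel)) (End_operad A) g \<and>
      (\<forall>n. \<forall>x\<in>carrier (sp (TP V) n). g n (RB.cl n x) = f n x)"
    by (rule RB.hom_factor[OF f]) (rule eval_RB_ideal[OF f ft[rule_format]])
  then obtain g where g: "operad_hom (quot_operad (TP V) (RB_ideal V Rel)) (End_operad A) g"
    and gx: "\<forall>n. \<forall>x\<in>carrier (sp (TP V) n). g n (RB.cl n x) = f n x"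
    by (elim exE conjE) (rule that)
  show ?thesis
  proof (intro exI conjI ballI)
    show "operad_hom (RB1 V Rel) (End_operad A) g" using g by (simp add: RB1_def)
    fix t assume t: "t \<in> trees (VP V) 2"
    have "clP V 2 (bas t) \<in> carrier (sp (TP V) 2)"
      by (rule R.tree_class_closed) (use t in simp)
    then show "g 2 (RB.cl 2 (clP V 2 (bas t))) = eval_map 2 t" using gx ft t by simp
  qed
qed

text \<open>An arbitrary isomorphism onto the trisuccessor is allowed, so that the one chosen for
  the black product can be inserted. The operations are then read off by evaluating the trees that
  represent the images of the generators.\<close>

theorem ex_postLie_algebra:
  assumes iso: "operad_iso B (TSu V Rel) \<phi>"
  shows "\<exists>\<rho>'. operad_algebra B A \<rho>' \<and>
    (\<forall>\<omega>\<in>elts V. \<forall>x\<in>carrier A. \<forall>y\<in>carrier A.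
      let gen = (\<lambda>d. inv_into (carrier (sp B 2)) (\<phi> 2) (TSu_gen V Rel \<omega> d)) in
      binop \<rho>' (gen Prec) x y = op \<omega> x (P y) \<and>
      binop \<rho>' (gen Succ) x y = op \<omega> (P x) y \<and>
      binop \<rho>' (gen Dot) x y = op \<omega> x y)"
proof -
  interpret H: s2mod "hat V" by (rule s2mod_hat)
  interpret \<phi>: operad_iso B "TSu V Rel" \<phi> by (rule iso)
  obtain \<Phi> where \<Phi>: "operad_hom (TSu V Rel) (RB1 V Rel) \<Phi>"
    and \<Phi>v: "\<forall>\<omega>\<in>elts V.
        \<Phi> 2 (TSu_gen V Rel \<omega> Prec) = comp_id_P (RB1 V Rel) (RB1_op V Rel \<omega>) (RB1_P V Rel) \<and>
        \<Phi> 2 (TSu_gen V Rel \<omega> Succ) = comp_P_id (RB1 V Rel) (RB1_op V Rel \<omega>) (RB1_P V Rel) \<and>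
        \<Phi> 2 (TSu_gen V Rel \<omega> Dot) = RB1_op V Rel \<omega>"
    using ex_TSu_RB1 by (elim exE conjE) (rule that)
  obtain g where g: "operad_hom (RB1 V Rel) (End_operad A) g"
    and gt: "\<forall>t\<in>trees (VP V) 2. g 2 (RB.cl 2 (clP V 2 (bas t))) = eval_map 2 t"
    using ex_RB1_algebra by (elim exE conjE) (rule that)
  have hom: "operad_hom B (End_operad A) (\<lambda>n x. g n (\<Phi> n (\<phi> n x)))"
    by (rule operad_hom_compose[OF operad_hom_compose[OF \<phi>.operad_hom_axioms \<Phi>] g])
  \<comment> \<open>The generators are named through \<open>inv_into\<close>, which is a genuine
    preimage because \<phi> is onto in arity two.\<close>
  have gen: "\<phi> 2 (inv_into (carrier (sp B 2)) (\<phi> 2) (TSu_gen V Rel \<omega> d)) = TSu_gen V Rel \<omega> d" if "\<omega> \<in> elts V" for \<omega> d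
  proof (rule f_inv_into_f)
    interpret QT: operad_quotient "TV (hat V)" "quad_ideal (hat V) (TSu_rel V Rel)"
      by (rule H.quad_quotient[OF TSu_rel_closed])
    have "Node (dec V \<omega> d) [Leaf 1, Leaf 2] \<in> trees (arity2 (hat V)) 2"
      using that by (auto simp: trees_def)
    then have "gen2 (hat V) (dec V \<omega> d) \<in> carrier (sp (TV (hat V)) 2)"
      unfolding gen2_def by (intro H.T.tree_class_closed) simp
    from linear_mapD(1)[OF QT.linear_map_cl this]
    have "TSu_gen V Rel \<omega> d \<in> carrier (sp (TSu V Rel) 2)"
      unfolding TSu_gen_def quad_gen_def TSu_def quad_operad_def quot_operad_def by simp
    then show "TSu_gen V Rel \<omega> d \<in> \<phi> 2 ` carrier (sp B 2)"
      using \<phi>.iso_bij[of 2] by (simp add: bij_betw_def)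
  qed
  show ?thesis
  proof (intro exI conjI ballI)
    show "operad_algebra B A (\<lambda>n x. g n (\<Phi> n (\<phi> n x)))" using hom vspace_A by (simp add: operad_algebra_def)
    fix \<omega> x y assume w: "\<omega> \<in> elts V" and xy: "x \<in> carrier A" "y \<in> carrier A"
    note T = two_leaf_trees[OF w]
    note v = \<Phi>v[rule_format, OF w, unfolded RB1_comp[OF w], unfolded VP_comp(1,2)[OF w], unfolded RB1_op_def VP_gens(1)]
    have "g 2 (\<Phi> 2 (TSu_gen V Rel \<omega> Prec)) = eval_map 2 (n2 \<omega> (Leaf 1) (Pn V (Leaf 2)))"
      "g 2 (\<Phi> 2 (TSu_gen V Rel \<omega> Succ)) = eval_map 2 (n2 \<omega> (Pn V (Leaf 1)) (Leaf 2))"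
      "g 2 (\<Phi> 2 (TSu_gen V Rel \<omega> Dot)) = eval_map 2 (n2 \<omega> (Leaf 1) (Leaf 2))"
      by (simp_all only: v gt[rule_format] T(1-3))
    then show "let gen = (\<lambda>d. inv_into (carrier (sp B 2)) (\<phi> 2) (TSu_gen V Rel \<omega> d)) in
      binop (\<lambda>n x. g n (\<Phi> n (\<phi> n x))) (gen Prec) x y = op \<omega> x (P y) \<and>
      binop (\<lambda>n x. g n (\<Phi> n (\<phi> n x))) (gen Succ) x y = op \<omega> (P x) y \<and>
      binop (\<lambda>n x. g n (\<Phi> n (\<phi> n x))) (gen Dot) x y = op \<omega> x y"
      unfolding Let_def binop_def[of "\<lambda>n x. g n (\<Phi> n (\<phi> n x))"] gen[OF w]
      by (simp only: eval_map_n2_Pn[OF w xy] simp_thms)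
  qed
qed

end

theorem theorem5p4:
  fixes V :: "('k::field, 'v) s2mod"
    and R :: "('k, 'v) free_elem set"
  assumes "s2_module V"
    and "fin_dim (vsp V)"
    and "s3_submodule V R"
  shows "\<exists>\<phi>. operad_iso (black_product PL PL_rel V R) (TSu V R) \<phi> \<and>
    (\<forall>\<omega>\<in>carrier (vsp V).
       \<phi> 2 (black_gen PL PL_rel V R (bas Bracket) \<omega>) = TSu_gen V R \<omega> Dot \<and>
       \<phi> 2 (black_gen PL PL_rel V R (bas Circ) \<omega>) = TSu_gen V R \<omega> Prec) \<and>
    (\<exists>\<Phi>. operad_hom (TSu V R) (RB1 V R) \<Phi> \<and>
       (\<forall>\<omega>\<in>carrier (vsp V).
          \<Phi> 2 (TSu_gen V R \<omega> Prec) = comp_id_P (RB1 V R) (RB1_op V R \<omega>) (RB1_P V R) \<and>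
          \<Phi> 2 (TSu_gen V R \<omega> Succ) = comp_P_id (RB1 V R) (RB1_op V R \<omega>) (RB1_P V R) \<and>
          \<Phi> 2 (TSu_gen V R \<omega> Dot) = RB1_op V R \<omega>)) \<and>
    (\<forall>(A :: ('k, 'a) module) \<rho> P.
       operad_algebra (quad_operad V R) A \<rho> \<and> rota_baxter_weight_one (quad_operad V R) A \<rho> P \<longrightarrow>
       (\<exists>\<rho>'. operad_algebra (black_product PL PL_rel V R) A \<rho>' \<and>
          (\<forall>\<omega>\<in>carrier (vsp V). \<forall>x\<in>carrier A. \<forall>y\<in>carrier A.
             let gen = (\<lambda>d. inv_into (carrier (sp (black_product PL PL_rel V R) 2)) (\<phi> 2) (TSu_gen V R \<omega> d));
                 op = binop \<rho> (quad_gen V R \<omega>) in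
             binop \<rho>' (gen Prec) x y = op x (P y) \<and>
             binop \<rho>' (gen Succ) x y = op (P x) y \<and>
             binop \<rho>' (gen Dot) x y = op x y)))"
proof -
  interpret s2mod V by (rule s2mod.intro) (rule assms(1))
  have RC: "R \<subseteq> carrier (sp (TV V) 3)"
    using assms(3) vspace_submoduleD(1)[OF T.free.vspace_sp] by (auto simp: s3_submodule_def)
  interpret rota_baxter_setup V R
    by (intro rota_baxter_setup.intro rota_baxter_setup_axioms.intro s2mod_axioms RC)
  \<comment> \<open>The isomorphism is fixed once and for all algebras, since (b) names the
    generators of the black product through its inverse.\<close>
  obtain \<phi> where \<phi>: "operad_iso (black_product PL PL_rel V R) (TSu V R) \<phi>"
    and gens: "\<forall>\<omega>\<in>elts V.
       \<phi> 2 (black_gen PL PL_rel V R (bas Bracket) \<omega>) = TSu_gen V R \<omega> Dot \<and>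
       \<phi> 2 (black_gen PL PL_rel V R (bas Circ) \<omega>) = TSu_gen V R \<omega> Prec"
    using black_product_TSu_iso[OF assms(3)] by (elim exE conjE) (rule that)
  show ?thesis
  proof (rule exI[of _ \<phi>], intro conjI allI impI)
    fix A :: "('k, 'a) module" and \<rho> P
    assume "operad_algebra (quad_operad V R) A \<rho> \<and> rota_baxter_weight_one (quad_operad V R) A \<rho> P"
    then interpret rota_baxter_algebra V R A \<rho> P
      by (intro rota_baxter_algebra.intro rota_baxter_algebra_axioms.intro rota_baxter_setup_axioms) blast+
    show "\<exists>\<rho>'. operad_algebra (black_product PL PL_rel V R) A \<rho>' \<and>
          (\<forall>\<omega>\<in>elts V. \<forall>x\<in>carrier A. \<forall>y\<in>carrier A.
             let gen = (\<lambda>d. inv_into (carrier (sp (black_product PL PL_rel V R) 2)) (\<phi> 2) (TSu_gen V R \<omega> d));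
                 op = binop \<rho> (quad_gen V R \<omega>) in
             binop \<rho>' (gen Prec) x y = op x (P y) \<and>
             binop \<rho>' (gen Succ) x y = op (P x) y \<and>
             binop \<rho>' (gen Dot) x y = op x y)"
      using ex_postLie_algebra[OF \<phi>] by (simp only: Let_def)
  qed (use \<phi> gens ex_TSu_RB1 in blast)+
qed

end
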